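(* Let $N\ge2$ and let $M, M'\subset\mathbb{C}^{N}$ be smooth ($C^\infty$) real hypersurfaces. Assume that $M$ is $k_0$-nondegenerate at a point $p_0\in M$. Let $f^0\colon M\to M'$ be a smooth CR diffeomorphism and put $p_0'=f^0(p_0)$. Let $x=(x_1,\ldots,x_{2N-1})$ and $x'=(x'_1,\ldots,x'_{2N-1})$ be any local coordinate systems on $M$ and $M'$ near $p_0$ and $p_0'$, respectively, and for a mapping $f$ into $M'$ write $f_i:=x'_i\circ f$. Put $k:=k_0^3+k_0^2+k_0+1$. Then there is an open neighborhood $U\subset J^{k}(M,M')_{(p_0,p_0')}\times M'\times M$ of the point $\big((\partial_x^\beta f^0(p_0))_{1\le|\beta|\le k},f^0(p_0),p_0\big)$ and, for any multi-index $\alpha\in\mathbb{Z}_+^{2N-1}$ with $|\alpha|=k+1=k_0^3+k_0^2+k_0+2$ and any $j=1,\ldots,2N-1$, there is a smooth function $r^\alpha_j(\lambda^{k};x')(x)$ on $U$, rational in $\lambda^{k}\in J^{k}(M,M')_{(p_0,p_0')}$, such that $$\partial_x^\alpha f_j=r^\alpha_j\big((\partial_x^\beta f)_{1\le|\beta|\le k};f\big),\qquad \forall\, |\alpha|=k_0^3+k_0^2+k_0+2,\ j=1,\ldots,2N-1,$$ near $p_0$, for every smooth CR diffeomorphism $f\colon V\to M'$ (onto its image), where $V\subset M$ is some open neighborhood of $p_0$, with $\big((\partial_x^\beta f(p_0))_{1\le|\beta|\le k},f(p_0),p_0\big)\in U$.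
   Context: $k_0$-nondegeneracy: let $M\subset\mathbb{C}^N$ be given near $p_0\in M$ by $\rho(z,\bar z)=0$, where $\rho$ is smooth and real-valued with $\rho(p_0,\bar p_0)=0$, $d\rho(p_0,\bar p_0)\neq 0$. Let $L_{\bar 1},\ldots,L_{\bar n}$, $n=N-1$, be a basis for the CR vector fields on $M$ near $p_0$ (the $(0,1)$ vector fields tangent to $M$), $L^{\bar\alpha}:=L_{\bar 1}^{\alpha_1}\cdots L_{\bar n}^{\alpha_n}$, $\rho_z:=(\partial\rho/\partial z_j)_{1\le j\le N}$. Then $M$ is $k_0$-nondegenerate at $p_0$ if $\mathrm{Span}_{\mathbb{C}}\{L^{\bar\alpha}\rho_z(p_0,\bar p_0)\colon |\alpha|\le k_0\}=\mathbb{C}^N$. A smooth mapping between real hypersurfaces is CR if its tangent mapping sends CR vectors to CR vectors; a CR diffeomorphism is a diffeomorphism which is CR and whose inverse is CR. $J^k(M,M')_{(p,p')}$ denotes the space of $k$-jets at $p\in M$ of smooth mappings $f\colon M\to M'$ with $f(p)=p'\in M'$. Given local coordinates $x$ on $M$ near $p$ and $x'$ on $M'$ near $p'$, it has natural coordinates $\lambda^k=(\lambda_i^\beta)$, $1\le i\le 2N-1$, $\beta\in\mathbb{Z}_+^{2N-1}$, $1\le|\beta|\le k$, in which the $k$-jet at $p$ of $f$ is $\lambda_i^\beta=(\partial_x^\beta f_i)(p)$. Using these coordinates, any tuple $(\partial_x^\beta f_i(y))_{1\le|\beta|\le k}$, with $y$ near $p_0$ and $f(y)$ near $p_0'$, is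 regarded as a point of $J^k(M,M')_{(p_0,p_0')}$. In the system of equations, at a point $y$ near $p_0$ the right hand side is $r_j^\alpha$ evaluated at $\lambda^k=(\partial_x^\beta f(y))_{1\le|\beta|\le k}$, $x'=x'(f(y))$, $x=x(y)$. *)

theory Defs
  imports "HOL-Analysis.Analysis"
begin

section \<open>Smooth functions\<close>

text \<open>Meant for open sets \<open>S\<close>.\<close>

primrec Ck_on :: "nat \<Rightarrow> 'a::euclidean_space set \<Rightarrow> ('a \<Rightarrow> 'b::real_normed_vector) \<Rightarrow> bool" where
  "Ck_on 0 S f \<longleftrightarrow> continuous_on S f"
| "Ck_on (Suc k) S f \<longleftrightarrow>
     (\<forall>x\<in>S. f differentiable (at x)) \<and>
     (\<forall>b\<in>Basis. Ck_on k S (\<lambda>x. frechet_derivative f (at x) b))"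

definition smooth_on :: "'a::euclidean_space set \<Rightarrow> ('a \<Rightarrow> 'b::real_normed_vector) \<Rightarrow> bool" where
  "smooth_on S f \<longleftrightarrow> (\<forall>k. Ck_on k S f)"

text \<open>Smoothness on an arbitrary subset, in particular on a submanifold, of a Euclidean space:
  local existence of smooth extensions to the ambient space.\<close>

definition smooth_map_on :: "'a::euclidean_space set \<Rightarrow> ('a \<Rightarrow> 'b::real_normed_vector) \<Rightarrow> bool" where
  "smooth_map_on S f \<longleftrightarrow>
     (\<forall>p\<in>S. \<exists>W F. open W \<and> p \<in> W \<and> smooth_on W F \<and> (\<forall>x\<in>S \<inter> W. F x = f x))"

section \<open>Real hypersurfaces and CR vectors\<close>

definition defining_function ::
    "(complex ^ 'n) set \<Rightarrow> complex ^ 'n \<Rightarrow> (complex ^ 'n) set \<Rightarrow> (complex ^ 'n \<Rightarrow> real) \<Rightarrow> bool" where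
  "defining_function M p U \<rho> \<longleftrightarrow>
     p \<in> M \<and> open U \<and> p \<in> U \<and> smooth_on U \<rho> \<and> M \<inter> U = {z \<in> U. \<rho> z = 0} \<and>
     frechet_derivative \<rho> (at p) \<noteq> (\<lambda>v. 0)"

definition real_hypersurface :: "(complex ^ 'n) set \<Rightarrow> bool" where
  "real_hypersurface M \<longleftrightarrow> (\<forall>p\<in>M. \<exists>U \<rho>. defining_function M p U \<rho>)"

definition tangent_space :: "(complex ^ 'n) set \<Rightarrow> complex ^ 'n \<Rightarrow> (complex ^ 'n) set" where
  "tangent_space M p =
     {v. \<exists>e>0. \<exists>\<gamma>. smooth_on {-e<..<e} \<gamma> \<and> \<gamma> ` {-e<..<e} \<subseteq> M \<and> \<gamma> 0 = p \<and>
           (\<gamma> has_vector_derivative v) (at 0)}"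

text \<open>A vector of type \<open>(0,1)\<close>, i.e. \<open>\<Sum>j. a\<^sub>j \<partial>/\<partial>zbar\<^sub>j\<close>, is represented by its coefficient
  vector \<open>a\<close>. Expanding \<open>\<partial>/\<partial>zbar\<^sub>j = (\<partial>/\<partial>x\<^sub>j + \<i> \<partial>/\<partial>y\<^sub>j) / 2\<close>, it equals \<open>X + \<i> Y\<close>, where \<open>X\<close> and \<open>Y\<close> are the
  real vectors \<open>re01 a\<close> and \<open>im01 a\<close> (as usual, \<open>\<partial>/\<partial>x\<^sub>j\<close> and \<open>\<partial>/\<partial>y\<^sub>j\<close> are identified with
  \<open>axis j 1\<close> and \<open>axis j \<i>\<close>). It is tangent to \<open>M\<close>, that is, lies in the complexified tangent space
  of \<open>M\<close>, iff \<open>X\<close> and \<open>Y\<close> are tangent to \<open>M\<close>.\<close>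

definition re01 :: "complex ^ 'n \<Rightarrow> complex ^ 'n" where
  "re01 a = (\<chi> j. cnj (a $ j) / 2)"

definition im01 :: "complex ^ 'n \<Rightarrow> complex ^ 'n" where
  "im01 a = (\<chi> j. \<i> * cnj (a $ j) / 2)"

definition CR_vectors :: "(complex ^ 'n) set \<Rightarrow> complex ^ 'n \<Rightarrow> (complex ^ 'n) set" where
  "CR_vectors M p = {a. re01 a \<in> tangent_space M p \<and> im01 a \<in> tangent_space M p}"

section \<open>Nondegeneracy\<close>

definition dz :: "'n \<Rightarrow> (complex ^ 'n \<Rightarrow> complex) \<Rightarrow> complex ^ 'n \<Rightarrow> complex" where
  "dz j g p =
     (frechet_derivative g (at p) (axis j 1) - \<i> * frechet_derivative g (at p) (axis j \<i>)) / 2"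

definition dzbar :: "'n \<Rightarrow> (complex ^ 'n \<Rightarrow> complex) \<Rightarrow> complex ^ 'n \<Rightarrow> complex" where
  "dzbar j g p =
     (frechet_derivative g (at p) (axis j 1) + \<i> * frechet_derivative g (at p) (axis j \<i>)) / 2"

text \<open>The action of the \<open>(0,1)\<close> vector field with coefficient vector \<open>a z\<close> at \<open>z\<close>.\<close>

definition CR_deriv ::
    "(complex ^ 'n \<Rightarrow> complex ^ 'n) \<Rightarrow> (complex ^ 'n \<Rightarrow> complex) \<Rightarrow> complex ^ 'n \<Rightarrow> complex" where
  "CR_deriv a g = (\<lambda>z. \<Sum>j\<in>UNIV. a z $ j * dzbar j g z)"

text \<open>\<open>L\<^sub>0\<^bsup>\<alpha> 0\<^esup> \<dots> L\<^sub>m\<^sub>-\<^sub>1\<^bsup>\<alpha> (m-1)\<^esup> g\<close>, in this order, as the fields need not commute.\<close>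

definition CR_derivs ::
    "nat \<Rightarrow> (nat \<Rightarrow> complex ^ 'n \<Rightarrow> complex ^ 'n) \<Rightarrow> (nat \<Rightarrow> nat) \<Rightarrow>
     (complex ^ 'n \<Rightarrow> complex) \<Rightarrow> complex ^ 'n \<Rightarrow> complex" where
  "CR_derivs m L \<alpha> g = foldr (\<lambda>i. CR_deriv (L i) ^^ \<alpha> i) [0..<m] g"

text \<open>A basis of the CR vector fields on \<open>M \<inter> U\<close>. The coefficients are given as smooth functions on
  the open subset \<open>U\<close> of the ambient space; tangency is required along \<open>M\<close> only. Since the fields are
  tangent to \<open>M\<close>, the restriction of \<open>CR_deriv (L i) g\<close> to \<open>M\<close> depends only on that of \<open>g\<close>.\<close>

definition CR_frame ::
    "(complex ^ 'n) set \<Rightarrow> (complex ^ 'n) set \<Rightarrow> nat \<Rightarrow>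
     (nat \<Rightarrow> complex ^ 'n \<Rightarrow> complex ^ 'n) \<Rightarrow> bool" where
  "CR_frame M U m L \<longleftrightarrow>
     (\<forall>i<m. smooth_on U (L i)) \<and>
     (\<forall>z\<in>M \<inter> U. inj_on (\<lambda>i. L i z) {..<m} \<and>
        vec.independent ((\<lambda>i. L i z) ` {..<m}) \<and>
        vec.span ((\<lambda>i. L i z) ` {..<m}) = CR_vectors M z)"

text \<open>The condition does not depend on the choice of \<open>\<rho>\<close> and \<open>L\<close>.\<close>

definition nondegenerate_at :: "nat \<Rightarrow> (complex ^ 'n) set \<Rightarrow> complex ^ 'n \<Rightarrow> bool" where
  "nondegenerate_at k0 M p \<longleftrightarrow>
     (\<exists>U \<rho> L. defining_function M p U \<rho> \<and> CR_frame M U (CARD('n) - 1) L \<and>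
        vec.span {(\<chi> j. CR_derivs (CARD('n) - 1) L \<alpha> (dz j (\<lambda>z. complex_of_real (\<rho> z))) p) | \<alpha>.
                    (\<Sum>i<CARD('n) - 1. \<alpha> i) \<le> k0} = UNIV)"

section \<open>CR mappings\<close>

text \<open>Derivatives within \<open>M\<close> are not unique as linear maps on the ambient space, but any two of
  them agree on \<open>tangent_space M p\<close>, where they are the tangent map of \<open>f\<close> at \<open>p\<close>. The image of
  \<open>X + \<i> Y\<close> under the complexified tangent map is \<open>df X + \<i> df Y\<close>.\<close>

definition CR_map ::
    "(complex ^ 'n) set \<Rightarrow> (complex ^ 'n) set \<Rightarrow> (complex ^ 'n \<Rightarrow> complex ^ 'n) \<Rightarrow> bool" where
  "CR_map M M' f \<longleftrightarrow>
     f ` M \<subseteq> M' \<and> smooth_map_on M f \<and>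
     (\<forall>p\<in>M. \<forall>a\<in>CR_vectors M p. \<exists>b\<in>CR_vectors M' (f p).
        frechet_derivative f (at p within M) (re01 a) = re01 b \<and>
        frechet_derivative f (at p within M) (im01 a) = im01 b)"

definition CR_diffeo ::
    "(complex ^ 'n) set \<Rightarrow> (complex ^ 'n) set \<Rightarrow> (complex ^ 'n \<Rightarrow> complex ^ 'n) \<Rightarrow> bool" where
  "CR_diffeo M M' f \<longleftrightarrow>
     bij_betw f M M' \<and> CR_map M M' f \<and> CR_map M' M (inv_into M f)"

section \<open>Local coordinates and jets\<close>

definition local_coords ::
    "(complex ^ 'n) set \<Rightarrow> complex ^ 'n \<Rightarrow> (complex ^ 'n) set \<Rightarrow> (complex ^ 'n \<Rightarrow> real ^ 'd) \<Rightarrow> bool"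
  where
  "local_coords M p A x \<longleftrightarrow>
     openin (top_of_set M) A \<and> p \<in> A \<and> inj_on x A \<and> smooth_map_on A x \<and>
     open (x ` A) \<and> smooth_on (x ` A) (inv_into A x)"

definition msize :: "('d::finite \<Rightarrow> nat) \<Rightarrow> nat" where
  "msize \<beta> = (\<Sum>i\<in>UNIV. \<beta> i)"

primrec partials :: "'d list \<Rightarrow> (real ^ 'd \<Rightarrow> real) \<Rightarrow> real ^ 'd \<Rightarrow> real" where
  "partials [] g = g"
| "partials (i # is) g = (\<lambda>u. frechet_derivative (partials is g) (at u) (axis i 1))"

text \<open>The index type carries no order, so some order of differentiation is chosen; for smooth
  functions the result does not depend on it.\<close>

definition mpartial :: "('d::finite \<Rightarrow> nat) \<Rightarrow> (real ^ 'd \<Rightarrow> real) \<Rightarrow> real ^ 'd \<Rightarrow> real" where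
  "mpartial \<beta> = partials (SOME is. \<forall>i. count_list is i = \<beta> i)"

text \<open>The derivative of order \<open>\<beta>\<close> of the component \<open>x'\<^sub>j \<circ> f\<close>, with respect to the coordinates
  \<open>x\<close> with domain \<open>A\<close>, at the point \<open>y\<close>.\<close>

definition coord_deriv ::
    "(complex ^ 'n) set \<Rightarrow> (complex ^ 'n \<Rightarrow> real ^ 'd) \<Rightarrow> (complex ^ 'n \<Rightarrow> real ^ 'd) \<Rightarrow>
     ('d \<Rightarrow> nat) \<Rightarrow> (complex ^ 'n \<Rightarrow> complex ^ 'n) \<Rightarrow> 'd \<Rightarrow> complex ^ 'n \<Rightarrow> real" where
  "coord_deriv A x x' \<beta> f j y = mpartial \<beta> (\<lambda>u. x' (f (inv_into A x u)) $ j) (x y)"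

text \<open>The \<open>k\<close>-jet space is identified, through its natural coordinates, with \<open>real ^ 'j\<close>, where
  \<open>e\<close> enumerates the index pairs \<open>(i, \<beta>)\<close> with \<open>1 \<le> |\<beta>| \<le> k\<close>. (A finite index type depending on
  \<open>k\<close> cannot be formed, so the type is a parameter.)\<close>

definition jet_indices :: "nat \<Rightarrow> ('d::finite \<times> ('d \<Rightarrow> nat)) set" where
  "jet_indices k = {(i, \<beta>). 1 \<le> msize \<beta> \<and> msize \<beta> \<le> k}"

definition jet ::
    "('j::finite \<Rightarrow> 'd::finite \<times> ('d \<Rightarrow> nat)) \<Rightarrow> (complex ^ 'n) set \<Rightarrow>
     (complex ^ 'n \<Rightarrow> real ^ 'd) \<Rightarrow> (complex ^ 'n \<Rightarrow> real ^ 'd) \<Rightarrow>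
     (complex ^ 'n \<Rightarrow> complex ^ 'n) \<Rightarrow> complex ^ 'n \<Rightarrow> real ^ 'j" where
  "jet e A x x' f y = (\<chi> l. coord_deriv A x x' (snd (e l)) f (fst (e l)) y)"

text \<open>Quotients, with denominator vanishing nowhere on \<open>U\<close>, of polynomials in \<open>t\<close> whose
  coefficients are functions of the remaining variable \<open>y\<close>; \<open>E\<close> is the set of exponents.\<close>

definition rational_in_fst_on :: "((real ^ 'j) \<times> 'y) set \<Rightarrow> ((real ^ 'j) \<times> 'y \<Rightarrow> real) \<Rightarrow> bool" where
  "rational_in_fst_on U r \<longleftrightarrow>
     (\<exists>(E :: ('j \<Rightarrow> nat) set) P Q. finite E \<and>
        (\<forall>(t, y)\<in>U.
           (\<Sum>m\<in>E. Q m y * (\<Prod>l\<in>UNIV. (t $ l) ^ m l)) \<noteq> 0 \<and>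
           r (t, y) = (\<Sum>m\<in>E. P m y * (\<Prod>l\<in>UNIV. (t $ l) ^ m l)) /
                      (\<Sum>m\<in>E. Q m y * (\<Prod>l\<in>UNIV. (t $ l) ^ m l))))"

end

theory Submission
  imports Defs "HOL-Computational_Algebra.Fundamental_Theorem_Algebra"
begin

text \<open>
Let \<open>\<rho>'\<close> define \<open>M'\<close>. Differentiating \<open>\<rho>'(f, f\<^sup>-) = 0\<close> along words of at most \<open>k0\<close> CR fields and then along a
\<open>(1,0)\<close> field \<open>L\<close> gives a linear system for the \<open>L f\<^sub>j\<close>, which by \<open>k0\<close>-nondegeneracy can be solved: \<open>L f\<^sub>j\<close> is rational in
the derivatives of \<open>f\<^sup>-\<close> of order at most \<open>k0\<close>. Since \<open>L\<close> annihilates \<open>f\<^sup>-\<close>, commuting it past these derivatives does not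
raise their order, so this ring of functionals is closed under \<open>(1,0)\<close> fields. Conjugating, all words of CR fields applied to
\<open>f\<^sup>-\<close> have order at most \<open>k0\<close>.

The transversal derivatives come from a \<open>(1,0)\<close> field \<open>L = Z\<^sub>1 - q Z\<^sub>\<nu>\<close>, where \<open>Z\<^sub>1\<close> and \<open>Z\<^sub>\<nu>\<close> preserve CR functions and
commute on them. Up to lower order, \<open>L\<^sup>n f = \<Sum>\<^sub>s (n choose s) (-q)\<^sup>s Z\<^sub>1\<^sup>n\<^sup>-\<^sup>s Z\<^sub>\<nu>\<^sup>s f\<close>. Monomials in the CR fields pass through the CR
functions \<open>Z\<^sub>1\<^sup>n\<^sup>-\<^sup>s Z\<^sub>\<nu>\<^sup>s f\<close> and separate the powers of \<open>q\<close>: the functions annihilated by all these monomials at the base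
point form a prime ideal, so a polynomial relation for \<open>q\<close> modulo this ideal would force \<open>q\<close> to be constant modulo it, contrary to nondegeneracy.
Hence \<open>Z\<^sub>\<nu>\<^sup>s f\<close> has order at most \<open>2 k0\<close> for every \<open>s\<close>.

Finally, words of \<open>k + 1\<close> fields commute modulo functionals of order \<open>k\<close>, and \<open>(0,1)\<close> fields kill \<open>f\<close>. In a word of \<open>(1,0)\<close> fields and
\<open>Z\<^sub>\<nu>\<close> either the number of \<open>(1,0)\<close> fields or that of \<open>Z\<^sub>\<nu>\<close> is large, and as \<open>k \<ge> 3 k0\<close> its order is at most \<open>k\<close>.
\<close>

section \<open>Smooth functions\<close>

text \<open>Estimates have to be uniform in the unknown map. So identities are stated between
  functionals of a germ and a base point, valid once the jet is close to that of \<open>F0\<close>;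
  a pivot is inspected only at \<open>(F0, u0)\<close>, and inverting it keeps the answer rational.
  The obstacle is the transversal direction. Nondegeneracy of order \<open>k0\<close> provides no
  Levi form to invert: brackets of (1,0) and (0,1) fields may be tangential at the base point. What
  is available is that a ratio \<open>q\<close> of two components of the complex gradient of the
  defining function of \<open>M\<close> is not constant along the CR fields. It has to separate the
  powers of \<open>q\<close> up to every exponent, with no bound on the number of differentiations
  spent; hence flatness of infinite order and prime ideals instead of a count of orders. The 3 in
  \<open>3 * k0 \<le> k\<close> is made up of one \<open>k0\<close> for (0,1) words on the conjugate
  map, one for outer derivatives kept in front of such words, and one for (1,0) fields moved in
  front of a power of \<open>Z \<nu>\<close>.\<close>

lemma frechet_derivative_eqI: "(f has_derivative D) (at x) \<Longrightarrow> frechet_derivative f (at x) = D"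
  using frechet_derivative_at by blast

lemma frechet_derivative_worksI:
  "f differentiable (at x) \<Longrightarrow> (f has_derivative frechet_derivative f (at x)) (at x)"
  by (simp add: frechet_derivative_works)

lemma has_derivative_cong_nhds:
  assumes "\<forall>\<^sub>F v in nhds x. f v = g v"
  shows "(f has_derivative D) (at x) \<longleftrightarrow> (g has_derivative D) (at x)"
proof -
  obtain S where "open S" "x \<in> S" "\<forall>v\<in>S. f v = g v"
    using assms unfolding eventually_nhds by blast
  then show ?thesis
    by (metis has_derivative_transform_within_open)
qed

lemma frechet_derivative_cong_ev:
  assumes "\<forall>\<^sub>F v in nhds x. f v = g v"
  shows "frechet_derivative f (at x) = frechet_derivative g (at x)"
proof -
  have "(f has_derivative D) (at x) \<longleftrightarrow> (g has_derivative D) (at x)" for D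
    by (rule has_derivative_cong_nhds[OF assms])
  then show ?thesis by (simp add: frechet_derivative_def)
qed

lemma differentiable_cong_ev:
  assumes "\<forall>\<^sub>F v in nhds x. f v = g v"
  shows "f differentiable (at x) \<longleftrightarrow> g differentiable (at x)"
proof -
  have "(f has_derivative D) (at x) \<longleftrightarrow> (g has_derivative D) (at x)" for D
    by (rule has_derivative_cong_nhds[OF assms])
  then show ?thesis by (simp add: differentiable_def)
qed

lemma Ck_on_cong:
  assumes "open S" "\<And>x. x \<in> S \<Longrightarrow> f x = g x"
  shows "Ck_on k S f \<longleftrightarrow> Ck_on k S g"
  using assms(2)
proof (induction k arbitrary: f g)
  case 0 then show ?case by (simp cong: continuous_on_cong)
next
  case (Suc k)
  have ev: "\<forall>\<^sub>F v in nhds x. f v = g v" if "x \<in> S" for x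
    using assms(1) that Suc.prems eventually_nhds by blast
  have "Ck_on k S (\<lambda>x. frechet_derivative f (at x) b) = Ck_on k S (\<lambda>x. frechet_derivative g (at x) b)" for b
    by (rule Suc.IH) (simp add: frechet_derivative_cong_ev[OF ev])
  then show ?case
    using differentiable_cong_ev[OF ev] by auto
qed

lemma Ck_on_subset: "Ck_on k S f \<Longrightarrow> T \<subseteq> S \<Longrightarrow> Ck_on k T f"
  by (induction k arbitrary: f) (auto intro: continuous_on_subset)

lemma Ck_on_SucD: "Ck_on (Suc k) S f \<Longrightarrow> Ck_on k S f"
proof (induction k arbitrary: f)
  case 0 then show ?case
    by (simp add: continuous_at_imp_continuous_on differentiable_imp_continuous_within)
next
  case (Suc k) then show ?case by auto
qed

lemma Ck_on_continuous: "Ck_on k S f \<Longrightarrow> continuous_on S f"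
  by (induction k) (use Ck_on_SucD in \<open>auto simp del: Ck_on.simps(2)\<close>)

lemma Ck_on_const: "open S \<Longrightarrow> Ck_on k S (\<lambda>x. c)"
  by (induction k arbitrary: c) auto

lemma Ck_on_add: "open S \<Longrightarrow> Ck_on k S f \<Longrightarrow> Ck_on k S g \<Longrightarrow> Ck_on k S (\<lambda>x. f x + g x)"
proof (induction k arbitrary: f g)
  case 0 then show ?case by (auto intro: continuous_on_add)
next
  case (Suc k)
  have D: "frechet_derivative (\<lambda>x. f x + g x) (at x) b = frechet_derivative f (at x) b + frechet_derivative g (at x) b"
    if "x \<in> S" for x b
    using Suc.prems that
    by (subst frechet_derivative_eqI[OF has_derivative_add[OF frechet_derivative_worksI frechet_derivative_worksI]]) auto
  have "Ck_on k S (\<lambda>x. frechet_derivative (\<lambda>x. f x + g x) (at x) b)" if "b \<in> Basis" for b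
    using Suc.IH[of "\<lambda>x. frechet_derivative f (at x) b" "\<lambda>x. frechet_derivative g (at x) b"] Suc.prems that
    by (subst Ck_on_cong[OF Suc.prems(1) D]) auto
  then show ?case using Suc.prems by (auto intro: differentiable_add)
qed

lemma Ck_on_sum: "open S \<Longrightarrow> (\<And>i. i \<in> I \<Longrightarrow> Ck_on k S (f i)) \<Longrightarrow> Ck_on k S (\<lambda>x. \<Sum>i\<in>I. f i x)"
  by (induction I rule: infinite_finite_induct) (auto intro: Ck_on_const Ck_on_add)

lemma Ck_on_bilinear:
  assumes "bounded_bilinear B" "open S"
  shows "Ck_on k S f \<Longrightarrow> Ck_on k S g \<Longrightarrow> Ck_on k S (\<lambda>x. B (f x) (g x))"
proof (induction k arbitrary: f g)
  case 0 then show ?case using bounded_bilinear.continuous_on[OF assms(1)] by auto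
next
  case (Suc k)
  have H: "((\<lambda>x. B (f x) (g x)) has_derivative
    (\<lambda>b. B (f x) (frechet_derivative g (at x) b) + B (frechet_derivative f (at x) b) (g x))) (at x)" if "x \<in> S" for x
    using Suc.prems that by (intro bounded_bilinear.FDERIV[OF assms(1)] frechet_derivative_worksI) auto
  have D: "frechet_derivative (\<lambda>x. B (f x) (g x)) (at x) b =
     B (f x) (frechet_derivative g (at x) b) + B (frechet_derivative f (at x) b) (g x)" if "x \<in> S" for x b
    using frechet_derivative_eqI[OF H[OF that]] by simp
  have "Ck_on k S (\<lambda>x. frechet_derivative (\<lambda>x. B (f x) (g x)) (at x) b)" if "b \<in> Basis" for b
    using Suc.prems that
    by (subst Ck_on_cong[OF assms(2) D]) (auto intro!: Ck_on_add assms Suc.IH Ck_on_SucD[of k S f] Ck_on_SucD[of k S g])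
  then show ?case using H by (auto intro: differentiableI)
qed

lemma Ck_on_linear:
  assumes "bounded_linear L" "open S"
  shows "Ck_on k S f \<Longrightarrow> Ck_on k S (\<lambda>x. L (f x))"
proof (induction k arbitrary: f)
  case 0 then show ?case using bounded_linear.continuous_on[OF assms(1)] by auto
next
  case (Suc k)
  have H: "((\<lambda>x. L (f x)) has_derivative (\<lambda>b. L (frechet_derivative f (at x) b))) (at x)" if "x \<in> S" for x
    using Suc.prems that by (intro bounded_linear.has_derivative[OF assms(1)] frechet_derivative_worksI) auto
  have D: "frechet_derivative (\<lambda>x. L (f x)) (at x) b = L (frechet_derivative f (at x) b)" if "x \<in> S" for x b
    using frechet_derivative_eqI[OF H[OF that]] by simp
  have "Ck_on k S (\<lambda>x. frechet_derivative (\<lambda>x. L (f x)) (at x) b)" if "b \<in> Basis" for b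
    using Suc.prems that
    by (subst Ck_on_cong[OF assms(2) D]) (auto intro!: Suc.IH)
  then show ?case using H by (auto intro: differentiableI)
qed

lemma linear_expand_Basis:
  fixes D :: "'a::euclidean_space \<Rightarrow> 'b::real_vector"
  assumes "linear D" shows "D v = (\<Sum>c\<in>Basis. (v \<bullet> c) *\<^sub>R D c)"
  using assms euclidean_representation[of v] linear_sum linear_scale
  by (metis (mono_tags, lifting) sum.cong)

lemma linear_frechet: "f differentiable (at x) \<Longrightarrow> linear (frechet_derivative f (at x))"
  by (simp add: linear_frechet_derivative)

lemma Ck_on_compose:
  fixes f :: "'a::euclidean_space \<Rightarrow> 'b::euclidean_space" and g :: "'b \<Rightarrow> 'c::real_normed_vector"
  assumes "open S" "open T" "f ` S \<subseteq> T"
  shows "Ck_on k S f \<Longrightarrow> Ck_on k T g \<Longrightarrow> Ck_on k S (\<lambda>x. g (f x))"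
proof (induction k arbitrary: g)
  case 0 then show ?case using continuous_on_compose2[of T g S f] assms(3) by simp
next
  case (Suc k)
  have H: "((\<lambda>x. g (f x)) has_derivative (\<lambda>b. frechet_derivative g (at (f x)) (frechet_derivative f (at x) b))) (at x)" if "x \<in> S" for x
    by (rule has_derivative_compose[OF frechet_derivative_worksI frechet_derivative_worksI])
       (use Suc.prems that assms(3) in auto)
  have D: "frechet_derivative (\<lambda>x. g (f x)) (at x) b =
     (\<Sum>c\<in>Basis. (frechet_derivative f (at x) b \<bullet> c) *\<^sub>R frechet_derivative g (at (f x)) c)" if "x \<in> S" for x b
  proof -
    have "linear (frechet_derivative g (at (f x)))"
      using Suc.prems that assms(3) by (intro linear_frechet) auto
    note * = linear_expand_Basis[OF this, of "frechet_derivative f (at x) b"]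
    show ?thesis
      unfolding frechet_derivative_eqI[OF H[OF that]] by (rule *)
  qed
  have "Ck_on k S (\<lambda>x. frechet_derivative (\<lambda>x. g (f x)) (at x) b)" if "b \<in> Basis" for b
  proof -
    have 1: "Ck_on k S (\<lambda>x. frechet_derivative f (at x) b)" using Suc.prems that by auto
    have 2: "Ck_on k S (\<lambda>x. frechet_derivative g (at (f x)) c)" if "c \<in> Basis" for c
    proof (rule Suc.IH)
      show "Ck_on k S f" by (rule Ck_on_SucD[OF Suc.prems(1)])
      show "Ck_on k T (\<lambda>x. frechet_derivative g (at x) c)" using Suc.prems(2) that by simp
    qed
    have "Ck_on k S (\<lambda>x. \<Sum>c\<in>Basis. (frechet_derivative f (at x) b \<bullet> c) *\<^sub>R frechet_derivative g (at (f x)) c)"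
      by (intro Ck_on_sum Ck_on_bilinear[OF bounded_bilinear_scaleR] Ck_on_linear[OF bounded_linear_inner_left] assms(1) 1 2)
    then show ?thesis by (subst Ck_on_cong[OF assms(1) D])
  qed
  then show ?case using H by (auto intro: differentiableI)
qed

lemma Ck_on_inverse: "Ck_on k (- {0}) (inverse :: 'a::{real_normed_field,euclidean_space} \<Rightarrow> 'a)"
proof (induction k)
  case 0 then show ?case by (auto intro!: continuous_intros)
next
  case (Suc k)
  have H: "(inverse has_derivative (\<lambda>b. - (inverse x * b * inverse x))) (at x)" if "x \<in> - {0}" for x :: 'a
    using that by (intro has_derivative_inverse') auto
  have D: "frechet_derivative inverse (at x) b = - inverse x * (b * inverse x)" if "x \<in> - {0}" for x b :: 'a
    using frechet_derivative_eqI[OF H[OF that]] by (simp add: algebra_simps)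
  have "Ck_on k (- {0}) (\<lambda>x. frechet_derivative inverse (at x) b)" for b :: 'a
    apply (subst Ck_on_cong[OF _ D])
    apply (simp add: open_delete open_Compl)
     apply assumption
    apply (intro Ck_on_bilinear[OF bounded_bilinear_mult] Ck_on_const Suc.IH
       Ck_on_linear[OF bounded_linear_minus, OF bounded_linear_ident])
    apply (simp_all add: open_delete open_Compl)
    done
  then show ?case using H by (auto intro: differentiableI)
qed

text \<open>Smoothness of a germ. Being an open condition on the point, it combines with other facts
  under \<open>nhds\<close>, so that local identities can be differentiated.\<close>

definition smooth_at :: "'a::euclidean_space \<Rightarrow> ('a \<Rightarrow> 'b::real_normed_vector) \<Rightarrow> bool" where
  "smooth_at x f \<longleftrightarrow> (\<exists>S. open S \<and> x \<in> S \<and> smooth_on S f)"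

lemma smooth_atI: "open S \<Longrightarrow> x \<in> S \<Longrightarrow> smooth_on S f \<Longrightarrow> smooth_at x f"
  by (auto simp: smooth_at_def)

lemma smooth_on_subset: "smooth_on S f \<Longrightarrow> T \<subseteq> S \<Longrightarrow> smooth_on T f"
  unfolding smooth_on_def using Ck_on_subset by blast

lemma smooth_on_cong: "open S \<Longrightarrow> (\<And>x. x \<in> S \<Longrightarrow> f x = g x) \<Longrightarrow> smooth_on S f \<longleftrightarrow> smooth_on S g"
  unfolding smooth_on_def using Ck_on_cong by blast

lemma smooth_at_ev: "smooth_at x f \<Longrightarrow> \<forall>\<^sub>F v in nhds x. smooth_at v f"
  unfolding smooth_at_def eventually_nhds by blast

lemma smooth_at_cong_ev:
  assumes "\<forall>\<^sub>F v in nhds x. f v = g v" shows "smooth_at x f \<longleftrightarrow> smooth_at x g"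
proof -
  have *: "smooth_at x g" if ev: "\<forall>\<^sub>F v in nhds x. f v = g v" and sm: "smooth_at x f" for f g :: "'a \<Rightarrow> 'b"
  proof -
    obtain S where S: "open S" "x \<in> S" "\<forall>v\<in>S. f v = g v"
      using ev unfolding eventually_nhds by blast
    obtain T where T: "open T" "x \<in> T" "smooth_on T f"
      using sm unfolding smooth_at_def by blast
    have "smooth_on (S \<inter> T) f" by (rule smooth_on_subset[OF T(3)]) simp
    moreover have "smooth_on (S \<inter> T) f \<longleftrightarrow> smooth_on (S \<inter> T) g"
      by (rule smooth_on_cong) (use S T in auto)
    ultimately show ?thesis using S T by (intro smooth_atI[of "S \<inter> T"]) auto
  qed
  have "\<forall>\<^sub>F v in nhds x. g v = f v" using assms by (simp add: eq_commute)
  then show ?thesis using * assms by blast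
qed

lemma smooth_on_continuous: "smooth_on S f \<Longrightarrow> continuous_on S f"
  unfolding smooth_on_def using Ck_on_continuous by blast

lemma smooth_at_continuous: "smooth_at x f \<Longrightarrow> isCont f x"
  unfolding smooth_at_def using smooth_on_continuous continuous_on_eq_continuous_at by blast

lemma smooth_at_differentiable: "smooth_at x f \<Longrightarrow> f differentiable (at x)"
  unfolding smooth_at_def smooth_on_def by (metis Ck_on.simps(2))

lemma smooth_at_has_derivative: "smooth_at x f \<Longrightarrow> (f has_derivative frechet_derivative f (at x)) (at x)"
  by (simp add: frechet_derivative_worksI smooth_at_differentiable)

lemma smooth_on_deriv_Basis: "smooth_on S f \<Longrightarrow> b \<in> Basis \<Longrightarrow> smooth_on S (\<lambda>x. frechet_derivative f (at x) b)"
  unfolding smooth_on_def by (metis Ck_on.simps(2))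

lemma smooth_at_const [simp, intro]: "smooth_at x (\<lambda>x. c)"
  by (rule smooth_atI[of UNIV]) (auto simp: smooth_on_def intro: Ck_on_const)

lemma smooth_on_add: "open S \<Longrightarrow> smooth_on S f \<Longrightarrow> smooth_on S g \<Longrightarrow> smooth_on S (\<lambda>x. f x + g x)"
  by (auto simp: smooth_on_def intro: Ck_on_add)

lemma smooth_at_2:
  assumes "smooth_at x f" "smooth_at x g"
    and "\<And>S. open S \<Longrightarrow> smooth_on S f \<Longrightarrow> smooth_on S g \<Longrightarrow> smooth_on S h"
  shows "smooth_at x h"
proof -
  obtain S T where "open S" "x \<in> S" "smooth_on S f" "open T" "x \<in> T" "smooth_on T g"
    using assms unfolding smooth_at_def by blast
  then show ?thesis
    by (intro smooth_atI[of "S \<inter> T"] assms(3)) (auto intro: smooth_on_subset)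
qed

lemma smooth_at_add: "smooth_at x f \<Longrightarrow> smooth_at x g \<Longrightarrow> smooth_at x (\<lambda>x. f x + g x)"
  by (erule smooth_at_2, assumption) (rule smooth_on_add)

lemma smooth_at_bilinear: "bounded_bilinear B \<Longrightarrow> smooth_at x f \<Longrightarrow> smooth_at x g \<Longrightarrow> smooth_at x (\<lambda>x. B (f x) (g x))"
  by (erule smooth_at_2, assumption) (auto simp: smooth_on_def intro: Ck_on_bilinear)

lemma smooth_at_linear: "bounded_linear L \<Longrightarrow> smooth_at x f \<Longrightarrow> smooth_at x (\<lambda>x. L (f x))"
  by (rule smooth_at_2[where f=f and g=f]) (auto simp: smooth_on_def intro: Ck_on_linear)

lemma smooth_at_linear_self: "bounded_linear L \<Longrightarrow> smooth_at x L"
proof -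
  assume L: "bounded_linear L"
  have "smooth_on UNIV L"
    unfolding smooth_on_def
  proof
    fix k show "Ck_on k UNIV L"
    proof (cases k)
      case 0 then show ?thesis using L linear_continuous_on by simp blast
    next
      case (Suc m)
      have "frechet_derivative L (at x) b = L b" for x b
        using frechet_derivative_eqI[OF bounded_linear_imp_has_derivative[OF L]] by metis
      then show ?thesis using L Suc by (auto intro: bounded_linear_imp_differentiable Ck_on_const)
    qed
  qed
  then show ?thesis by (intro smooth_atI[of UNIV]) auto
qed

lemma smooth_at_mult: "smooth_at x f \<Longrightarrow> smooth_at x g \<Longrightarrow> smooth_at x (\<lambda>x. f x * g x :: 'b::real_normed_algebra)"
  by (rule smooth_at_bilinear[OF bounded_bilinear_mult])

lemma smooth_at_uminus: "smooth_at x f \<Longrightarrow> smooth_at x (\<lambda>x. - f x)"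
  by (rule smooth_at_linear[OF bounded_linear_minus[OF bounded_linear_ident]])

lemma smooth_at_diff: "smooth_at x f \<Longrightarrow> smooth_at x g \<Longrightarrow> smooth_at x (\<lambda>x. f x - g x)"
  using smooth_at_add[of x f "\<lambda>x. - g x"] smooth_at_uminus by auto

lemma smooth_at_cnj: "smooth_at x f \<Longrightarrow> smooth_at x (\<lambda>x. cnj (f x))"
  by (rule smooth_at_linear[OF bounded_linear_cnj])

lemma smooth_at_of_real: "smooth_at x f \<Longrightarrow> smooth_at x (\<lambda>x. complex_of_real (f x))"
  by (rule smooth_at_linear[OF bounded_linear_of_real])

lemma smooth_at_Re: "smooth_at x f \<Longrightarrow> smooth_at x (\<lambda>x. Re (f x))"
  by (rule smooth_at_linear[OF bounded_linear_Re])

lemma smooth_at_Im: "smooth_at x f \<Longrightarrow> smooth_at x (\<lambda>x. Im (f x))"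
  by (rule smooth_at_linear[OF bounded_linear_Im])

lemma smooth_at_vec_nth: "smooth_at x f \<Longrightarrow> smooth_at x (\<lambda>x. f x $ i)"
  by (rule smooth_at_linear[OF bounded_linear_vec_nth])

lemma smooth_at_sum: "(\<And>i. i \<in> I \<Longrightarrow> smooth_at x (f i)) \<Longrightarrow> smooth_at x (\<lambda>x. \<Sum>i\<in>I. f i x)"
  by (induction I rule: infinite_finite_induct) (auto intro: smooth_at_add)

lemma smooth_at_compose:
  fixes f :: "'a::euclidean_space \<Rightarrow> 'b::euclidean_space" and g :: "'b \<Rightarrow> 'c::real_normed_vector"
  assumes "smooth_at x f" "smooth_at (f x) g"
  shows "smooth_at x (\<lambda>x. g (f x))"
proof -
  obtain S T where S: "open S" "x \<in> S" "smooth_on S f" and T: "open T" "f x \<in> T" "smooth_on T g"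
    using assms unfolding smooth_at_def by blast
  let ?S = "S \<inter> f -` T"
  have "open ?S" by (rule continuous_open_preimage[OF smooth_on_continuous[OF S(3)] S(1) T(1)])
  moreover have "smooth_on ?S (\<lambda>x. g (f x))"
    unfolding smooth_on_def
  proof
    fix k show "Ck_on k ?S (\<lambda>x. g (f x))"
    proof (rule Ck_on_compose[of _ T])
      show "Ck_on k ?S f" using S(3) Ck_on_subset[of k S f ?S] by (simp add: smooth_on_def)
      show "Ck_on k T g" using T(3) by (simp add: smooth_on_def)
    qed (use \<open>open ?S\<close> T in auto)
  qed
  ultimately show ?thesis using S T by (intro smooth_atI[of ?S]) auto
qed

lemma smooth_at_inverse:
  fixes f :: "'a::euclidean_space \<Rightarrow> 'b::{real_normed_field,euclidean_space}"
  assumes "smooth_at x f" "f x \<noteq> 0"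
  shows "smooth_at x (\<lambda>x. inverse (f x))"
proof (rule smooth_at_compose[OF assms(1)])
  show "smooth_at (f x) inverse"
    by (rule smooth_atI[of "- {0}"]) (use assms(2) in \<open>auto intro: Ck_on_inverse simp: smooth_on_def\<close>)
qed

lemma smooth_at_divide:
  fixes f g :: "'a::euclidean_space \<Rightarrow> 'b::{real_normed_field,euclidean_space}"
  shows "smooth_at x f \<Longrightarrow> smooth_at x g \<Longrightarrow> g x \<noteq> 0 \<Longrightarrow> smooth_at x (\<lambda>x. f x / g x)"
  unfolding divide_inverse by (intro smooth_at_mult smooth_at_inverse)

lemma smooth_at_power: "smooth_at x f \<Longrightarrow> smooth_at x (\<lambda>x. f x ^ n :: 'b::real_normed_field)"
  by (induction n) (auto intro: smooth_at_mult)

lemma smooth_at_deriv: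
  assumes "smooth_at x f" shows "smooth_at x (\<lambda>x. frechet_derivative f (at x) v)"
proof -
  obtain S where S: "open S" "x \<in> S" "smooth_on S f" using assms smooth_at_def by blast
  have lin: "linear (frechet_derivative f (at y))" if "y \<in> S" for y
    using S that smooth_atI smooth_at_differentiable linear_frechet by blast
  \<comment> \<open>\<open>Ck_on\<close> controls only derivatives along \<open>Basis\<close>, so a
    general direction \<open>v\<close> is expanded; the two expressions agree near
    \<open>x\<close>.\<close>
  have "smooth_at x (\<lambda>x. \<Sum>b\<in>Basis. (v \<bullet> b) *\<^sub>R frechet_derivative f (at x) b)"
    using S by (intro smooth_at_sum smooth_at_linear[OF bounded_linear_scaleR_right]) (auto intro: smooth_atI smooth_on_deriv_Basis)
  moreover have "\<forall>\<^sub>F y in nhds x. (\<Sum>b\<in>Basis. (v \<bullet> b) *\<^sub>R frechet_derivative f (at y) b) = frechet_derivative f (at y) v"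
    using S lin linear_expand_Basis[symmetric] by (subst eventually_nhds) blast
  ultimately show ?thesis by (rule smooth_at_cong_ev[THEN iffD1, rotated])
qed

lemma smooth_on_iff_smooth_at: "open S \<Longrightarrow> smooth_on S f \<longleftrightarrow> (\<forall>x\<in>S. smooth_at x f)"
proof
  assume S: "open S" and *: "\<forall>x\<in>S. smooth_at x f"
  have "\<forall>x\<in>S. smooth_at x f \<Longrightarrow> Ck_on k S f" for k
  proof (induction k arbitrary: f)
    case 0 then show ?case
      by (auto simp: continuous_on_eq_continuous_within smooth_at_continuous continuous_at_imp_continuous_at_within)
  next
    case (Suc k) then show ?case by (auto simp: smooth_at_differentiable intro: smooth_at_deriv)
  qed
  then show "smooth_on S f" using * by (simp add: smooth_on_def)
qed (auto intro: smooth_atI)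

lemma smooth_at_Pair: 
  assumes "smooth_at x f" "smooth_at x g"
  shows "smooth_at x (\<lambda>x. (f x, g x))"
proof -
  have "smooth_at x (\<lambda>x. (f x, 0))" "smooth_at x (\<lambda>x. (0, g x))"
    by (rule smooth_at_linear[OF bounded_linear_Pair[OF bounded_linear_ident bounded_linear_zero] assms(1)],
        rule smooth_at_linear[OF bounded_linear_Pair[OF bounded_linear_zero bounded_linear_ident] assms(2)])
  from smooth_at_add[OF this] show ?thesis by simp
qed

lemma smooth_at_ident [simp, intro]: "smooth_at x (\<lambda>x. x)"
  by (rule smooth_at_linear_self) (rule bounded_linear_ident)

lemma smooth_at_vec_iff:
  fixes f :: "'a::euclidean_space \<Rightarrow> 'b::euclidean_space ^ 'n"
  shows "smooth_at x f \<longleftrightarrow> (\<forall>i. smooth_at x (\<lambda>x. f x $ i))"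
proof
  assume *: "\<forall>i. smooth_at x (\<lambda>x. f x $ i)"
  have f: "f = (\<lambda>y. \<Sum>i\<in>UNIV. axis i (f y $ i))"
  proof
    fix y show "f y = (\<Sum>i\<in>UNIV. axis i (f y $ i))"
      by (simp add: vec_eq_iff axis_def)
  qed
  have "linear (\<lambda>a::'b. axis i a :: 'b ^ 'n)" for i
    by (auto intro!: linearI simp: vec_eq_iff axis_def)
  then have "smooth_at x (\<lambda>y. axis i (f y $ i))" for i
    by (intro smooth_at_linear[where L="axis i" and f="\<lambda>y. f y $ i"])
      (use * in \<open>simp_all add: linear_conv_bounded_linear\<close>)
  then have "smooth_at x (\<lambda>y. \<Sum>i\<in>UNIV. axis i (f y $ i))"
    by (rule smooth_at_sum)
  then show "smooth_at x f" unfolding f[symmetric] .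
qed (auto intro: smooth_at_vec_nth)

section \<open>Symmetry of second derivatives\<close>

lemma mvt_mixed_difference:
  fixes g :: "'a::euclidean_space \<Rightarrow> real"
  assumes h: "h > 0" and sm: "\<And>s t. 0 \<le> s \<Longrightarrow> s \<le> h \<Longrightarrow> 0 \<le> t \<Longrightarrow> t \<le> h \<Longrightarrow> smooth_at (u + s *\<^sub>R a + t *\<^sub>R b) g"
  shows "\<exists>s t. 0 \<le> s \<and> s \<le> h \<and> 0 \<le> t \<and> t \<le> h \<and>
    g (u + h *\<^sub>R a + h *\<^sub>R b) - g (u + h *\<^sub>R a) - g (u + h *\<^sub>R b) + g u =
    h * h * frechet_derivative (\<lambda>v. frechet_derivative g (at v) a) (at (u + s *\<^sub>R a + t *\<^sub>R b)) b"
proof -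
  have D: "((\<lambda>s. k (p + s *\<^sub>R c)) has_real_derivative frechet_derivative k (at (p + s *\<^sub>R c)) c) (at s)"
    if "smooth_at (p + s *\<^sub>R c) k" for k :: "'a \<Rightarrow> real" and p c :: 'a and s
  proof -
    have k: "(k has_derivative frechet_derivative k (at (p + s *\<^sub>R c))) (at (p + s *\<^sub>R c))"
      by (rule smooth_at_has_derivative[OF that])
    have "((\<lambda>s. p + s *\<^sub>R c) has_derivative (\<lambda>t. t *\<^sub>R c)) (at s)"
      by (auto intro!: derivative_eq_intros)
    from has_derivative_compose[OF this k]
    have "((\<lambda>s. k (p + s *\<^sub>R c)) has_derivative (\<lambda>t. frechet_derivative k (at (p + s *\<^sub>R c)) (t *\<^sub>R c))) (at s)" .
    moreover have "frechet_derivative k (at (p + s *\<^sub>R c)) (t *\<^sub>R c) = frechet_derivative k (at (p + s *\<^sub>R c)) c * t" for t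
      using linear_scale[OF linear_frechet[OF smooth_at_differentiable[OF that]], of t c] by simp
    ultimately show ?thesis by (simp add: has_field_derivative_def)
  qed
  \<comment> \<open>The mean value theorem is applied to this difference in direction
    \<open>a\<close>, then to the difference of the resulting derivatives in direction
    \<open>b\<close>.\<close>
  define f where "f s = g ((u + h *\<^sub>R b) + s *\<^sub>R a) - g (u + s *\<^sub>R a)" for s
  have sm2: "smooth_at ((u + h *\<^sub>R b) + s *\<^sub>R a) g" "smooth_at (u + s *\<^sub>R a) g" if "0 \<le> s" "s \<le> h" for s
    using sm[of s h] sm[of s 0] h that by (simp_all add: algebra_simps)
  have "\<exists>s>0. s < h \<and> f h - f 0 = (h - 0) * (frechet_derivative g (at ((u + h *\<^sub>R b) + s *\<^sub>R a)) a - frechet_derivative g (at (u + s *\<^sub>R a)) a)"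
    unfolding f_def by (rule MVT2[OF h]) (intro DERIV_diff D sm2)
  then obtain s where s: "0 < s" "s < h"
    "f h - f 0 = h * (frechet_derivative g (at ((u + s *\<^sub>R a) + h *\<^sub>R b)) a - frechet_derivative g (at ((u + s *\<^sub>R a) + 0 *\<^sub>R b)) a)"
    by (auto simp: algebra_simps)
  have "\<exists>t>0. t < h \<and> frechet_derivative g (at ((u + s *\<^sub>R a) + h *\<^sub>R b)) a - frechet_derivative g (at ((u + s *\<^sub>R a) + 0 *\<^sub>R b)) a
     = (h - 0) * frechet_derivative (\<lambda>v. frechet_derivative g (at v) a) (at ((u + s *\<^sub>R a) + t *\<^sub>R b)) b"
    by (rule MVT2[OF h]) (intro D smooth_at_deriv sm, use s in auto)
  then obtain t where t: "0 < t" "t < h" "f h - f 0 = h * (h * frechet_derivative (\<lambda>v. frechet_derivative g (at v) a) (at ((u + s *\<^sub>R a) + t *\<^sub>R b)) b)"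
    using s by auto
  have "f h - f 0 = g (u + h *\<^sub>R a + h *\<^sub>R b) - g (u + h *\<^sub>R a) - g (u + h *\<^sub>R b) + g u"
    by (simp add: f_def algebra_simps)
  with s t show ?thesis by (intro exI[of _ s] exI[of _ t]) (simp add: algebra_simps)
qed

lemma smooth_at_tendsto: "smooth_at u f \<Longrightarrow> (f \<longlongrightarrow> f u) (nhds u)"
  using smooth_at_continuous unfolding isCont_def tendsto_at_iff_tendsto_nhds .

text \<open>The second difference over a small parallelogram is symmetric in \<open>a\<close> and
  \<open>b\<close> and equals \<open>h * h\<close> times either mixed derivative at some nearby
  point; by continuity the two derivatives cannot differ.\<close>

lemma frechet_derivative_commute_real:
  fixes g :: "'a::euclidean_space \<Rightarrow> real"
  assumes "smooth_at u g"
  shows "frechet_derivative (\<lambda>v. frechet_derivative g (at v) a) (at u) b =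
         frechet_derivative (\<lambda>v. frechet_derivative g (at v) b) (at u) a"
proof (rule ccontr)
  let ?A = "\<lambda>u. frechet_derivative (\<lambda>v. frechet_derivative g (at v) a) (at u) b"
  let ?B = "\<lambda>u. frechet_derivative (\<lambda>v. frechet_derivative g (at v) b) (at u) a"
  assume "?A u \<noteq> ?B u"
  then have e: "\<bar>?A u - ?B u\<bar> / 2 > 0" (is "?e > 0") by simp
  have cA: "(?A \<longlongrightarrow> ?A u) (nhds u)" and cB: "(?B \<longlongrightarrow> ?B u) (nhds u)"
    by (rule smooth_at_tendsto, (rule smooth_at_deriv)+, rule assms)+
  have "\<forall>\<^sub>F v in nhds u. smooth_at v g \<and> dist (?A v) (?A u) < ?e \<and> dist (?B v) (?B u) < ?e"
    using smooth_at_ev[OF assms] tendstoD[OF cA e] tendstoD[OF cB e]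
    by eventually_elim simp
  then obtain d where d: "d > 0" "\<And>v. dist v u < d \<Longrightarrow> smooth_at v g \<and> dist (?A v) (?A u) < ?e \<and> dist (?B v) (?B u) < ?e"
    unfolding eventually_nhds_metric by blast
  \<comment> \<open>Keeps the parallelogram with sides \<open>h *\<^sub>R a\<close> and
    \<open>h *\<^sub>R b\<close> within distance \<open>d / 2\<close>; the summand 1 covers
    \<open>a = b = 0\<close>.\<close>
  define h where "h = d / (2 * (norm a + norm b + 1))"
  have pos: "norm a + norm b + 1 > 0" by (simp add: add_nonneg_pos)
  have h: "h > 0" using d pos by (simp add: h_def)
  have near: "dist (u + s *\<^sub>R a + t *\<^sub>R b) u < d" if "0 \<le> s" "s \<le> h" "0 \<le> t" "t \<le> h" for s t
  proof -
    have "dist (u + s *\<^sub>R a + t *\<^sub>R b) u = norm (s *\<^sub>R a + t *\<^sub>R b)" by (simp add: dist_norm)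
    also have "\<dots> \<le> s * norm a + t * norm b" using norm_triangle_ineq[of "s *\<^sub>R a" "t *\<^sub>R b"] that by simp
    also have "\<dots> \<le> h * norm a + h * norm b" using that by (intro add_mono mult_right_mono) auto
    also have "\<dots> \<le> h * (norm a + norm b + 1)" using h by (simp add: algebra_simps)
    also have "\<dots> = d / 2"
    proof -
      have "d / (2 * n) * n = d / 2" if "n > 0" for n :: real using that by (simp add: field_simps)
      then show ?thesis using pos unfolding h_def by blast
    qed
    finally show ?thesis using d by simp
  qed
  obtain s t where st: "0 \<le> s" "s \<le> h" "0 \<le> t" "t \<le> h"
    "g (u + h *\<^sub>R a + h *\<^sub>R b) - g (u + h *\<^sub>R a) - g (u + h *\<^sub>R b) + g u = h * h * ?A (u + s *\<^sub>R a + t *\<^sub>R b)"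
    using mvt_mixed_difference[OF h, of u a b g] near d by blast
  have near': "dist (u + s *\<^sub>R b + t *\<^sub>R a) u < d" if "0 \<le> s" "s \<le> h" "0 \<le> t" "t \<le> h" for s t
    using near[of t s] that by (simp add: algebra_simps)
  obtain s' t' where st': "0 \<le> s'" "s' \<le> h" "0 \<le> t'" "t' \<le> h"
    "g (u + h *\<^sub>R b + h *\<^sub>R a) - g (u + h *\<^sub>R b) - g (u + h *\<^sub>R a) + g u = h * h * ?B (u + s' *\<^sub>R b + t' *\<^sub>R a)"
    using mvt_mixed_difference[OF h, of u b a g] near' d by blast
  have "h * h * ?A (u + s *\<^sub>R a + t *\<^sub>R b) = h * h * ?B (u + s' *\<^sub>R b + t' *\<^sub>R a)"
    using st(5) st'(5) by (simp add: algebra_simps)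
  then have "?A (u + s *\<^sub>R a + t *\<^sub>R b) = ?B (u + s' *\<^sub>R b + t' *\<^sub>R a)" using h by simp
  moreover have "dist (?A (u + s *\<^sub>R a + t *\<^sub>R b)) (?A u) < ?e" "dist (?B (u + s' *\<^sub>R b + t' *\<^sub>R a)) (?B u) < ?e"
    using d(2)[OF near] d(2)[OF near'] st st' by auto
  ultimately show False by (auto simp: dist_real_def abs_if split: if_splits)
qed

lemma frechet_derivative_bounded_linear:
  assumes "bounded_linear L" "f differentiable (at x)"
  shows "frechet_derivative (\<lambda>x. L (f x)) (at x) = (\<lambda>v. L (frechet_derivative f (at x) v))"
  by (rule frechet_derivative_eqI) (rule bounded_linear.has_derivative[OF assms(1) frechet_derivative_worksI[OF assms(2)]])

lemma frechet_derivative_commute: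
  fixes g :: "'a::euclidean_space \<Rightarrow> complex"
  assumes "smooth_at u g"
  shows "frechet_derivative (\<lambda>v. frechet_derivative g (at v) a) (at u) b =
         frechet_derivative (\<lambda>v. frechet_derivative g (at v) b) (at u) a"
proof -
  have *: "L (frechet_derivative (\<lambda>v. frechet_derivative g (at v) a) (at u) b) =
     frechet_derivative (\<lambda>v. frechet_derivative (\<lambda>x. L (g x)) (at v) a) (at u) b" 
    if L: "bounded_linear L" for L :: "complex \<Rightarrow> real" and a b
  proof -
    have "L (frechet_derivative (\<lambda>v. frechet_derivative g (at v) a) (at u) b) =
       frechet_derivative (\<lambda>v. L (frechet_derivative g (at v) a)) (at u) b"
      by (simp add: frechet_derivative_bounded_linear[OF L] smooth_at_differentiable smooth_at_deriv assms)
    also have "\<dots> = frechet_derivative (\<lambda>v. frechet_derivative (\<lambda>x. L (g x)) (at v) a) (at u) b"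
    proof -
      have "\<forall>\<^sub>F v in nhds u. L (frechet_derivative g (at v) a) = frechet_derivative (\<lambda>x. L (g x)) (at v) a"
        using smooth_at_ev[OF assms] by eventually_elim (simp add: frechet_derivative_bounded_linear[OF L] smooth_at_differentiable)
      from frechet_derivative_cong_ev[OF this] show ?thesis by simp
    qed
    finally show ?thesis .
  qed
  show ?thesis
  proof (rule complex_eqI)
    show "Re (frechet_derivative (\<lambda>v. frechet_derivative g (at v) a) (at u) b) =
      Re (frechet_derivative (\<lambda>v. frechet_derivative g (at v) b) (at u) a)"
      unfolding *[OF bounded_linear_Re] by (rule frechet_derivative_commute_real[OF smooth_at_Re[OF assms]])
    show "Im (frechet_derivative (\<lambda>v. frechet_derivative g (at v) a) (at u) b) =
      Im (frechet_derivative (\<lambda>v. frechet_derivative g (at v) b) (at u) a)"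
      unfolding *[OF bounded_linear_Im] by (rule frechet_derivative_commute_real[OF smooth_at_Im[OF assms]])
  qed
qed

section \<open>Vector fields in coordinates\<close>

definition pd :: "'d \<Rightarrow> (real ^ 'd \<Rightarrow> complex) \<Rightarrow> real ^ 'd \<Rightarrow> complex" where
  "pd i g = (\<lambda>u. frechet_derivative g (at u) (axis i 1))"

definition pds :: "'d list \<Rightarrow> (real ^ 'd \<Rightarrow> complex) \<Rightarrow> real ^ 'd \<Rightarrow> complex" where
  "pds = foldr pd"

lemma pds_simps [simp]: "pds [] g = g" "pds (i # is) g = pd i (pds is g)"
  by (simp_all add: pds_def)

lemma pds_append: "pds (is @ js) g = pds is (pds js g)"
  by (simp add: pds_def)

lemma smooth_at_pd: "smooth_at u g \<Longrightarrow> smooth_at u (pd i g)"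
  unfolding pd_def by (rule smooth_at_deriv)

lemma smooth_at_pds: "smooth_at u g \<Longrightarrow> smooth_at u (pds is g)"
  by (induction "is") (auto intro: smooth_at_pd)

lemma pd_cong_ev: "\<forall>\<^sub>F v in nhds u. f v = g v \<Longrightarrow> pd i f u = pd i g u"
  by (simp add: pd_def frechet_derivative_cong_ev)

lemma nhds_ev_ev: "\<forall>\<^sub>F v in nhds u. P v \<Longrightarrow> \<forall>\<^sub>F v in nhds u. \<forall>\<^sub>F x in nhds v. P x"
  by (simp add: eventually_eventually)

lemma pd_cong_ev': "\<forall>\<^sub>F v in nhds u. f v = g v \<Longrightarrow> \<forall>\<^sub>F v in nhds u. pd i f v = pd i g v"
  by (drule nhds_ev_ev) (auto elim!: eventually_mono intro: pd_cong_ev)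

lemma pds_cong_ev': "\<forall>\<^sub>F v in nhds u. f v = g v \<Longrightarrow> \<forall>\<^sub>F v in nhds u. pds is f v = pds is g v"
  by (induction "is") (auto intro: pd_cong_ev')

lemma pd_const [simp]: "pd i (\<lambda>u. c) = (\<lambda>u. 0)"
  by (simp add: pd_def)

lemma pd_add: "smooth_at u f \<Longrightarrow> smooth_at u g \<Longrightarrow> pd i (\<lambda>u. f u + g u) u = pd i f u + pd i g u"
  unfolding pd_def
  by (subst frechet_derivative_eqI[OF has_derivative_add[OF smooth_at_has_derivative smooth_at_has_derivative]]) auto

lemma pd_mult: "smooth_at u f \<Longrightarrow> smooth_at u g \<Longrightarrow> pd i (\<lambda>u. f u * g u) u = pd i f u * g u + f u * pd i g u"
  unfolding pd_def
  by (subst frechet_derivative_eqI[OF has_derivative_mult[OF smooth_at_has_derivative smooth_at_has_derivative]]) auto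

lemma pd_linear: "bounded_linear L \<Longrightarrow> smooth_at u f \<Longrightarrow> pd i (\<lambda>u. L (f u)) u = L (pd i f u)"
  by (simp add: pd_def frechet_derivative_bounded_linear smooth_at_differentiable)

lemma pd_cnj: "smooth_at u f \<Longrightarrow> pd i (\<lambda>u. cnj (f u)) u = cnj (pd i f u)"
  by (rule pd_linear[OF bounded_linear_cnj])

lemma pd_commute: "smooth_at u g \<Longrightarrow> pd i (pd j g) u = pd j (pd i g) u"
  unfolding pd_def by (rule frechet_derivative_commute)

text \<open>Links the list that \<open>mpartial\<close> picks by choice with arbitrary lists: the
  first index is pulled out of its place in the other list by symmetry of mixed derivatives.\<close>

lemma pds_mset:
  assumes "mset is = mset js" "smooth_at u g"
  shows "pds is g u = pds js g u"
  using assms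
proof (induction "is" arbitrary: js u)
  case Nil then show ?case by simp
next
  case (Cons i xs)
  then obtain as bs where js: "js = as @ i # bs"
    by (metis list.set_intros(1) mset_eq_setD split_list)
  have m: "mset xs = mset (as @ bs)" using Cons.prems js by simp
  have ev: "\<forall>\<^sub>F v in nhds u. smooth_at v g" using Cons.prems smooth_at_ev by blast
  have "\<forall>\<^sub>F v in nhds u. pds xs g v = pds (as @ bs) g v"
    using ev by eventually_elim (rule Cons.IH[OF m])
  then have "pds (i # xs) g u = pds (i # as @ bs) g u"
    by (simp add: pd_cong_ev)
  also have "\<dots> = pds (as @ i # bs) g u"
  proof -
    have "smooth_at u h \<Longrightarrow> pd i (pds as h) u = pds as (pd i h) u" for h u
    proof (induction as arbitrary: u)
      case (Cons a as)
      have "\<forall>\<^sub>F v in nhds u. pd i (pds as h) v = pds as (pd i h) v"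
        using smooth_at_ev[OF Cons.prems] by eventually_elim (rule Cons.IH)
      then show ?case using pd_commute[OF smooth_at_pds[OF Cons.prems]] pd_cong_ev by fastforce
    qed simp
    from this[OF smooth_at_pds[OF Cons.prems(2)]] show ?thesis by (simp add: pds_append)
  qed
  finally show ?case using js by simp
qed

text \<open>Complex coefficients: these are sections of the complexified tangent bundle in a chart,
  so (1,0) and (0,1) fields have the same type and conjugation exchanges them.\<close>

type_synonym 'd field = "real ^ 'd \<Rightarrow> complex ^ 'd"

definition vf :: "'d::finite field \<Rightarrow> (real ^ 'd \<Rightarrow> complex) \<Rightarrow> real ^ 'd \<Rightarrow> complex" where
  "vf b g = (\<lambda>u. \<Sum>i\<in>UNIV. b u $ i * pd i g u)"

lemma smooth_at_vf: "smooth_at u b \<Longrightarrow> smooth_at u g \<Longrightarrow> smooth_at u (vf b g)"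
  unfolding vf_def by (intro smooth_at_sum smooth_at_mult smooth_at_pd smooth_at_vec_nth)

lemma vf_cong_ev: "\<forall>\<^sub>F v in nhds u. f v = g v \<Longrightarrow> vf b f u = vf b g u"
  by (simp add: vf_def pd_cong_ev)

lemma vf_cong_ev': "\<forall>\<^sub>F v in nhds u. f v = g v \<Longrightarrow> \<forall>\<^sub>F v in nhds u. vf b f v = vf b g v"
  by (drule nhds_ev_ev) (auto elim!: eventually_mono intro: vf_cong_ev)

lemma vf_const [simp]: "vf b (\<lambda>u. c) = (\<lambda>u. 0)"
  by (simp add: vf_def)

lemma vf_add: "smooth_at u f \<Longrightarrow> smooth_at u g \<Longrightarrow> vf b (\<lambda>u. f u + g u) u = vf b f u + vf b g u"
  by (simp add: vf_def pd_add algebra_simps sum.distrib)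

lemma vf_mult: "smooth_at u f \<Longrightarrow> smooth_at u g \<Longrightarrow> vf b (\<lambda>u. f u * g u) u = vf b f u * g u + f u * vf b g u"
  by (simp add: vf_def pd_mult algebra_simps sum.distrib sum_distrib_left)

lemma vf_cmult: "smooth_at u g \<Longrightarrow> vf b (\<lambda>u. c * g u) u = c * vf b g u"
  by (simp add: vf_mult)

lemma vf_uminus: "smooth_at u g \<Longrightarrow> vf b (\<lambda>u. - g u) u = - vf b g u"
  using vf_cmult[of u g b "-1"] by simp

lemma vf_sum: "(\<And>i. i \<in> I \<Longrightarrow> smooth_at u (f i)) \<Longrightarrow> vf b (\<lambda>u. \<Sum>i\<in>I. f i u) u = (\<Sum>i\<in>I. vf b (f i) u)"
  by (induction I rule: infinite_finite_induct) (auto simp: vf_add smooth_at_sum)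

definition cnjf :: "'d::finite field \<Rightarrow> 'd field" where
  "cnjf b = (\<lambda>u. \<chi> i. cnj (b u $ i))"

lemma cnjf_cnjf [simp]: "cnjf (cnjf b) = b"
  by (simp add: cnjf_def)

lemma smooth_at_cnjf: "smooth_at u b \<Longrightarrow> smooth_at u (cnjf b)"
  by (subst smooth_at_vec_iff) (auto simp: cnjf_def intro: smooth_at_cnj smooth_at_vec_nth)

lemma vf_cnj: "smooth_at u g \<Longrightarrow> vf b (\<lambda>v. cnj (g v)) u = cnj (vf (cnjf b) g u)"
  by (simp add: vf_def pd_cnj cnjf_def)

text \<open>The Lie bracket in components.\<close>

definition brk :: "'d::finite field \<Rightarrow> 'd field \<Rightarrow> 'd field" where
  "brk b c = (\<lambda>u. \<chi> i. vf b (\<lambda>v. c v $ i) u - vf c (\<lambda>v. b v $ i) u)"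

lemma smooth_at_brk: "smooth_at u b \<Longrightarrow> smooth_at u c \<Longrightarrow> smooth_at u (brk b c)"
  by (subst smooth_at_vec_iff) (auto simp: brk_def intro!: smooth_at_diff smooth_at_vf smooth_at_vec_nth)

text \<open>The second-order terms of the two compositions coincide by symmetry of mixed
  derivatives; derivatives of the coefficients remain and form the bracket.\<close>

lemma vf_commute:
  assumes "smooth_at u b" "smooth_at u c" "smooth_at u g"
  shows "vf b (vf c g) u = vf c (vf b g) u + vf (brk b c) g u"
proof -
  have *: "vf b (vf c g) u = (\<Sum>j\<in>UNIV. vf b (\<lambda>v. c v $ j) u * pd j g u) + (\<Sum>j\<in>UNIV. \<Sum>i\<in>UNIV. c u $ j * b u $ i * pd i (pd j g) u)"
    if "smooth_at u b" "smooth_at u c" for b c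
  proof -
    have "vf b (vf c g) u = (\<Sum>j\<in>UNIV. vf b (\<lambda>v. c v $ j * pd j g v) u)"
      unfolding vf_def[of c] using that assms(3) by (intro vf_sum smooth_at_mult smooth_at_pd smooth_at_vec_nth)
    also have "\<dots> = (\<Sum>j\<in>UNIV. vf b (\<lambda>v. c v $ j) u * pd j g u + c u $ j * vf b (pd j g) u)"
      using that assms(3) by (intro sum.cong refl vf_mult smooth_at_pd smooth_at_vec_nth)
    finally show ?thesis by (simp add: sum.distrib vf_def[of b "pd _ g"] sum_distrib_left mult.assoc)
  qed
  have "(\<Sum>j\<in>UNIV. \<Sum>i\<in>UNIV. c u $ j * b u $ i * pd i (pd j g) u) = (\<Sum>j\<in>UNIV. \<Sum>i\<in>UNIV. b u $ j * c u $ i * pd i (pd j g) u)"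
    by (subst sum.swap) (simp add: pd_commute[OF assms(3)] mult.commute[of "c u $ _" "b u $ _"])
  moreover have "vf (brk b c) g u = (\<Sum>j\<in>UNIV. vf b (\<lambda>v. c v $ j) u * pd j g u) - (\<Sum>j\<in>UNIV. vf c (\<lambda>v. b v $ j) u * pd j g u)"
    unfolding vf_def[of "brk b c"] by (simp add: brk_def left_diff_distrib sum_subtractf)
  ultimately show ?thesis
    by (simp add: *[OF assms(1,2)] *[OF assms(2,1)])
qed

definition cf :: "'d \<Rightarrow> 'd::finite field" where "cf i = (\<lambda>u. axis i 1)"

lemma vf_cf [simp]: "vf (cf i) g = pd i g"
proof
  fix u
  have "vf (cf i) g u = (\<Sum>j\<in>UNIV. if j = i then pd j g u else 0)"
    unfolding vf_def cf_def by (intro sum.cong) (auto simp: axis_def)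
  then show "vf (cf i) g u = pd i g u" by simp
qed

lemma smooth_at_cf [simp]: "smooth_at u (cf i)"
  by (simp add: cf_def)

lemma vf_lincomb: "vf (\<lambda>u. \<Sum>l\<in>I. c l u *s b l u) g u = (\<Sum>l\<in>I. c l u * vf (b l) g u)"
proof -
  have "vf (\<lambda>u. \<Sum>l\<in>I. c l u *s b l u) g u = (\<Sum>i\<in>UNIV. \<Sum>l\<in>I. c l u * (b l u $ i * pd i g u))"
    by (simp add: vf_def sum_distrib_right mult.assoc)
  also have "\<dots> = (\<Sum>l\<in>I. c l u * vf (b l) g u)"
    by (subst sum.swap) (simp add: vf_def sum_distrib_left)
  finally show ?thesis .
qed

lemma smooth_at_lincomb: "(\<And>l. l \<in> I \<Longrightarrow> smooth_at u (c l)) \<Longrightarrow> (\<And>l. l \<in> I \<Longrightarrow> smooth_at u (b l)) \<Longrightarrow>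
   smooth_at u (\<lambda>u. \<Sum>l\<in>I. (c l u :: complex) *s (b l u :: complex ^ 'd))"
  by (subst smooth_at_vec_iff) (auto intro!: smooth_at_sum smooth_at_mult smooth_at_vec_nth)

section \<open>Linear systems over local rings\<close>

text \<open>The \<open>R\<close>-span of the rows \<open>V a\<close>, inductive because
  \<open>S\<close> may be infinite: a property of rows that survives sums and multiples passes to
  the solution of a linear system.\<close>

inductive_set rcomb :: "('x \<Rightarrow> complex) set \<Rightarrow> 'a set \<Rightarrow> ('a \<Rightarrow> 'i \<Rightarrow> 'x \<Rightarrow> complex) \<Rightarrow> ('i \<Rightarrow> 'x \<Rightarrow> complex) set"
  for R S V where
  row: "a \<in> S \<Longrightarrow> V a \<in> rcomb R S V"
| add: "g \<in> rcomb R S V \<Longrightarrow> h \<in> rcomb R S V \<Longrightarrow> (\<lambda>i x. g i x + h i x) \<in> rcomb R S V"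
| scale: "r \<in> R \<Longrightarrow> g \<in> rcomb R S V \<Longrightarrow> (\<lambda>i x. r x * g i x) \<in> rcomb R S V"

text \<open>Local in the sense that nonvanishing at \<open>x0\<close> means invertible. The
  instances are germs of smooth functions at a point (\<open>local_ring_germs\<close>) and
  functionals of germs of maps (\<open>local_ring_BB\<close>).\<close>

locale local_ring =
  fixes FF :: "'x filter" and x0 :: 'x and R :: "('x \<Rightarrow> complex) set"
  assumes ev_base: "\<And>P. eventually P FF \<Longrightarrow> P x0"
    and const_R: "\<And>c. (\<lambda>_. c) \<in> R"
    and add_R: "\<And>f g. f \<in> R \<Longrightarrow> g \<in> R \<Longrightarrow> (\<lambda>x. f x + g x) \<in> R"
    and mult_R: "\<And>f g. f \<in> R \<Longrightarrow> g \<in> R \<Longrightarrow> (\<lambda>x. f x * g x) \<in> R"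
    and inverse_R: "\<And>f. f \<in> R \<Longrightarrow> f x0 \<noteq> 0 \<Longrightarrow> (\<lambda>x. inverse (f x)) \<in> R"
    and ev_nonzero: "\<And>f. f \<in> R \<Longrightarrow> f x0 \<noteq> 0 \<Longrightarrow> eventually (\<lambda>x. f x \<noteq> 0) FF"
begin

lemma uminus_R: "f \<in> R \<Longrightarrow> (\<lambda>x. - f x) \<in> R"
  using mult_R[OF const_R[of "-1"]] by fastforce

lemma rcomb_add_sum:
  assumes "finite J" "h \<in> rcomb R S V" "\<And>i. i \<in> J \<Longrightarrow> r i \<in> R" "\<And>i. i \<in> J \<Longrightarrow> g i \<in> rcomb R S V"
  shows "(\<lambda>l x. h l x + (\<Sum>i\<in>J. r i x * g i l x)) \<in> rcomb R S V"
  using assms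
proof (induction J rule: finite_induct)
  case empty then show ?case by simp
next
  case (insert j J)
  have "(\<lambda>l x. (\<lambda>l x. h l x + (\<Sum>i\<in>J. r i x * g i l x)) l x + (\<lambda>l x. r j x * g j l x) l x) \<in> rcomb R S V"
    using insert by (intro rcomb.add rcomb.scale insert.IH) auto
  then show ?case using insert by (simp add: algebra_simps)
qed

text \<open>By Gaussian elimination; pivots are found at the base point and are invertible in \<open>R\<close>.\<close>

lemma left_inverse:
  assumes "finite I" "\<And>a i. a \<in> S \<Longrightarrow> i \<in> I \<Longrightarrow> V a i \<in> R"
    and "\<And>c. (\<And>a. a \<in> S \<Longrightarrow> (\<Sum>i\<in>I. c i * V a i x0) = 0) \<Longrightarrow> \<forall>i\<in>I. c i = 0" "j \<in> I"
  shows "\<exists>g\<in>rcomb R S V. eventually (\<lambda>x. \<forall>i\<in>I. g i x = (if i = j then 1 else 0)) FF"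
  using assms
proof (induction I arbitrary: V j rule: finite_induct)
  case empty then show ?case by simp
next
  case (insert i0 I)
  \<comment> \<open>The unit vector at \<open>i0\<close> is not annihilated by all rows, so some
    entry of column \<open>i0\<close> is nonzero at the base point.\<close>
  obtain a0 where a0: "a0 \<in> S" "V a0 i0 x0 \<noteq> 0"
  proof -
    have "\<not> (\<forall>a\<in>S. (\<Sum>i\<in>insert i0 I. (if i = i0 then 1 else 0) * V a i x0) = 0)"
      using insert.prems(2)[of "\<lambda>i. if i = i0 then 1 else 0"] by auto
    moreover have "(\<Sum>i\<in>insert i0 I. (if i = i0 then 1 else 0) * V a i x0) = V a i0 x0" for a
      using insert.hyps by (simp add: if_distrib[of "\<lambda>c. c * _"] cong: if_cong)
    ultimately show ?thesis using that by auto
  qed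
  define W where "W x = inverse (V a0 i0 x)" for x
  have W: "W \<in> R" unfolding W_def using insert.prems(1) a0 by (intro inverse_R) auto
  have Wev: "eventually (\<lambda>x. W x * V a0 i0 x = 1) FF"
    using ev_nonzero[of "V a0 i0"] insert.prems(1) a0 by (auto simp: W_def elim: eventually_mono)
  \<comment> \<open>Column \<open>i0\<close> is cleared with the pivot row; it vanishes along
    \<open>FF\<close>, see \<open>zero\<close>.\<close>
  define V' where "V' a i x = V a i x + (- (V a i0 x * W x)) * V a0 i x" for a i x
  have V'R: "V' a i \<in> R" if "a \<in> S" "i \<in> I" for a i
    unfolding V'_def[abs_def] using that insert.prems(1) a0 W by (intro add_R mult_R uminus_R) auto
  have V'comb: "V' a \<in> rcomb R S V" if "a \<in> S" for a
    unfolding V'_def[abs_def] using that insert.prems(1) a0 W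
    by (intro rcomb.add rcomb.scale rcomb.row uminus_R mult_R) auto
  have sub: "g \<in> rcomb R S V" if "g \<in> rcomb R S V'" for g
    using that by induction (auto intro: V'comb rcomb.add rcomb.scale)
  have zero: "eventually (\<lambda>x. g i0 x = 0) FF" if "g \<in> rcomb R S V'" for g
    using that
  proof induction
    case (row a) show ?case using Wev by eventually_elim (simp add: V'_def mult.assoc)
  next
    case (add g h) from add.IH show ?case by eventually_elim simp
  next
    case (scale r g) from scale.IH show ?case by eventually_elim simp
  qed
  have ind: "\<forall>i\<in>I. c i = 0" if c: "\<And>a. a \<in> S \<Longrightarrow> (\<Sum>i\<in>I. c i * V' a i x0) = 0" for c
  proof -
    \<comment> \<open>A relation among the reduced columns extends to all columns: the pivot row
      dictates the coefficient at \<open>i0\<close>.\<close>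
    define c' where "c' i = (if i = i0 then - W x0 * (\<Sum>i\<in>I. c i * V a0 i x0) else c i)" for i
    have "(\<Sum>i\<in>insert i0 I. c' i * V a i x0) = 0" if "a \<in> S" for a
    proof -
      have "(\<Sum>i\<in>insert i0 I. c' i * V a i x0) = c' i0 * V a i0 x0 + (\<Sum>i\<in>I. c i * V a i x0)"
        using insert.hyps by (auto simp: c'_def intro!: sum.cong)
      also have "\<dots> = (\<Sum>i\<in>I. c i * V' a i x0)"
        by (simp add: c'_def V'_def algebra_simps sum_subtractf sum_distrib_left sum_negf)
      finally show ?thesis using c[OF that] by simp
    qed
    then have "\<forall>i\<in>insert i0 I. c' i = 0" by (rule insert.prems(2))
    then show ?thesis using insert.hyps by (auto simp: c'_def split: if_splits)
  qed
  have I: "\<exists>g\<in>rcomb R S V. eventually (\<lambda>x. \<forall>i\<in>insert i0 I. g i x = (if i = j then 1 else 0)) FF" if "j \<in> I" for j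
  proof -
    have "\<exists>g\<in>rcomb R S V'. eventually (\<lambda>x. \<forall>i\<in>I. g i x = (if i = j then 1 else 0)) FF"
    proof (rule insert.IH[OF _ _ that])
      show "\<And>a i. a \<in> S \<Longrightarrow> i \<in> I \<Longrightarrow> V' a i \<in> R" by (rule V'R)
    next
      fix c assume "\<And>a. a \<in> S \<Longrightarrow> (\<Sum>i\<in>I. c i * V' a i x0) = 0"
      then show "\<forall>i\<in>I. c i = 0" by (rule ind)
    qed
    then obtain g where g: "g \<in> rcomb R S V'" "eventually (\<lambda>x. \<forall>i\<in>I. g i x = (if i = j then 1 else 0)) FF"
      by blast
    show ?thesis
      by (rule bexI[OF _ sub[OF g(1)]])
        (use zero[OF g(1)] g(2) in eventually_elim, use that insert.hyps in auto)
  qed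
  then have "\<forall>j\<in>I. \<exists>g. g \<in> rcomb R S V \<and> eventually (\<lambda>x. \<forall>i\<in>insert i0 I. g i x = (if i = j then 1 else 0)) FF"
    by blast
  from bchoice[OF this] obtain G where G: "\<And>j. j \<in> I \<Longrightarrow> G j \<in> rcomb R S V"
    "\<And>j. j \<in> I \<Longrightarrow> eventually (\<lambda>x. \<forall>i\<in>insert i0 I. G j i x = (if i = j then 1 else 0)) FF" by blast
  show ?case
  proof (cases "j = i0")
    case True
    \<comment> \<open>For the pivot column, the normalized pivot row is freed from its other entries
      with the solutions \<open>G\<close> already found.\<close>
    let ?h = "\<lambda>i x. W x * V a0 i x"
    let ?g = "\<lambda>l x. ?h l x + (\<Sum>i\<in>I. (- ?h i x) * G i l x)"
    have "?g \<in> rcomb R S V"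
      using insert.hyps insert.prems(1) a0 W G by (intro rcomb_add_sum rcomb.scale rcomb.row uminus_R mult_R) auto
    moreover have "eventually (\<lambda>x. \<forall>j\<in>I. \<forall>i\<in>insert i0 I. G j i x = (if i = j then 1 else 0)) FF"
      using G(2) insert.hyps by (simp add: eventually_ball_finite_distrib)
    then have "eventually (\<lambda>x. \<forall>i\<in>insert i0 I. ?g i x = (if i = j then 1 else 0)) FF"
      using Wev
    proof eventually_elim
      case (elim x)
      have "(\<Sum>i\<in>I. (- ?h i x) * G i l x) = (if l = i0 then 0 else - ?h l x)" if "l \<in> insert i0 I" for l
      proof -
        have "(\<Sum>i\<in>I. (- ?h i x) * G i l x) = (\<Sum>i\<in>I. if i = l then - ?h i x else 0)"
          using elim that by (intro sum.cong) auto
        then show ?thesis using that insert.hyps by auto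
      qed
      then show ?case using elim True by auto
    qed
    ultimately show ?thesis by (intro bexI[where x="?g"])
  next
    case False then show ?thesis by (intro I) (use insert.prems(3) in simp)
  qed
qed

end

section \<open>Prime ideals of flat functions\<close>

lemma pascal_sum:
  fixes A :: "nat \<Rightarrow> complex"
  shows "(\<Sum>k\<le>Suc m. of_nat (Suc m choose k) * A k) =
    (\<Sum>k\<le>m. of_nat (m choose k) * A k) + (\<Sum>k\<le>m. of_nat (m choose k) * A (Suc k))"
proof -
  have "(\<Sum>k\<le>Suc m. of_nat (Suc m choose k) * A k) = A 0 + (\<Sum>k\<le>m. of_nat (Suc m choose Suc k) * A (Suc k))"
    by (subst sum.atMost_Suc_shift) simp
  also have "\<dots> = (A 0 + (\<Sum>k\<le>m. of_nat (m choose Suc k) * A (Suc k))) + (\<Sum>k\<le>m. of_nat (m choose k) * A (Suc k))"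
    by (simp add: algebra_simps sum.distrib)
  also have "A 0 + (\<Sum>k\<le>m. of_nat (m choose Suc k) * A (Suc k)) = (\<Sum>k\<le>Suc m. of_nat (m choose k) * A k)"
    by (subst sum.atMost_Suc_shift) simp
  also have "\<dots> = (\<Sum>k\<le>m. of_nat (m choose k) * A k)"
    by simp
  finally show ?thesis .
qed

definition Sm :: "'a::euclidean_space set \<Rightarrow> ('a \<Rightarrow> 'b::real_normed_vector) \<Rightarrow> bool" where
  "Sm \<Omega> g \<longleftrightarrow> (\<forall>u\<in>\<Omega>. smooth_at u g)"

lemma SmD: "Sm \<Omega> g \<Longrightarrow> u \<in> \<Omega> \<Longrightarrow> smooth_at u g"
  by (simp add: Sm_def)

lemma Sm_vf: "Sm \<Omega> b \<Longrightarrow> Sm \<Omega> g \<Longrightarrow> Sm \<Omega> (vf b g)"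
  by (simp add: Sm_def smooth_at_vf)

lemma Sm_vf_pow: "Sm \<Omega> b \<Longrightarrow> Sm \<Omega> g \<Longrightarrow> Sm \<Omega> ((vf b ^^ m) g)"
  by (induction m) (auto intro: Sm_vf)

lemma Sm_mult: "Sm \<Omega> f \<Longrightarrow> Sm \<Omega> g \<Longrightarrow> Sm \<Omega> (\<lambda>u. f u * g u :: complex)"
  by (simp add: Sm_def smooth_at_mult)

lemma Sm_add: "Sm \<Omega> f \<Longrightarrow> Sm \<Omega> g \<Longrightarrow> Sm \<Omega> (\<lambda>u. f u + g u)"
  by (simp add: Sm_def smooth_at_add)

lemma vf_cong_on:
  assumes "open \<Omega>" "\<And>v. v \<in> \<Omega> \<Longrightarrow> f v = g v" "u \<in> \<Omega>"
  shows "vf b f u = vf b g u"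
  using assms by (intro vf_cong_ev) (auto simp: eventually_nhds)

lemma vf_pow_cong_on:
  assumes "open \<Omega>" "\<And>v. v \<in> \<Omega> \<Longrightarrow> f v = g v"
  shows "u \<in> \<Omega> \<Longrightarrow> (vf b ^^ m) f u = (vf b ^^ m) g u"
proof (induction m arbitrary: u)
  case (Suc m) show ?case using vf_cong_on[OF assms(1) Suc.IH Suc.prems] by simp
qed (use assms in simp)

lemma vf_pow_mult:
  assumes "open \<Omega>" "Sm \<Omega> b" "Sm \<Omega> g" "Sm \<Omega> h" "u \<in> \<Omega>"
  shows "(vf b ^^ m) (\<lambda>u. g u * h u) u =
    (\<Sum>k\<le>m. of_nat (m choose k) * ((vf b ^^ k) g u * (vf b ^^ (m - k)) h u))"
  using assms(5)
proof (induction m arbitrary: u)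
  case 0 then show ?case by simp
next
  case (Suc m)
  let ?G = "\<lambda>k. (vf b ^^ k) g" and ?H = "\<lambda>k. (vf b ^^ k) h"
  have sm: "smooth_at u (?G k)" "smooth_at u (?H k)" for k
    using Sm_vf_pow[OF assms(2,3)] Sm_vf_pow[OF assms(2,4)] Suc.prems by (auto simp: Sm_def)
  have "(vf b ^^ Suc m) (\<lambda>u. g u * h u) u =
      vf b (\<lambda>u. \<Sum>k\<le>m. of_nat (m choose k) * (?G k u * ?H (m - k) u)) u"
    using vf_cong_on[OF assms(1) Suc.IH Suc.prems] by simp
  also have "\<dots> = (\<Sum>k\<le>m. of_nat (m choose k) * (?G (Suc k) u * ?H (m - k) u + ?G k u * ?H (Suc m - k) u))"
    using sm by (subst vf_sum) (auto intro!: smooth_at_mult sum.cong simp: vf_cmult vf_mult smooth_at_mult Suc_diff_le)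
  also have "\<dots> = (\<Sum>k\<le>m. of_nat (m choose k) * (?G k u * ?H (Suc m - k) u)) +
      (\<Sum>k\<le>m. of_nat (m choose k) * (?G (Suc k) u * ?H (Suc m - Suc k) u))"
    by (simp add: algebra_simps sum.distrib)
  also have "\<dots> = (\<Sum>k\<le>Suc m. of_nat (Suc m choose k) * (?G k u * ?H (Suc m - k) u))"
    by (simp only: pascal_sum[of m "\<lambda>k. ?G k u * ?H (Suc m - k) u"])
  finally show ?case .
qed

text \<open>A prime ideal of the ring of smooth functions on \<open>\<Omega>\<close>. Functions are
  total, so the last clause makes membership depend on values on \<open>\<Omega>\<close> only; that
  nonzero constants stay outside is stated separately in \<open>const_notin_flats\<close>.\<close>

definition prime_in :: "(real ^ 'd) set \<Rightarrow> (real ^ 'd \<Rightarrow> complex) set \<Rightarrow> bool" where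
  "prime_in \<Omega> P \<longleftrightarrow> (\<forall>g\<in>P. Sm \<Omega> g) \<and> (\<lambda>_. 0) \<in> P \<and> (\<forall>g\<in>P. \<forall>h\<in>P. (\<lambda>u. g u + h u) \<in> P) \<and>
     (\<forall>g h. Sm \<Omega> g \<longrightarrow> h \<in> P \<longrightarrow> (\<lambda>u. g u * h u) \<in> P) \<and>
     (\<forall>g h. Sm \<Omega> g \<longrightarrow> Sm \<Omega> h \<longrightarrow> (\<lambda>u. g u * h u) \<in> P \<longrightarrow> g \<in> P \<or> h \<in> P) \<and>
     (\<forall>g h. g \<in> P \<longrightarrow> Sm \<Omega> h \<longrightarrow> (\<forall>u\<in>\<Omega>. g u = h u) \<longrightarrow> h \<in> P)"

lemma
  assumes "prime_in \<Omega> P"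
  shows prime_in_Sm: "g \<in> P \<Longrightarrow> Sm \<Omega> g" and prime_in_0: "(\<lambda>_. 0) \<in> P"
    and prime_in_add: "g \<in> P \<Longrightarrow> h \<in> P \<Longrightarrow> (\<lambda>u. g u + h u) \<in> P"
    and prime_in_mult: "Sm \<Omega> g \<Longrightarrow> h \<in> P \<Longrightarrow> (\<lambda>u. g u * h u) \<in> P"
    and prime_in_prime: "Sm \<Omega> g \<Longrightarrow> Sm \<Omega> h \<Longrightarrow> (\<lambda>u. g u * h u) \<in> P \<Longrightarrow> g \<in> P \<or> h \<in> P"
    and prime_in_cong: "g \<in> P \<Longrightarrow> Sm \<Omega> h \<Longrightarrow> \<forall>u\<in>\<Omega>. g u = h u \<Longrightarrow> h \<in> P"
  using assms unfolding prime_in_def by blast+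

lemma prime_in_sum:
  assumes "prime_in \<Omega> P"
  shows "(\<And>i. i \<in> I \<Longrightarrow> f i \<in> P) \<Longrightarrow> (\<lambda>u. \<Sum>i\<in>I. f i u) \<in> P"
proof (induction I rule: infinite_finite_induct)
  case (insert i I)
  have "f i \<in> P" "(\<lambda>u. \<Sum>i\<in>I. f i u) \<in> P" using insert by blast+
  from prime_in_add[OF assms this] show ?case using insert.hyps by simp
qed (simp_all add: prime_in_0[OF assms])

text \<open>For smooth \<open>b\<close>, the largest set of smooth functions inside \<open>P\<close>
  that is stable under \<open>b\<close>.\<close>

definition flatten :: "(real ^ 'd) set \<Rightarrow> 'd::finite field \<Rightarrow> (real ^ 'd \<Rightarrow> complex) set \<Rightarrow> (real ^ 'd \<Rightarrow> complex) set" where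
  "flatten \<Omega> b P = {g. Sm \<Omega> g \<and> (\<forall>m. (vf b ^^ m) g \<in> P)}"

text \<open>Primality: if \<open>m\<close> and \<open>m'\<close> are minimal with \<open>b\<^sup>m g \<notin> P\<close> and \<open>b\<^sup>m\<^sup>' h \<notin> P\<close>, then
  \<open>b\<^sup>m\<^sup>+\<^sup>m\<^sup>' (g h)\<close> is congruent to a nonzero multiple of \<open>b\<^sup>m g \<cdot> b\<^sup>m\<^sup>' h\<close> modulo \<open>P\<close>.\<close>

lemma prime_in_flatten:
  assumes "open \<Omega>" "Sm \<Omega> b" and P: "prime_in \<Omega> P"
  shows "prime_in \<Omega> (flatten \<Omega> b P)"
proof -
  note P2 = prime_in_0[OF P] and P3 = prime_in_add[OF P] and P4 = prime_in_mult[OF P]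
    and P5 = prime_in_prime[OF P]
  have P6: "g \<in> P \<Longrightarrow> Sm \<Omega> h \<Longrightarrow> (\<And>u. u \<in> \<Omega> \<Longrightarrow> g u = h u) \<Longrightarrow> h \<in> P" for g h
    using prime_in_cong[OF P] by blast
  have c: "Sm \<Omega> (\<lambda>_. c)" for c :: complex by (simp add: Sm_def)
  let ?F = "flatten \<Omega> b P"
  note Smp = Sm_vf_pow[OF assms(2)]
  have zero: "(vf b ^^ m) (\<lambda>_. 0) = (\<lambda>_. 0)" for m by (induction m) auto
  have add: "(vf b ^^ m) (\<lambda>u. g u + h u) u = (vf b ^^ m) g u + (vf b ^^ m) h u"
    if "Sm \<Omega> g" "Sm \<Omega> h" "u \<in> \<Omega>" for g h m u
    using that(3)
  proof (induction m arbitrary: u)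
    case (Suc m)
    then show ?case
      using vf_cong_on[OF assms(1) Suc.IH Suc.prems, where b=b] Smp[OF that(1), of m] Smp[OF that(2), of m]
      by (simp add: vf_add Sm_def)
  qed simp
  have A: "(\<lambda>u. g u + h u) \<in> ?F" if gh: "g \<in> ?F" "h \<in> ?F" for g h
  proof -
    have gh': "Sm \<Omega> g" "Sm \<Omega> h" "\<And>m. (vf b ^^ m) g \<in> P" "\<And>m. (vf b ^^ m) h \<in> P"
      using gh by (auto simp: flatten_def)
    have "(vf b ^^ m) (\<lambda>u. g u + h u) \<in> P" for m
      by (rule P6[OF P3[OF gh'(3)[of m] gh'(4)[of m]] Smp[OF Sm_add[OF gh'(1,2)]]]) (simp add: add gh')
    then show ?thesis using gh' by (simp add: flatten_def Sm_add)
  qed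
  have M: "(\<lambda>u. g u * h u) \<in> ?F" if g: "Sm \<Omega> g" and h: "h \<in> ?F" for g h
  proof -
    have h': "Sm \<Omega> h" "\<And>m. (vf b ^^ m) h \<in> P" using h by (auto simp: flatten_def)
    have "(vf b ^^ m) (\<lambda>u. g u * h u) \<in> P" for m
    proof (rule P6)
      show "(\<lambda>u. \<Sum>k\<le>m. of_nat (m choose k) * ((vf b ^^ k) g u * (vf b ^^ (m - k)) h u)) \<in> P"
        by (rule prime_in_sum[OF P], rule P4[OF c], rule P4[OF Smp[OF g] h'(2)])
      show "Sm \<Omega> ((vf b ^^ m) (\<lambda>u. g u * h u))" by (rule Smp[OF Sm_mult[OF g h'(1)]])
    qed (simp add: vf_pow_mult[OF assms(1,2) g h'(1)])
    then show ?thesis using g h' by (simp add: flatten_def Sm_mult)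
  qed
  have Pr: "g \<in> ?F \<or> h \<in> ?F" if g: "Sm \<Omega> g" and h: "Sm \<Omega> h" and gh: "(\<lambda>u. g u * h u) \<in> ?F" for g h
  proof (rule ccontr)
    assume "\<not> ?thesis"
    then have ex: "\<exists>m. (vf b ^^ m) g \<notin> P" "\<exists>m. (vf b ^^ m) h \<notin> P" using g h by (auto simp: flatten_def)
    define m where "m = (LEAST m. (vf b ^^ m) g \<notin> P)"
    define n where "n = (LEAST m. (vf b ^^ m) h \<notin> P)"
    have m: "(vf b ^^ m) g \<notin> P" "\<And>k. k < m \<Longrightarrow> (vf b ^^ k) g \<in> P"
      unfolding m_def using LeastI_ex[OF ex(1)] not_less_Least by blast+
    have n: "(vf b ^^ n) h \<notin> P" "\<And>k. k < n \<Longrightarrow> (vf b ^^ k) h \<in> P"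
      unfolding n_def using LeastI_ex[OF ex(2)] not_less_Least by blast+
    let ?T = "\<lambda>k u. of_nat (m + n choose k) * ((vf b ^^ k) g u * (vf b ^^ (m + n - k)) h u) :: complex"
    \<comment> \<open>Every term except the one at \<open>k = m\<close> contains a derivative of
      \<open>g\<close> of order below \<open>m\<close> or one of \<open>h\<close> of order below
      \<open>n\<close>.\<close>
    have T: "?T k \<in> P" if "k \<le> m + n" "k \<noteq> m" for k
    proof (cases "k < m")
      case True
      have "(\<lambda>u. (of_nat (m + n choose k) * (vf b ^^ (m + n - k)) h u) * (vf b ^^ k) g u) \<in> P"
        by (rule P4[OF Sm_mult[OF c Smp[OF h]] m(2)[OF True]])
      then show ?thesis by (simp add: mult.commute mult.left_commute)
    next
      case False
      then have "(vf b ^^ (m + n - k)) h \<in> P" using that by (intro n) auto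
      then show ?thesis by (rule P4[OF c P4[OF Smp[OF g]]])
    qed
    let ?R = "\<lambda>u. \<Sum>k\<in>{..m+n} - {m}. ?T k u"
    have R: "?R \<in> P" by (rule prime_in_sum[OF P], rule T) auto
    have L: "(vf b ^^ (m + n)) (\<lambda>u. g u * h u) \<in> P" using gh by (auto simp: flatten_def)
    have "(\<lambda>u. (vf b ^^ (m + n)) (\<lambda>u. g u * h u) u + (- 1) * ?R u) \<in> P"
      by (rule P3[OF L P4[OF c R]])
    then have "?T m \<in> P"
    proof (rule P6)
      fix u assume u: "u \<in> \<Omega>"
      show "(vf b ^^ (m + n)) (\<lambda>u. g u * h u) u + (- 1) * ?R u = ?T m u"
        unfolding vf_pow_mult[OF assms(1,2) g h u] by (simp add: sum_diff1)
    qed (rule Sm_mult[OF c Sm_mult[OF Smp[OF g] Smp[OF h]]])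
    \<comment> \<open>Characteristic zero: the binomial coefficient is a unit, so its membership
      would put \<open>(vf b ^^ m) g\<close> into \<open>P\<close>.\<close>
    moreover have "(\<lambda>u. of_nat (m + n choose m) :: complex) \<notin> P"
    proof
      assume "(\<lambda>u. of_nat (m + n choose m) :: complex) \<in> P"
      from P4[OF Smp[OF g, of m] P4[OF c[of "inverse (of_nat (m + n choose m))"] this]]
      show False using m(1) by (simp add: mult.commute)
    qed
    ultimately have "(\<lambda>u. (vf b ^^ m) g u * (vf b ^^ n) h u) \<in> P"
      using P5[OF c Sm_mult[OF Smp[OF g, of m] Smp[OF h, of n]], of "of_nat (m + n choose m)"] by simp
    from P5[OF Smp[OF g] Smp[OF h] this] show False using m n by blast
  qed
  have Z: "(\<lambda>_. 0) \<in> ?F" using P2 by (simp add: flatten_def zero Sm_def)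
  have C: "h \<in> ?F" if "g \<in> ?F" "Sm \<Omega> h" "\<forall>u\<in>\<Omega>. g u = h u" for g h
  proof -
    have "(vf b ^^ m) h \<in> P" for m
      by (rule P6[of "(vf b ^^ m) g"])
        (use that vf_pow_cong_on[OF assms(1), of g h] in \<open>auto simp: flatten_def Smp\<close>)
    then show ?thesis using that by (simp add: flatten_def)
  qed
  show ?thesis unfolding prime_in_def
  proof (intro conjI ballI allI impI)
    show "\<And>g. g \<in> ?F \<Longrightarrow> Sm \<Omega> g" by (simp add: flatten_def)
  qed (rule Z A M Pr C; assumption)+
qed

lemma prime_in_point: "u0 \<in> \<Omega> \<Longrightarrow> prime_in \<Omega> {g. Sm \<Omega> g \<and> g u0 = 0}"
  by (simp add: prime_in_def Sm_add Sm_mult) (auto simp: Sm_def)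

definition ops :: "(nat \<Rightarrow> 'd::finite field) \<Rightarrow> nat list \<Rightarrow> (nat \<Rightarrow> nat) \<Rightarrow> (real ^ 'd \<Rightarrow> complex) \<Rightarrow> real ^ 'd \<Rightarrow> complex" where
  "ops b is \<alpha> = foldr (\<lambda>i. vf (b i) ^^ \<alpha> i) is"

primrec flats :: "(real ^ 'd) set \<Rightarrow> real ^ 'd \<Rightarrow> (nat \<Rightarrow> 'd::finite field) \<Rightarrow> nat list \<Rightarrow> (real ^ 'd \<Rightarrow> complex) set" where
  "flats \<Omega> u0 b [] = {g. Sm \<Omega> g \<and> g u0 = 0}"
| "flats \<Omega> u0 b (i # is) = flatten \<Omega> (b i) (flats \<Omega> u0 b is)"

lemma ops_cong: "(\<And>i. i \<in> set is \<Longrightarrow> \<alpha> i = \<beta> i) \<Longrightarrow> ops b is \<alpha> = ops b is \<beta>"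
  unfolding ops_def by (induction "is") auto

text \<open>The head of the list is flattened last, so its field acts on \<open>g\<close> first;
  hence \<open>rev\<close>. Distinctness lets the exponents be chosen independently, which turns
  iterated flatness into flatness along all ordered monomials.\<close>

lemma flats_iff:
  assumes "distinct is" "\<And>i. i \<in> set is \<Longrightarrow> Sm \<Omega> (b i)"
  shows "g \<in> flats \<Omega> u0 b is \<longleftrightarrow> Sm \<Omega> g \<and> (\<forall>\<alpha>. ops b (rev is) \<alpha> g u0 = 0)"
  using assms
proof (induction "is" arbitrary: g)
  case Nil then show ?case by (simp add: ops_def)
next
  case (Cons i xs)
  have *: "ops b (rev (i # xs)) \<alpha> g = ops b (rev xs) \<alpha> ((vf (b i) ^^ \<alpha> i) g)" for \<alpha>
    by (simp add: ops_def)
  have "ops b (rev xs) (\<alpha>(i := m)) = ops b (rev xs) \<alpha>" for \<alpha> m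
    using Cons.prems by (intro ops_cong) auto
  then have "(\<forall>\<alpha>. ops b (rev (i # xs)) \<alpha> g u0 = 0) \<longleftrightarrow> (\<forall>m \<alpha>. ops b (rev xs) \<alpha> ((vf (b i) ^^ m) g) u0 = 0)"
    unfolding * by (metis fun_upd_same)
  then show ?case using Cons by (auto simp: flatten_def Sm_vf_pow)
qed

lemma prime_in_flats:
  assumes "open \<Omega>" "u0 \<in> \<Omega>" "\<And>i. i \<in> set is \<Longrightarrow> Sm \<Omega> (b i)"
  shows "prime_in \<Omega> (flats \<Omega> u0 b is)"
  using assms by (induction "is") (auto intro: prime_in_point prime_in_flatten)

lemma const_notin_flats: "c \<noteq> 0 \<Longrightarrow> (\<lambda>_. c) \<notin> flats \<Omega> u0 b is"
proof (induction "is")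
  case (Cons i xs)
  then show ?case using spec[of "\<lambda>m. (vf (b i) ^^ m) (\<lambda>_. c) \<in> flats \<Omega> u0 b xs" 0]
    by (auto simp: flatten_def simp del: funpow.simps)
qed simp

text \<open>Over the complex numbers \<open>p\<close> splits into linear factors, and no
  \<open>q - r\<close> lies in the prime ideal; degree zero is the exclusion of nonzero
  constants.\<close>

lemma poly_notin_prime:
  assumes P: "prime_in \<Omega> P" and q: "Sm \<Omega> q" "\<And>r. (\<lambda>u. q u - r) \<notin> P" and c: "\<And>c. c \<noteq> 0 \<Longrightarrow> (\<lambda>_. c) \<notin> P"
  shows "p \<noteq> 0 \<Longrightarrow> (\<lambda>u. poly p (q u)) \<notin> P"
proof (induction "degree p" arbitrary: p rule: less_induct)
  case less
  have Smp: "Sm \<Omega> (\<lambda>u. poly p (q u))" for p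
    using q(1) unfolding Sm_def poly_altdef by (auto intro!: smooth_at_sum smooth_at_mult smooth_at_power)
  show ?case
  proof (cases "degree p = 0")
    case True
    then obtain c0 where "p = [:c0:]" by (metis degree_eq_zeroE)
    then show ?thesis using less.prems c by simp
  next
    case False
    then have "\<not> constant (poly p)" by (simp add: constant_degree)
    then obtain r where "poly p r = 0" using fundamental_theorem_of_algebra by blast
    then obtain p' where p': "p = [:- r, 1:] * p'" unfolding poly_eq_0_iff_dvd by (auto elim: dvdE)
    then have "p' \<noteq> 0" using less.prems by auto
    moreover have "degree p' < degree p"
      using p' \<open>p' \<noteq> 0\<close> by (subst p', subst degree_mult_eq) auto
    ultimately have "(\<lambda>u. poly p' (q u)) \<notin> P" by (intro less.hyps) auto
    moreover have "(\<lambda>u. poly p (q u)) = (\<lambda>u. (q u - r) * poly p' (q u))" by (subst p') (simp add: algebra_simps)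
    moreover have "Sm \<Omega> (\<lambda>u. q u - r)" using q(1) by (auto simp: Sm_def intro: smooth_at_diff)
    ultimately show ?thesis using prime_in_prime[OF P _ Smp[of p'], of "\<lambda>u. q u - r"] q(2)[of r] by auto
  qed
qed

text \<open>A relation with constant coefficients among the powers of \<open>q\<close>, valid modulo
  functions flat at \<open>u0\<close>, is a polynomial in \<open>q\<close> lying in a prime ideal;
  \<open>nf\<close> says that \<open>q\<close> is not constant modulo this ideal.\<close>

lemma powers_independent:
  assumes "open \<Omega>" "u0 \<in> \<Omega>" "\<And>i. i < m \<Longrightarrow> Sm \<Omega> (b i)" and q: "Sm \<Omega> q"
    and nf: "\<And>r. \<exists>\<alpha>. ops b [0..<m] \<alpha> (\<lambda>u. q u - r) u0 \<noteq> 0"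
    and z: "\<And>\<alpha>. ops b [0..<m] \<alpha> (\<lambda>u. \<Sum>j\<le>s. d j * q u ^ j) u0 = 0" and "j \<le> s"
  shows "d j = 0"
proof -
  let ?P = "flats \<Omega> u0 b (rev [0..<m])"
  have P: "g \<in> ?P \<longleftrightarrow> Sm \<Omega> g \<and> (\<forall>\<alpha>. ops b [0..<m] \<alpha> g u0 = 0)" for g
    using flats_iff[of "rev [0..<m]" \<Omega> b g u0] assms(3) by simp
  define p where "p = (\<Sum>j\<le>s. monom (d j) j)"
  have p: "poly p (q u) = (\<Sum>j\<le>s. d j * q u ^ j)" for u by (simp add: p_def poly_sum poly_monom)
  have "Sm \<Omega> (\<lambda>u. \<Sum>j\<le>s. d j * q u ^ j)"
    using q unfolding Sm_def by (auto intro!: smooth_at_sum smooth_at_mult smooth_at_power)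
  then have "(\<lambda>u. poly p (q u)) \<in> ?P" using z by (simp add: P p)
  moreover have "prime_in \<Omega> ?P" by (rule prime_in_flats) (use assms in auto)
  moreover have "(\<lambda>u. q u - r) \<notin> ?P" for r using nf[of r] by (auto simp: P)
  ultimately have "p = 0" using poly_notin_prime[of \<Omega> ?P q p] q const_notin_flats by blast
  then have "coeff p j = 0" by simp
  then show ?thesis using \<open>j \<le> s\<close> by (simp add: p_def coeff_sum)
qed

section \<open>CR functions\<close>

lemma vf_point: "b u = c u \<Longrightarrow> vf b g u = vf c g u"
  by (simp add: vf_def)

lemma vf_field_diff: "vf (\<lambda>u. b u - c u) g u = vf b g u - vf c g u"
  by (simp add: vf_def left_diff_distrib sum_subtractf)

lemma vf_field_add: "vf (\<lambda>u. b u + c u) g u = vf b g u + vf c g u"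
  by (simp add: vf_def distrib_right sum.distrib)

lemma vf_field_scale: "vf (\<lambda>u. c u *s b u) g u = c u * vf b g u"
  by (simp add: vf_def sum_distrib_left mult.assoc)

lemma eventually_in: "open \<Omega> \<Longrightarrow> u \<in> \<Omega> \<Longrightarrow> \<forall>\<^sub>F v in nhds u. v \<in> \<Omega>"
  by (auto simp: eventually_nhds)

text \<open>\<open>Z i\<close> need not be of type \<open>(1,0)\<close>, but it acts on CR functions like \<open>\<partial>/\<partial>z\<^sub>i\<close> on holomorphic ones:
  it preserves them (\<open>crf_Z\<close>), and these fields commute on them (\<open>crf_Z_commute\<close>).\<close>

locale cr_structure =
  fixes \<Omega> :: "(real ^ 'd) set" and z :: "'n::finite \<Rightarrow> real ^ 'd::finite \<Rightarrow> complex" and Z :: "'n \<Rightarrow> 'd field"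
  assumes open_\<Omega>: "open \<Omega>" and Sm_z: "Sm \<Omega> (z j)" and Sm_Z: "Sm \<Omega> (Z j)"
    and Z_z: "u \<in> \<Omega> \<Longrightarrow> vf (Z i) (z j) u = (if i = j then 1 else 0)"
begin

text \<open>\<open>K\<close> only matters through \<open>K u\<close>: the condition says that all \<open>(0,1)\<close> vectors at \<open>u\<close> annihilate \<open>g\<close>.\<close>

definition cr_at :: "(real ^ 'd \<Rightarrow> complex) \<Rightarrow> real ^ 'd \<Rightarrow> bool" where
  "cr_at g u \<longleftrightarrow> (\<forall>K. (\<forall>j. vf K (z j) u = 0) \<longrightarrow> vf K g u = 0)"

definition crf :: "(real ^ 'd \<Rightarrow> complex) \<Rightarrow> real ^ 'd \<Rightarrow> bool" where
  "crf g u \<longleftrightarrow> (\<forall>\<^sub>F v in nhds u. smooth_at v g \<and> cr_at g v)"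

lemma crf_D: "crf g u \<Longrightarrow> smooth_at u g" "crf g u \<Longrightarrow> cr_at g u"
  using eventually_nhds_x_imp_x unfolding crf_def by blast+

lemma crf_ev: "crf g u \<Longrightarrow> \<forall>\<^sub>F v in nhds u. crf g v"
  unfolding crf_def by (simp add: eventually_eventually)

lemma crf_\<Omega>_ev: "crf g u \<Longrightarrow> u \<in> \<Omega> \<Longrightarrow> \<forall>\<^sub>F v in nhds u. v \<in> \<Omega> \<and> crf g v"
  using crf_ev eventually_in[OF open_\<Omega>] by (simp add: eventually_conj)

text \<open>A (0,1) vector at one point is extended to a (0,1) field \<open>K'\<close>. The bracket
  of \<open>K'\<close> and \<open>Z i\<close> annihilates every \<open>z j\<close>, because
  \<open>K'\<close> kills \<open>z j\<close> and \<open>Z i\<close> maps it to a constant; so the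
  bracket kills \<open>g\<close>, and \<open>K'\<close> commutes with \<open>Z i\<close> on
  \<open>g\<close>.\<close>

lemma crf_Z:
  assumes "u \<in> \<Omega>" "crf g u" shows "crf (vf (Z i) g) u"
  unfolding crf_def
  using crf_\<Omega>_ev[OF assms(2,1)]
proof eventually_elim
  case (elim v)
  then have v: "v \<in> \<Omega>" "crf g v" by auto
  have "vf K (vf (Z i) g) v = 0" if K: "\<And>j. vf K (z j) v = 0" for K
  proof -
    \<comment> \<open>The constant extension of the vector; subtracting its components along the
      \<open>Z j\<close> gives a field that kills every \<open>z j\<close> and agrees with
      \<open>K\<close> at \<open>v\<close>.\<close>
    define C where "C = (\<lambda>w::real ^ 'd. K v)"
    define K' where "K' w = C w - (\<Sum>j\<in>UNIV. vf C (z j) w *s Z j w)" for w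
    have K': "vf K' h w = vf C h w - (\<Sum>j\<in>UNIV. vf C (z j) w * vf (Z j) h w)" for h w
      unfolding K'_def[abs_def] vf_field_diff vf_lincomb ..
    have smC: "smooth_at w C" for w by (simp add: C_def)
    have smK': "smooth_at v K'"
      unfolding K'_def[abs_def] using v SmD[OF Sm_z] SmD[OF Sm_Z]
      by (intro smooth_at_diff smooth_at_lincomb smooth_at_vf smC) auto
    have K'z: "vf K' (z j) w = 0" if "w \<in> \<Omega>" for j w
      using that by (simp add: K' Z_z if_distrib[of "\<lambda>c. _ * c"] cong: if_cong)
    have Cz: "vf C (z j) v = 0" for j
      using K[of j] vf_point[of C v K "z j"] by (simp add: C_def)
    have K'v: "K' v = K v"
      by (simp add: K'_def Cz) (simp add: C_def)
    have "\<forall>\<^sub>F w in nhds v. vf K' g w = 0"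
      using crf_\<Omega>_ev[OF v(2,1)] by eventually_elim (use K'z crf_D in \<open>auto simp: cr_at_def\<close>)
    then have 1: "vf (Z i) (vf K' g) v = 0"
      by (subst vf_cong_ev[of _ "\<lambda>_. 0"]) auto
    have "vf (brk K' (Z i)) (z j) v = 0" for j
    proof -
      have "vf K' (vf (Z i) (z j)) v = 0"
        by (subst vf_cong_on[OF open_\<Omega> Z_z v(1)]) auto
      moreover have "vf (Z i) (vf K' (z j)) v = 0"
        by (subst vf_cong_on[OF open_\<Omega> K'z v(1)]) auto
      ultimately show ?thesis
        using vf_commute[OF smK' SmD[OF Sm_Z v(1)] SmD[OF Sm_z v(1)], of i j] by simp
    qed
    then have "vf (brk K' (Z i)) g v = 0" using crf_D(2)[OF v(2)] by (simp add: cr_at_def)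
    then have "vf K' (vf (Z i) g) v = 0"
      using vf_commute[OF smK' SmD[OF Sm_Z v(1)] crf_D(1)[OF v(2)], of i] 1 by simp
    then show ?thesis using vf_point[of K' v K, OF K'v] by simp
  qed
  then show ?case using v crf_D(1) SmD[OF Sm_Z] by (auto simp: cr_at_def intro: smooth_at_vf)
qed

text \<open>Both fields map each \<open>z k\<close> to a constant, so their bracket kills all
  \<open>z k\<close> and with them every CR function.\<close>

lemma crf_Z_commute:
  assumes "u \<in> \<Omega>" "crf g u" shows "vf (Z i) (vf (Z j) g) u = vf (Z j) (vf (Z i) g) u"
proof -
  have "vf (brk (Z i) (Z j)) (z k) u = 0" for k
  proof -
    have "vf (Z i) (vf (Z j) (z k)) u = 0" for i j
      by (subst vf_cong_on[OF open_\<Omega> Z_z assms(1)]) auto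
    then show ?thesis
      using vf_commute[OF SmD[OF Sm_Z assms(1)] SmD[OF Sm_Z assms(1)] SmD[OF Sm_z assms(1)], of i j k] by simp
  qed
  then have "vf (brk (Z i) (Z j)) g u = 0" using crf_D(2)[OF assms(2)] by (simp add: cr_at_def)
  then show ?thesis
    using vf_commute[OF SmD[OF Sm_Z assms(1)] SmD[OF Sm_Z assms(1)] crf_D(1)[OF assms(2)], of i j] by simp
qed

lemma crf_Z_pow: "u \<in> \<Omega> \<Longrightarrow> crf g u \<Longrightarrow> crf ((vf (Z i) ^^ m) g) u"
  by (induction m) (auto intro: crf_Z)

lemma Z_pow_commute:
  assumes "u \<in> \<Omega>" "crf g u"
  shows "vf (Z i) ((vf (Z j) ^^ m) g) u = (vf (Z j) ^^ m) (vf (Z i) g) u"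
  using assms
proof (induction m arbitrary: u)
  case (Suc m)
  have "vf (Z i) ((vf (Z j) ^^ Suc m) g) u = vf (Z j) (vf (Z i) ((vf (Z j) ^^ m) g)) u"
    using crf_Z_commute[OF Suc.prems(1) crf_Z_pow[OF Suc.prems]] by simp
  also have "\<dots> = vf (Z j) ((vf (Z j) ^^ m) (vf (Z i) g)) u"
    using crf_\<Omega>_ev[OF Suc.prems(2,1)] by (intro vf_cong_ev) (auto elim!: eventually_mono intro: Suc.IH)
  finally show ?case by simp
qed simp

end

lemma crf_mult_zero_one:
  assumes "smooth_at u c" "smooth_at u h" "vf K h u = 0"
  shows "vf K (\<lambda>u. c u * h u) u = vf K c u * h u"
  using assms by (simp add: vf_mult)

locale cr_structure_pair = cr_structure \<Omega> z Z
  for \<Omega> :: "(real ^ 'd::finite) set" and z :: "'n::finite \<Rightarrow> real ^ 'd \<Rightarrow> complex" and Z :: "'n \<Rightarrow> 'd field" +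
  fixes L :: "'d field" and q :: "real ^ 'd \<Rightarrow> complex" and i1 \<nu> :: 'n
  assumes Sm_q: "Sm \<Omega> q" and Sm_L: "Sm \<Omega> L"
    and L_eq: "u \<in> \<Omega> \<Longrightarrow> L u = Z i1 u - q u *s Z \<nu> u"
begin

definition H :: "nat \<Rightarrow> nat \<Rightarrow> (real ^ 'd \<Rightarrow> complex) \<Rightarrow> real ^ 'd \<Rightarrow> complex" where
  "H a b g = (vf (Z i1) ^^ a) ((vf (Z \<nu>) ^^ b) g)"

lemma crf_H: "u \<in> \<Omega> \<Longrightarrow> crf g u \<Longrightarrow> crf (H a b g) u"
  unfolding H_def by (intro crf_Z_pow)

lemma L_H:
  assumes "u \<in> \<Omega>" "crf g u"
  shows "vf L (H a b g) u = H (Suc a) b g u - q u * H a (Suc b) g u"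
proof -
  have "vf L (H a b g) u = vf (\<lambda>u. Z i1 u - q u *s Z \<nu> u) (H a b g) u"
    using L_eq[OF assms(1)] by (rule vf_point)
  also have "\<dots> = vf (Z i1) (H a b g) u - q u * vf (Z \<nu>) (H a b g) u"
    by (simp only: vf_field_diff vf_field_scale)
  also have "vf (Z \<nu>) (H a b g) u = H a (Suc b) g u"
    unfolding H_def using Z_pow_commute[OF assms(1) crf_Z_pow[OF assms]] by simp
  finally show ?thesis by (simp add: H_def)
qed

text \<open>Remainders of order below \<open>n\<close>. They are operators rather than functions
  because the coefficients \<open>c\<close> must not depend on \<open>g\<close>: the remainder has
  to be uniform in the CR map to which it is applied.\<close>

inductive_set low :: "nat \<Rightarrow> ((real ^ 'd \<Rightarrow> complex) \<Rightarrow> real ^ 'd \<Rightarrow> complex) set" for n where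
  low_zero: "(\<lambda>g u. 0) \<in> low n"
| low_base: "Sm \<Omega> c \<Longrightarrow> a + b < n \<Longrightarrow> (\<lambda>g u. c u * H a b g u) \<in> low n"
| low_add: "\<Phi> \<in> low n \<Longrightarrow> \<Psi> \<in> low n \<Longrightarrow> (\<lambda>g u. \<Phi> g u + \<Psi> g u) \<in> low n"

lemma low_sum: "(\<And>i. i \<in> I \<Longrightarrow> \<Phi> i \<in> low n) \<Longrightarrow> (\<lambda>g u. \<Sum>i\<in>I. \<Phi> i g u) \<in> low n"
  by (induction I rule: infinite_finite_induct) (auto intro: low_zero low_add)

lemma low_smooth: "\<Phi> \<in> low n \<Longrightarrow> u \<in> \<Omega> \<Longrightarrow> crf g u \<Longrightarrow> smooth_at u (\<Phi> g)"
proof (induction rule: low.induct)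
  case (low_base c a b)
  then show ?case using SmD[OF low_base.hyps(1)] crf_D(1)[OF crf_H] by (intro smooth_at_mult) auto
qed (auto intro: smooth_at_add)

lemma low_L:
  assumes "\<Phi> \<in> low n"
  shows "\<exists>\<Psi>\<in>low (Suc n). \<forall>g u. u \<in> \<Omega> \<longrightarrow> crf g u \<longrightarrow> vf L (\<Phi> g) u = \<Psi> g u"
  using assms
proof (induction rule: low.induct)
  case low_zero then show ?case by (intro bexI[of _ "\<lambda>g u. 0"]) (auto intro: low.low_zero)
next
  case (low_base c a b)
  let ?\<Psi> = "\<lambda>g u. vf L c u * H a b g u + (c u * H (Suc a) b g u + (- c u * q u) * H a (Suc b) g u)"
  have "Sm \<Omega> (\<lambda>u. - c u * q u)"
    using low_base Sm_q by (auto simp: Sm_def intro!: smooth_at_mult smooth_at_uminus)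
  then have "?\<Psi> \<in> low (Suc n)"
    using low_base Sm_L by (intro low.low_add low.low_base Sm_vf) auto
  moreover have "vf L (\<lambda>u. c u * H a b g u) u = ?\<Psi> g u" if "u \<in> \<Omega>" "crf g u" for g u
    using that SmD[OF low_base(1)] crf_D(1)[OF crf_H[OF that]]
    by (simp add: vf_mult L_H algebra_simps)
  ultimately show ?case by (intro bexI[of _ ?\<Psi>]) auto
next
  case (low_add \<Phi> \<Psi>)
  then obtain \<Phi>' \<Psi>' where *: "\<Phi>' \<in> low (Suc n)" "\<Psi>' \<in> low (Suc n)"
    "\<And>g u. u \<in> \<Omega> \<Longrightarrow> crf g u \<Longrightarrow> vf L (\<Phi> g) u = \<Phi>' g u" "\<And>g u. u \<in> \<Omega> \<Longrightarrow> crf g u \<Longrightarrow> vf L (\<Psi> g) u = \<Psi>' g u"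
    by blast
  then show ?case
    using low_smooth[OF low_add.hyps(1)] low_smooth[OF low_add.hyps(2)]
    by (intro bexI[of _ "\<lambda>g u. \<Phi>' g u + \<Psi>' g u"]) (auto simp: vf_add intro: low.low_add)
qed

text \<open>A (0,1) field differentiates only the coefficients, as \<open>H a b g\<close> is again
  CR; so the order stays below the same \<open>n\<close>.\<close>

lemma low_zero_one:
  assumes "\<Phi> \<in> low n" "Sm \<Omega> K" "\<And>u j. u \<in> \<Omega> \<Longrightarrow> vf K (z j) u = 0"
  shows "\<exists>\<Psi>\<in>low n. \<forall>g u. u \<in> \<Omega> \<longrightarrow> crf g u \<longrightarrow> vf K (\<Phi> g) u = \<Psi> g u"
  using assms(1)
proof (induction rule: low.induct)
  case low_zero then show ?case by (intro bexI[of _ "\<lambda>g u. 0"]) (auto intro: low.low_zero)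
next
  case (low_base c a b)
  have "vf K (\<lambda>u. c u * H a b g u) u = vf K c u * H a b g u" if "u \<in> \<Omega>" "crf g u" for g u
    using that SmD[OF low_base(1)] crf_D[OF crf_H[OF that]] assms(3)
    by (intro crf_mult_zero_one) (auto simp: cr_at_def)
  moreover have "(\<lambda>g u. vf K c u * H a b g u) \<in> low n"
    using low_base assms(2) by (intro low.low_base Sm_vf) auto
  ultimately show ?case by (intro bexI[of _ "\<lambda>g u. vf K c u * H a b g u"]) auto
next
  case (low_add \<Phi> \<Psi>)
  then obtain \<Phi>' \<Psi>' where *: "\<Phi>' \<in> low n" "\<Psi>' \<in> low n"
    "\<And>g u. u \<in> \<Omega> \<Longrightarrow> crf g u \<Longrightarrow> vf K (\<Phi> g) u = \<Phi>' g u" "\<And>g u. u \<in> \<Omega> \<Longrightarrow> crf g u \<Longrightarrow> vf K (\<Psi> g) u = \<Psi>' g u"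
    by blast
  then show ?case
    using low_smooth[OF low_add.hyps(1)] low_smooth[OF low_add.hyps(2)]
    by (intro bexI[of _ "\<lambda>g u. \<Phi>' g u + \<Psi>' g u"]) (auto simp: vf_add intro: low.low_add)
qed

definition main :: "nat \<Rightarrow> (real ^ 'd \<Rightarrow> complex) \<Rightarrow> real ^ 'd \<Rightarrow> complex" where
  "main s g u = (\<Sum>b\<le>s. of_nat (s choose b) * ((- q u) ^ b * H (s - b) b g u))"

lemma Sm_qpow: "Sm \<Omega> (\<lambda>u. (- q u) ^ b)"
  using Sm_q by (auto simp: Sm_def intro!: smooth_at_power smooth_at_uminus)

lemma smooth_main: "u \<in> \<Omega> \<Longrightarrow> crf g u \<Longrightarrow> smooth_at u (main s g)"
  unfolding main_def[abs_def]
  by (intro smooth_at_sum smooth_at_mult smooth_at_const SmD[OF Sm_qpow] crf_D(1)[OF crf_H])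

text \<open>On the main term \<open>L\<close> either reaches \<open>H\<close>, where
  \<open>L_H\<close> reproduces Pascal's rule, or differentiates a power of \<open>q\<close>, which
  leaves a term of lower order.\<close>

lemma L_pow_expand:
  "\<exists>\<Phi>\<in>low s. \<forall>g u. u \<in> \<Omega> \<longrightarrow> crf g u \<longrightarrow> (vf L ^^ s) g u = main s g u + \<Phi> g u"
proof (induction s)
  case 0
  then show ?case by (intro bexI[of _ "\<lambda>g u. 0"]) (auto simp: main_def H_def intro: low_zero)
next
  case (Suc s)
  then obtain \<Phi> where \<Phi>: "\<Phi> \<in> low s" "\<And>g u. u \<in> \<Omega> \<Longrightarrow> crf g u \<Longrightarrow> (vf L ^^ s) g u = main s g u + \<Phi> g u" by blast
  obtain \<Psi> where \<Psi>: "\<Psi> \<in> low (Suc s)" "\<And>g u. u \<in> \<Omega> \<Longrightarrow> crf g u \<Longrightarrow> vf L (\<Phi> g) u = \<Psi> g u"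
    using low_L[OF \<Phi>(1)] by blast
  define c where "c b u = of_nat (s choose b) * vf L (\<lambda>u. (- q u) ^ b) u" for b u
  let ?\<Theta> = "\<lambda>g u. (\<Sum>b\<le>s. c b u * H (s - b) b g u)"
  have Smc: "Sm \<Omega> (c b)" for b
    unfolding c_def[abs_def] using Sm_vf[OF Sm_L Sm_qpow] by (intro Sm_mult) (auto simp: Sm_def)
  have \<Theta>: "?\<Theta> \<in> low (Suc s)"
    by (intro low_sum low_base Smc) auto
  have M: "vf L (main s g) u = main (Suc s) g u + ?\<Theta> g u" if u: "u \<in> \<Omega>" "crf g u" for g u
  proof -
    have sm: "smooth_at u (\<lambda>u. (- q u) ^ b)" "smooth_at u (H a b g)" for a b
      using SmD[OF Sm_qpow u(1)] crf_D(1)[OF crf_H[OF u]] .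
    let ?A = "\<lambda>b. (- q u) ^ b * H (Suc s - b) b g u"
    have "vf L (main s g) u = (\<Sum>b\<le>s. of_nat (s choose b) * (vf L (\<lambda>u. (- q u) ^ b) u * H (s - b) b g u
       + (- q u) ^ b * vf L (H (s - b) b g) u))"
      unfolding main_def[abs_def]
      by (subst vf_sum) (auto intro!: smooth_at_mult sm sum.cong simp: vf_cmult vf_mult smooth_at_mult sm)
    also have "\<dots> = (\<Sum>b\<le>s. c b u * H (s - b) b g u + (of_nat (s choose b) * ?A b + of_nat (s choose b) * ?A (Suc b)))"
      by (intro sum.cong refl) (simp add: L_H[OF u] c_def Suc_diff_le algebra_simps)
    also have "\<dots> = ?\<Theta> g u + main (Suc s) g u"
      unfolding main_def pascal_sum[of s ?A] by (simp add: sum.distrib sum_subtractf sum_negf)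
    finally show ?thesis by simp
  qed
  have "(vf L ^^ Suc s) g u = main (Suc s) g u + (?\<Theta> g u + \<Psi> g u)" if u: "u \<in> \<Omega>" "crf g u" for g u
  proof -
    have "\<forall>\<^sub>F v in nhds u. (vf L ^^ s) g v = main s g v + \<Phi> g v"
      using crf_\<Omega>_ev[OF u(2,1)] by eventually_elim (simp add: \<Phi>(2))
    from vf_cong_ev[OF this, of L]
    have "(vf L ^^ Suc s) g u = vf L (main s g) u + vf L (\<Phi> g) u"
      using vf_add[OF smooth_main[OF u] low_smooth[OF \<Phi>(1) u]] by simp
    then show ?thesis using M[OF u] \<Psi>(2)[OF u] by simp
  qed
  then show ?case using low_add[OF \<Theta> \<Psi>(1)] by (intro bexI[of _ "\<lambda>g u. ?\<Theta> g u + \<Psi> g u"]) auto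
qed

end

section \<open>Rational functionals of the jet\<close>

text \<open>The splitting of a real-linear map into its complex linear and its antilinear
  part.\<close>

lemma wirtinger:
  fixes l :: "complex ^ 'n::finite \<Rightarrow> complex"
  assumes "linear l"
  shows "l \<zeta> = (\<Sum>j\<in>UNIV. (l (axis j 1) - \<i> * l (axis j \<i>)) / 2 * \<zeta> $ j) +
    (\<Sum>j\<in>UNIV. (l (axis j 1) + \<i> * l (axis j \<i>)) / 2 * cnj (\<zeta> $ j))"
proof -
  have \<zeta>: "\<zeta> = (\<Sum>j\<in>UNIV. Re (\<zeta> $ j) *\<^sub>R axis j 1 + Im (\<zeta> $ j) *\<^sub>R axis j \<i>)" (is "_ = ?s")
  proof (subst vec_eq_iff, rule allI)
    fix i
    have "?s $ i = (\<Sum>j\<in>UNIV. if j = i then \<zeta> $ i else 0)"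
      unfolding sum_component by (intro sum.cong) (auto simp: axis_def complex_eq_iff)
    then show "\<zeta> $ i = ?s $ i" by simp
  qed
  have "l \<zeta> = (\<Sum>j\<in>UNIV. Re (\<zeta> $ j) *\<^sub>R l (axis j 1) + Im (\<zeta> $ j) *\<^sub>R l (axis j \<i>))"
    by (subst (1) \<zeta>) (simp only: linear_sum[OF assms] linear_add[OF assms] linear_scale[OF assms])
  also have "\<dots> = (\<Sum>j\<in>UNIV. (l (axis j 1) - \<i> * l (axis j \<i>)) / 2 * \<zeta> $ j + (l (axis j 1) + \<i> * l (axis j \<i>)) / 2 * cnj (\<zeta> $ j))"
  proof (intro sum.cong refl)
    fix j
    show "Re (\<zeta> $ j) *\<^sub>R l (axis j 1) + Im (\<zeta> $ j) *\<^sub>R l (axis j \<i>) =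
      (l (axis j 1) - \<i> * l (axis j \<i>)) / 2 * \<zeta> $ j + (l (axis j 1) + \<i> * l (axis j \<i>)) / 2 * cnj (\<zeta> $ j)"
      by (simp add: complex_eq_iff field_simps)
  qed
  finally show ?thesis by (simp add: sum.distrib)
qed

lemma real_vec_expand:
  fixes v :: "real ^ 'd::finite"
  assumes "linear l" shows "l v = (\<Sum>i\<in>UNIV. v $ i *\<^sub>R l (axis i 1))"
proof -
  have v: "v = (\<Sum>i\<in>UNIV. v $ i *\<^sub>R axis i 1)"
    using basis_expansion[of v] by (simp add: scalar_mult_eq_scaleR)
  show ?thesis
    by (subst (1) v) (simp only: linear_sum[OF assms] linear_scale[OF assms])
qed

text \<open>Wirtinger derivative in the first argument, which will be the value of the map, with the
  source point fixed.\<close>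

definition dz1 :: "'n \<Rightarrow> ((complex ^ 'n::finite) \<times> (real ^ 'd::finite) \<Rightarrow> complex) \<Rightarrow> (complex ^ 'n) \<times> (real ^ 'd) \<Rightarrow> complex" where
  "dz1 j h p = (frechet_derivative h (at p) (axis j 1, 0) - \<i> * frechet_derivative h (at p) (axis j \<i>, 0)) / 2"

definition dzb1 :: "'n \<Rightarrow> ((complex ^ 'n::finite) \<times> (real ^ 'd::finite) \<Rightarrow> complex) \<Rightarrow> (complex ^ 'n) \<times> (real ^ 'd) \<Rightarrow> complex" where
  "dzb1 j h p = (frechet_derivative h (at p) (axis j 1, 0) + \<i> * frechet_derivative h (at p) (axis j \<i>, 0)) / 2"

lemma smooth_dz1: "smooth_at p h \<Longrightarrow> smooth_at p (dz1 j h)" "smooth_at p h \<Longrightarrow> smooth_at p (dzb1 j h)"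
  unfolding dz1_def[abs_def] dzb1_def[abs_def]
  by (auto intro!: smooth_at_divide smooth_at_diff smooth_at_add smooth_at_mult smooth_at_deriv)

lemma vf_chain:
  assumes F: "smooth_at v F" and h: "smooth_at (F v, v) h"
  shows "vf b (\<lambda>w. h (F w, w)) v = (\<Sum>j\<in>UNIV. dz1 j h (F v, v) * vf b (\<lambda>w. F w $ j) v)
    + (\<Sum>j\<in>UNIV. dzb1 j h (F v, v) * vf b (\<lambda>w. cnj (F w $ j)) v)
    + (\<Sum>i\<in>UNIV. b v $ i * frechet_derivative h (at (F v, v)) (0, axis i 1))"
proof -
  let ?h = "frechet_derivative h (at (F v, v))"
  let ?F = "frechet_derivative F (at v)"
  have lin: "linear ?h" by (rule linear_frechet[OF smooth_at_differentiable[OF h]])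
  have lin1: "linear (\<lambda>\<zeta>. ?h (\<zeta>, 0))"
    using linear_compose[of "\<lambda>\<zeta>. (\<zeta>, 0)" ?h] lin by (simp add: o_def linear_iff)
  have pF: "pd i (\<lambda>w. F w $ j) v = ?F (axis i 1) $ j" for i j
    unfolding pd_def by (subst frechet_derivative_bounded_linear[OF bounded_linear_vec_nth]) (auto intro: smooth_at_differentiable F)
  have pcF: "pd i (\<lambda>w. cnj (F w $ j)) v = cnj (?F (axis i 1) $ j)" for i j
    using pd_cnj[OF smooth_at_vec_nth[OF F, of j], of i] by (simp add: pF)
  have "((\<lambda>w. (F w, w)) has_derivative (\<lambda>d. (?F d, d))) (at v)"
    by (intro has_derivative_Pair smooth_at_has_derivative[OF F] has_derivative_ident)
  from has_derivative_compose[OF this smooth_at_has_derivative[OF h]]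
  have D: "frechet_derivative (\<lambda>w. h (F w, w)) (at v) = (\<lambda>d. ?h (?F d, d))"
    by (rule frechet_derivative_eqI)
  have "pd i (\<lambda>w. h (F w, w)) v = (\<Sum>j\<in>UNIV. dz1 j h (F v, v) * pd i (\<lambda>w. F w $ j) v)
     + (\<Sum>j\<in>UNIV. dzb1 j h (F v, v) * pd i (\<lambda>w. cnj (F w $ j)) v) + ?h (0, axis i 1)" for i
  proof -
    have "pd i (\<lambda>w. h (F w, w)) v = ?h ((?F (axis i 1), 0) + (0, axis i 1))"
      by (simp add: pd_def D)
    also have "\<dots> = ?h (?F (axis i 1), 0) + ?h (0, axis i 1)"
      by (rule linear_add[OF lin])
    also have "?h (?F (axis i 1), 0) = (\<Sum>j\<in>UNIV. dz1 j h (F v, v) * ?F (axis i 1) $ j) +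
      (\<Sum>j\<in>UNIV. dzb1 j h (F v, v) * cnj (?F (axis i 1) $ j))"
      using wirtinger[OF lin1] unfolding dz1_def dzb1_def .
    finally show ?thesis by (simp add: pF pcF)
  qed
  then have "vf b (\<lambda>w. h (F w, w)) v = (\<Sum>i\<in>UNIV. \<Sum>j\<in>UNIV. b v $ i * (dz1 j h (F v, v) * pd i (\<lambda>w. F w $ j) v))
     + (\<Sum>i\<in>UNIV. \<Sum>j\<in>UNIV. b v $ i * (dzb1 j h (F v, v) * pd i (\<lambda>w. cnj (F w $ j)) v))
     + (\<Sum>i\<in>UNIV. b v $ i * ?h (0, axis i 1))"
    by (simp add: vf_def distrib_left sum.distrib sum_distrib_left)
  also have "(\<Sum>i\<in>UNIV. \<Sum>j\<in>UNIV. b v $ i * (dz1 j h (F v, v) * pd i (\<lambda>w. F w $ j) v)) =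
     (\<Sum>j\<in>UNIV. dz1 j h (F v, v) * vf b (\<lambda>w. F w $ j) v)"
    by (subst sum.swap) (simp add: vf_def sum_distrib_left mult.left_commute)
  also have "(\<Sum>i\<in>UNIV. \<Sum>j\<in>UNIV. b v $ i * (dzb1 j h (F v, v) * pd i (\<lambda>w. cnj (F w $ j)) v)) =
     (\<Sum>j\<in>UNIV. dzb1 j h (F v, v) * vf b (\<lambda>w. cnj (F w $ j)) v)"
    by (subst sum.swap) (simp add: vf_def sum_distrib_left mult.left_commute)
  finally show ?thesis .
qed

lemma partials_of_real:
  assumes "smooth_at u g"
  shows "pds is (\<lambda>w. complex_of_real (g w)) u = complex_of_real (partials is g u)" "smooth_at u (partials is g)"
proof -
  have "smooth_at u g \<Longrightarrow> smooth_at u (partials is g) \<and> pds is (\<lambda>w. complex_of_real (g w)) u = complex_of_real (partials is g u)" for u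
  proof (induction "is" arbitrary: u)
    case (Cons i xs)
    have sm: "smooth_at u (partials xs g)" using Cons by blast
    have "\<forall>\<^sub>F v in nhds u. pds xs (\<lambda>w. complex_of_real (g w)) v = complex_of_real (partials xs g v)"
      using smooth_at_ev[OF Cons.prems] by eventually_elim (use Cons.IH in blast)
    from pd_cong_ev[OF this, of i]
    have "pds (i # xs) (\<lambda>w. complex_of_real (g w)) u = complex_of_real (partials (i # xs) g u)"
      by (simp add: pd_def frechet_derivative_bounded_linear[OF bounded_linear_of_real smooth_at_differentiable[OF sm]])
    then show ?case using sm by (simp add: smooth_at_deriv)
  qed simp
  then show "pds is (\<lambda>w. complex_of_real (g w)) u = complex_of_real (partials is g u)" "smooth_at u (partials is g)"
    using assms by blast+
qed

lemma count_list_ex: "\<exists>is. \<forall>i. count_list is i = (\<beta> i :: nat)" for \<beta> :: "'d::finite \<Rightarrow> nat"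
proof -
  have "\<exists>M. \<forall>i. count M i = \<beta> i"
    by (rule exI[of _ "Abs_multiset \<beta>"]) (simp add: Abs_multiset_inverse)
  then obtain M where M: "\<forall>i. count M i = \<beta> i" by blast
  obtain xs where "mset xs = M" using ex_mset by blast
  then have "\<forall>i. count_list xs i = \<beta> i" using M by (metis count_mset)
  then show ?thesis by blast
qed

lemma mpartial_list:
  assumes "smooth_at u g" and that: "\<forall>i. count_list is i = \<beta> i"
  shows "complex_of_real (mpartial \<beta> g u) = pds is (\<lambda>w. complex_of_real (g w)) u"
proof -
  define js where "js = (SOME js. \<forall>i. count_list js i = \<beta> i)"
  have js: "\<forall>i. count_list js i = \<beta> i" unfolding js_def by (rule someI_ex[OF count_list_ex])
  have "mset js = mset is" using js that by (simp add: multiset_eq_iff count_mset)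
  have "complex_of_real (mpartial \<beta> g u) = pds js (\<lambda>w. complex_of_real (g w)) u"
    unfolding mpartial_def js_def[symmetric] by (rule partials_of_real(1)[OF assms(1), symmetric])
  also have "\<dots> = pds is (\<lambda>w. complex_of_real (g w)) u"
    by (rule pds_mset[OF \<open>mset js = mset is\<close> smooth_at_of_real[OF assms(1)]])
  finally show ?thesis .
qed

lemma smooth_mpartial: "smooth_at u g \<Longrightarrow> smooth_at u (mpartial \<beta> g)"
  unfolding mpartial_def by (rule partials_of_real(2))

lemma msize_count: "msize (count_list xs) = length xs"
  by (simp add: msize_def sum_count_set)

text \<open>\<open>T\<close> stands for a piece of the target hypersurface, \<open>X\<close> for an
  ambient smooth extension of its chart and \<open>\<psi>\<close> for the inverse chart;
  \<open>F0\<close> is the given map read in the source chart. The order \<open>k\<close> of the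
  jets is arbitrary here.\<close>

locale jet_setting = cr_structure \<Omega> z Z
  for \<Omega> :: "(real ^ 'd::finite) set" and z :: "'n::finite \<Rightarrow> real ^ 'd \<Rightarrow> complex" and Z :: "'n \<Rightarrow> 'd field" +
  fixes u0 :: "real ^ 'd" and T :: "(complex ^ 'n) set" and X :: "complex ^ 'n \<Rightarrow> real ^ 'd"
    and \<psi> :: "real ^ 'd \<Rightarrow> complex ^ 'n" and F0 :: "real ^ 'd \<Rightarrow> complex ^ 'n" and k :: nat
    and e :: "'j::finite \<Rightarrow> 'd \<times> ('d \<Rightarrow> nat)"
  assumes u0: "u0 \<in> \<Omega>" and bij_e: "bij_betw e UNIV (jet_indices k)"
    and smooth_X: "\<zeta> \<in> T \<Longrightarrow> smooth_at \<zeta> X" and smooth_\<psi>: "\<zeta> \<in> T \<Longrightarrow> smooth_at (X \<zeta>) \<psi>"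
    and \<psi>_X: "\<zeta> \<in> T \<Longrightarrow> \<psi> (X \<zeta>) = \<zeta>"
    and adm_F0': "\<forall>\<^sub>F v in nhds u0. v \<in> \<Omega> \<and> smooth_at v F0 \<and> F0 v \<in> T \<and> (\<forall>j. cr_at (\<lambda>w. F0 w $ j) v)"
begin

text \<open>The conditions on a competing map that closeness of jets cannot supply, required near
  \<open>u\<close> so that they can be differentiated. Open conditions come from
  \<open>FF\<close>.\<close>

definition adm :: "(real ^ 'd \<Rightarrow> complex ^ 'n) \<Rightarrow> real ^ 'd \<Rightarrow> bool" where
  "adm F u \<longleftrightarrow> (\<forall>\<^sub>F v in nhds u. v \<in> \<Omega> \<and> smooth_at v F \<and> F v \<in> T \<and> (\<forall>j. cr_at (\<lambda>w. F w $ j) v))"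

lemma adm_F0: "adm F0 u0" using adm_F0' by (simp add: adm_def)

lemma adm_ev: "adm F u \<Longrightarrow> \<forall>\<^sub>F v in nhds u. adm F v"
  unfolding adm_def by (simp add: eventually_eventually)

lemma admD:
  assumes "adm F u"
  shows "u \<in> \<Omega>" "smooth_at u F" "F u \<in> T" "cr_at (\<lambda>w. F w $ j) u" "smooth_at u (\<lambda>w. F w $ j)" "smooth_at u (\<lambda>w. cnj (F w $ j))"
    and adm_crf: "crf (\<lambda>w. F w $ j) u" and adm_X: "smooth_at u (\<lambda>w. X (F w) $ i)"
proof -
  show *: "u \<in> \<Omega>" "smooth_at u F" "F u \<in> T" "cr_at (\<lambda>w. F w $ j) u"
    using eventually_nhds_x_imp_x[OF assms[unfolded adm_def]] by auto
  then show "smooth_at u (\<lambda>w. F w $ j)" "smooth_at u (\<lambda>w. cnj (F w $ j))"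
    by (auto intro: smooth_at_cnj smooth_at_vec_nth)
  show "crf (\<lambda>w. F w $ j) u"
    using assms unfolding crf_def adm_def by eventually_elim (auto intro: smooth_at_vec_nth)
  show "smooth_at u (\<lambda>w. X (F w) $ i)"
    by (rule smooth_at_vec_nth[OF smooth_at_compose[OF *(2) smooth_X[OF *(3)]]])
qed

definition J :: "(real ^ 'd \<Rightarrow> complex ^ 'n) \<times> (real ^ 'd) \<Rightarrow> (real ^ 'j) \<times> (complex ^ 'n) \<times> (real ^ 'd)" where
  "J = (\<lambda>(F, u). (\<chi> l. mpartial (snd (e l)) (\<lambda>w. X (F w) $ fst (e l)) u, F u, u))"

text \<open>A functional maps a germ \<open>F\<close> of a CR map at \<open>u\<close>, written in a chart of the source, to a number. Two functionals are
  identified when they agree along \<open>FF\<close>, that is, as soon as the \<open>k\<close>-jet of \<open>F\<close> at \<open>u\<close> is close to that of \<open>F0\<close> at \<open>u0\<close>.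
  \<open>Rg G\<close> then is the local ring of rational expressions in \<open>G\<close>.\<close>

definition FF :: "((real ^ 'd \<Rightarrow> complex ^ 'n) \<times> (real ^ 'd)) filter" where
  "FF = inf (filtercomap J (nhds (J (F0, u0)))) (principal {(F, u). adm F u})"

lemma eventually_FF:
  "eventually P FF \<longleftrightarrow> (\<exists>S. open S \<and> J (F0, u0) \<in> S \<and> (\<forall>F u. adm F u \<longrightarrow> J (F, u) \<in> S \<longrightarrow> P (F, u)))"
proof -
  have "eventually P FF \<longleftrightarrow> (\<exists>Q. (\<exists>S. open S \<and> J (F0, u0) \<in> S \<and> (\<forall>p\<in>S. Q p)) \<and> (\<forall>x. Q (J x) \<longrightarrow> (case x of (F, u) \<Rightarrow> adm F u) \<longrightarrow> P x))"
    unfolding FF_def eventually_inf_principal eventually_filtercomap eventually_nhds by simp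
  also have "\<dots> \<longleftrightarrow> (\<exists>S. open S \<and> J (F0, u0) \<in> S \<and> (\<forall>F u. adm F u \<longrightarrow> J (F, u) \<in> S \<longrightarrow> P (F, u)))" (is "?l \<longleftrightarrow> ?r")
  proof
    assume ?l
    then obtain Q S where "open S" "J (F0, u0) \<in> S" "\<forall>p\<in>S. Q p"
      and Q: "\<And>x. Q (J x) \<Longrightarrow> (case x of (F, u) \<Rightarrow> adm F u) \<Longrightarrow> P x" by blast
    moreover have "P (F, u)" if "adm F u" "Q (J (F, u))" for F u using Q[of "(F, u)"] that by simp
    ultimately show ?r by (intro exI[of _ S]) blast
  next
    assume ?r
    then obtain S where "open S" "J (F0, u0) \<in> S" "\<And>F u. adm F u \<Longrightarrow> J (F, u) \<in> S \<Longrightarrow> P (F, u)" by blast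
    then show ?l by (intro exI[of _ "\<lambda>p. p \<in> S"]) auto
  qed
  finally show ?thesis .
qed

lemma ev_base_FF: "eventually P FF \<Longrightarrow> P (F0, u0)"
  using adm_F0 by (auto simp: eventually_FF)

lemma ev_adm: "eventually (\<lambda>(F, u). adm F u) FF"
  unfolding eventually_FF by (rule exI[of _ UNIV]) auto

lemma isCont_J:
  assumes "adm F u" shows "((\<lambda>v. J (F, v)) \<longlongrightarrow> J (F, u)) (nhds u)"
proof -
  have 1: "((\<lambda>v. \<chi> l. mpartial (snd (e l)) (\<lambda>w. X (F w) $ fst (e l)) v) \<longlongrightarrow> (\<chi> l. mpartial (snd (e l)) (\<lambda>w. X (F w) $ fst (e l)) u)) (nhds u)"
    by (rule vec_tendstoI, simp only: vec_lambda_beta, rule smooth_at_tendsto[OF smooth_mpartial[OF adm_X[OF assms]]])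
  show ?thesis
    using tendsto_Pair[OF 1 tendsto_Pair[OF smooth_at_tendsto[OF admD(2)[OF assms]] smooth_at_tendsto[OF smooth_at_ident[of u]]]]
    by (simp add: J_def)
qed

text \<open>Closeness of jets persists when the base point moves with \<open>F\<close> fixed. So an
  identity along \<open>FF\<close> may be differentiated, as in \<open>fd_cong\<close>.\<close>

lemma ev_local:
  assumes "eventually P FF"
  shows "eventually (\<lambda>(F, u). \<forall>\<^sub>F v in nhds u. P (F, v)) FF"
proof -
  obtain S where S: "open S" "J (F0, u0) \<in> S" "\<And>F u. adm F u \<Longrightarrow> J (F, u) \<in> S \<Longrightarrow> P (F, u)"
    using assms unfolding eventually_FF by blast
  have "\<forall>\<^sub>F v in nhds u. P (F, v)" if "adm F u" "J (F, u) \<in> S" for F u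
    using adm_ev[OF that(1)] topological_tendstoD[OF isCont_J[OF that(1)] S(1) that(2)]
    by eventually_elim (rule S(3))
  then show ?thesis unfolding eventually_FF using S by auto
qed

lemma filterlim_J: "filterlim J (nhds (J (F0, u0))) FF"
  unfolding FF_def by (rule filterlim_mono[OF filterlim_filtercomap]) auto

inductive_set Rg :: "((real ^ 'd \<Rightarrow> complex ^ 'n) \<times> (real ^ 'd) \<Rightarrow> complex) set \<Rightarrow>
    ((real ^ 'd \<Rightarrow> complex ^ 'n) \<times> (real ^ 'd) \<Rightarrow> complex) set" for G where
  Rg_gen: "\<Theta> \<in> G \<Longrightarrow> \<Theta> \<in> Rg G"
| Rg_const: "(\<lambda>_. c) \<in> Rg G"
| Rg_add: "\<Theta> \<in> Rg G \<Longrightarrow> \<Psi> \<in> Rg G \<Longrightarrow> (\<lambda>x. \<Theta> x + \<Psi> x) \<in> Rg G"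
| Rg_mult: "\<Theta> \<in> Rg G \<Longrightarrow> \<Psi> \<in> Rg G \<Longrightarrow> (\<lambda>x. \<Theta> x * \<Psi> x) \<in> Rg G"
| Rg_inverse: "\<Theta> \<in> Rg G \<Longrightarrow> \<Theta> (F0, u0) \<noteq> 0 \<Longrightarrow> (\<lambda>x. inverse (\<Theta> x)) \<in> Rg G"
| Rg_cong: "\<Theta> \<in> Rg G \<Longrightarrow> eventually (\<lambda>x. \<Theta> x = \<Psi> x) FF \<Longrightarrow> \<Psi> \<in> Rg G"

lemma Rg_sum: "(\<And>i. i \<in> I \<Longrightarrow> \<Theta> i \<in> Rg G) \<Longrightarrow> (\<lambda>x. \<Sum>i\<in>I. \<Theta> i x) \<in> Rg G"
  by (induction I rule: infinite_finite_induct) (auto intro: Rg_const Rg_add)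

lemma Rg_uminus: "\<Theta> \<in> Rg G \<Longrightarrow> (\<lambda>x. - \<Theta> x) \<in> Rg G"
  using Rg_mult[OF Rg_const[of "-1"]] by fastforce

lemma Rg_diff: "\<Theta> \<in> Rg G \<Longrightarrow> \<Psi> \<in> Rg G \<Longrightarrow> (\<lambda>x. \<Theta> x - \<Psi> x) \<in> Rg G"
  using Rg_add[OF _ Rg_uminus] by fastforce

lemma Rg_cong_adm:
  assumes "\<Theta> \<in> Rg G" "\<And>F u. adm F u \<Longrightarrow> \<Theta> (F, u) = \<Psi> (F, u)" shows "\<Psi> \<in> Rg G"
  by (rule Rg_cong[OF assms(1)]) (use ev_adm assms(2) in \<open>auto elim: eventually_mono\<close>)

lemma Rg_sub:
  assumes "\<Theta> \<in> Rg G" "G \<subseteq> Rg G'" shows "\<Theta> \<in> Rg G'"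
  using assms(1)
proof (induction rule: Rg.induct)
  case (Rg_cong \<Theta> \<Psi>) show ?case by (rule Rg.Rg_cong[OF Rg_cong.IH Rg_cong.hyps(2)])
qed (use assms(2) in \<open>auto intro: Rg_const Rg_add Rg_mult Rg_inverse\<close>)

definition coef :: "((complex ^ 'n) \<times> (real ^ 'd) \<Rightarrow> complex) \<Rightarrow> (real ^ 'd \<Rightarrow> complex ^ 'n) \<times> (real ^ 'd) \<Rightarrow> complex" where
  "coef h = (\<lambda>(F, u). h (F u, u))"

definition "Cf = coef ` {h. smooth_at (F0 u0, u0) h}"

text \<open>Coefficients depending on the source point alone: differentiating them, unlike members
  of \<open>Cf\<close>, produces no derivative of the map.\<close>

definition "Cu = (\<lambda>c (F :: real ^ 'd \<Rightarrow> complex ^ 'n, u). c u) ` {c :: real ^ 'd \<Rightarrow> complex. smooth_at u0 c}"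

text \<open>\<open>F\<close> for the components of the map, \<open>B\<close> (bar) for their
  conjugates, \<open>G\<close> for its coordinates in the chart of the target, in which the jets are
  recorded.\<close>

definition "pF is j = (\<lambda>(F :: real ^ 'd \<Rightarrow> complex ^ 'n, u :: real ^ 'd). pds is (\<lambda>w. F w $ j) u)"
definition "pB is j = (\<lambda>(F :: real ^ 'd \<Rightarrow> complex ^ 'n, u :: real ^ 'd). pds is (\<lambda>w. cnj (F w $ j)) u)"
definition "pG is i = (\<lambda>(F :: real ^ 'd \<Rightarrow> complex ^ 'n, u :: real ^ 'd). pds is (\<lambda>w. complex_of_real (X (F w) $ i)) u)"

definition "FA m = {pF is j |is j. length is \<le> m}"
definition "FB m = {pB is j |is j. length is \<le> m}"
definition "JG m = {pG is i |is i. length is \<le> m}"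

definition fd :: "'d field \<Rightarrow> ((real ^ 'd \<Rightarrow> complex ^ 'n) \<times> (real ^ 'd) \<Rightarrow> complex) \<Rightarrow> (real ^ 'd \<Rightarrow> complex ^ 'n) \<times> (real ^ 'd) \<Rightarrow> complex" where
  "fd b \<Theta> = (\<lambda>(F, u). vf b (\<lambda>v. \<Theta> (F, v)) u)"

text \<open>The rational functionals of the \<open>k\<close>-jet in the chart \<open>X\<close> of the target; the paper's \<open>r\<^sub>j\<^sup>\<alpha>\<close> have to be found here.\<close>

abbreviation "JJ \<equiv> Rg (Cf \<union> JG k)"

lemma coefI: "smooth_at (F0 u0, u0) h \<Longrightarrow> coef h \<in> Cf"
  by (auto simp: Cf_def)

lemma smooth_fst_snd: "smooth_at p fst" "smooth_at p snd"
  by (rule smooth_at_linear_self, rule bounded_linear_fst, rule smooth_at_linear_self, rule bounded_linear_snd)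

lemma CuI: "smooth_at u0 c \<Longrightarrow> (\<lambda>(F :: real ^ 'd \<Rightarrow> complex ^ 'n, u). c u) \<in> Cu"
  by (auto simp: Cu_def)

lemma Cu_sub: "Cu \<subseteq> Cf"
proof
  fix \<Theta> assume "\<Theta> \<in> Cu"
  then obtain c where c: "\<Theta> = (\<lambda>(F, u). c u)" "smooth_at u0 c" by (auto simp: Cu_def)
  have "smooth_at (F0 u0, u0) (\<lambda>p. c (snd p))"
    using smooth_at_compose[OF smooth_fst_snd(2), of "(F0 u0, u0)" c] c by simp
  moreover have "\<Theta> = coef (\<lambda>p. c (snd p))" using c by (auto simp: coef_def)
  ultimately show "\<Theta> \<in> Cf" by (simp add: coefI)
qed

lemma ev_coef:
  assumes "smooth_at (F0 u0, u0) h"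
  shows "eventually (\<lambda>(F, u). smooth_at (F u, u) h) FF" "(coef h \<longlongrightarrow> coef h (F0, u0)) FF"
proof -
  have J: "((\<lambda>x. snd (J x)) \<longlongrightarrow> (F0 u0, u0)) FF"
    using tendsto_snd[OF filterlim_J] by (simp add: J_def)
  have "\<forall>\<^sub>F x in FF. smooth_at (snd (J x)) h"
    using filterlim_iff[THEN iffD1, OF J] smooth_at_ev[OF assms] by blast
  then show "eventually (\<lambda>(F, u). smooth_at (F u, u) h) FF"
    by (auto simp: J_def case_prod_unfold elim: eventually_mono)
  have "((\<lambda>x. h (snd (J x))) \<longlongrightarrow> h (F0 u0, u0)) FF"
    by (rule isCont_tendsto_compose[OF smooth_at_continuous[OF assms] J])
  then show "(coef h \<longlongrightarrow> coef h (F0, u0)) FF" by (simp add: coef_def J_def case_prod_unfold)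
qed

text \<open>Jet coordinates start at order 1; order 0 is a function of the value of the map and
  belongs to \<open>Cf\<close> (\<open>pG_Nil\<close>).\<close>

lemma pG_component:
  assumes "1 \<le> length is" "length is \<le> k"
  shows "\<exists>l. \<forall>F u. adm F u \<longrightarrow> pG is i (F, u) = complex_of_real (fst (J (F, u)) $ l)"
proof -
  have "(i, count_list is) \<in> jet_indices k" using assms by (simp add: jet_indices_def msize_count)
  then obtain l where l: "e l = (i, count_list is)" using bij_e by (metis bij_betw_imp_surj_on imageE)
  have "pG is i (F, u) = complex_of_real (fst (J (F, u)) $ l)" if "adm F u" for F u
    by (simp add: J_def l pG_def mpartial_list[OF adm_X[OF that], of "is"])
  then show ?thesis by blast
qed

lemma pG_Nil: "pG [] i \<in> Cf"
proof -
  have "smooth_at (F0 u0, u0) (\<lambda>p. complex_of_real (X (fst p) $ i))"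
    using admD(3)[OF adm_F0] smooth_at_compose[OF smooth_fst_snd(1), of "(F0 u0, u0)" X]
    by (intro smooth_at_of_real smooth_at_vec_nth) (auto intro: smooth_X)
  moreover have "pG [] i = coef (\<lambda>p. complex_of_real (X (fst p) $ i))"
    by (auto simp: pG_def coef_def)
  ultimately show ?thesis by (simp add: coefI)
qed

lemma JJ_tendsto: "\<Theta> \<in> JJ \<Longrightarrow> (\<Theta> \<longlongrightarrow> \<Theta> (F0, u0)) FF"
proof (induction rule: Rg.induct)
  case (Rg_gen \<Theta>)
  have "\<Theta> \<in> Cf \<or> (\<exists>is i. 1 \<le> length is \<and> length is \<le> k \<and> \<Theta> = pG is i)"
  proof (cases "\<Theta> \<in> Cf")
    case False
    then obtain "is" i where i: "length is \<le> k" "\<Theta> = pG is i" using Rg_gen by (auto simp: JG_def)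
    moreover have "is \<noteq> []" using False pG_Nil i by auto
    ultimately show ?thesis by (metis length_greater_0_conv Suc_le_eq One_nat_def)
  qed simp
  then consider "\<Theta> \<in> Cf" | "is" i where "1 \<le> length is" "length is \<le> k" "\<Theta> = pG is i"
    by blast
  then show ?case
  proof cases
    case 1 then show ?thesis using ev_coef by (auto simp: Cf_def)
  next
    case 2
    then obtain l where l: "\<And>F u. adm F u \<Longrightarrow> \<Theta> (F, u) = complex_of_real (fst (J (F, u)) $ l)"
      using pG_component by blast
    have "((\<lambda>x. complex_of_real (fst (J x) $ l)) \<longlongrightarrow> complex_of_real (fst (J (F0, u0)) $ l)) FF"
      by (intro tendsto_of_real tendsto_vec_nth tendsto_fst filterlim_J)
    moreover have "\<forall>\<^sub>F x in FF. complex_of_real (fst (J x) $ l) = \<Theta> x"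
      using ev_adm by eventually_elim (auto simp: l)
    ultimately show ?thesis unfolding l[OF adm_F0] by (rule Lim_transform_eventually)
  qed
next
  case (Rg_cong \<Theta> \<Psi>)
  show ?case
    using Lim_transform_eventually[OF Rg_cong.IH Rg_cong.hyps(2)] ev_base_FF[OF Rg_cong.hyps(2)] by simp
next
  case (Rg_const c) show ?case by (rule tendsto_const)
next
  case (Rg_add \<Theta> \<Psi>) show ?case by (rule tendsto_add[OF Rg_add.IH])
next
  case (Rg_mult \<Theta> \<Psi>) show ?case by (rule tendsto_mult[OF Rg_mult.IH])
next
  case (Rg_inverse \<Theta>) show ?case by (rule tendsto_inverse[OF Rg_inverse.IH Rg_inverse.hyps(2)])
qed

text \<open>Members of \<open>JJ\<close> use only the \<open>k\<close>-jet, so they are continuous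
  for the convergence defining \<open>FF\<close>, and nonvanishing at the base point is an open
  condition.\<close>

lemma JJ_nonzero: "\<Theta> \<in> JJ \<Longrightarrow> \<Theta> (F0, u0) \<noteq> 0 \<Longrightarrow> eventually (\<lambda>x. \<Theta> x \<noteq> 0) FF"
  using JJ_tendsto tendsto_imp_eventually_ne by blast

text \<open>With \<open>F\<close> fixed the functional becomes a smooth function of the base point,
  so that vector fields can act on it.\<close>

lemma JJ_smooth: "\<Theta> \<in> JJ \<Longrightarrow> eventually (\<lambda>(F, u). smooth_at u (\<lambda>v. \<Theta> (F, v))) FF"
proof (induction rule: Rg.induct)
  case (Rg_gen \<Theta>)
  then consider h where "smooth_at (F0 u0, u0) h" "\<Theta> = coef h" | "is" i where "\<Theta> = pG is i"
    by (auto simp: Cf_def JG_def)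
  then show ?case
  proof cases
    case 1
    show ?thesis using ev_coef(1)[OF 1(1)] ev_adm
      by eventually_elim (auto simp: 1 coef_def intro!: smooth_at_compose[where g=h] smooth_at_Pair admD)
  next
    case 2
    show ?thesis using ev_adm
      by eventually_elim (auto simp: 2 pG_def intro!: smooth_at_pds smooth_at_of_real adm_X)
  qed
next
  case (Rg_const c) then show ?case by simp
next
  case (Rg_add \<Theta> \<Psi>)
  from Rg_add.IH show ?case by eventually_elim (auto intro: smooth_at_add)
next
  case (Rg_mult \<Theta> \<Psi>)
  from Rg_mult.IH show ?case by eventually_elim (auto intro: smooth_at_mult)
next
  case (Rg_inverse \<Theta>)
  from Rg_inverse.IH JJ_nonzero[OF Rg_inverse.hyps] show ?case by eventually_elim (auto intro: smooth_at_inverse)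
next
  case (Rg_cong \<Theta> \<Psi>)
  from Rg_cong.IH ev_local[OF Rg_cong.hyps(2)] show ?case
    by eventually_elim (auto simp: smooth_at_cong_ev)
qed

lemma fd_cong: "eventually (\<lambda>x. \<Theta> x = \<Psi> x) FF \<Longrightarrow> eventually (\<lambda>x. fd b \<Theta> x = fd b \<Psi> x) FF"
  by (drule ev_local) (auto simp: fd_def elim!: eventually_mono intro: vf_cong_ev)

text \<open>By the rules for sums, products and inverses a derivation is controlled on the whole
  ring by its values on generators; \<open>G \<subseteq> JJ\<close> provides smoothness and keeps
  denominators nonzero near the base jet.\<close>

lemma fd_Rg:
  assumes "G \<subseteq> JJ" "G \<subseteq> Rg G'" "\<And>\<Theta>. \<Theta> \<in> G \<Longrightarrow> fd b \<Theta> \<in> Rg G'"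
  shows "\<Theta> \<in> Rg G \<Longrightarrow> fd b \<Theta> \<in> Rg G'"
proof (induction rule: Rg.induct)
  case (Rg_gen \<Theta>) then show ?case by (rule assms(3))
next
  case (Rg_const c)
  show ?case by (rule Rg_cong[OF Rg.Rg_const[of 0]]) (auto simp: fd_def)
next
  case (Rg_add \<Theta> \<Psi>)
  have "eventually (\<lambda>x. fd b \<Theta> x + fd b \<Psi> x = fd b (\<lambda>x. \<Theta> x + \<Psi> x) x) FF"
    using JJ_smooth[OF Rg_sub[OF Rg_add.hyps(1) assms(1)]] JJ_smooth[OF Rg_sub[OF Rg_add.hyps(2) assms(1)]]
    by eventually_elim (auto simp: fd_def vf_add)
  then show ?case by (rule Rg_cong[OF Rg.Rg_add[OF Rg_add.IH]])
next
  case (Rg_mult \<Theta> \<Psi>)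
  have "eventually (\<lambda>x. fd b \<Theta> x * \<Psi> x + \<Theta> x * fd b \<Psi> x = fd b (\<lambda>x. \<Theta> x * \<Psi> x) x) FF"
    using JJ_smooth[OF Rg_sub[OF Rg_mult.hyps(1) assms(1)]] JJ_smooth[OF Rg_sub[OF Rg_mult.hyps(2) assms(1)]]
    by eventually_elim (auto simp: fd_def vf_mult)
  then show ?case
    by (rule Rg_cong[OF Rg.Rg_add[OF Rg.Rg_mult Rg.Rg_mult], rotated -1])
      (use Rg_mult Rg_sub[OF _ assms(2)] in auto)
next
  case (Rg_inverse \<Theta>)
  note nz = JJ_nonzero[OF Rg_sub[OF Rg_inverse.hyps(1) assms(1)] Rg_inverse.hyps(2)]
  have "eventually (\<lambda>x. - (inverse (\<Theta> x) * inverse (\<Theta> x) * fd b \<Theta> x) = fd b (\<lambda>x. inverse (\<Theta> x)) x) FF"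
    using JJ_smooth[OF Rg_sub[OF Rg_inverse.hyps(1) assms(1)]] nz ev_local[OF nz]
  proof eventually_elim
    case (elim x)
    obtain F u where x: "x = (F, u)" by (cases x)
    let ?g = "\<lambda>v. \<Theta> (F, v)"
    have g: "smooth_at u ?g" "?g u \<noteq> 0" "\<forall>\<^sub>F v in nhds u. ?g v \<noteq> 0" using elim x by auto
    have "\<forall>\<^sub>F v in nhds u. ?g v * inverse (?g v) = 1"
      using g(3) by eventually_elim simp
    from vf_cong_ev[OF this, of b]
    have "vf b ?g u * inverse (?g u) + ?g u * vf b (\<lambda>v. inverse (?g v)) u = 0"
      using g vf_mult[OF g(1) smooth_at_inverse[OF g(1,2)], of b] by simp
    then have "?g u * (vf b (\<lambda>v. inverse (?g v)) u + inverse (?g u) * inverse (?g u) * vf b ?g u) = 0"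
      using g(2) by (simp add: field_simps)
    then have "vf b (\<lambda>v. inverse (?g v)) u = - (inverse (?g u) * inverse (?g u) * vf b ?g u)"
      using g(2) by (simp add: add_eq_0_iff)
    then show ?case by (simp add: x fd_def)
  qed
  then show ?case
    by (rule Rg_cong[OF Rg_uminus[OF Rg.Rg_mult[OF Rg.Rg_mult]], rotated -1])
      (use Rg_inverse Rg_sub[OF _ assms(2)] in \<open>auto intro!: Rg.Rg_inverse\<close>)
next
  case (Rg_cong \<Theta> \<Psi>)
  show ?case by (rule Rg.Rg_cong[OF Rg_cong.IH fd_cong[OF Rg_cong.hyps(2)]])
qed

text \<open>The chain rule: which ring contains the result depends only on where the derivatives of
  the map and of its conjugate lie.\<close>

lemma fd_coef:
  assumes h: "smooth_at (F0 u0, u0) h" and b: "Sm \<Omega> b" and G: "Cf \<subseteq> Rg G"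
    and F: "\<And>j. fd b (pF [] j) \<in> Rg G" and B: "\<And>j. fd b (pB [] j) \<in> Rg G"
  shows "fd b (coef h) \<in> Rg G"
proof -
  let ?d = "\<lambda>i p. snd p $ i"
  have c: "coef h' \<in> Rg G" if "smooth_at (F0 u0, u0) h'" for h' using coefI[OF that] G by blast
  have bi: "(\<lambda>(F :: real ^ 'd \<Rightarrow> complex ^ 'n, u). b u $ i) \<in> Rg G" for i
    using CuI[of "\<lambda>u. b u $ i"] Cu_sub G SmD[OF b u0] by (blast intro: smooth_at_vec_nth)
  have "(\<lambda>x. (\<Sum>j\<in>UNIV. coef (dz1 j h) x * fd b (pF [] j) x) + (\<Sum>j\<in>UNIV. coef (dzb1 j h) x * fd b (pB [] j) x)
    + (\<Sum>i\<in>UNIV. (\<lambda>(F, u). b u $ i) x * coef (\<lambda>p. frechet_derivative h (at p) (0, axis i 1)) x)) \<in> Rg G"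
    by (intro Rg_add Rg_sum Rg_mult c smooth_dz1 smooth_at_deriv h F B bi)
  moreover have "eventually (\<lambda>x. (\<Sum>j\<in>UNIV. coef (dz1 j h) x * fd b (pF [] j) x) + (\<Sum>j\<in>UNIV. coef (dzb1 j h) x * fd b (pB [] j) x)
    + (\<Sum>i\<in>UNIV. (\<lambda>(F, u). b u $ i) x * coef (\<lambda>p. frechet_derivative h (at p) (0, axis i 1)) x) = fd b (coef h) x) FF"
    using ev_coef(1)[OF h] ev_adm
    by eventually_elim (auto simp: coef_def fd_def pF_def pB_def vf_chain[OF admD(2)])
  ultimately show ?thesis by (rule Rg_cong)
qed

lemma Rg_cnj:
  assumes "\<And>\<Theta>. \<Theta> \<in> G \<Longrightarrow> (\<lambda>x. cnj (\<Theta> x)) \<in> Rg G'"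
  shows "\<Theta> \<in> Rg G \<Longrightarrow> (\<lambda>x. cnj (\<Theta> x)) \<in> Rg G'"
proof (induction rule: Rg.induct)
  case (Rg_cong \<Theta> \<Psi>)
  show ?case by (rule Rg.Rg_cong[OF Rg_cong.IH]) (use Rg_cong.hyps in \<open>auto elim: eventually_mono\<close>)
qed (auto intro: assms Rg_const Rg_add Rg_mult Rg_inverse)

lemma cnj_Cf:
  assumes "\<Theta> \<in> Cf" shows "(\<lambda>x. cnj (\<Theta> x)) \<in> Cf"
proof -
  obtain h where h: "\<Theta> = coef h" "smooth_at (F0 u0, u0) h" using assms by (auto simp: Cf_def)
  have "(\<lambda>x. cnj (\<Theta> x)) = coef (\<lambda>p. cnj (h p))" by (auto simp: h coef_def)
  then show ?thesis by (simp add: coefI smooth_at_cnj h)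
qed

lemma fd_mono_JG:
  assumes "m \<le> k" shows "\<Theta> \<in> Rg (Cf \<union> JG m) \<Longrightarrow> \<Theta> \<in> JJ"
  by (erule Rg_sub) (use assms in \<open>auto simp: JG_def intro!: Rg_gen\<close>)

lemma cnj_RJG: "\<Theta> \<in> Rg (Cf \<union> JG m) \<Longrightarrow> (\<lambda>x. cnj (\<Theta> x)) \<in> Rg (Cf \<union> JG m)"
proof (erule Rg_cnj[rotated])
  fix \<Theta> assume "\<Theta> \<in> Cf \<union> JG m"
  then consider "\<Theta> \<in> Cf" | "is" i where "length is \<le> m" "\<Theta> = pG is i" by (auto simp: JG_def)
  then show "(\<lambda>x. cnj (\<Theta> x)) \<in> Rg (Cf \<union> JG m)"
  proof cases
    case 1 then show ?thesis using cnj_Cf by (auto intro: Rg_gen)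
  next
    case 2
    have "\<Theta> \<in> Rg (Cf \<union> JG m)" using 2 by (auto simp: JG_def intro!: Rg_gen)
    then show ?thesis
      by (rule Rg_cong_adm) (simp add: 2 pG_def partials_of_real[OF adm_X])
  qed
qed

lemma pF_Nil: "pF [] j \<in> Cf" "pB [] j \<in> Cf"
proof -
  have "pF [] j = coef (\<lambda>p. fst p $ j)" "pB [] j = coef (\<lambda>p. cnj (fst p $ j))"
    by (auto simp: pF_def pB_def coef_def)
  then show "pF [] j \<in> Cf" "pB [] j \<in> Cf"
    by (auto intro!: coefI smooth_at_cnj smooth_at_vec_nth smooth_fst_snd)
qed

lemma fd_pd: "fd (cf i) (pF is j) = pF (i # is) j" "fd (cf i) (pB is j) = pB (i # is) j" "fd (cf i) (pG is l) = pG (i # is) l"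
  by (auto simp: fd_def pF_def pB_def pG_def)

text \<open>Near admissible points \<open>F = \<psi> \<circ> X \<circ> F\<close>, so first
  derivatives of the ambient components are linear in those of the chart coordinates, with
  coefficients smooth in the value of \<open>F\<close>.\<close>

lemma pF1_JG: "pF [i] j \<in> Rg (Cf \<union> JG (Suc 0))" "pB [i] j \<in> Rg (Cf \<union> JG (Suc 0))"
proof -
  let ?h = "\<lambda>l p. pd l (\<lambda>v. \<psi> v $ j) (X (fst p))"
  have h: "smooth_at (F0 u0, u0) (?h l)" for l
    by (rule smooth_at_compose[where g="pd l (\<lambda>v. \<psi> v $ j)" and f="\<lambda>p. X (fst p)"])
      (use admD(3)[OF adm_F0] smooth_at_compose[OF smooth_fst_snd(1), of "(F0 u0, u0)" X]
        in \<open>auto intro!: smooth_at_pd smooth_at_vec_nth smooth_\<psi> smooth_X\<close>)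
  have "(\<lambda>x. \<Sum>l\<in>UNIV. coef (?h l) x * pG [i] l x) \<in> Rg (Cf \<union> JG (Suc 0))"
  proof (rule Rg_sum, rule Rg_mult)
    show "coef (?h l) \<in> Rg (Cf \<union> JG (Suc 0))" for l by (rule Rg_gen[OF UnI1[OF coefI[OF h]]])
    show "pG [i] l \<in> Rg (Cf \<union> JG (Suc 0))" for l by (rule Rg_gen[OF UnI2]) (auto simp: JG_def)
  qed
  then show 1: "pF [i] j \<in> Rg (Cf \<union> JG (Suc 0))"
  proof (rule Rg_cong_adm)
    fix F u assume a: "adm F u"
    have sX: "smooth_at u (\<lambda>w. X (F w))" by (rule smooth_at_compose[OF admD(2)[OF a] smooth_X[OF admD(3)[OF a]]])
    have s\<psi>: "smooth_at (X (F u)) (\<lambda>v. \<psi> v $ j)" by (rule smooth_at_vec_nth[OF smooth_\<psi>[OF admD(3)[OF a]]])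
    let ?X = "frechet_derivative (\<lambda>w. X (F w)) (at u)"
    have "\<forall>\<^sub>F w in nhds u. F w $ j = \<psi> (X (F w)) $ j"
      using adm_ev[OF a] by eventually_elim (simp add: \<psi>_X admD)
    then have "pd i (\<lambda>w. F w $ j) u = pd i (\<lambda>w. \<psi> (X (F w)) $ j) u" by (rule pd_cong_ev)
    also have "\<dots> = frechet_derivative (\<lambda>v. \<psi> v $ j) (at (X (F u))) (?X (axis i 1))"
      unfolding pd_def
      by (subst frechet_derivative_eqI[OF has_derivative_compose[OF smooth_at_has_derivative[OF sX] smooth_at_has_derivative[OF s\<psi>]]]) simp
    also have "\<dots> = (\<Sum>l\<in>UNIV. ?X (axis i 1) $ l *\<^sub>R pd l (\<lambda>v. \<psi> v $ j) (X (F u)))"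
      unfolding pd_def by (rule real_vec_expand) (rule linear_frechet[OF smooth_at_differentiable[OF s\<psi>]])
    also have "\<dots> = (\<Sum>l\<in>UNIV. pd l (\<lambda>v. \<psi> v $ j) (X (F u)) * pd i (\<lambda>w. complex_of_real (X (F w) $ l)) u)"
    proof (intro sum.cong refl)
      fix l
      have "pd i (\<lambda>w. complex_of_real (X (F w) $ l)) u = complex_of_real (?X (axis i 1) $ l)"
        unfolding pd_def
        by (simp add: frechet_derivative_bounded_linear[OF bounded_linear_of_real smooth_at_differentiable[OF adm_X[OF a]]]
            frechet_derivative_bounded_linear[OF bounded_linear_vec_nth smooth_at_differentiable[OF sX]])
      then show "?X (axis i 1) $ l *\<^sub>R pd l (\<lambda>v. \<psi> v $ j) (X (F u)) = pd l (\<lambda>v. \<psi> v $ j) (X (F u)) * pd i (\<lambda>w. complex_of_real (X (F w) $ l)) u"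
        by (simp add: scaleR_conv_of_real)
    qed
    finally show "(\<Sum>l\<in>UNIV. coef (?h l) (F, u) * pG [i] l (F, u)) = pF [i] j (F, u)"
      by (simp add: coef_def pG_def pF_def)
  qed
  show "pB [i] j \<in> Rg (Cf \<union> JG (Suc 0))"
    by (rule Rg_cong_adm[OF cnj_RJG[OF 1]]) (simp add: pF_def pB_def pd_cnj admD)
qed

lemma JG_mono: "m \<le> n \<Longrightarrow> JG m \<subseteq> JG n"
  by (auto simp: JG_def)

lemma fd_JG:
  assumes "m \<le> k" "\<Theta> \<in> Rg (Cf \<union> JG m)"
  shows "fd (cf i) \<Theta> \<in> Rg (Cf \<union> JG (Suc m))"
proof (rule fd_Rg[OF _ _ _ assms(2)])
  show "Cf \<union> JG m \<subseteq> JJ" using JG_mono[OF assms(1)] by (auto intro: Rg_gen)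
  show "Cf \<union> JG m \<subseteq> Rg (Cf \<union> JG (Suc m))" using JG_mono[of m "Suc m"] by (auto intro: Rg_gen)
  have s: "\<Theta> \<in> Rg (Cf \<union> JG (Suc 0)) \<Longrightarrow> \<Theta> \<in> Rg (Cf \<union> JG (Suc m))" for \<Theta>
    by (erule Rg_sub) (use JG_mono[of "Suc 0" "Suc m"] in \<open>auto intro: Rg_gen\<close>)
  fix \<Theta> assume "\<Theta> \<in> Cf \<union> JG m"
  then consider h where "smooth_at (F0 u0, u0) h" "\<Theta> = coef h" | "is" l where "length is \<le> m" "\<Theta> = pG is l"
    by (auto simp: JG_def Cf_def)
  then show "fd (cf i) \<Theta> \<in> Rg (Cf \<union> JG (Suc m))"
  proof cases
    case 1
    show ?thesis unfolding 1(2)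
      by (rule fd_coef[OF 1(1)]) (auto simp: Sm_def fd_pd intro: Rg_gen s pF1_JG)
  next
    case 2 then show ?thesis by (auto simp: fd_pd JG_def intro!: Rg_gen)
  qed
qed

lemma pF_JG:
  assumes "length is \<le> k"
  shows "pF is j \<in> Rg (Cf \<union> JG (length is))" "pB is j \<in> Rg (Cf \<union> JG (length is))"
proof -
  show 1: "pF is j \<in> Rg (Cf \<union> JG (length is))" using assms
  proof (induction "is")
    case Nil then show ?case using pF_Nil by (auto intro: Rg_gen)
  next
    case (Cons i xs) then show ?case using fd_JG[of "length xs" "pF xs j" i] by (simp add: fd_pd)
  qed
  show "pB is j \<in> Rg (Cf \<union> JG (length is))" using assms
  proof (induction "is")
    case Nil then show ?case using pF_Nil by (auto intro: Rg_gen)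
  next
    case (Cons i xs) then show ?case using fd_JG[of "length xs" "pB xs j" i] by (simp add: fd_pd)
  qed
qed

text \<open>Functionals of order at most \<open>m\<close>: smooth in the value and the point,
  rational in the derivatives of the map and its conjugate.\<close>

abbreviation "E m \<equiv> Rg (Cf \<union> FA m \<union> FB m)"

lemma gens_JJ: "m \<le> k \<Longrightarrow> Cf \<union> FA m \<union> FB m \<subseteq> JJ"
  by (auto simp: FA_def FB_def intro: Rg_gen fd_mono_JG[OF _ pF_JG(1)] fd_mono_JG[OF _ pF_JG(2)])

lemma E_JJ: "\<Theta> \<in> E m \<Longrightarrow> m \<le> k \<Longrightarrow> \<Theta> \<in> JJ"
  by (erule Rg_sub) (rule gens_JJ)

lemma E_mono: "\<Theta> \<in> E m \<Longrightarrow> m \<le> n \<Longrightarrow> \<Theta> \<in> E n"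
  by (erule Rg_sub) (auto simp: FA_def FB_def intro!: Rg_gen)

lemma pF_E: "length is \<le> m \<Longrightarrow> pF is j \<in> E m" "length is \<le> m \<Longrightarrow> pB is j \<in> E m"
  by (auto simp: FA_def FB_def intro!: Rg_gen)

lemma Cu_Rg: "Cu \<subseteq> Rg G \<Longrightarrow> smooth_at u0 c \<Longrightarrow> (\<lambda>(F :: real ^ 'd \<Rightarrow> complex ^ 'n, u). c u) \<in> Rg G"
  using CuI by blast

lemma fd_eq: "fd b \<Theta> = (\<lambda>x. \<Sum>i\<in>UNIV. (\<lambda>(F, u). b u $ i) x * fd (cf i) \<Theta> x)"
  by (auto simp: fd_def vf_def[of b])

lemma fd_E:
  assumes "Sm \<Omega> b" "m \<le> k" "\<Theta> \<in> E m"
  shows "fd b \<Theta> \<in> E (Suc m)"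
proof -
  have 1: "fd (cf i) \<Theta> \<in> E (Suc m)" for i
  proof (rule fd_Rg[OF gens_JJ[OF assms(2)] _ _ assms(3)])
    show "Cf \<union> FA m \<union> FB m \<subseteq> E (Suc m)" by (auto simp: FA_def FB_def intro!: Rg_gen)
    fix \<Theta> assume "\<Theta> \<in> Cf \<union> FA m \<union> FB m"
    then consider h where "smooth_at (F0 u0, u0) h" "\<Theta> = coef h" | "is" l where "length is \<le> m" "\<Theta> = pF is l"
      | "is" l where "length is \<le> m" "\<Theta> = pB is l"
      by (auto simp: FA_def FB_def Cf_def)
    then show "fd (cf i) \<Theta> \<in> E (Suc m)"
    proof cases
      case 1
      show ?thesis unfolding 1(2)
        by (rule fd_coef[OF 1(1)]) (auto simp: Sm_def fd_pd intro: Rg_gen intro!: pF_E)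
    qed (auto simp: fd_pd intro!: pF_E)
  qed
  have "Cu \<subseteq> E (Suc m)" using Cu_sub by (auto intro: Rg_gen)
  then show ?thesis
    by (subst fd_eq) (intro Rg_sum Rg_mult 1 Cu_Rg smooth_at_vec_nth SmD[OF assms(1) u0])
qed

end

section \<open>Wirtinger derivatives in the ambient space, and commutators on functionals\<close>

lemma pds_add:
  "smooth_at u f \<Longrightarrow> smooth_at u g \<Longrightarrow> pds is (\<lambda>u. f u + g u) u = pds is f u + pds is g u"
proof (induction "is" arbitrary: u)
  case (Cons i xs)
  have "\<forall>\<^sub>F v in nhds u. pds xs (\<lambda>u. f u + g u) v = pds xs f v + pds xs g v"
    using smooth_at_ev[OF Cons.prems(1)] smooth_at_ev[OF Cons.prems(2)] by eventually_elim (rule Cons.IH)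
  from pd_cong_ev[OF this, of i] show ?case
    by (simp add: pd_add smooth_at_pds Cons.prems)
qed simp

text \<open>The constants \<open>- \<i>\<close> and \<open>\<i>\<close> give \<open>dz\<close> and
  \<open>dzbar\<close>, so that smoothness and commutation are proved once for both.\<close>

definition dzc :: "complex \<Rightarrow> 'n \<Rightarrow> (complex ^ 'n::finite \<Rightarrow> complex) \<Rightarrow> complex ^ 'n \<Rightarrow> complex" where
  "dzc c j g p = (frechet_derivative g (at p) (axis j 1) + c * frechet_derivative g (at p) (axis j \<i>)) / 2"

lemma dz_dzc: "dz j = dzc (- \<i>) j" "dzbar j = dzc \<i> j"
  by (auto simp: fun_eq_iff dz_def dzbar_def dzc_def)

lemma smooth_dzc: "smooth_at p g \<Longrightarrow> smooth_at p (dzc c j g)"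
  unfolding dzc_def[abs_def]
  by (intro smooth_at_divide smooth_at_add smooth_at_mult smooth_at_deriv smooth_at_const) auto

lemma smooth_dz: "smooth_at p g \<Longrightarrow> smooth_at p (dz j g)" "smooth_at p g \<Longrightarrow> smooth_at p (dzbar j g)"
  by (simp_all add: dz_dzc smooth_dzc)

lemma frechet_dzc:
  assumes "smooth_at p g"
  shows "frechet_derivative (dzc c j g) (at p) v = (frechet_derivative (\<lambda>p. frechet_derivative g (at p) (axis j 1)) (at p) v
    + c * frechet_derivative (\<lambda>p. frechet_derivative g (at p) (axis j \<i>)) (at p) v) / 2"
proof -
  let ?f = "\<lambda>p. frechet_derivative g (at p) (axis j 1)" and ?g = "\<lambda>p. frechet_derivative g (at p) (axis j \<i>)"
  have f: "(?f has_derivative frechet_derivative ?f (at p)) (at p)" and g: "(?g has_derivative frechet_derivative ?g (at p)) (at p)"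
    by (rule smooth_at_has_derivative[OF smooth_at_deriv[OF assms]])+
  have "((\<lambda>p. (?f p + c * ?g p) / 2) has_derivative (\<lambda>v. (frechet_derivative ?f (at p) v + c * frechet_derivative ?g (at p) v) / 2)) (at p)"
    by (rule bounded_linear.has_derivative[OF bounded_linear_divide
          has_derivative_add[OF f bounded_linear.has_derivative[OF bounded_linear_mult_right g]]])
  from frechet_derivative_eqI[OF this] show ?thesis unfolding dzc_def[abs_def] by simp
qed

lemma dzc_commute:
  assumes "smooth_at p g" shows "dzc c j (dzc c' i g) p = dzc c' i (dzc c j g) p"
proof -
  let ?D = "\<lambda>a b. frechet_derivative (\<lambda>p. frechet_derivative g (at p) a) (at p) b"
  have "?D a b = ?D b a" for a b by (rule frechet_derivative_commute[OF assms])
  then show ?thesis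
    unfolding dzc_def[of c j "dzc c' i g"] dzc_def[of c' i "dzc c j g"] frechet_dzc[OF assms]
    by (simp add: algebra_simps add_divide_distrib)
qed

lemma dzc_cong_ev: "\<forall>\<^sub>F p in nhds x. f p = g p \<Longrightarrow> dzc c j f x = dzc c j g x"
  unfolding dzc_def by (drule frechet_derivative_cong_ev) simp

definition dbars :: "'n list \<Rightarrow> (complex ^ 'n::finite \<Rightarrow> complex) \<Rightarrow> complex ^ 'n \<Rightarrow> complex" where
  "dbars = foldr dzbar"

lemma dbars_simps [simp]: "dbars [] h = h" "dbars (j # js) h = dzbar j (dbars js h)"
  by (simp_all add: dbars_def)

lemma smooth_dbars: "smooth_at p h \<Longrightarrow> smooth_at p (dbars js h)"
  by (induction js) (auto intro: smooth_dz)

lemma dz_dbars_commute: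
  "smooth_at p h \<Longrightarrow> dz j (dbars js h) p = dbars js (dz j h) p"
proof (induction js arbitrary: p)
  case (Cons i js)
  have "\<forall>\<^sub>F p in nhds p. dz j (dbars js h) p = dbars js (dz j h) p"
    using smooth_at_ev[OF Cons.prems] by eventually_elim (rule Cons.IH)
  then have "dzbar i (dz j (dbars js h)) p = dzbar i (dbars js (dz j h)) p"
    unfolding dz_dzc by (rule dzc_cong_ev)
  then show ?case
    using dzc_commute[OF smooth_dbars[OF Cons.prems], of "- \<i>" j \<i> i js] by (simp add: dz_dzc)
qed simp

lemma vf_chain_amb:
  assumes F: "smooth_at v F" and h: "smooth_at (F v) h"
  shows "vf b (\<lambda>w. h (F w)) v = (\<Sum>j\<in>UNIV. dz j h (F v) * vf b (\<lambda>w. F w $ j) v)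
    + (\<Sum>j\<in>UNIV. dzbar j h (F v) * vf b (\<lambda>w. cnj (F w $ j)) v)"
proof -
  let ?h = "\<lambda>p. h (fst p)"
  have h': "smooth_at (F v, v) ?h"
    by (rule smooth_at_compose[where f=fst and g=h]) (auto intro: smooth_at_linear_self bounded_linear_fst h)
  have "(?h has_derivative (\<lambda>d. frechet_derivative h (at (F v)) (fst d))) (at (F v, v))"
    by (rule has_derivative_compose[where f=fst and g=h, simplified])
      (use smooth_at_has_derivative[OF h] in \<open>auto intro: has_derivative_fst has_derivative_ident\<close>)
  from frechet_derivative_eqI[OF this]
  have D: "frechet_derivative ?h (at (F v, v)) d = frechet_derivative h (at (F v)) (fst d)" for d by simp
  have 0: "frechet_derivative h (at (F v)) 0 = 0"
    by (rule linear_0[OF linear_frechet[OF smooth_at_differentiable[OF h]]])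
  show ?thesis
    using vf_chain[OF F h', of b] by (simp add: dz1_def dzb1_def dz_def dzbar_def D 0)
qed

context jet_setting
begin

text \<open>On a hypersurface the (0,1) fields are those annihilating all holomorphic coordinates;
  \<open>cnjf K\<close> is then of type (1,0).\<close>

definition type01 :: "'d field \<Rightarrow> bool" where
  "type01 K \<longleftrightarrow> Sm \<Omega> K \<and> (\<forall>u\<in>\<Omega>. \<forall>j. vf K (z j) u = 0)"

lemma type01_F: "type01 K \<Longrightarrow> adm F u \<Longrightarrow> vf K (\<lambda>w. F w $ j) u = 0"
  using admD(1,4)[of F u] by (auto simp: type01_def cr_at_def)

lemma type01_B: "type01 K \<Longrightarrow> adm F u \<Longrightarrow> vf (cnjf K) (\<lambda>w. cnj (F w $ j)) u = 0"
  by (simp add: vf_cnj admD type01_F)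

definition pdF :: "'d list \<Rightarrow> ((real ^ 'd \<Rightarrow> complex ^ 'n) \<times> (real ^ 'd) \<Rightarrow> complex) \<Rightarrow> (real ^ 'd \<Rightarrow> complex ^ 'n) \<times> (real ^ 'd) \<Rightarrow> complex" where
  "pdF is \<Theta> = (\<lambda>(F, u). pds is (\<lambda>v. \<Theta> (F, v)) u)"

definition smf :: "((real ^ 'd \<Rightarrow> complex ^ 'n) \<times> (real ^ 'd) \<Rightarrow> complex) \<Rightarrow> bool" where
  "smf \<Theta> \<longleftrightarrow> eventually (\<lambda>(F, u). smooth_at u (\<lambda>v. \<Theta> (F, v))) FF"

lemma pdF_simps: "pdF [] \<Theta> = \<Theta>" "pdF (i # is) \<Theta> = fd (cf i) (pdF is \<Theta>)" "pdF (is @ [i]) \<Theta> = pdF is (fd (cf i) \<Theta>)"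
  by (auto simp: pdF_def fd_def pds_append)

lemma smf_fd:
  assumes "smf \<Theta>" "Sm \<Omega> b" shows "smf (fd b \<Theta>)"
  using assms(1) ev_adm unfolding smf_def
  by eventually_elim (auto simp: fd_def intro!: smooth_at_vf SmD[OF assms(2)] admD(1))

lemma smf_JJ: "\<Theta> \<in> JJ \<Longrightarrow> smf \<Theta>"
  unfolding smf_def by (rule JJ_smooth)

lemma pdF_cong: "eventually (\<lambda>x. \<Theta> x = \<Psi> x) FF \<Longrightarrow> eventually (\<lambda>x. pdF is \<Theta> x = pdF is \<Psi> x) FF"
  by (drule ev_local) (auto simp: pdF_def elim!: eventually_mono intro: eventually_nhds_x_imp_x[OF pds_cong_ev'])

lemma pdF_add:
  assumes "smf \<Theta>" "smf \<Psi>" "pdF is \<Theta> \<in> Rg G" "pdF is \<Psi> \<in> Rg G"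
  shows "pdF is (\<lambda>x. \<Theta> x + \<Psi> x) \<in> Rg G"
proof (rule Rg_cong[OF Rg_add[OF assms(3,4)]])
  show "\<forall>\<^sub>F x in FF. pdF is \<Theta> x + pdF is \<Psi> x = pdF is (\<lambda>x. \<Theta> x + \<Psi> x) x"
    using assms(1,2) unfolding smf_def by eventually_elim (auto simp: pdF_def pds_add)
qed

lemma smf_scale:
  assumes "smf \<Theta>" "Sm \<Omega> c" shows "smf (\<lambda>(F, u). c u * \<Theta> (F, u))"
  using assms(1) ev_adm unfolding smf_def
  by eventually_elim (auto intro!: smooth_at_mult SmD[OF assms(2)] admD(1))

lemma smf_add:
  assumes "smf \<Theta>" "smf \<Psi>" shows "smf (\<lambda>x. \<Theta> x + \<Psi> x)"
  using assms unfolding smf_def by eventually_elim (auto intro: smooth_at_add)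

lemma smf_zero: "smf (\<lambda>x. 0)"
  by (simp add: smf_def case_prod_unfold)

lemma smf_sum: "(\<And>i. i \<in> I \<Longrightarrow> smf (\<Theta> i)) \<Longrightarrow> smf (\<lambda>x. \<Sum>i\<in>I. \<Theta> i x)"
  by (induction I rule: infinite_finite_induct) (auto intro: smf_zero smf_add)

lemma pdF_zero: "pdF is (\<lambda>x. 0) = (\<lambda>x. 0)"
proof -
  have "pds is (\<lambda>v. 0) = (\<lambda>v. 0)" by (induction "is") auto
  then show ?thesis by (auto simp: pdF_def)
qed

lemma pdF_sum:
  "(\<And>i. i \<in> I \<Longrightarrow> smf (\<Theta> i) \<and> pdF is (\<Theta> i) \<in> Rg G) \<Longrightarrow> pdF is (\<lambda>x. \<Sum>i\<in>I. \<Theta> i x) \<in> Rg G"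
proof (induction I rule: infinite_finite_induct)
  case (insert i I)
  have "pdF is (\<lambda>x. \<Theta> i x + (\<Sum>i\<in>I. \<Theta> i x)) \<in> Rg G"
    using insert by (intro pdF_add smf_sum) auto
  then show ?case using insert.hyps by simp
qed (auto simp: pdF_zero intro: Rg_const)

text \<open>Leibniz, peeling off the innermost derivative: it falls on \<open>c\<close>, or on
  \<open>\<Theta>\<close>, whose derivative satisfies the hypothesis with \<open>n\<close> lowered
  by one.\<close>

lemma pdF_scale:
  assumes "Cu \<subseteq> Rg G" "Sm \<Omega> c" "smf \<Theta>" "\<And>is. length is \<le> n \<Longrightarrow> pdF is \<Theta> \<in> Rg G" "length is \<le> n"
  shows "pdF is (\<lambda>(F, u). c u * \<Theta> (F, u)) \<in> Rg G"
  using assms(2-)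
proof (induction n arbitrary: c \<Theta> "is")
  have *: "(\<lambda>(F, u). c u * \<Theta> (F, u)) \<in> Rg G" if "Sm \<Omega> c" "\<Theta> \<in> Rg G" for c \<Theta>
    using Rg_mult[OF Cu_Rg[OF assms(1) SmD[OF that(1) u0]] that(2)] by (simp add: case_prod_unfold)
  {
    case 0 then show ?case using *[of c \<Theta>] 0(3)[of "[]"] by (simp add: pdF_simps)
  next
    case (Suc n)
    show ?case
    proof (cases "is" rule: rev_cases)
      case Nil then show ?thesis using * Suc.prems(1) Suc.prems(3)[of "[]"] by (simp add: pdF_simps)
    next
      case (snoc js i)
      have js: "length js \<le> n" using snoc Suc.prems by simp
      have "pdF js (\<lambda>x. (\<lambda>(F, u). pd i c u * \<Theta> (F, u)) x + (\<lambda>(F, u). c u * fd (cf i) \<Theta> (F, u)) x) \<in> Rg G"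
      proof (intro pdF_add)
        have pc: "Sm \<Omega> (pd i c)" using Suc.prems(1) by (auto simp: Sm_def intro: smooth_at_pd)
        have sf: "smf (fd (cf i) \<Theta>)" by (rule smf_fd[OF Suc.prems(2)]) (simp add: Sm_def)
        show "smf (\<lambda>(F, u). pd i c u * \<Theta> (F, u))" by (rule smf_scale[OF Suc.prems(2) pc])
        show "smf (\<lambda>(F, u). c u * fd (cf i) \<Theta> (F, u))" by (rule smf_scale[OF sf Suc.prems(1)])
        show "pdF js (\<lambda>(F, u). pd i c u * \<Theta> (F, u)) \<in> Rg G"
          by (rule Suc.IH[OF pc Suc.prems(2) _ js]) (simp add: Suc.prems(3))
        show "pdF js (\<lambda>(F, u). c u * fd (cf i) \<Theta> (F, u)) \<in> Rg G"
          by (rule Suc.IH[OF Suc.prems(1) sf _ js]) (simp add: Suc.prems(3) pdF_simps(3)[symmetric])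
      qed
      moreover have "eventually (\<lambda>x. (\<lambda>(F, u). pd i c u * \<Theta> (F, u)) x + (\<lambda>(F, u). c u * fd (cf i) \<Theta> (F, u)) x
         = fd (cf i) (\<lambda>(F, u). c u * \<Theta> (F, u)) x) FF"
        using Suc.prems(2)[unfolded smf_def] ev_adm
        by eventually_elim (auto simp: fd_def pd_mult SmD[OF Suc.prems(1) admD(1)])
      note pdF_cong[OF this, of js]
      ultimately show ?thesis unfolding snoc pdF_simps(3) by (rule Rg_cong)
    qed
  }
qed

lemma pdF_fd:
  assumes "Cu \<subseteq> Rg G" "Sm \<Omega> b" "smf \<Theta>" "\<And>is. length is \<le> Suc n \<Longrightarrow> pdF is \<Theta> \<in> Rg G" "length is \<le> n"
  shows "pdF is (fd b \<Theta>) \<in> Rg G"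
proof -
  have "fd b \<Theta> = (\<lambda>x. \<Sum>i\<in>UNIV. (\<lambda>(F, u). b u $ i * fd (cf i) \<Theta> (F, u)) x)"
    by (auto simp: fd_def vf_def[of b])
  moreover have "pdF is (\<lambda>x. \<Sum>i\<in>UNIV. (\<lambda>(F, u). b u $ i * fd (cf i) \<Theta> (F, u)) x) \<in> Rg G"
  proof (intro pdF_sum conjI)
    fix i
    have bi: "Sm \<Omega> (\<lambda>u. b u $ i)" using assms(2) by (auto simp: Sm_def intro: smooth_at_vec_nth)
    have sf: "smf (fd (cf i) \<Theta>)" by (rule smf_fd[OF assms(3)]) (simp add: Sm_def)
    show "smf (\<lambda>(F, u). b u $ i * fd (cf i) \<Theta> (F, u))" by (rule smf_scale[OF sf bi])
    show "pdF is (\<lambda>(F, u). b u $ i * fd (cf i) \<Theta> (F, u)) \<in> Rg G"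
      by (rule pdF_scale[OF assms(1) bi sf _ assms(5)]) (simp add: assms(4) pdF_simps(3)[symmetric])
  qed
  ultimately show ?thesis by simp
qed

lemma fd_commute:
  assumes "smf \<Theta>" "Sm \<Omega> b" "Sm \<Omega> c"
  shows "eventually (\<lambda>x. fd c (fd b \<Theta>) x + fd (brk b c) \<Theta> x = fd b (fd c \<Theta>) x) FF"
  using assms(1)[unfolded smf_def] ev_adm
  by eventually_elim (auto simp: fd_def vf_commute[OF SmD[OF assms(2) admD(1)] SmD[OF assms(3) admD(1)]])

lemma Sm_brk: "Sm \<Omega> b \<Longrightarrow> Sm \<Omega> c \<Longrightarrow> Sm \<Omega> (brk b c)"
  by (simp add: Sm_def smooth_at_brk)

lemma Sm_cf: "Sm \<Omega> (cf i)"
  by (simp add: Sm_def)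

text \<open>Commuting \<open>b\<close> with derivatives of order at most \<open>n\<close> only costs derivatives of order at most \<open>n\<close>.\<close>

lemma fd_pdF:
  assumes "Cu \<subseteq> Rg G" "Sm \<Omega> b" "smf \<Theta>" "\<And>is. length is \<le> n \<Longrightarrow> pdF is \<Theta> \<in> Rg G"
    "\<And>is. length is \<le> n \<Longrightarrow> pdF is (fd b \<Theta>) \<in> Rg G" "length is \<le> n"
  shows "fd b (pdF is \<Theta>) \<in> Rg G"
  using assms(3-)
proof (induction n arbitrary: \<Theta> "is")
  case 0 then show ?case using 0(3)[of "[]"] by (simp add: pdF_simps)
next
  case (Suc n)
  show ?case
  proof (cases "is" rule: rev_cases)
    case Nil then show ?thesis using Suc.prems(3)[of "[]"] by (simp add: pdF_simps)
  next
    case (snoc js i)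
    let ?\<Psi> = "fd (cf i) \<Theta>"
    have "fd b (pdF js ?\<Psi>) \<in> Rg G"
    proof (rule Suc.IH)
      show "smf ?\<Psi>" by (rule smf_fd[OF Suc.prems(1) Sm_cf])
      show "length js \<le> n" using snoc Suc.prems by simp
      fix is' :: "'d list" assume l: "length is' \<le> n"
      show "pdF is' ?\<Psi> \<in> Rg G" using l by (simp add: Suc.prems(2) pdF_simps(3)[symmetric])
      have "pdF is' (\<lambda>x. fd (cf i) (fd b \<Theta>) x + fd (brk b (cf i)) \<Theta> x) \<in> Rg G"
      proof (rule pdF_add)
        show "smf (fd (cf i) (fd b \<Theta>))" by (intro smf_fd Suc.prems Sm_cf assms(2))
        show "smf (fd (brk b (cf i)) \<Theta>)" by (intro smf_fd Suc.prems Sm_cf Sm_brk assms(2))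
        show "pdF is' (fd (cf i) (fd b \<Theta>)) \<in> Rg G"
          using l by (simp add: Suc.prems(3) pdF_simps(3)[symmetric])
        show "pdF is' (fd (brk b (cf i)) \<Theta>) \<in> Rg G"
          by (rule pdF_fd[OF assms(1) Sm_brk[OF assms(2) Sm_cf] Suc.prems(1,2) l])
      qed
      then show "pdF is' (fd b ?\<Psi>) \<in> Rg G"
        by (rule Rg_cong[OF _ pdF_cong[OF fd_commute[OF Suc.prems(1) assms(2) Sm_cf]]])
    qed
    then show ?thesis by (simp add: snoc pdF_simps)
  qed
qed

section \<open>The linear system for the (1,0) derivatives of the map\<close>

abbreviation "BB m \<equiv> Rg (Cf \<union> FB m)"
text \<open>\<open>PB m\<close> is closed under (1,0) fields because these kill the conjugate map
  and keep source coefficients among themselves (\<open>fd10_PB\<close>). For \<open>BB m\<close>,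
  whose coefficients involve the value of \<open>F\<close>, this needs the derivatives of
  \<open>F\<close> itself and is reached for \<open>m = k0\<close> in
  \<open>fd10_BB\<close>.\<close>

abbreviation "PB m \<equiv> Rg (Cu \<union> FB m)"

lemma pB_pdF: "pB is j = pdF is (pB [] j)" "pF is j = pdF is (pF [] j)"
  by (auto simp: pB_def pF_def pdF_def)

lemma PB_BB: "\<Theta> \<in> PB m \<Longrightarrow> \<Theta> \<in> BB m"
  by (erule Rg_sub) (use Cu_sub in \<open>auto intro: Rg_gen\<close>)

lemma BB_E: "\<Theta> \<in> BB m \<Longrightarrow> \<Theta> \<in> E m"
  by (erule Rg_sub) (auto intro: Rg_gen)

lemma PB_mono: "\<Theta> \<in> PB m \<Longrightarrow> m \<le> n \<Longrightarrow> \<Theta> \<in> PB n"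
  by (erule Rg_sub) (auto simp: FB_def intro!: Rg_gen)

lemma pB_PB: "length is \<le> m \<Longrightarrow> pB is j \<in> PB m"
  by (auto simp: FB_def intro!: Rg_gen)

lemma Cu_PB: "Cu \<subseteq> PB m" by (auto intro: Rg_gen)

lemma fd_Cu:
  assumes "\<Theta> \<in> Cu" "Sm \<Omega> b" "Cu \<subseteq> Rg G" shows "fd b \<Theta> \<in> Rg G"
proof -
  obtain c where c: "\<Theta> = (\<lambda>(F, u). c u)" "smooth_at u0 c" using assms(1) by (auto simp: Cu_def)
  have "fd b \<Theta> = (\<lambda>(F, u). vf b c u)" by (auto simp: fd_def c)
  moreover have "smooth_at u0 (vf b c)" by (rule smooth_at_vf[OF SmD[OF assms(2) u0] c(2)])
  ultimately show ?thesis using Cu_Rg[OF assms(3)] by simp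
qed

lemma gens_PB: "m \<le> k \<Longrightarrow> Cu \<union> FB m \<subseteq> JJ"
  using gens_JJ Cu_sub by blast

lemma smf_pB: "smf (pB [] j)" "smf (pF [] j)"
  by (rule smf_JJ, use gens_JJ[of 0] in \<open>auto simp: FB_def FA_def\<close>)+

text \<open>A (1,0) field annihilates the conjugate components, and commuting it to them through
  \<open>is\<close> costs no order by \<open>fd_pdF\<close>.\<close>

lemma fd10_pB:
  assumes "type01 K" "length is \<le> m" shows "fd (cnjf K) (pB is j) \<in> PB m"
  unfolding pB_pdF(1)[of "is"]
proof (rule fd_pdF[OF Cu_PB _ smf_pB(1) _ _ assms(2)])
  show "Sm \<Omega> (cnjf K)" using assms(1) by (auto simp: type01_def Sm_def intro: smooth_at_cnjf)
  show "pdF is (pB [] j) \<in> PB m" if "length is \<le> m" for "is" using pB_PB[OF that] by (simp add: pB_pdF(1)[of "is"])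
  show "pdF is (fd (cnjf K) (pB [] j)) \<in> PB m" for "is"
  proof (rule Rg_cong[OF Rg_const[of 0]])
    have "eventually (\<lambda>x. 0 = fd (cnjf K) (pB [] j) x) FF"
      using ev_adm by eventually_elim (auto simp: fd_def pB_def type01_B[OF assms(1)])
    from pdF_cong[OF this, of "is"] show "eventually (\<lambda>x. 0 = pdF is (fd (cnjf K) (pB [] j)) x) FF" by (simp add: pdF_zero)
  qed
qed

lemma fd10_PB:
  assumes "type01 K" "m \<le> k" "\<Theta> \<in> PB m" shows "fd (cnjf K) \<Theta> \<in> PB m"
proof (rule fd_Rg[OF gens_PB[OF assms(2)] _ _ assms(3)])
  have sm: "Sm \<Omega> (cnjf K)" using assms(1) by (auto simp: type01_def Sm_def intro: smooth_at_cnjf)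
  show "Cu \<union> FB m \<subseteq> PB m" by (auto intro: Rg_gen)
  fix \<Theta> assume "\<Theta> \<in> Cu \<union> FB m"
  then show "fd (cnjf K) \<Theta> \<in> PB m"
    using fd_Cu[OF _ sm Cu_PB] fd10_pB[OF assms(1)] by (auto simp: FB_def)
qed

lemma fd_PB:
  assumes "Sm \<Omega> b" "m \<le> k" "\<Theta> \<in> PB m" shows "fd b \<Theta> \<in> PB (Suc m)"
proof (rule fd_Rg[OF gens_PB[OF assms(2)] _ _ assms(3)])
  show "Cu \<union> FB m \<subseteq> PB (Suc m)" by (auto simp: FB_def intro!: Rg_gen)
  fix \<Theta> assume "\<Theta> \<in> Cu \<union> FB m"
  then consider "\<Theta> \<in> Cu" | "is" j where "length is \<le> m" "\<Theta> = pB is j" by (auto simp: FB_def)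
  then show "fd b \<Theta> \<in> PB (Suc m)"
  proof cases
    case 1 then show ?thesis by (rule fd_Cu[OF _ assms(1) Cu_PB])
  next
    case 2
    show ?thesis
      by (subst fd_eq) (intro Rg_sum Rg_mult Cu_Rg[OF Cu_PB] smooth_at_vec_nth SmD[OF assms(1) u0],
        simp add: 2 fd_pd pB_PB)
  qed
qed

definition comp :: "(complex ^ 'n \<Rightarrow> complex) \<Rightarrow> (real ^ 'd \<Rightarrow> complex ^ 'n) \<times> (real ^ 'd) \<Rightarrow> complex" where
  "comp h = (\<lambda>(F, u). h (F u))"

lemma comp_Cf: "smooth_at (F0 u0) h \<Longrightarrow> comp h \<in> Cf"
proof -
  assume "smooth_at (F0 u0) h"
  then have "smooth_at (F0 u0, u0) (\<lambda>p. h (fst p))"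
    using smooth_at_compose[OF smooth_fst_snd(1), of "(F0 u0, u0)" h] by simp
  moreover have "comp h = coef (\<lambda>p. h (fst p))" by (auto simp: comp_def coef_def)
  ultimately show ?thesis by (simp add: coefI)
qed

lemma ev_comp_smooth: "smooth_at (F0 u0) h \<Longrightarrow> eventually (\<lambda>(F, u). smooth_at (F u) h) FF"
proof -
  assume h: "smooth_at (F0 u0) h"
  have J: "((\<lambda>x. fst (snd (J x))) \<longlongrightarrow> F0 u0) FF"
    using tendsto_fst[OF tendsto_snd[OF filterlim_J]] by (simp add: J_def)
  have "\<forall>\<^sub>F x in FF. smooth_at (fst (snd (J x))) h"
    using filterlim_iff[THEN iffD1, OF J] smooth_at_ev[OF h] by blast
  then show ?thesis by (auto simp: J_def case_prod_unfold elim: eventually_mono)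
qed

lemma fd_comp:
  assumes "smooth_at (F0 u0) h"
  shows "eventually (\<lambda>x. fd b (comp h) x = (\<Sum>j\<in>UNIV. comp (dz j h) x * fd b (pF [] j) x) +
    (\<Sum>j\<in>UNIV. comp (dzbar j h) x * fd b (pB [] j) x)) FF"
  using ev_comp_smooth[OF assms] ev_adm
  by eventually_elim (auto simp: fd_def comp_def pF_def pB_def vf_chain_amb[OF admD(2)])

text \<open>\<open>Opr m\<close> contains the operators \<open>h \<mapsto> \<Sum>\<^sub>\<gamma> (\<partial>\<^sub>z\<^sub>b\<^sub>a\<^sub>r\<^sup>\<gamma> h)(F) \<cdot> p\<^sub>\<gamma>\<close> whose coefficients \<open>p\<^sub>\<gamma>\<close>
  do not involve \<open>F\<close>, only derivatives of its conjugate.\<close>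

inductive_set Opr :: "nat \<Rightarrow> ((complex ^ 'n \<Rightarrow> complex) \<Rightarrow> (real ^ 'd \<Rightarrow> complex ^ 'n) \<times> (real ^ 'd) \<Rightarrow> complex) set" for m where
  Opr_base: "p \<in> PB m \<Longrightarrow> (\<lambda>h x. comp (dbars \<gamma> h) x * p x) \<in> Opr m"
| Opr_add: "A \<in> Opr m \<Longrightarrow> B \<in> Opr m \<Longrightarrow> (\<lambda>h x. A h x + B h x) \<in> Opr m"

lemma Opr_zero: "(\<lambda>h x. 0) \<in> Opr m"
  using Opr_base[OF Rg_const[of 0], of "[]"] by simp

lemma Opr_sum: "(\<And>i. i \<in> I \<Longrightarrow> A i \<in> Opr m) \<Longrightarrow> (\<lambda>h x. \<Sum>i\<in>I. A i h x) \<in> Opr m"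
  by (induction I rule: infinite_finite_induct) (auto intro: Opr_zero Opr_add)

lemma Opr_BB:
  assumes h: "smooth_at (F0 u0) h"
  shows "A \<in> Opr m \<Longrightarrow> A h \<in> BB m"
proof (induction rule: Opr.induct)
  case (Opr_base p \<gamma>)
  have "comp (dbars \<gamma> h) \<in> BB m" by (intro Rg_gen UnI1 comp_Cf smooth_dbars h)
  then show ?case by (rule Rg_mult) (rule PB_BB[OF Opr_base])
next
  case (Opr_add A B) show ?case by (rule Rg_add[OF Opr_add.IH])
qed

lemma smf_BB: "m \<le> k \<Longrightarrow> \<Theta> \<in> BB m \<Longrightarrow> smf \<Theta>"
  by (rule smf_JJ[OF E_JJ[OF BB_E]])

lemma smf_PB: "m \<le> k \<Longrightarrow> \<Theta> \<in> PB m \<Longrightarrow> smf \<Theta>"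
  by (rule smf_BB[OF _ PB_BB])

lemma fd_add_ev:
  assumes "smf \<Theta>" "smf \<Psi>"
  shows "eventually (\<lambda>x. fd b (\<lambda>x. \<Theta> x + \<Psi> x) x = fd b \<Theta> x + fd b \<Psi> x) FF"
  using assms unfolding smf_def by eventually_elim (auto simp: fd_def vf_add)

lemma fd_mult_ev:
  assumes "smf \<Theta>" "smf \<Psi>"
  shows "eventually (\<lambda>x. fd b (\<lambda>x. \<Theta> x * \<Psi> x) x = fd b \<Theta> x * \<Psi> x + \<Theta> x * fd b \<Psi> x) FF"
  using assms unfolding smf_def by eventually_elim (auto simp: fd_def vf_mult)

lemma smf_comp: "smooth_at (F0 u0) h \<Longrightarrow> smf (comp h)"
  by (rule smf_JJ[OF Rg_gen[OF UnI1[OF comp_Cf]]])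

text \<open>A (0,1) field kills \<open>F\<close>, so on \<open>h \<circ> F\<close> only
  antiholomorphic derivatives of \<open>h\<close> appear, multiplied by first derivatives of the
  conjugate map; no derivative of \<open>F\<close> enters the coefficients.\<close>

lemma Opr_fd01:
  assumes K: "type01 K" and m: "m \<le> k" and "A \<in> Opr m"
  shows "\<exists>B\<in>Opr (Suc m). \<forall>h. smooth_at (F0 u0) h \<longrightarrow> eventually (\<lambda>x. fd K (A h) x = B h x) FF"
  using assms(3)
proof (induction rule: Opr.induct)
  case (Opr_base p \<gamma>)
  have sK: "Sm \<Omega> K" using K by (simp add: type01_def)
  let ?B = "\<lambda>h x. (\<Sum>j\<in>UNIV. comp (dbars (j # \<gamma>) h) x * (fd K (pB [] j) x * p x)) + comp (dbars \<gamma> h) x * fd K p x"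
  have "?B \<in> Opr (Suc m)"
  proof (intro Opr_add Opr_sum Opr.Opr_base Rg_mult)
    show "fd K (pB [] j) \<in> PB (Suc m)" for j
      using PB_mono[OF fd_PB[OF sK _ pB_PB[of "[]" 0 j]], of "Suc m"] by simp
    show "p \<in> PB (Suc m)" using PB_mono[OF Opr_base] by simp
    show "fd K p \<in> PB (Suc m)" by (rule fd_PB[OF sK m Opr_base])
  qed
  moreover have "eventually (\<lambda>x. fd K (\<lambda>x. comp (dbars \<gamma> h) x * p x) x = ?B h x) FF" if h: "smooth_at (F0 u0) h" for h
    using fd_mult_ev[OF smf_comp[OF smooth_dbars[OF h, of \<gamma>]] smf_PB[OF m Opr_base], of K] fd_comp[OF smooth_dbars[OF h, of \<gamma>], of K] ev_adm
  proof eventually_elim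
    case (elim x)
    have "fd K (pF [] j) x = 0" for j using elim(3) by (auto simp: fd_def pF_def type01_F[OF K])
    with elim(1,2) show ?case by (simp add: distrib_right sum_distrib_left sum_distrib_right mult.assoc mult.commute mult.left_commute)
  qed
  ultimately show ?case by (intro bexI[of _ ?B]) auto
next
  case (Opr_add A B)
  then obtain A' B' where *: "A' \<in> Opr (Suc m)" "B' \<in> Opr (Suc m)"
    and A': "\<And>h. smooth_at (F0 u0) h \<Longrightarrow> eventually (\<lambda>x. fd K (A h) x = A' h x) FF"
    and B': "\<And>h. smooth_at (F0 u0) h \<Longrightarrow> eventually (\<lambda>x. fd K (B h) x = B' h x) FF" by blast
  have "eventually (\<lambda>x. fd K (\<lambda>x. A h x + B h x) x = A' h x + B' h x) FF" if h: "smooth_at (F0 u0) h" for h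
    using fd_add_ev[OF smf_BB[OF m Opr_BB[OF h Opr_add.hyps(1)]] smf_BB[OF m Opr_BB[OF h Opr_add.hyps(2)]], of K] A'[OF h] B'[OF h]
    by eventually_elim simp
  then show ?case using Opr.Opr_add[OF *] by (intro bexI[of _ "\<lambda>h x. A' h x + B' h x"]) auto
qed

text \<open>A (1,0) field kills the conjugate map, so only holomorphic derivatives of
  \<open>h\<close> are brought out of \<open>h \<circ> F\<close>. As \<open>dz\<close> commutes with
  \<open>dbars\<close>, they are fed into the same operator \<open>A\<close>: these are the
  coefficients of the future linear system. What remains comes from differentiating the coefficients
  of \<open>A\<close>.\<close>

lemma Opr_fd10:
  assumes K: "type01 K" and m: "m \<le> k" and h: "smooth_at (F0 u0) h"
  shows "A \<in> Opr m \<Longrightarrow> (\<lambda>x. fd (cnjf K) (A h) x - (\<Sum>j\<in>UNIV. A (dz j h) x * fd (cnjf K) (pF [] j) x)) \<in> BB m"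
proof (induction rule: Opr.induct)
  case (Opr_base p \<gamma>)
  let ?L = "cnjf K"
  have "(\<lambda>x. comp (dbars \<gamma> h) x * fd ?L p x) \<in> BB m"
    by (intro Rg_mult PB_BB[OF fd10_PB[OF K m Opr_base]] Rg_gen UnI1 comp_Cf smooth_dbars h)
  then show ?case
  proof (rule Rg_cong)
    show "\<forall>\<^sub>F x in FF. comp (dbars \<gamma> h) x * fd ?L p x =
       fd ?L (\<lambda>x. comp (dbars \<gamma> h) x * p x) x - (\<Sum>j\<in>UNIV. comp (dbars \<gamma> (dz j h)) x * p x * fd ?L (pF [] j) x)"
      using fd_mult_ev[OF smf_comp[OF smooth_dbars[OF h, of \<gamma>]] smf_PB[OF m Opr_base], of ?L] fd_comp[OF smooth_dbars[OF h, of \<gamma>], of ?L] ev_adm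
        ev_comp_smooth[OF h]
    proof eventually_elim
      case (elim x)
      have 1: "fd ?L (pB [] j) x = 0" for j using elim(3) by (auto simp: fd_def pB_def type01_B[OF K])
      have 2: "comp (dz j (dbars \<gamma> h)) x = comp (dbars \<gamma> (dz j h)) x" for j
        using elim(4) by (auto simp: comp_def dz_dbars_commute)
      show ?case unfolding elim(1,2) by (simp add: 1 2 sum_distrib_right sum_distrib_left mult.assoc mult.commute mult.left_commute)
    qed
  qed
next
  case (Opr_add A B)
  show ?case
  proof (rule Rg_cong[OF Rg_add[OF Opr_add.IH]])
    show "\<forall>\<^sub>F x in FF. fd (cnjf K) (A h) x - (\<Sum>j\<in>UNIV. A (dz j h) x * fd (cnjf K) (pF [] j) x) +
         (fd (cnjf K) (B h) x - (\<Sum>j\<in>UNIV. B (dz j h) x * fd (cnjf K) (pF [] j) x)) =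
         fd (cnjf K) (\<lambda>x. A h x + B h x) x - (\<Sum>j\<in>UNIV. (A (dz j h) x + B (dz j h) x) * fd (cnjf K) (pF [] j) x)"
      using fd_add_ev[OF smf_BB[OF m Opr_BB[OF h Opr_add.hyps(1)]] smf_BB[OF m Opr_BB[OF h Opr_add.hyps(2)]], of "cnjf K"]
      by eventually_elim (simp add: distrib_right sum.distrib)
  qed
qed

text \<open>The operator is found before \<open>h\<close>, because \<open>fd10_F\<close> needs the
  same one for the defining function and for its holomorphic derivatives.\<close>

lemma words_Opr:
  assumes "\<forall>K\<in>set Ks. type01 K" "length Ks \<le> Suc k"
  shows "\<exists>A\<in>Opr (length Ks). \<forall>h. smooth_at (F0 u0) h \<longrightarrow> eventually (\<lambda>x. foldr fd Ks (comp h) x = A h x) FF"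
  using assms
proof (induction Ks)
  case Nil
  show ?case using Opr_base[OF Rg_const[of 1], of "[]"]
    by (intro bexI[of _ "\<lambda>h x. comp (dbars [] h) x * 1"]) auto
next
  case (Cons K Ks)
  then obtain A where A: "A \<in> Opr (length Ks)" "\<And>h. smooth_at (F0 u0) h \<Longrightarrow> eventually (\<lambda>x. foldr fd Ks (comp h) x = A h x) FF"
    by auto
  obtain B where B: "B \<in> Opr (Suc (length Ks))" "\<And>h. smooth_at (F0 u0) h \<Longrightarrow> eventually (\<lambda>x. fd K (A h) x = B h x) FF"
    using Opr_fd01[of K "length Ks" A] A(1) Cons.prems by auto
  have "eventually (\<lambda>x. foldr fd (K # Ks) (comp h) x = B h x) FF" if "smooth_at (F0 u0) h" for h
    using fd_cong[OF A(2)[OF that], of K] B(2)[OF that] by eventually_elim simp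
  then show ?case using B(1) by (intro bexI[of _ B]) auto
qed

end

section \<open>Solving for all derivatives of a CR map\<close>

lemma smooth_foldr_vf: "(\<forall>K\<in>set Ks. Sm \<Omega> K) \<Longrightarrow> u \<in> \<Omega> \<Longrightarrow> smooth_at u g \<Longrightarrow> smooth_at u (foldr vf Ks g)"
  by (induction Ks) (auto intro: smooth_at_vf SmD)

lemma smooth_vf_pow: "Sm \<Omega> K \<Longrightarrow> u \<in> \<Omega> \<Longrightarrow> smooth_at u g \<Longrightarrow> smooth_at u ((vf K ^^ n) g)"
  by (induction n) (auto intro: smooth_at_vf SmD)

lemma foldr_vf_cnj:
  assumes "open \<Omega>" "\<forall>K\<in>set Ks. Sm \<Omega> K"
  shows "u \<in> \<Omega> \<Longrightarrow> smooth_at u g \<Longrightarrow> foldr vf Ks (\<lambda>v. cnj (g v)) u = cnj (foldr vf (map cnjf Ks) g u)"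
  using assms(2)
proof (induction Ks arbitrary: u)
  case (Cons K Ks)
  have "\<forall>\<^sub>F v in nhds u. foldr vf Ks (\<lambda>v. cnj (g v)) v = cnj (foldr vf (map cnjf Ks) g v)"
    using eventually_in[OF assms(1) Cons.prems(1)] smooth_at_ev[OF Cons.prems(2)]
    by eventually_elim (use Cons in auto)
  moreover have "smooth_at u (foldr vf (map cnjf Ks) g)"
    using Cons.prems by (intro smooth_foldr_vf[of _ \<Omega>]) (auto simp: Sm_def smooth_at_cnjf)
  ultimately show ?case by (simp add: vf_cong_ev vf_cnj)
qed simp

lemma pds_cnj: "smooth_at u g \<Longrightarrow> pds is (\<lambda>v. cnj (g v)) u = cnj (pds is g u)"
proof (induction "is" arbitrary: u)
  case (Cons i xs)
  have "\<forall>\<^sub>F v in nhds u. pds xs (\<lambda>v. cnj (g v)) v = cnj (pds xs g v)"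
    using smooth_at_ev[OF Cons.prems] by eventually_elim (rule Cons.IH)
  then show ?case by (simp add: pd_cong_ev pd_cnj smooth_at_pds Cons.prems)
qed simp

lemma local_ring_germs:
  "local_ring (nhds (u0 :: 'a::euclidean_space)) u0 {c :: 'a \<Rightarrow> complex. smooth_at u0 c}"
proof
  fix P show "\<forall>\<^sub>F x in nhds u0. P x \<Longrightarrow> P u0" by (rule eventually_nhds_x_imp_x)
next
  fix f :: "'a \<Rightarrow> complex" assume "f \<in> {c. smooth_at u0 c}" "f u0 \<noteq> 0"
  then show "\<forall>\<^sub>F x in nhds u0. f x \<noteq> 0"
    using tendsto_imp_eventually_ne[OF smooth_at_tendsto] by blast
qed (auto intro: smooth_at_add smooth_at_mult smooth_at_inverse)

text \<open>\<open>indep\<close> is the \<open>k0\<close>-nondegeneracy of the target at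
  \<open>F0 u0\<close>, read on the source; \<open>nonflat\<close> says that \<open>q i1\<close> is
  not constant to infinite order along the fixed CR frame \<open>b\<close>. The (1,0) fields
  \<open>cnjf (Kf i)\<close> together with \<open>Z \<nu>\<close> recover all
  \<open>Z i\<close>.\<close>

locale cr_jets = jet_setting \<Omega> z Z u0 T X \<psi> F0 k e
  for \<Omega> :: "(real ^ 'd::finite) set" and z :: "'n::finite \<Rightarrow> real ^ 'd \<Rightarrow> complex" and Z :: "'n \<Rightarrow> 'd field"
    and u0 :: "real ^ 'd" and T :: "(complex ^ 'n) set" and X :: "complex ^ 'n \<Rightarrow> real ^ 'd"
    and \<psi> :: "real ^ 'd \<Rightarrow> complex ^ 'n" and F0 :: "real ^ 'd \<Rightarrow> complex ^ 'n" and k :: nat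
    and e :: "'j::finite \<Rightarrow> 'd \<times> ('d \<Rightarrow> nat)" +
  fixes k0 :: nat and \<rho>' :: "complex ^ 'n \<Rightarrow> complex" and Kf :: "'n \<Rightarrow> 'd field"
    and q :: "'n \<Rightarrow> real ^ 'd \<Rightarrow> complex" and \<nu> i1 :: 'n and b :: "nat \<Rightarrow> 'd field" and m :: nat
  assumes k3: "3 * k0 \<le> k"
    and smooth_\<rho>': "smooth_at (F0 u0) \<rho>'" and \<rho>'_T: "\<zeta> \<in> T \<Longrightarrow> \<rho>' \<zeta> = 0"
    and indep: "\<And>c j. (\<And>Ks. (\<forall>K\<in>set Ks. type01 K) \<Longrightarrow> length Ks \<le> k0 \<Longrightarrow>
       (\<Sum>j\<in>UNIV. c j * foldr vf Ks (\<lambda>v. dz j \<rho>' (F0 v)) u0) = 0) \<Longrightarrow> c j = 0"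
    and Kf01: "type01 (Kf i)" and Sm_qi: "Sm \<Omega> (q i)"
    and Kf_eq: "u \<in> \<Omega> \<Longrightarrow> cnjf (Kf i) u = Z i u - q i u *s Z \<nu> u"
    and b01: "l < m \<Longrightarrow> type01 (b l)"
    and nonflat: "\<exists>\<alpha>. ops b [0..<m] \<alpha> (\<lambda>u. q i1 u - r) u0 \<noteq> 0"
begin

lemma Sm_01: "type01 K \<Longrightarrow> Sm \<Omega> K" "type01 K \<Longrightarrow> Sm \<Omega> (cnjf K)"
  by (auto simp: type01_def Sm_def intro: smooth_at_cnjf)

sublocale cr_structure_pair \<Omega> z Z "cnjf (Kf i1)" "q i1" i1 \<nu>
  by unfold_locales (auto intro: Sm_qi Sm_01 Kf01 simp: Kf_eq)

lemma foldr_fd: "foldr fd Ks \<Theta> = (\<lambda>(F, u). foldr vf Ks (\<lambda>v. \<Theta> (F, v)) u)"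
  by (induction Ks) (auto simp: fd_def fun_eq_iff)

lemma foldr_fd_cong: "eventually (\<lambda>x. \<Theta> x = \<Psi> x) FF \<Longrightarrow> eventually (\<lambda>x. foldr fd Ks \<Theta> x = foldr fd Ks \<Psi> x) FF"
  by (induction Ks) (auto intro: fd_cong)

lemma foldr_fd_zero: "foldr fd Ks (\<lambda>x. 0) = (\<lambda>x. 0)"
  by (induction Ks) (auto simp: fd_def)

lemma BB_mono: "\<Theta> \<in> BB n \<Longrightarrow> n \<le> n' \<Longrightarrow> \<Theta> \<in> BB n'"
  by (erule Rg_sub) (auto simp: FB_def intro!: Rg_gen)

lemma local_ring_BB: "n \<le> k \<Longrightarrow> local_ring FF (F0, u0) (BB n)"
  by unfold_locales (auto intro: ev_base_FF Rg_const Rg_add Rg_mult Rg_inverse JJ_nonzero E_JJ BB_E)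

lemma k0_k: "k0 \<le> k" "2 * k0 \<le> k" using k3 by auto

text \<open>Differentiating the words \<open>K\<^sub>1 \<dots> K\<^sub>r (\<rho>' \<circ> F) = 0\<close>, \<open>r \<le> k0\<close>, along a \<open>(1,0)\<close> field gives a linear
  system for the derivatives of the components of \<open>F\<close>.\<close>

lemma fd10_F:
  assumes K: "type01 K" shows "fd (cnjf K) (pF [] j) \<in> BB k0"
proof -
  let ?L = "cnjf K"
  let ?S = "{Ks. (\<forall>K\<in>set Ks. type01 K) \<and> length Ks \<le> k0}"
  have "\<forall>Ks\<in>?S. \<exists>A. A \<in> Opr (length Ks) \<and> (\<forall>h. smooth_at (F0 u0) h \<longrightarrow> eventually (\<lambda>x. foldr fd Ks (comp h) x = A h x) FF)"
    using words_Opr k0_k by fastforce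
  from bchoice[OF this] obtain A where A: "\<And>Ks. Ks \<in> ?S \<Longrightarrow> A Ks \<in> Opr (length Ks)"
    and Aeq: "\<And>Ks h. Ks \<in> ?S \<Longrightarrow> smooth_at (F0 u0) h \<Longrightarrow> eventually (\<lambda>x. foldr fd Ks (comp h) x = A Ks h x) FF" by blast
  define V where "V Ks j = A Ks (dz j \<rho>')" for Ks j
  have VB: "V Ks j \<in> BB k0" if "Ks \<in> ?S" for Ks j
    unfolding V_def by (rule BB_mono[OF Opr_BB[OF smooth_dz(1)[OF smooth_\<rho>'] A[OF that]]]) (use that in auto)
  \<comment> \<open>Each word gives one equation: it annihilates \<open>\<rho>' \<circ> F\<close>,
    and a further (1,0) derivative isolates the unknowns by \<open>Opr_fd10\<close>.\<close>
  have row: "(\<lambda>x. \<Sum>j\<in>UNIV. V Ks j x * fd ?L (pF [] j) x) \<in> BB k0" if Ks: "Ks \<in> ?S" for Ks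
  proof -
    have l: "length Ks \<le> k" "length Ks \<le> k0" using Ks k0_k by auto
    have "eventually (\<lambda>x. comp \<rho>' x = 0) FF"
      using ev_adm by eventually_elim (auto simp: comp_def \<rho>'_T admD)
    from foldr_fd_cong[OF this, of Ks] Aeq[OF Ks smooth_\<rho>']
    have "eventually (\<lambda>x. A Ks \<rho>' x = 0) FF" by eventually_elim (simp add: foldr_fd_zero)
    from fd_cong[OF this, of ?L] have "eventually (\<lambda>x. fd ?L (A Ks \<rho>') x = 0) FF"
      by (simp add: fd_def)
    then have "eventually (\<lambda>x. - (fd ?L (A Ks \<rho>') x - (\<Sum>j\<in>UNIV. A Ks (dz j \<rho>') x * fd ?L (pF [] j) x))
       = (\<Sum>j\<in>UNIV. V Ks j x * fd ?L (pF [] j) x)) FF"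
      by eventually_elim (simp add: V_def)
    moreover have "(\<lambda>x. - (fd ?L (A Ks \<rho>') x - (\<Sum>j\<in>UNIV. A Ks (dz j \<rho>') x * fd ?L (pF [] j) x))) \<in> BB k0"
      by (rule BB_mono[OF Rg_uminus[OF Opr_fd10[OF K l(1) smooth_\<rho>' A[OF Ks]]] l(2)])
    ultimately show ?thesis by (rule Rg_cong[rotated])
  qed
  have "\<exists>g\<in>rcomb (BB k0) ?S V. eventually (\<lambda>x. \<forall>i\<in>UNIV. g i x = (if i = j then 1 else 0)) FF"
  proof (rule local_ring.left_inverse[OF local_ring_BB[OF k0_k(1)]])
    fix c assume c: "\<And>Ks. Ks \<in> ?S \<Longrightarrow> (\<Sum>i\<in>UNIV. c i * V Ks i (F0, u0)) = 0"
    have "V Ks i (F0, u0) = foldr vf Ks (\<lambda>v. dz i \<rho>' (F0 v)) u0" if "Ks \<in> ?S" for Ks i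
      using ev_base_FF[OF Aeq[OF that smooth_dz(1)[OF smooth_\<rho>', of i]]] by (simp add: V_def foldr_fd comp_def)
    then have "(\<Sum>j\<in>UNIV. c j * foldr vf Ks (\<lambda>v. dz j \<rho>' (F0 v)) u0) = 0"
      if "\<forall>K\<in>set Ks. type01 K" "length Ks \<le> k0" for Ks using c[of Ks] that by simp
    then have "c i = 0" for i by (rule indep[of c i])
    then show "\<forall>i\<in>UNIV. c i = 0" by simp
  qed (auto intro: VB)
  then obtain g where g: "g \<in> rcomb (BB k0) ?S V" "eventually (\<lambda>x. \<forall>i\<in>UNIV. g i x = (if i = j then 1 else 0)) FF" by blast
  \<comment> \<open>The combination \<open>g\<close> of the rows is the unit row at
    \<open>j\<close>, so the same combination of the equations is the unknown.\<close>
  from g(1) have "(\<lambda>x. \<Sum>i\<in>UNIV. g i x * fd ?L (pF [] i) x) \<in> BB k0"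
  proof induction
    case (row Ks) then show ?case by (rule \<open>\<And>Ks. Ks \<in> ?S \<Longrightarrow> (\<lambda>x. \<Sum>j\<in>UNIV. V Ks j x * fd ?L (pF [] j) x) \<in> BB k0\<close>)
  next
    case (add g h) from Rg_add[OF add.IH] show ?case by (simp add: distrib_right sum.distrib)
  next
    case (scale r g) from Rg_mult[OF scale.hyps(1) scale.IH] show ?case by (simp add: sum_distrib_left mult.assoc)
  qed
  then show ?thesis
  proof (rule Rg_cong)
    show "\<forall>\<^sub>F x in FF. (\<Sum>i\<in>UNIV. g i x * fd ?L (pF [] i) x) = fd ?L (pF [] j) x"
      using g(2) by eventually_elim (simp add: if_distrib[of "\<lambda>c. c * _"] cong: if_cong)
  qed
qed

text \<open>On a smooth coefficient the chain rule brings in (1,0) derivatives of \<open>F\<close>,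
  already in the ring by \<open>fd10_F\<close>, and those of the conjugate map, which
  vanish.\<close>

lemma fd10_BB:
  assumes K: "type01 K" and \<Theta>: "\<Theta> \<in> BB k0" shows "fd (cnjf K) \<Theta> \<in> BB k0"
proof (rule fd_Rg[OF _ _ _ \<Theta>])
  show "Cf \<union> FB k0 \<subseteq> JJ" using gens_JJ[OF k0_k(1)] by blast
  show G: "Cf \<union> FB k0 \<subseteq> BB k0" by (auto intro: Rg_gen)
  fix \<Theta> assume "\<Theta> \<in> Cf \<union> FB k0"
  then consider h where "smooth_at (F0 u0, u0) h" "\<Theta> = coef h" | "is" j where "length is \<le> k0" "\<Theta> = pB is j"
    by (auto simp: Cf_def FB_def)
  then show "fd (cnjf K) \<Theta> \<in> BB k0"
  proof cases
    case 1
    show ?thesis unfolding 1(2)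
      by (rule fd_coef[OF 1(1) Sm_01(2)[OF K]]) (use G fd10_F[OF K] PB_BB[OF fd10_pB[OF K]] in auto)
  next
    case 2 then show ?thesis using PB_BB[OF fd10_pB[OF K 2(1)]] by simp
  qed
qed

lemma words10_F: "\<forall>K\<in>set Ks. type01 K \<Longrightarrow> foldr fd (map cnjf Ks) (pF [] j) \<in> BB k0"
proof (induction Ks)
  case Nil then show ?case using pF_Nil by (auto intro: Rg_gen)
next
  case (Cons K Ks) then show ?case using fd10_BB by simp
qed

text \<open>Conjugation turns (0,1) words on the conjugate map into (1,0) words on \<open>F\<close>.
  It also turns derivatives of the conjugate map into derivatives of \<open>F\<close>, so the result
  lies in \<open>E k0\<close> instead of \<open>BB k0\<close>.\<close>

lemma words01_B:
  assumes "\<forall>K\<in>set Ks. type01 K" shows "foldr fd Ks (pB [] j) \<in> E k0"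
proof -
  have "(\<lambda>x. cnj (foldr fd (map cnjf Ks) (pF [] j) x)) \<in> E k0"
  proof (rule Rg_cnj[OF _ words10_F[OF assms]])
    fix \<Theta> assume "\<Theta> \<in> Cf \<union> FB k0"
    then consider "\<Theta> \<in> Cf" | "is" j where "length is \<le> k0" "\<Theta> = pB is j" by (auto simp: FB_def)
    then show "(\<lambda>x. cnj (\<Theta> x)) \<in> E k0"
    proof cases
      case 1 then show ?thesis using cnj_Cf by (auto intro: Rg_gen)
    next
      case 2
      show ?thesis
        by (rule Rg_cong_adm[OF pF_E(1)[OF 2(1), of j]]) (simp add: 2 pB_def pF_def pds_cnj admD)
    qed
  qed
  then show ?thesis
  proof (rule Rg_cong_adm)
    fix F u assume "adm F u"
    then show "cnj (foldr fd (map cnjf Ks) (pF [] j) (F, u)) = foldr fd Ks (pB [] j) (F, u)"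
      using foldr_vf_cnj[OF open_\<Omega>, of Ks u "\<lambda>w. F w $ j"] assms
      by (simp add: foldr_fd pF_def pB_def admD Sm_01)
  qed
qed

text \<open>While \<open>BB k0\<close> is closed under \<open>(1,0)\<close> fields, \<open>CC\<close> contains it and is closed under \<open>(0,1)\<close> fields.\<close>

definition "CG = {pdF is (foldr fd Ks (pB [] j)) |is Ks j. length is \<le> k0 \<and> (\<forall>K\<in>set Ks. type01 K)}"

abbreviation "CC \<equiv> Rg (Cf \<union> CG)"

lemma pdF_E: "\<Theta> \<in> E n \<Longrightarrow> n + length is \<le> Suc k \<Longrightarrow> pdF is \<Theta> \<in> E (n + length is)"
proof (induction "is")
  case (Cons i xs)
  then show ?case using fd_E[OF Sm_cf, of "n + length xs" "pdF xs \<Theta>" i] by (simp add: pdF_simps)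
qed (simp add: pdF_simps)

text \<open>Here \<open>2 * k0\<close> arises: a word of any length has order \<open>k0\<close> by
  \<open>words01_B\<close>, and at most \<open>k0\<close> outer derivatives are added.\<close>

lemma CG_E: "Cf \<union> CG \<subseteq> E (2 * k0)"
proof
  fix \<Theta> assume "\<Theta> \<in> Cf \<union> CG"
  then consider "\<Theta> \<in> Cf" | "is" Ks j where "length is \<le> k0" "\<forall>K\<in>set Ks. type01 K" "\<Theta> = pdF is (foldr fd Ks (pB [] j))"
    by (auto simp: CG_def)
  then show "\<Theta> \<in> E (2 * k0)"
  proof cases
    case 1 then show ?thesis by (auto intro: Rg_gen)
  next
    case 2
    have "pdF is (foldr fd Ks (pB [] j)) \<in> E (k0 + length is)"
      using 2 k0_k by (intro pdF_E words01_B) auto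
    then show ?thesis using E_mono[of _ "k0 + length is" "2 * k0"] 2 by simp
  qed
qed

lemma CC_E: "\<Theta> \<in> CC \<Longrightarrow> \<Theta> \<in> E (2 * k0)"
  by (erule Rg_sub[OF _ CG_E])

lemma pdF_CC: "length is \<le> k0 \<Longrightarrow> \<forall>K\<in>set Ks. type01 K \<Longrightarrow> pdF is (foldr fd Ks (pB [] j)) \<in> CC"
  unfolding CG_def by (rule Rg_gen) blast

lemma BB_CC: "\<Theta> \<in> BB k0 \<Longrightarrow> \<Theta> \<in> CC"
proof (erule Rg_sub, rule subsetI)
  fix \<Theta> assume "\<Theta> \<in> Cf \<union> FB k0"
  then consider "\<Theta> \<in> Cf" | "is" j where "length is \<le> k0" "\<Theta> = pB is j" by (auto simp: FB_def)
  then show "\<Theta> \<in> CC"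
  proof cases
    case 1 then show ?thesis by (auto intro: Rg_gen)
  next
    case 2
    then show ?thesis using pdF_CC[OF 2(1), of "[]" j] by (simp add: pB_pdF(1)[of "is"])
  qed
qed

lemma Cu_CC: "Cu \<subseteq> CC" using Cu_sub by (auto intro: Rg_gen)

text \<open>On a generator \<open>K\<close> is commuted inwards through the outer derivatives and
  lengthens the word \<open>Ks\<close>; on a smooth coefficient it kills \<open>F\<close>, and its
  value on the conjugate map is a generator.\<close>

lemma fd01_CC:
  assumes K: "type01 K" and \<Theta>: "\<Theta> \<in> CC" shows "fd K \<Theta> \<in> CC"
proof (rule fd_Rg[OF _ _ _ \<Theta>])
  show "Cf \<union> CG \<subseteq> JJ" using CG_E E_JJ k0_k by blast
  show G: "Cf \<union> CG \<subseteq> CC" by (auto intro: Rg_gen)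
  fix \<Theta> assume "\<Theta> \<in> Cf \<union> CG"
  then consider h where "smooth_at (F0 u0, u0) h" "\<Theta> = coef h"
    | "is" Ks j where "length is \<le> k0" "\<forall>K\<in>set Ks. type01 K" "\<Theta> = pdF is (foldr fd Ks (pB [] j))"
    by (auto simp: Cf_def CG_def)
  then show "fd K \<Theta> \<in> CC"
  proof cases
    case 1
    have "fd K (pF [] j) \<in> CC" for j
      by (rule Rg_cong_adm[OF Rg_const[of 0]]) (simp add: fd_def pF_def type01_F[OF K])
    moreover have "fd K (pB [] j) \<in> CC" for j
      using pdF_CC[of "[]" "[K]" j] K by (simp add: pdF_simps)
    ultimately show ?thesis unfolding 1(2)
      using G by (intro fd_coef[OF 1(1) Sm_01(1)[OF K]]) auto
  next
    case 2
    show ?thesis unfolding 2(3)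
    proof (rule fd_pdF[OF Cu_CC Sm_01(1)[OF K] _ _ _ 2(1)])
      show "smf (foldr fd Ks (pB [] j))" by (rule smf_JJ[OF E_JJ[OF words01_B[OF 2(2)] k0_k(1)]])
      show "pdF is (foldr fd Ks (pB [] j)) \<in> CC" if "length is \<le> k0" for "is" by (rule pdF_CC[OF that 2(2)])
      show "pdF is (fd K (foldr fd Ks (pB [] j))) \<in> CC" if "length is \<le> k0" for "is"
        using pdF_CC[OF that, of "K # Ks"] 2(2) K by simp
    qed
  qed
qed

section \<open>Transversal derivatives\<close>

definition fops :: "nat list \<Rightarrow> (nat \<Rightarrow> nat) \<Rightarrow> ((real ^ 'd \<Rightarrow> complex ^ 'n) \<times> (real ^ 'd) \<Rightarrow> complex) \<Rightarrow> (real ^ 'd \<Rightarrow> complex ^ 'n) \<times> (real ^ 'd) \<Rightarrow> complex" where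
  "fops is \<alpha> \<Theta> = (\<lambda>(F, u). ops b is \<alpha> (\<lambda>v. \<Theta> (F, v)) u)"

lemma fd_pow: "(fd K ^^ n) \<Theta> = (\<lambda>(F, u). (vf K ^^ n) (\<lambda>v. \<Theta> (F, v)) u)"
  by (induction n) (auto simp: fd_def)

lemma fops_CC: "\<Theta> \<in> CC \<Longrightarrow> \<forall>i\<in>set is. i < m \<Longrightarrow> fops is \<alpha> \<Theta> \<in> CC"
proof (induction "is")
  case Nil then show ?case by (simp add: fops_def ops_def)
next
  case (Cons i xs)
  have "fops (i # xs) \<alpha> \<Theta> = (fd (b i) ^^ \<alpha> i) (fops xs \<alpha> \<Theta>)"
    by (auto simp: fops_def ops_def fd_pow)
  moreover have "(fd (b i) ^^ n) \<Psi> \<in> CC" if "\<Psi> \<in> CC" for n \<Psi>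
    using that Cons.prems by (induction n) (auto intro: fd01_CC b01)
  ultimately show ?case using Cons by simp
qed

lemma ops_smooth:
  assumes "\<forall>i\<in>set is. i < m" "u \<in> \<Omega>" "smooth_at u g" shows "smooth_at u (ops b is \<alpha> g)"
  using assms(1)
proof (induction "is")
  case (Cons i xs)
  have "smooth_at u ((vf (b i) ^^ n) h)" if "smooth_at u h" for n h
    using Cons.prems by (intro smooth_vf_pow[OF Sm_01(1)[OF b01] assms(2) that]) simp
  then show ?case using Cons by (simp add: ops_def)
qed (simp add: ops_def assms(3))

lemma ops_cong_ev:
  "\<forall>\<^sub>F v in nhds u. f v = g v \<Longrightarrow> \<forall>\<^sub>F v in nhds u. ops b is \<alpha> f v = ops b is \<alpha> g v"
proof (induction "is")
  case (Cons i xs)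
  have "\<forall>\<^sub>F v in nhds u. (vf (b i) ^^ n) f v = (vf (b i) ^^ n) g v" if "\<forall>\<^sub>F v in nhds u. f v = g v" for n f g
    using that by (induction n) (auto intro: vf_cong_ev')
  then show ?case using Cons by (simp add: ops_def)
qed (simp add: ops_def)

text \<open>For (0,1) fields the CR functions \<open>h l\<close> behave like constants, and they do
  so near \<open>u\<close> as well, so the argument can be iterated.\<close>

lemma ops_linear:
  assumes "\<forall>i\<in>set is. i < m" "u \<in> \<Omega>" "finite I"
    and "\<And>l. l \<in> I \<Longrightarrow> Sm \<Omega> (c l)" "\<And>l. l \<in> I \<Longrightarrow> crf (h l) u"
  shows "ops b is \<alpha> (\<lambda>v. \<Sum>l\<in>I. c l v * h l v) u = (\<Sum>l\<in>I. ops b is \<alpha> (c l) u * h l u)"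
  using assms(1,2,5)
proof (induction "is" arbitrary: u)
  case Nil then show ?case by (simp add: ops_def)
next
  case (Cons i xs)
  have K: "type01 (b i)" using Cons.prems by (auto intro: b01)
  have ev: "\<forall>\<^sub>F v in nhds u. v \<in> \<Omega> \<and> (\<forall>l\<in>I. crf (h l) v)"
    using eventually_in[OF open_\<Omega> Cons.prems(2)] Cons.prems(3) crf_ev assms(3)
    by (auto intro!: eventually_conj simp: eventually_ball_finite_distrib)
  let ?c = "\<lambda>n l. (vf (b i) ^^ n) (ops b xs \<alpha> (c l))"
  have Smc: "Sm \<Omega> (?c n l)" if "l \<in> I" for n l
    using ops_smooth[of xs _ "c l" \<alpha>] Cons.prems(1) assms(4)[OF that]
    by (intro Sm_vf_pow Sm_01 K) (auto simp: Sm_def)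
  have "v \<in> \<Omega> \<Longrightarrow> (\<forall>l\<in>I. crf (h l) v) \<Longrightarrow>
     (vf (b i) ^^ n) (ops b xs \<alpha> (\<lambda>v. \<Sum>l\<in>I. c l v * h l v)) v = (\<Sum>l\<in>I. ?c n l v * h l v)" for n v
  proof (induction n arbitrary: v)
    case 0 then show ?case using Cons by simp
  next
    case (Suc n)
    have ev: "\<forall>\<^sub>F v in nhds v. v \<in> \<Omega> \<and> (\<forall>l\<in>I. crf (h l) v)"
      using eventually_in[OF open_\<Omega> Suc.prems(1)] Suc.prems(2) crf_ev assms(3)
      by (auto intro!: eventually_conj simp: eventually_ball_finite_distrib)
    then have "\<forall>\<^sub>F v in nhds v. (vf (b i) ^^ n) (ops b xs \<alpha> (\<lambda>v. \<Sum>l\<in>I. c l v * h l v)) v = (\<Sum>l\<in>I. ?c n l v * h l v)"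
      by eventually_elim (simp add: Suc.IH)
    from vf_cong_ev[OF this, of "b i"]
    have "(vf (b i) ^^ Suc n) (ops b xs \<alpha> (\<lambda>v. \<Sum>l\<in>I. c l v * h l v)) v = vf (b i) (\<lambda>v. \<Sum>l\<in>I. ?c n l v * h l v) v"
      by simp
    also have "\<dots> = (\<Sum>l\<in>I. vf (b i) (\<lambda>v. ?c n l v * h l v) v)"
      using Suc.prems crf_D(1) SmD[OF Smc] by (intro vf_sum smooth_at_mult) auto
    also have "\<dots> = (\<Sum>l\<in>I. ?c (Suc n) l v * h l v)"
    proof (intro sum.cong refl)
      fix l assume l: "l \<in> I"
      have h: "smooth_at v (h l)" "cr_at (h l) v" using Suc.prems l crf_D by auto
      have "vf (b i) (h l) v = 0" using h(2) K Suc.prems(1) by (auto simp: cr_at_def type01_def)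
      from crf_mult_zero_one[OF SmD[OF Smc[OF l] Suc.prems(1)] h(1) this]
      show "vf (b i) (\<lambda>v. ?c n l v * h l v) v = ?c (Suc n) l v * h l v" by simp
    qed
    finally show ?case .
  qed
  from this[OF Cons.prems(2), of "\<alpha> i"] Cons.prems(3) show ?case by (simp add: ops_def)
qed

lemma ops_add:
  assumes "\<forall>i\<in>set is. i < m" "u \<in> \<Omega>" "smooth_at u f" "smooth_at u g"
  shows "ops b is \<alpha> (\<lambda>v. f v + g v) u = ops b is \<alpha> f u + ops b is \<alpha> g u"
  using assms
proof (induction "is" arbitrary: u)
  case Nil then show ?case by (simp add: ops_def)
next
  case (Cons i xs)
  have sm: "smooth_at u ((vf (b i) ^^ n) (ops b xs \<alpha> h))" if "u \<in> \<Omega>" "smooth_at u h" for n h u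
    using that Cons.prems(1) by (intro smooth_vf_pow[OF Sm_01(1)[OF b01] that(1)] ops_smooth) auto
  have "(vf (b i) ^^ n) (ops b xs \<alpha> (\<lambda>v. f v + g v)) v = (vf (b i) ^^ n) (ops b xs \<alpha> f) v + (vf (b i) ^^ n) (ops b xs \<alpha> g) v"
    if "v \<in> \<Omega>" "smooth_at v f" "smooth_at v g" for n v
    using that
  proof (induction n arbitrary: v)
    case 0 then show ?case using Cons by simp
  next
    case (Suc n)
    have "\<forall>\<^sub>F v in nhds v. (vf (b i) ^^ n) (ops b xs \<alpha> (\<lambda>v. f v + g v)) v = (vf (b i) ^^ n) (ops b xs \<alpha> f) v + (vf (b i) ^^ n) (ops b xs \<alpha> g) v"
      using eventually_in[OF open_\<Omega> Suc.prems(1)] smooth_at_ev[OF Suc.prems(2)] smooth_at_ev[OF Suc.prems(3)]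
      by eventually_elim (rule Suc.IH)
    from vf_cong_ev[OF this, of "b i"] show ?case
      using sm[OF Suc.prems(1,2)] sm[OF Suc.prems(1,3)] by (simp add: vf_add)
  qed
  from this[OF Cons.prems(2-4)] show ?case by (simp add: ops_def)
qed

lemma low_ops:
  assumes "\<Phi> \<in> low n" "\<forall>i\<in>set is. i < m"
  shows "\<exists>\<Psi>\<in>low n. \<forall>g u. u \<in> \<Omega> \<longrightarrow> crf g u \<longrightarrow> ops b is \<alpha> (\<Phi> g) u = \<Psi> g u"
  using assms(2)
proof (induction "is")
  case Nil then show ?case using assms(1) by (intro bexI[of _ \<Phi>]) (auto simp: ops_def)
next
  case (Cons i xs)
  have K: "type01 (b i)" using Cons.prems by (auto intro: b01)
  obtain \<Psi> where \<Psi>: "\<Psi> \<in> low n" "\<And>g u. u \<in> \<Omega> \<Longrightarrow> crf g u \<Longrightarrow> ops b xs \<alpha> (\<Phi> g) u = \<Psi> g u" using Cons by auto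
  have "\<exists>\<Psi>'\<in>low n. \<forall>g u. u \<in> \<Omega> \<longrightarrow> crf g u \<longrightarrow> (vf (b i) ^^ r) (ops b xs \<alpha> (\<Phi> g)) u = \<Psi>' g u" for r
  proof (induction r)
    case 0 then show ?case using \<Psi> by auto
  next
    case (Suc r)
    then obtain \<Psi>1 where 1: "\<Psi>1 \<in> low n" "\<And>g u. u \<in> \<Omega> \<Longrightarrow> crf g u \<Longrightarrow> (vf (b i) ^^ r) (ops b xs \<alpha> (\<Phi> g)) u = \<Psi>1 g u" by auto
    obtain \<Psi>2 where 2: "\<Psi>2 \<in> low n" "\<And>g u. u \<in> \<Omega> \<Longrightarrow> crf g u \<Longrightarrow> vf (b i) (\<Psi>1 g) u = \<Psi>2 g u"
      using low_zero_one[OF 1(1), of "b i"] K by (auto simp: type01_def)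
    have "(vf (b i) ^^ Suc r) (ops b xs \<alpha> (\<Phi> g)) u = \<Psi>2 g u" if u: "u \<in> \<Omega>" "crf g u" for g u
    proof -
      have "\<forall>\<^sub>F v in nhds u. (vf (b i) ^^ r) (ops b xs \<alpha> (\<Phi> g)) v = \<Psi>1 g v"
        using crf_\<Omega>_ev[OF u(2,1)] by eventually_elim (simp add: 1(2))
      from vf_cong_ev[OF this, of "b i"] show ?thesis by (simp add: 2(2)[OF u])
    qed
    then show ?case using 2(1) by blast
  qed
  from this[of "\<alpha> i"] show ?case by (simp add: ops_def)
qed

definition hH :: "nat \<Rightarrow> nat \<Rightarrow> 'n \<Rightarrow> (real ^ 'd \<Rightarrow> complex ^ 'n) \<times> (real ^ 'd) \<Rightarrow> complex" where
  "hH r s j = (\<lambda>(F, u). H r s (\<lambda>w. F w $ j) u)"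

lemma low_CC:
  assumes "\<And>r s. r + s < n \<Longrightarrow> hH r s j \<in> CC"
  shows "\<Phi> \<in> low n \<Longrightarrow> (\<lambda>(F, u). \<Phi> (\<lambda>w. F w $ j) u) \<in> CC"
proof (induction rule: low.induct)
  case low_zero then show ?case using Rg_const[of 0] by (simp add: case_prod_unfold)
next
  case (low_base c r s)
  have "(\<lambda>x. (\<lambda>(F, u). c u) x * hH r s j x) \<in> CC"
    by (intro Rg_mult Cu_Rg[OF Cu_CC] SmD[OF low_base(1) u0] assms low_base)
  then show ?case by (simp add: hH_def case_prod_unfold)
next
  case (low_add \<Phi> \<Psi>) from Rg_add[OF low_add.IH] show ?case by (simp add: case_prod_unfold)
qed

lemma ev_base_point: "\<forall>\<^sub>F u in nhds u0. P u \<Longrightarrow> eventually (\<lambda>(F, u). P u) FF"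
proof -
  assume P: "\<forall>\<^sub>F u in nhds u0. P u"
  have "((\<lambda>x. snd (snd (J x))) \<longlongrightarrow> u0) FF"
    using tendsto_snd[OF tendsto_snd[OF filterlim_J]] by (simp add: J_def)
  from filterlim_iff[THEN iffD1, OF this] have "\<forall>\<^sub>F x in FF. P (snd (snd (J x)))" using P by blast
  then show ?thesis by (auto simp: J_def case_prod_unfold elim: eventually_mono)
qed

text \<open>Since the ordered monomials \<open>ops b \<alpha>\<close> kill the CR functions \<open>H r s F\<close>, applying them to the expansion of
  \<open>L\<^sup>n F\<close> only differentiates the coefficients \<open>(-q)\<^sup>s\<close>, and these separate the terms.\<close>

lemma hH_CC: "r + s = n \<Longrightarrow> hH r s j \<in> CC"
proof (induction n arbitrary: r s rule: less_induct)
  case (less n)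
  let ?L = "cnjf (Kf i1)" and ?f = "\<lambda>F :: real ^ 'd \<Rightarrow> complex ^ 'n. \<lambda>w. F w $ j"
  let ?is = "[0..<m]"
  obtain \<Phi> where \<Phi>: "\<Phi> \<in> low n" "\<And>g u. u \<in> \<Omega> \<Longrightarrow> crf g u \<Longrightarrow> (vf ?L ^^ n) g u = main n g u + \<Phi> g u"
    using L_pow_expand[of n] by blast
  have "(fd ?L ^^ n) (pF [] j) = foldr fd (map cnjf (replicate n (Kf i1))) (pF [] j)"
    by (induction n) auto
  then have L: "(fd ?L ^^ n) (pF [] j) \<in> CC"
    using BB_CC[OF words10_F[of "replicate n (Kf i1)" j]] Kf01 by auto
  define c where "c s u = of_nat (n choose s) * (- q i1 u) ^ s" for s u
  have Smc: "Sm \<Omega> (c s)" for s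
    unfolding c_def[abs_def] using Sm_qpow[of s] by (intro Sm_mult) (auto simp: Sm_def)
  define V where "V \<alpha> s = ops b ?is \<alpha> (c s)" for \<alpha> s
  \<comment> \<open>One equation per monomial. The unknowns are the \<open>hH (n - s) s j\<close>;
    the lower-order terms are in \<open>CC\<close> by induction.\<close>
  have row: "(\<lambda>x. \<Sum>s\<le>n. (\<lambda>(F, u). V \<alpha> s u) x * hH (n - s) s j x) \<in> CC" for \<alpha>
  proof -
    have "\<exists>\<Psi>\<in>low n. \<forall>g u. u \<in> \<Omega> \<longrightarrow> crf g u \<longrightarrow> ops b ?is \<alpha> (\<Phi> g) u = \<Psi> g u"
      by (rule low_ops[OF \<Phi>(1)]) simp
    then obtain \<Psi> where \<Psi>: "\<Psi> \<in> low n" "\<And>g u. u \<in> \<Omega> \<Longrightarrow> crf g u \<Longrightarrow> ops b ?is \<alpha> (\<Phi> g) u = \<Psi> g u"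
      by blast
    have "(\<lambda>x. fops ?is \<alpha> ((fd ?L ^^ n) (pF [] j)) x - (\<lambda>(F, u). \<Psi> (?f F) u) x) \<in> CC"
      by (intro Rg_diff fops_CC L low_CC[OF _ \<Psi>(1)]) (auto intro: less.IH)
    then show ?thesis
    proof (rule Rg_cong_adm)
      fix F u assume a: "adm F u"
      have u: "u \<in> \<Omega>" "crf (?f F) u" using a by (auto intro: admD adm_crf)
      have m: "main n g v = (\<Sum>s\<le>n. c s v * H (n - s) s g v)" for g v
        by (simp add: main_def c_def mult.assoc)
      have "\<forall>\<^sub>F v in nhds u. (vf ?L ^^ n) (?f F) v = main n (?f F) v + \<Phi> (?f F) v"
        using crf_\<Omega>_ev[OF u(2,1)] by eventually_elim (simp add: \<Phi>(2))
      from eventually_nhds_x_imp_x[OF ops_cong_ev[OF this, of ?is \<alpha>]]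
      have "ops b ?is \<alpha> ((vf ?L ^^ n) (?f F)) u = ops b ?is \<alpha> (main n (?f F)) u + ops b ?is \<alpha> (\<Phi> (?f F)) u"
        using ops_add[of ?is u "main n (?f F)" "\<Phi> (?f F)" \<alpha>] smooth_main[OF u] low_smooth[OF \<Phi>(1) u] u by simp
      also have "ops b ?is \<alpha> (main n (?f F)) u = (\<Sum>s\<le>n. V \<alpha> s u * H (n - s) s (?f F) u)"
        unfolding m[abs_def] V_def by (rule ops_linear) (use u Smc crf_H in auto)
      finally show "fops ?is \<alpha> ((fd ?L ^^ n) (pF [] j)) (F, u) - (\<lambda>(F, u). \<Psi> (?f F) u) (F, u)
        = (\<Sum>s\<le>n. (\<lambda>(F, u). V \<alpha> s u) (F, u) * hH (n - s) s j (F, u))"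
        using \<Psi>(2)[OF u] by (simp add: fops_def fd_pow pF_def hH_def)
    qed
  qed
  have s: "s \<in> {..n}" using less.prems by auto
  \<comment> \<open>The matrix \<open>V\<close> depends on the source point alone, so it is inverted
    over germs of smooth functions at \<open>u0\<close>.\<close>
  have "\<exists>g\<in>rcomb {c. smooth_at u0 c} UNIV V. eventually (\<lambda>x. \<forall>i\<in>{..n}. g i x = (if i = s then 1 else 0)) (nhds u0)"
  proof (rule local_ring.left_inverse[OF local_ring_germs _ _ _ s])
    show "V \<alpha> i \<in> {c. smooth_at u0 c}" for \<alpha> i
      unfolding V_def using ops_smooth[of ?is u0 "c i" \<alpha>] u0 SmD[OF Smc u0] by auto
    fix d assume d: "\<And>\<alpha>. \<alpha> \<in> UNIV \<Longrightarrow> (\<Sum>i\<in>{..n}. d i * V \<alpha> i u0) = 0"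
    have one: "crf (\<lambda>_. 1) u0" by (auto simp: crf_def cr_at_def)
    \<comment> \<open>A linear relation among the columns is a relation among the powers of
      \<open>q i1\<close> modulo flat functions; binomial coefficients and signs are
      nonzero.\<close>
    have "d i * (of_nat (n choose i) * (- 1) ^ i) = 0" if "i \<le> n" for i
    proof (rule powers_independent[OF open_\<Omega> u0 Sm_01(1)[OF b01] Sm_qi nonflat _ that])
      fix \<alpha>
      have sdc: "Sm \<Omega> (\<lambda>u. d i * c i u)" for i
        by (rule Sm_mult[OF _ Smc]) (simp add: Sm_def)
      have "ops b ?is \<alpha> (\<lambda>u. \<Sum>i\<le>n. (d i * c i u) * 1) u0 = (\<Sum>i\<le>n. ops b ?is \<alpha> (\<lambda>u. d i * c i u) u0 * 1)"
        by (rule ops_linear) (use u0 one sdc in auto)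
      also have "\<dots> = (\<Sum>i\<le>n. d i * V \<alpha> i u0)"
      proof (intro sum.cong refl)
        fix i
        \<comment> \<open>With a one-element index set \<open>ops_linear\<close> pulls out the
          constant \<open>d i\<close>, regarded as a CR function.\<close>
        have "ops b ?is \<alpha> (\<lambda>u. \<Sum>l\<in>{()}. c i u * d i) u0 = (\<Sum>l\<in>{()}. ops b ?is \<alpha> (c i) u0 * d i)"
          by (rule ops_linear) (use u0 Smc in \<open>auto simp: crf_def cr_at_def\<close>)
        then show "ops b ?is \<alpha> (\<lambda>u. d i * c i u) u0 * 1 = d i * V \<alpha> i u0" by (simp add: V_def mult.commute)
      qed
      also have "\<dots> = 0" using d by simp
      moreover have "(\<lambda>u. \<Sum>i\<le>n. (d i * c i u) * 1) = (\<lambda>u. \<Sum>i\<le>n. (d i * (of_nat (n choose i) * (- 1) ^ i)) * q i1 u ^ i)"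
        by (auto simp: c_def power_minus[of "q i1 _"] intro!: sum.cong)
      ultimately show "ops b ?is \<alpha> (\<lambda>u. \<Sum>i\<le>n. (d i * (of_nat (n choose i) * (- 1) ^ i)) * q i1 u ^ i) u0 = 0" by simp
    qed
    then show "\<forall>i\<in>{..n}. d i = 0" by auto
  qed auto
  then obtain g where g: "g \<in> rcomb {c. smooth_at u0 c} UNIV V"
    "\<forall>\<^sub>F u in nhds u0. \<forall>i\<in>{..n}. g i u = (if i = s then 1 else 0)" by blast
  from g(1) have "(\<lambda>x. \<Sum>s\<le>n. (\<lambda>(F, u). g s u) x * hH (n - s) s j x) \<in> CC"
  proof induction
    case (row \<alpha>) show ?case by fact
  next
    case (add g h) from Rg_add[OF add.IH] show ?case by (simp add: distrib_right sum.distrib case_prod_unfold)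
  next
    case (scale r g)
    then have "(\<lambda>(F :: real ^ 'd \<Rightarrow> complex ^ 'n, u). r u) \<in> CC" by (intro Cu_Rg[OF Cu_CC]) auto
    from Rg_mult[OF this scale.IH] show ?case by (simp add: sum_distrib_left mult.assoc case_prod_unfold)
  qed
  then show ?case
  proof (rule Rg_cong)
    show "\<forall>\<^sub>F x in FF. (\<Sum>s\<le>n. (\<lambda>(F, u). g s u) x * hH (n - s) s j x) = hH r s j x"
      using ev_base_point[OF g(2)]
    proof eventually_elim
      case (elim x)
      have "(\<Sum>l\<le>n. (\<lambda>(F, u). g l u) x * hH (n - l) l j x) = (\<Sum>l\<le>n. if l = s then hH (n - s) s j x else 0)"
        using elim by (intro sum.cong) auto
      then show ?case using less.prems by auto
    qed
  qed
qed

section \<open>Words of \<open>k + 1\<close> fields\<close>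

lemma fd_words_E:
  "\<forall>R\<in>set Xs. Sm \<Omega> R \<Longrightarrow> length Xs + n \<le> Suc k \<Longrightarrow> \<Theta> \<in> E n \<Longrightarrow> foldr fd Xs \<Theta> \<in> E (length Xs + n)"
proof (induction Xs)
  case (Cons R Xs) then show ?case using fd_E[of R "length Xs + n" "foldr fd Xs \<Theta>"] by simp
qed simp

lemma pF0_E: "pF [] j \<in> E 0"
  by (rule pF_E) simp

text \<open>Each transposition produces a bracket, one field in place of two, so the difference of
  the two words loses one order.\<close>

lemma fd_move:
  assumes "Sm \<Omega> R" "\<Theta> \<in> E n"
  shows "\<forall>Y\<in>set as. Sm \<Omega> Y \<Longrightarrow> length as + n \<le> k \<Longrightarrow>
    (\<lambda>x. foldr fd (as @ [R]) \<Theta> x - foldr fd (R # as) \<Theta> x) \<in> E (length as + n)"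
proof (induction as)
  case Nil then show ?case using Rg_const[of 0] by simp
next
  case (Cons a as)
  let ?W1 = "foldr fd (as @ [R]) \<Theta>" and ?W0 = "foldr fd as \<Theta>" and ?n = "length as + n"
  have a: "Sm \<Omega> a" using Cons.prems by simp
  have W0: "?W0 \<in> E ?n" using Cons.prems assms(2) by (intro fd_words_E) auto
  have W1: "?W1 \<in> E (Suc ?n)" using fd_words_E[of "as @ [R]" n \<Theta>] Cons.prems assms by auto
  have W2: "fd R ?W0 \<in> E (Suc ?n)" using Cons.prems W0 assms by (intro fd_E) auto
  have "(\<lambda>x. fd a (\<lambda>x. ?W1 x + (- fd R ?W0 x)) x + fd (brk a R) ?W0 x) \<in> E (Suc ?n)"
  proof -
    have D: "(\<lambda>x. ?W1 x + (- fd R ?W0 x)) \<in> E ?n" using Cons.IH Cons.prems by simp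
    have "?n \<le> k" using Cons.prems by simp
    then show ?thesis by (intro Rg_add[OF fd_E[OF a _ D] fd_E[OF Sm_brk[OF a assms(1)] _ W0]])
  qed
  then have "(\<lambda>x. foldr fd ((a # as) @ [R]) \<Theta> x - foldr fd (R # a # as) \<Theta> x) \<in> E (Suc ?n)"
  proof (rule Rg_cong)
    have k: "Suc ?n \<le> k" "?n \<le> k" using Cons.prems by auto
    have s: "smf ?W1" "smf (fd R ?W0)" "smf ?W0"
      by (rule smf_JJ[OF E_JJ[OF W1 k(1)]], rule smf_JJ[OF E_JJ[OF W2 k(1)]], rule smf_JJ[OF E_JJ[OF W0 k(2)]])
    have sm: "smf (\<lambda>x. - fd R ?W0 x)" by (rule smf_JJ[OF Rg_uminus[OF E_JJ[OF W2 k(1)]]])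
    have neg: "eventually (\<lambda>x. fd a (\<lambda>x. - fd R ?W0 x) x = - fd a (fd R ?W0) x) FF"
      using s(2) unfolding smf_def by eventually_elim (auto simp: fd_def vf_uminus)
    show "\<forall>\<^sub>F x in FF. fd a (\<lambda>x. ?W1 x + (- fd R ?W0 x)) x + fd (brk a R) ?W0 x
       = foldr fd ((a # as) @ [R]) \<Theta> x - foldr fd (R # a # as) \<Theta> x"
      using fd_add_ev[OF s(1) sm, of a] neg fd_commute[OF s(3) a assms(1)]
    proof eventually_elim
      case (elim x)
      show ?case unfolding elim(1,2) using elim(3) by (simp add: algebra_simps)
    qed
  qed
  then show ?case by simp
qed

text \<open>Meant for words of length \<open>Suc k\<close>: by \<open>fd_move\<close> the property
  is then unaffected when a letter is moved to the front, so such words can be sorted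
  (\<open>closed_word_move\<close>).\<close>

definition closed_word :: "'d field list \<Rightarrow> bool" where
  "closed_word Xs \<longleftrightarrow> (\<forall>j. foldr fd Xs (pF [] j) \<in> E k)"

lemma closed_word_move:
  assumes "\<forall>Y\<in>set (as @ R # bs). Sm \<Omega> Y" "length (as @ R # bs) = Suc k"
  shows "closed_word (as @ R # bs) \<longleftrightarrow> closed_word (R # as @ bs)"
proof -
  have D: "(\<lambda>x. foldr fd (as @ R # bs) (pF [] j) x - foldr fd (R # as @ bs) (pF [] j) x) \<in> E k" for j
  proof -
    have "foldr fd bs (pF [] j) \<in> E (length bs)"
      using fd_words_E[of bs 0 "pF [] j"] pF0_E assms by auto
    from fd_move[OF _ this, of R as] show ?thesis using assms by simp
  qed
  show ?thesis
    unfolding closed_word_def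
  proof (intro iffI allI)
    fix j assume "\<forall>j. foldr fd (as @ R # bs) (pF [] j) \<in> E k"
    from Rg_diff[OF spec[OF this, of j] D[of j]] show "foldr fd (R # as @ bs) (pF [] j) \<in> E k" by simp
  next
    fix j assume "\<forall>j. foldr fd (R # as @ bs) (pF [] j) \<in> E k"
    from Rg_add[OF spec[OF this, of j] D[of j]] show "foldr fd (as @ R # bs) (pF [] j) \<in> E k" by simp
  qed
qed

text \<open>The (0,1) part of the coordinate field \<open>cf i\<close>, by projection along the
  \<open>Z j\<close>.\<close>

definition Ki :: "'d \<Rightarrow> 'd field" where
  "Ki i = (\<lambda>u. cf i u - (\<Sum>j\<in>UNIV. pd i (z j) u *s Z j u))"

lemma Ki01: "type01 (Ki i)"
proof -
  have "vf (Ki i) (z l) u = 0" if "u \<in> \<Omega>" for l u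
    using that by (simp add: Ki_def vf_field_diff vf_lincomb Z_z if_distrib[of "\<lambda>c. _ * c"] cong: if_cong)
  moreover have "smooth_at u (Ki i)" if "u \<in> \<Omega>" for u
    unfolding Ki_def using that SmD[OF Sm_z] SmD[OF Sm_Z]
    by (intro smooth_at_diff smooth_at_lincomb smooth_at_cf smooth_at_pd) auto
  ultimately show ?thesis by (auto simp: type01_def Sm_def)
qed

text \<open>Decomposes a coordinate field into (0,1) fields, (1,0) fields and
  \<open>Z \<nu>\<close>, so that only these three kinds of letters have to be treated.\<close>

lemma vf_cf_expand:
  assumes "u \<in> \<Omega>"
  shows "vf (cf i) g u = vf (Ki i) g u + (\<Sum>j\<in>UNIV. pd i (z j) u * (vf (cnjf (Kf j)) g u + q j u * vf (Z \<nu>) g u))"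
proof -
  have "vf (Z j) g u = vf (cnjf (Kf j)) g u + q j u * vf (Z \<nu>) g u" for j
  proof -
    have "Z j u = cnjf (Kf j) u + q j u *s Z \<nu> u" using Kf_eq[OF assms, of j] by simp
    then have "vf (Z j) g u = vf (\<lambda>u. cnjf (Kf j) u + q j u *s Z \<nu> u) g u" by (rule vf_point)
    then show ?thesis by (simp only: vf_field_add vf_field_scale)
  qed
  then have A: "(\<Sum>j\<in>UNIV. pd i (z j) u * vf (Z j) g u) = (\<Sum>j\<in>UNIV. pd i (z j) u * (vf (cnjf (Kf j)) g u + q j u * vf (Z \<nu>) g u))"
    by (intro sum.cong refl arg_cong2[where f="(*)"])
  have B: "vf (Ki i) g u = vf (cf i) g u - (\<Sum>j\<in>UNIV. pd i (z j) u * vf (Z j) g u)"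
    unfolding Ki_def vf_field_diff vf_lincomb ..
  show ?thesis unfolding A[symmetric] B by simp
qed

lemma closed_word_cf:
  assumes "closed_word (Ki i # Xs)" "\<And>j. closed_word (cnjf (Kf j) # Xs)" "closed_word (Z \<nu> # Xs)"
  shows "closed_word (cf i # Xs)"
  unfolding closed_word_def
proof
  fix l
  let ?W = "foldr fd Xs (pF [] l)"
  have Cu: "Cu \<subseteq> E k" using Cu_sub by (auto intro: Rg_gen)
  have w: "fd (Ki i) ?W \<in> E k" "fd (cnjf (Kf j)) ?W \<in> E k" "fd (Z \<nu>) ?W \<in> E k" for j
    using assms by (simp_all add: closed_word_def)
  have "(\<lambda>x. fd (Ki i) ?W x + (\<Sum>j\<in>UNIV. (\<lambda>(F, u). pd i (z j) u) x * (fd (cnjf (Kf j)) ?W x + (\<lambda>(F, u). q j u) x * fd (Z \<nu>) ?W x))) \<in> E k"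
    by (intro Rg_add Rg_sum Rg_mult w Cu_Rg[OF Cu] smooth_at_pd SmD[OF Sm_z u0] SmD[OF Sm_qi u0])
  then show "foldr fd (cf i # Xs) (pF [] l) \<in> E k"
  proof (rule Rg_cong_adm)
    fix F u assume "adm F u"
    from vf_cf_expand[OF admD(1)[OF this], of i "\<lambda>v. ?W (F, v)"]
    show "fd (Ki i) ?W (F, u) + (\<Sum>j\<in>UNIV. (\<lambda>(F, u). pd i (z j) u) (F, u) * (fd (cnjf (Kf j)) ?W (F, u) +
        (\<lambda>(F, u). q j u) (F, u) * fd (Z \<nu>) ?W (F, u))) = foldr fd (cf i # Xs) (pF [] l) (F, u)"
      by (simp only: fd_def prod.case foldr.simps o_apply)
  qed
qed

lemma hH_word: "foldr fd (replicate r (Z \<nu>)) (pF [] j) = hH 0 r j"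
proof -
  have "foldr fd (replicate r (Z \<nu>)) (pF [] j) = (\<lambda>(F, u). (vf (Z \<nu>) ^^ r) (\<lambda>w. F w $ j) u)"
    by (induction r) (auto simp: fd_def pF_def)
  then show ?thesis by (auto simp: hH_def H_def)
qed

text \<open>The case of few (1,0) fields. They are moved in front one by one, onto
  \<open>Ms\<close>; what remains is a power of \<open>Z \<nu>\<close> acting on \<open>F\<close>,
  of order \<open>2 * k0\<close>, and the at most \<open>k0\<close> fields in front raise this to at
  most \<open>3 * k0 \<le> k\<close>.\<close>

lemma closed_word_short:
  assumes "\<forall>K\<in>set Ms. type01 K" "\<forall>K\<in>set Ls. type01 K" "length Ms + length Ls \<le> k0"
    "r + length Ms + length Ls = Suc k"
  shows "closed_word (map cnjf Ms @ replicate r (Z \<nu>) @ map cnjf Ls)"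
  using assms
proof (induction Ls arbitrary: Ms)
  case Nil
  show ?case unfolding closed_word_def
  proof
    fix j
    have "hH 0 r j \<in> E (2 * k0)" by (rule CC_E[OF hH_CC]) simp
    then have "foldr fd (map cnjf Ms) (hH 0 r j) \<in> E (length Ms + 2 * k0)"
      using Nil.prems k3 fd_words_E[of "map cnjf Ms" "2 * k0" "hH 0 r j"] by (auto intro: Sm_01)
    then show "foldr fd (map cnjf Ms @ replicate r (Z \<nu>) @ map cnjf []) (pF [] j) \<in> E k"
      using Nil.prems k3 E_mono[of _ "length Ms + 2 * k0" k] by (simp add: hH_word del: foldr_replicate)
  qed
next
  case (Cons K Ls)
  have "closed_word (map cnjf (K # Ms) @ replicate r (Z \<nu>) @ map cnjf Ls)"
    using Cons.prems by (intro Cons.IH) auto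
  moreover have "\<forall>Y\<in>set ((map cnjf Ms @ replicate r (Z \<nu>)) @ cnjf K # map cnjf Ls). Sm \<Omega> Y"
    using Cons.prems Sm_Z by (auto intro: Sm_01)
  moreover have "length ((map cnjf Ms @ replicate r (Z \<nu>)) @ cnjf K # map cnjf Ls) = Suc k"
    using Cons.prems by simp
  ultimately show ?case
    using closed_word_move[of "map cnjf Ms @ replicate r (Z \<nu>)" "cnjf K" "map cnjf Ls"] by simp
qed

text \<open>Coordinate fields are replaced from the left, and each new letter is moved to its block.
  The (0,1) fields go to the right end, where they kill \<open>F\<close>.\<close>

lemma closed_word_sorted:
  assumes "\<forall>K\<in>set Ls. type01 K" "\<forall>K\<in>set Ks. type01 K" "length is + r + length Ls + length Ks = Suc k"
  shows "closed_word (map cf is @ replicate r (Z \<nu>) @ map cnjf Ls @ Ks)"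
  using assms
proof (induction "is" arbitrary: r Ls Ks)
  case Nil
  \<comment> \<open>No coordinate field is left. Either a (0,1) field acts first on
    \<open>F\<close>, or there are few (1,0) fields, or there are more than \<open>k0\<close> of
    them; then \<open>r + k0 \<le> k\<close>, because \<open>r + length Ls = Suc k\<close>.\<close>
  consider K Ks' where "Ks = Ks' @ [K]" | "Ks = []" "length Ls \<le> k0" | "Ks = []" "k0 < length Ls"
    by (cases Ks rule: rev_cases) (auto simp: not_le[symmetric])
  then show ?case
  proof cases
    case 1
    have K: "type01 K" using Nil.prems 1 by simp
    let ?Ys = "replicate r (Z \<nu>) @ map cnjf Ls @ Ks'"
    have "eventually (\<lambda>x. 0 = fd K (pF [] j) x) FF" for j
      using ev_adm by eventually_elim (auto simp: fd_def pF_def type01_F[OF K])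
    from foldr_fd_cong[OF this, of ?Ys]
    have "foldr fd ?Ys (fd K (pF [] j)) \<in> E k" for j
      unfolding foldr_fd_zero by (rule Rg_cong[OF Rg_const[of 0]])
    then show ?thesis by (simp add: closed_word_def 1)
  next
    case 2 then show ?thesis using closed_word_short[of "[]" Ls r] Nil.prems by simp
  next
    case 3
    show ?thesis unfolding closed_word_def
    proof
      fix j
      have "foldr fd (map cnjf Ls) (pF [] j) \<in> E k0" using BB_E words10_F Nil.prems by blast
      then have "foldr fd (replicate r (Z \<nu>)) (foldr fd (map cnjf Ls) (pF [] j)) \<in> E (r + k0)"
        using fd_words_E[of "replicate r (Z \<nu>)" k0] Sm_Z Nil.prems 3 by auto
      then show "foldr fd (map cf [] @ replicate r (Z \<nu>) @ map cnjf Ls @ Ks) (pF [] j) \<in> E k"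
        using 3 Nil.prems E_mono[of _ "r + k0" k] by simp
    qed
  qed
next
  case (Cons i xs)
  let ?rest = "replicate r (Z \<nu>) @ map cnjf Ls @ Ks"
  have sm: "\<forall>Y\<in>set (map cf xs @ ?rest). Sm \<Omega> Y"
    using Cons.prems Sm_01 Sm_Z Sm_cf by auto
  have "closed_word (cf i # (map cf xs @ ?rest))"
  proof (rule closed_word_cf)
    have "closed_word ((map cf xs @ ?rest) @ Ki i # [])"
      using Cons.IH[of Ls "Ks @ [Ki i]" r] Cons.prems Ki01 by auto
    then show "closed_word (Ki i # (map cf xs @ ?rest))"
      using closed_word_move[of "map cf xs @ ?rest" "Ki i" "[]"] sm Cons.prems Sm_01(1)[OF Ki01] by auto
  next
    fix j
    have "closed_word ((map cf xs @ replicate r (Z \<nu>)) @ cnjf (Kf j) # (map cnjf Ls @ Ks))"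
      using Cons.IH[of "Kf j # Ls" Ks r] Cons.prems Kf01 by auto
    then show "closed_word (cnjf (Kf j) # (map cf xs @ ?rest))"
      using closed_word_move[of "map cf xs @ replicate r (Z \<nu>)" "cnjf (Kf j)" "map cnjf Ls @ Ks"] sm Cons.prems Sm_01(2)[OF Kf01] by auto
  next
    have "closed_word (map cf xs @ Z \<nu> # ?rest)"
      using Cons.IH[of Ls Ks "Suc r"] Cons.prems by auto
    then show "closed_word (Z \<nu> # (map cf xs @ ?rest))"
      using closed_word_move[of "map cf xs" "Z \<nu>" ?rest] sm Cons.prems Sm_Z by auto
  qed
  then show ?case by simp
qed

lemma pF_word: "foldr fd (map cf is) (pF [] j) = pF is j"
  by (induction "is") (auto simp: fd_pd)

lemma pF_top:
  assumes "length is = Suc k" shows "pF is j \<in> E k"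
  using closed_word_sorted[of "[]" "[]" "is" 0] assms unfolding closed_word_def by (simp add: pF_word)

lemma cnj_E: "\<Theta> \<in> E n \<Longrightarrow> (\<lambda>x. cnj (\<Theta> x)) \<in> E n"
proof (erule Rg_cnj[rotated])
  fix \<Theta> assume "\<Theta> \<in> Cf \<union> FA n \<union> FB n"
  then consider "\<Theta> \<in> Cf" | "is" j where "length is \<le> n" "\<Theta> = pB is j" | "is" j where "length is \<le> n" "\<Theta> = pF is j"
    by (auto simp: FA_def FB_def)
  then show "(\<lambda>x. cnj (\<Theta> x)) \<in> E n"
  proof cases
    case 1 then show ?thesis using cnj_Cf by (auto intro: Rg_gen)
  next
    case 2
    show ?thesis by (rule Rg_cong_adm[OF pF_E(1)[OF 2(1), of j]]) (simp add: 2 pB_def pF_def pds_cnj admD)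
  next
    case 3
    show ?thesis by (rule Rg_cong_adm[OF pF_E(2)[OF 3(1), of j]]) (simp add: 3 pB_def pF_def pds_cnj admD)
  qed
qed

lemma E_Suc_k: "\<Theta> \<in> E (Suc k) \<Longrightarrow> \<Theta> \<in> E k"
proof (erule Rg_sub, rule subsetI)
  fix \<Theta> assume "\<Theta> \<in> Cf \<union> FA (Suc k) \<union> FB (Suc k)"
  then consider "\<Theta> \<in> Cf" | "is" j where "length is \<le> Suc k" "\<Theta> = pF is j \<or> \<Theta> = pB is j"
    by (auto simp: FA_def FB_def)
  then show "\<Theta> \<in> E k"
  proof cases
    case 1 then show ?thesis by (auto intro: Rg_gen)
  next
    case 2
    have F: "pF is j \<in> E k"
      using 2(1) pF_top pF_E(1) by (cases "length is = Suc k") auto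
    have "pB is j \<in> E k"
      by (rule Rg_cong_adm[OF cnj_E[OF F]]) (simp add: pB_def pF_def pds_cnj admD)
    then show ?thesis using F 2 by auto
  qed
qed

text \<open>Returns from ambient components to chart coordinates: \<open>k + 1\<close> derivatives
  of \<open>X \<circ> F\<close> have order at most \<open>k + 1\<close> in \<open>F\<close>, hence
  at most \<open>k\<close> by \<open>E_Suc_k\<close>, and are thus rational in the
  \<open>k\<close>-jet.\<close>

theorem pG_JJ:
  assumes "length is \<le> Suc k" shows "pG is i \<in> JJ"
proof -
  have "pG is i \<in> E (length is)"
    using assms
  proof (induction "is")
    case Nil then show ?case using pG_Nil by (auto intro: Rg_gen)
  next
    case (Cons l xs)
    then show ?case using fd_E[OF Sm_cf, of "length xs" "pG xs i" l] by (simp add: fd_pd)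
  qed
  then have "pG is i \<in> E (Suc k)" using E_mono assms by blast
  then show ?thesis using E_JJ[OF E_Suc_k] by simp
qed

end

section \<open>Polynomials and rational functions of the jet variables\<close>

definition mon :: "('j \<Rightarrow> nat) \<Rightarrow> real ^ 'j::finite \<Rightarrow> real" where
  "mon m t = (\<Prod>l\<in>UNIV. (t $ l) ^ m l)"

lemma mon_add: "mon (\<lambda>l. m l + n l) t = mon m t * mon n t"
  by (simp add: mon_def power_add prod.distrib)

lemma mon_0: "mon (\<lambda>l. 0) t = 1"
  by (simp add: mon_def)

lemma mon_unit: "mon (\<lambda>l. if l = i then 1 else 0) t = t $ i"
  by (simp add: mon_def if_distrib[of "\<lambda>n. _ ^ n"] cong: if_cong)

definition poly_form :: "((real ^ 'j::finite) \<times> 'y \<Rightarrow> real) \<Rightarrow> bool" where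
  "poly_form A \<longleftrightarrow> (\<exists>E P. finite E \<and> (\<forall>t y. A (t, y) = (\<Sum>m\<in>E. P m y * mon m t)))"

lemma poly_form_coef: "poly_form (\<lambda>(t, y). c y)"
  unfolding poly_form_def by (rule exI[of _ "{\<lambda>l. 0}"], rule exI[of _ "\<lambda>m. c"]) (simp add: mon_0)

lemma poly_form_var: "poly_form (\<lambda>(t, y). t $ i)"
  unfolding poly_form_def
  by (rule exI[of _ "{\<lambda>l. if l = i then 1 else 0}"], rule exI[of _ "\<lambda>m y. 1"]) (simp add: mon_unit)

lemma sum_extend: "finite E' \<Longrightarrow> E \<subseteq> E' \<Longrightarrow> (\<Sum>m\<in>E. P m y * mon m t) = (\<Sum>m\<in>E'. (if m \<in> E then P m y else 0) * mon m t)"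
  by (rule sum.mono_neutral_cong_left) auto

lemma poly_form_add:
  assumes "poly_form A" "poly_form B" shows "poly_form (\<lambda>p. A p + B p)"
proof -
  obtain E P E' P' where f: "finite E" "finite E'"
    and A: "\<And>t y. A (t, y) = (\<Sum>m\<in>E. P m y * mon m t)" and B: "\<And>t y. B (t, y) = (\<Sum>m\<in>E'. P' m y * mon m t)"
    using assms unfolding poly_form_def by blast
  have "A (t, y) + B (t, y) = (\<Sum>m\<in>E \<union> E'. ((if m \<in> E then P m y else 0) + (if m \<in> E' then P' m y else 0)) * mon m t)" for t y
    using sum_extend[of "E \<union> E'" E P y t] sum_extend[of "E \<union> E'" E' P' y t] f
    by (simp add: A B distrib_right sum.distrib)
  then show ?thesis unfolding poly_form_def using f
    by (intro exI[of _ "E \<union> E'"] exI[of _ "\<lambda>m y. (if m \<in> E then P m y else 0) + (if m \<in> E' then P' m y else 0)"]) auto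
qed

lemma poly_form_mult:
  fixes A B :: "(real ^ 'j::finite) \<times> 'y \<Rightarrow> real"
  assumes "poly_form A" "poly_form B" shows "poly_form (\<lambda>p. A p * B p)"
proof -
  obtain E P E' P' where f: "finite E" "finite E'"
    and A: "\<And>t y. A (t, y) = (\<Sum>m\<in>E. P m y * mon m t)" and B: "\<And>t y. B (t, y) = (\<Sum>m\<in>E'. P' m y * mon m t)"
    using assms unfolding poly_form_def by blast
  \<comment> \<open>Exponents add under multiplication; terms with equal exponents are collected in
    \<open>Q\<close>.\<close>
  define g where "g = (\<lambda>(m, n). \<lambda>l :: 'j. m l + n l :: nat)"
  define Q where "Q k y = (\<Sum>p\<in>{p \<in> E \<times> E'. g p = k}. P (fst p) y * P' (snd p) y)" for k y
  have "A (t, y) * B (t, y) = (\<Sum>k\<in>g ` (E \<times> E'). Q k y * mon k t)" for t y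
  proof -
    have "A (t, y) * B (t, y) = (\<Sum>p\<in>E \<times> E'. P (fst p) y * P' (snd p) y * mon (g p) t)"
      by (simp add: A B sum_product sum.cartesian_product case_prod_unfold g_def mon_add mult.assoc mult.left_commute)
    also have "\<dots> = (\<Sum>k\<in>g ` (E \<times> E'). \<Sum>p\<in>{p \<in> E \<times> E'. g p = k}. P (fst p) y * P' (snd p) y * mon (g p) t)"
      using f by (intro sum.group[symmetric]) auto
    also have "\<dots> = (\<Sum>k\<in>g ` (E \<times> E'). Q k y * mon k t)"
      unfolding Q_def sum_distrib_right by (intro sum.cong refl) auto
    finally show ?thesis .
  qed
  then show ?thesis unfolding poly_form_def using f by (intro exI[of _ "g ` (E \<times> E')"] exI[of _ Q]) auto
qed

lemma rational_quotient:
  assumes "poly_form A" "poly_form B" "\<And>p. p \<in> U \<Longrightarrow> B p \<noteq> 0"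
  shows "rational_in_fst_on U (\<lambda>p. A p / B p)"
proof -
  obtain E P E' P' where f: "finite E" "finite E'"
    and A: "\<And>t y. A (t, y) = (\<Sum>m\<in>E. P m y * mon m t)" and B: "\<And>t y. B (t, y) = (\<Sum>m\<in>E'. P' m y * mon m t)"
    using assms(1,2) unfolding poly_form_def by blast
  have A': "A (t, y) = (\<Sum>m\<in>E \<union> E'. (if m \<in> E then P m y else 0) * mon m t)"
    and B': "B (t, y) = (\<Sum>m\<in>E \<union> E'. (if m \<in> E' then P' m y else 0) * mon m t)" for t y
    using sum_extend[of "E \<union> E'" E P y t] sum_extend[of "E \<union> E'" E' P' y t] f by (simp_all add: A B)
  show ?thesis
    unfolding rational_in_fst_on_def
    by (rule exI[of _ "E \<union> E'"], rule exI[of _ "\<lambda>m y. if m \<in> E then P m y else 0"], rule exI[of _ "\<lambda>m y. if m \<in> E' then P' m y else 0"])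
      (use f assms(3) in \<open>auto simp flip: mon_def A' B'\<close>)
qed

section \<open>Real quotients representing complex functionals\<close>

context jet_setting
begin

inductive_set Pl :: "((real ^ 'j) \<times> (complex ^ 'n) \<times> (real ^ 'd) \<Rightarrow> real) set" where
  Pl_coef: "smooth_at (F0 u0, u0) c \<Longrightarrow> (\<lambda>p. c (snd p)) \<in> Pl"
| Pl_var: "(\<lambda>p. fst p $ l) \<in> Pl"
| Pl_add: "A \<in> Pl \<Longrightarrow> B \<in> Pl \<Longrightarrow> (\<lambda>p. A p + B p) \<in> Pl"
| Pl_mult: "A \<in> Pl \<Longrightarrow> B \<in> Pl \<Longrightarrow> (\<lambda>p. A p * B p) \<in> Pl"

lemma Pl_const: "(\<lambda>p. c) \<in> Pl"
  using Pl_coef[of "\<lambda>_. c"] by simp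

lemma Pl_uminus: "A \<in> Pl \<Longrightarrow> (\<lambda>p. - A p) \<in> Pl"
  using Pl_mult[OF Pl_const[of "-1"]] by fastforce

lemma Pl_diff: "A \<in> Pl \<Longrightarrow> B \<in> Pl \<Longrightarrow> (\<lambda>p. A p - B p) \<in> Pl"
  using Pl_add[OF _ Pl_uminus] by fastforce

lemma Pl_poly_form: "A \<in> Pl \<Longrightarrow> poly_form A"
proof (induction rule: Pl.induct)
  case (Pl_coef c) show ?case using poly_form_coef[of c] by (simp add: case_prod_unfold)
next
  case (Pl_var l) show ?case using poly_form_var[of l] by (simp add: case_prod_unfold)
qed (auto intro: poly_form_add poly_form_mult)

lemma Pl_smooth: "A \<in> Pl \<Longrightarrow> smooth_at (J (F0, u0)) A"
proof (induction rule: Pl.induct)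
  case (Pl_coef c)
  show ?case
    by (rule smooth_at_compose[where g=c and f=snd])
      (use Pl_coef in \<open>auto simp: J_def intro: smooth_at_linear_self bounded_linear_snd\<close>)
next
  case (Pl_var l)
  show ?case by (rule smooth_at_vec_nth) (rule smooth_at_linear_self[OF bounded_linear_fst])
qed (auto intro: smooth_at_add smooth_at_mult)

lemma Pl_nonzero: "A \<in> Pl \<Longrightarrow> A (J (F0, u0)) \<noteq> 0 \<Longrightarrow> eventually (\<lambda>x. A (J x) \<noteq> 0) FF"
proof -
  assume A: "A \<in> Pl" "A (J (F0, u0)) \<noteq> 0"
  have "((\<lambda>x. A (J x)) \<longlongrightarrow> A (J (F0, u0))) FF"
    by (rule isCont_tendsto_compose[OF smooth_at_continuous[OF Pl_smooth[OF A(1)]] filterlim_J])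
  then show ?thesis using A(2) tendsto_imp_eventually_ne by blast
qed

text \<open>Functionals are complex, but the right-hand sides of the system must be real and
  rational in real jet variables: hence separate real numerators for both parts over a common real
  denominator.\<close>

definition rep :: "((real ^ 'd \<Rightarrow> complex ^ 'n) \<times> (real ^ 'd) \<Rightarrow> complex) \<Rightarrow> bool" where
  "rep \<Theta> \<longleftrightarrow> (\<exists>A\<in>Pl. \<exists>B\<in>Pl. \<exists>Q\<in>Pl. Q (J (F0, u0)) \<noteq> 0 \<and>
     eventually (\<lambda>x. \<Theta> x * complex_of_real (Q (J x)) = Complex (A (J x)) (B (J x))) FF)"

lemma repI:
  "A \<in> Pl \<Longrightarrow> B \<in> Pl \<Longrightarrow> Q \<in> Pl \<Longrightarrow> Q (J (F0, u0)) \<noteq> 0 \<Longrightarrow>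
   eventually (\<lambda>x. \<Theta> x * complex_of_real (Q (J x)) = Complex (A (J x)) (B (J x))) FF \<Longrightarrow> rep \<Theta>"
  unfolding rep_def by blast

lemma JJ_rep: "\<Theta> \<in> JJ \<Longrightarrow> rep \<Theta>"
proof (induction rule: Rg.induct)
  case (Rg_gen \<Theta>)
  show ?case
  proof (cases "\<Theta> \<in> Cf")
    case True
    then obtain h where h: "smooth_at (F0 u0, u0) h" "\<Theta> = coef h" by (auto simp: Cf_def)
    show ?thesis
      by (rule repI[OF Pl_coef[OF smooth_at_Re[OF h(1)]] Pl_coef[OF smooth_at_Im[OF h(1)]] Pl_const[of 1]])
        (auto simp: h coef_def J_def case_prod_unfold)
  next
    case False
    then obtain "is" i where i: "length is \<le> k" "\<Theta> = pG is i" using Rg_gen by (auto simp: JG_def)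
    have "is \<noteq> []" using False pG_Nil i by auto
    then have "1 \<le> length is" by (cases "is") auto
    then obtain l where l: "\<And>F u. adm F u \<Longrightarrow> \<Theta> (F, u) = complex_of_real (fst (J (F, u)) $ l)"
      using pG_component i by blast
    show ?thesis
      by (rule repI[OF Pl_var[of l] Pl_const[of 0] Pl_const[of 1]])
        (use ev_adm in \<open>auto simp: l complex_eq_iff elim!: eventually_mono\<close>)
  qed
next
  case (Rg_const c)
  show ?case by (rule repI[OF Pl_const[of "Re c"] Pl_const[of "Im c"] Pl_const[of 1]]) auto
next
  case (Rg_add \<Theta> \<Psi>)
  then obtain A B Q A' B' Q' where P: "A \<in> Pl" "B \<in> Pl" "Q \<in> Pl" "A' \<in> Pl" "B' \<in> Pl" "Q' \<in> Pl"
    and nz: "Q (J (F0, u0)) \<noteq> 0" "Q' (J (F0, u0)) \<noteq> 0"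
    and e: "eventually (\<lambda>x. \<Theta> x * complex_of_real (Q (J x)) = Complex (A (J x)) (B (J x))) FF"
      "eventually (\<lambda>x. \<Psi> x * complex_of_real (Q' (J x)) = Complex (A' (J x)) (B' (J x))) FF"
    unfolding rep_def by blast
  show ?case
  proof (rule repI)
    show "(\<lambda>p. A p * Q' p + A' p * Q p) \<in> Pl" "(\<lambda>p. B p * Q' p + B' p * Q p) \<in> Pl" "(\<lambda>p. Q p * Q' p) \<in> Pl"
      using P by (auto intro: Pl_add Pl_mult)
    show "\<forall>\<^sub>F x in FF. (\<Theta> x + \<Psi> x) * complex_of_real (Q (J x) * Q' (J x)) =
      Complex (A (J x) * Q' (J x) + A' (J x) * Q (J x)) (B (J x) * Q' (J x) + B' (J x) * Q (J x))"
      using e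
    proof eventually_elim
      case (elim x)
      have "(\<Theta> x + \<Psi> x) * complex_of_real (Q (J x) * Q' (J x)) =
        (\<Theta> x * complex_of_real (Q (J x))) * complex_of_real (Q' (J x)) + (\<Psi> x * complex_of_real (Q' (J x))) * complex_of_real (Q (J x))"
        by (simp add: algebra_simps)
      then show ?case unfolding elim by (simp add: complex_eq_iff)
    qed
  qed (use nz in simp)
next
  case (Rg_mult \<Theta> \<Psi>)
  then obtain A B Q A' B' Q' where P: "A \<in> Pl" "B \<in> Pl" "Q \<in> Pl" "A' \<in> Pl" "B' \<in> Pl" "Q' \<in> Pl"
    and nz: "Q (J (F0, u0)) \<noteq> 0" "Q' (J (F0, u0)) \<noteq> 0"
    and e: "eventually (\<lambda>x. \<Theta> x * complex_of_real (Q (J x)) = Complex (A (J x)) (B (J x))) FF"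
      "eventually (\<lambda>x. \<Psi> x * complex_of_real (Q' (J x)) = Complex (A' (J x)) (B' (J x))) FF"
    unfolding rep_def by blast
  show ?case
  proof (rule repI)
    show "(\<lambda>p. A p * A' p - B p * B' p) \<in> Pl" "(\<lambda>p. A p * B' p + B p * A' p) \<in> Pl" "(\<lambda>p. Q p * Q' p) \<in> Pl"
      using P by (auto intro: Pl_add Pl_mult Pl_diff)
    show "\<forall>\<^sub>F x in FF. (\<Theta> x * \<Psi> x) * complex_of_real (Q (J x) * Q' (J x)) =
      Complex (A (J x) * A' (J x) - B (J x) * B' (J x)) (A (J x) * B' (J x) + B (J x) * A' (J x))"
      using e
    proof eventually_elim
      case (elim x)
      have "(\<Theta> x * \<Psi> x) * complex_of_real (Q (J x) * Q' (J x)) =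
        (\<Theta> x * complex_of_real (Q (J x))) * (\<Psi> x * complex_of_real (Q' (J x)))"
        by (simp add: algebra_simps)
      then show ?case unfolding elim by (simp add: complex_eq_iff)
    qed
  qed (use nz in simp)
next
  case (Rg_inverse \<Theta>)
  then obtain A B Q where P: "A \<in> Pl" "B \<in> Pl" "Q \<in> Pl"
    and nz: "Q (J (F0, u0)) \<noteq> 0"
    and e: "eventually (\<lambda>x. \<Theta> x * complex_of_real (Q (J x)) = Complex (A (J x)) (B (J x))) FF"
    unfolding rep_def by blast
  have "Complex (A (J (F0, u0))) (B (J (F0, u0))) \<noteq> 0"
    using ev_base_FF[OF e] nz Rg_inverse.hyps(2) by (metis mult_eq_0_iff of_real_eq_0_iff)
  then have nz2: "A (J (F0, u0)) * A (J (F0, u0)) + B (J (F0, u0)) * B (J (F0, u0)) \<noteq> 0"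
    by (simp add: complex_eq_iff sum_squares_eq_zero_iff)
  \<comment> \<open>From \<open>(A + i B) / Q\<close> one obtains the inverse
    \<open>Q (A - i B) / (A^2 + B^2)\<close>, whose denominator is again real.\<close>
  have P2: "(\<lambda>p. A p * A p + B p * B p) \<in> Pl" using P by (auto intro: Pl_add Pl_mult)
  show ?case
  proof (rule repI[OF Pl_mult[OF P(3,1)] Pl_uminus[OF Pl_mult[OF P(3,2)]] P2 nz2])
    show "\<forall>\<^sub>F x in FF. inverse (\<Theta> x) * complex_of_real (A (J x) * A (J x) + B (J x) * B (J x)) =
      Complex (Q (J x) * A (J x)) (- (Q (J x) * B (J x)))"
      using e Pl_nonzero[OF P2 nz2] Pl_nonzero[OF P(3) nz]
    proof eventually_elim
      case (elim x)
      define c where "c = Complex (A (J x)) (B (J x))"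
      have c0: "c \<noteq> 0" using elim(2) by (auto simp: c_def complex_eq_iff)
      have "\<Theta> x = c / complex_of_real (Q (J x))" using elim(1,3) by (simp add: c_def field_simps)
      then have "inverse (\<Theta> x) = complex_of_real (Q (J x)) / c" by simp
      moreover have "complex_of_real (A (J x) * A (J x) + B (J x) * B (J x)) = c * cnj c"
        by (simp add: c_def complex_eq_iff)
      ultimately have "inverse (\<Theta> x) * complex_of_real (A (J x) * A (J x) + B (J x) * B (J x)) = complex_of_real (Q (J x)) * cnj c"
        using c0 by simp
      then show ?case by (simp add: c_def complex_eq_iff)
    qed
  qed
next
  case (Rg_cong \<Theta> \<Psi>)
  then obtain A B Q where P: "A \<in> Pl" "B \<in> Pl" "Q \<in> Pl"
    and nz: "Q (J (F0, u0)) \<noteq> 0"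
    and e: "eventually (\<lambda>x. \<Theta> x * complex_of_real (Q (J x)) = Complex (A (J x)) (B (J x))) FF"
    unfolding rep_def by blast
  show ?case
    by (rule repI[OF P nz]) (use e Rg_cong.hyps(2) in eventually_elim, simp)
qed

lemma JJ_rational:
  assumes "\<Theta> \<in> JJ"
  shows "\<exists>S R. open S \<and> J (F0, u0) \<in> S \<and> (\<forall>p\<in>S. smooth_at p R) \<and> rational_in_fst_on S R \<and>
    (\<forall>F u. adm F u \<longrightarrow> J (F, u) \<in> S \<longrightarrow> Re (\<Theta> (F, u)) = R (J (F, u)))"
proof -
  obtain A B Q where P: "A \<in> Pl" "B \<in> Pl" "Q \<in> Pl"
    and nz: "Q (J (F0, u0)) \<noteq> 0"
    and e: "eventually (\<lambda>x. \<Theta> x * complex_of_real (Q (J x)) = Complex (A (J x)) (B (J x))) FF"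
    using JJ_rep[OF assms] unfolding rep_def by blast
  obtain S1 where S1: "open S1" "J (F0, u0) \<in> S1"
    "\<And>F u. adm F u \<Longrightarrow> J (F, u) \<in> S1 \<Longrightarrow> \<Theta> (F, u) * complex_of_real (Q (J (F, u))) = Complex (A (J (F, u))) (B (J (F, u)))"
    using e unfolding eventually_FF by blast
  let ?R = "\<lambda>p. A p / Q p"
  have "\<forall>\<^sub>F p in nhds (J (F0, u0)). Q p \<noteq> 0"
    using smooth_at_tendsto[OF Pl_smooth[OF P(3)]] nz tendsto_imp_eventually_ne by blast
  moreover have "\<forall>\<^sub>F p in nhds (J (F0, u0)). smooth_at p A" "\<forall>\<^sub>F p in nhds (J (F0, u0)). smooth_at p Q"
    using Pl_smooth P smooth_at_ev by blast+
  ultimately have "\<forall>\<^sub>F p in nhds (J (F0, u0)). Q p \<noteq> 0 \<and> smooth_at p ?R"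
    by eventually_elim (auto intro: smooth_at_divide)
  then obtain S2 where S2: "open S2" "J (F0, u0) \<in> S2" "\<And>p. p \<in> S2 \<Longrightarrow> Q p \<noteq> 0 \<and> smooth_at p ?R"
    unfolding eventually_nhds by blast
  have "Re (\<Theta> (F, u)) = ?R (J (F, u))" if "adm F u" "J (F, u) \<in> S1 \<inter> S2" for F u
  proof -
    have "Re (\<Theta> (F, u) * complex_of_real (Q (J (F, u)))) = A (J (F, u))"
      by (subst S1(3)) (use that in auto)
    then show ?thesis using S2(3) that by (simp add: field_simps)
  qed
  moreover have "rational_in_fst_on (S1 \<inter> S2) ?R"
    using Pl_poly_form P S2(3) by (intro rational_quotient) auto
  ultimately show ?thesis using S1 S2 by (intro exI[of _ "S1 \<inter> S2"] exI[of _ ?R]) auto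
qed

end

lemma finite_msize: "finite {\<alpha> :: 'd::finite \<Rightarrow> nat. msize \<alpha> = r}"
proof (rule finite_subset)
  show "{\<alpha> :: 'd \<Rightarrow> nat. msize \<alpha> = r} \<subseteq> PiE UNIV (\<lambda>_. {..r})"
    by (auto simp: msize_def PiE_def extensional_def intro!: member_le_sum)
qed (auto intro: finite_PiE)

lemma rational_subset: "rational_in_fst_on S R \<Longrightarrow> T \<subseteq> S \<Longrightarrow> rational_in_fst_on T R"
  unfolding rational_in_fst_on_def by blast

context cr_jets
begin

text \<open>All \<open>\<alpha>\<close> and \<open>j\<close> share one domain, an intersection of
  finitely many open sets.\<close>

theorem complete_system:
  "\<exists>S R. open S \<and> J (F0, u0) \<in> S \<and> (\<forall>\<alpha> j. msize \<alpha> = Suc k \<longrightarrow> (\<forall>p\<in>S. smooth_at p (R \<alpha> j)) \<and>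
     rational_in_fst_on S (R \<alpha> j) \<and>
     (\<forall>F u. adm F u \<longrightarrow> J (F, u) \<in> S \<longrightarrow> mpartial \<alpha> (\<lambda>w. X (F w) $ j) u = R \<alpha> j (J (F, u))))"
proof -
  let ?I = "{\<alpha> :: 'd \<Rightarrow> nat. msize \<alpha> = Suc k} \<times> (UNIV :: 'd set)"
  let ?P = "\<lambda>i S R. open S \<and> J (F0, u0) \<in> S \<and> (\<forall>p\<in>S. smooth_at p R) \<and> rational_in_fst_on S R \<and>
    (\<forall>F u. adm F u \<longrightarrow> J (F, u) \<in> S \<longrightarrow> mpartial (fst i) (\<lambda>w. X (F w) $ snd i) u = R (J (F, u)))"
  have ex: "\<exists>SR. ?P i (fst SR) (snd SR)" if i: "i \<in> ?I" for i
  proof -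
    obtain \<alpha> j where ij: "i = (\<alpha>, j)" "msize \<alpha> = Suc k" using i by auto
    obtain xs where xs: "\<forall>l. count_list xs l = \<alpha> l" using count_list_ex by blast
    then have "count_list xs = \<alpha>" by auto
    then have "length xs = Suc k" using ij msize_count[of xs] by simp
    then obtain S R where SR: "open S" "J (F0, u0) \<in> S" "\<forall>p\<in>S. smooth_at p R" "rational_in_fst_on S R"
      "\<And>F u. adm F u \<Longrightarrow> J (F, u) \<in> S \<Longrightarrow> Re (pG xs j (F, u)) = R (J (F, u))"
      using JJ_rational[OF pG_JJ[of xs j]] by auto
    have "mpartial \<alpha> (\<lambda>w. X (F w) $ j) u = R (J (F, u))" if "adm F u" "J (F, u) \<in> S" for F u
      using SR(5)[OF that] arg_cong[OF mpartial_list[OF adm_X[OF that(1), of j] xs], of Re] by (simp add: pG_def)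
    then show ?thesis using SR ij by (intro exI[of _ "(S, R)"]) auto
  qed
  define f where "f i = (SOME SR. ?P i (fst SR) (snd SR))" for i
  have f: "?P i (fst (f i)) (snd (f i))" if "i \<in> ?I" for i
    unfolding f_def by (rule someI_ex[OF ex[OF that]])
  define SS where "SS = (\<Inter>i\<in>?I. fst (f i))"
  have "finite ?I" by (intro finite_cartesian_product finite_msize finite)
  then have "open SS" unfolding SS_def using f by (intro open_INT) simp_all
  moreover have "J (F0, u0) \<in> SS" unfolding SS_def using f by simp
  moreover have "(\<forall>p\<in>SS. smooth_at p (snd (f (\<alpha>, j)))) \<and> rational_in_fst_on SS (snd (f (\<alpha>, j))) \<and>
     (\<forall>F u. adm F u \<longrightarrow> J (F, u) \<in> SS \<longrightarrow> mpartial \<alpha> (\<lambda>w. X (F w) $ j) u = snd (f (\<alpha>, j)) (J (F, u)))"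
    if "msize \<alpha> = Suc k" for \<alpha> j
  proof -
    have i: "(\<alpha>, j) \<in> ?I" using that by simp
    have sub: "SS \<subseteq> fst (f (\<alpha>, j))" unfolding SS_def by (rule INT_lower[OF i])
    show ?thesis using f[OF i] sub rational_subset[OF _ sub] by auto
  qed
  ultimately show ?thesis by (intro exI[of _ SS] exI[of _ "\<lambda>\<alpha> j. snd (f (\<alpha>, j))"] conjI allI impI) simp_all
qed

end

section \<open>Tangent and CR vectors of real hypersurfaces\<close>

definition re_vec :: "complex ^ 'd \<Rightarrow> real ^ 'd" where "re_vec K = (\<chi> i. Re (K $ i))"
definition im_vec :: "complex ^ 'd \<Rightarrow> real ^ 'd" where "im_vec K = (\<chi> i. Im (K $ i))"

lemma vf_complex:
  assumes "\<Phi> differentiable (at v)"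
  shows "vf K (\<lambda>w. \<Phi> w $ j) v = frechet_derivative \<Phi> (at v) (re_vec (K v)) $ j + \<i> * frechet_derivative \<Phi> (at v) (im_vec (K v)) $ j"
proof -
  let ?D = "frechet_derivative \<Phi> (at v)"
  have lin: "linear (\<lambda>d. ?D d $ j)"
    using linear_compose[OF linear_frechet[OF assms] bounded_linear.linear[OF bounded_linear_vec_nth]] by (simp add: o_def)
  have p: "pd i (\<lambda>w. \<Phi> w $ j) v = ?D (axis i 1) $ j" for i
    unfolding pd_def frechet_derivative_bounded_linear[OF bounded_linear_vec_nth assms] ..
  have "vf K (\<lambda>w. \<Phi> w $ j) v = (\<Sum>i\<in>UNIV. Re (K v $ i) *\<^sub>R ?D (axis i 1) $ j) + \<i> * (\<Sum>i\<in>UNIV. Im (K v $ i) *\<^sub>R ?D (axis i 1) $ j)"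
    unfolding vf_def p sum_distrib_left sum.distrib[symmetric]
    by (intro sum.cong refl) (simp add: complex_eq_iff scaleR_conv_of_real)
  also have "(\<Sum>i\<in>UNIV. Re (K v $ i) *\<^sub>R ?D (axis i 1) $ j) = ?D (re_vec (K v)) $ j"
    using real_vec_expand[OF lin, of "re_vec (K v)"] by (simp add: re_vec_def)
  also have "(\<Sum>i\<in>UNIV. Im (K v $ i) *\<^sub>R ?D (axis i 1) $ j) = ?D (im_vec (K v)) $ j"
    using real_vec_expand[OF lin, of "im_vec (K v)"] by (simp add: im_vec_def)
  finally show ?thesis .
qed

lemma smooth_map_on_has_derivative:
  assumes "smooth_map_on S h" "p \<in> S"
  shows "(h has_derivative frechet_derivative h (at p within S)) (at p within S)"
proof -
  obtain W H where W: "open W" "p \<in> W" "smooth_on W H" "\<forall>x\<in>S \<inter> W. H x = h x"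
    using assms unfolding smooth_map_on_def by blast
  have "(H has_derivative frechet_derivative H (at p)) (at p within S)"
    using smooth_at_has_derivative[OF smooth_atI[OF W(1-3)]] has_derivative_at_withinI by blast
  then have "(h has_derivative frechet_derivative H (at p)) (at p within S)"
  proof (rule has_derivative_transform_eventually)
    show "\<forall>\<^sub>F x in at p within S. H x = h x"
      unfolding eventually_at_filter using W by (auto simp: eventually_nhds)
    show "H p = h p" using W assms by auto
  qed (rule assms(2))
  then show ?thesis by (meson differentiable_def frechet_derivative_works)
qed

lemma smooth_map_on_compose:
  assumes "smooth_map_on S h" "smooth_at v \<Phi>" "\<forall>\<^sub>F w in nhds v. \<Phi> w \<in> S"
  shows "smooth_at v (\<lambda>w. h (\<Phi> w))"
proof -
  have "\<Phi> v \<in> S" using assms(3) eventually_nhds_x_imp_x by blast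
  then obtain W H where W: "open W" "\<Phi> v \<in> W" "smooth_on W H" "\<forall>x\<in>S \<inter> W. H x = h x"
    using assms(1) unfolding smooth_map_on_def by blast
  have "\<forall>\<^sub>F w in nhds v. \<Phi> w \<in> W"
    by (rule topological_tendstoD[OF smooth_at_tendsto[OF assms(2)] W(1,2)])
  with assms(3) have "\<forall>\<^sub>F w in nhds v. H (\<Phi> w) = h (\<Phi> w)"
    by eventually_elim (use W(4) in auto)
  moreover have "smooth_at v (\<lambda>w. H (\<Phi> w))"
    by (rule smooth_at_compose[OF assms(2) smooth_atI[OF W(1-3)]])
  ultimately show ?thesis by (rule smooth_at_cong_ev[THEN iffD1])
qed

lemma tangent_curve:
  fixes \<Phi> :: "real ^ 'd \<Rightarrow> complex ^ 'n"
  assumes "smooth_at v \<Phi>" "\<forall>\<^sub>F w in nhds v. \<Phi> w \<in> S"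
  shows "frechet_derivative \<Phi> (at v) \<xi> \<in> tangent_space S (\<Phi> v)"
proof -
  obtain W where W: "open W" "v \<in> W" "\<And>w. w \<in> W \<Longrightarrow> \<Phi> w \<in> S \<and> smooth_at w \<Phi>"
    using eventually_conj[OF assms(2) smooth_at_ev[OF assms(1)]] unfolding eventually_nhds by blast
  let ?l = "\<lambda>t::real. v + t *\<^sub>R \<xi>"
  have sl: "smooth_at t ?l" for t
    by (intro smooth_at_add smooth_at_const smooth_at_linear_self bounded_linear_scaleR_left)
  have "\<forall>\<^sub>F t in nhds 0. ?l t \<in> W"
    by (rule topological_tendstoD[OF smooth_at_tendsto[OF sl] W(1)]) (use W in simp)
  then obtain e where e: "e > 0" "\<And>t. dist t 0 < e \<Longrightarrow> ?l t \<in> W"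
    unfolding eventually_nhds_metric by blast
  have in_W: "?l t \<in> W" if "t \<in> {-e<..<e}" for t using that by (intro e(2)) (auto simp: dist_real_def)
  let ?\<gamma> = "\<lambda>t. \<Phi> (?l t)"
  have "smooth_on {-e<..<e} ?\<gamma>"
    unfolding smooth_on_iff_smooth_at[OF open_greaterThanLessThan]
  proof
    fix t assume "t \<in> {-e<..<e}"
    then show "smooth_at t ?\<gamma>" using W(3) in_W by (intro smooth_at_compose[OF sl]) blast
  qed
  moreover have "(?\<gamma> has_vector_derivative frechet_derivative \<Phi> (at v) \<xi>) (at 0)"
  proof -
    have 1: "(?l has_derivative (\<lambda>t. t *\<^sub>R \<xi>)) (at 0)" by (auto intro!: derivative_eq_intros)
    have 2: "(\<Phi> has_derivative frechet_derivative \<Phi> (at v)) (at (?l 0))"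
      using smooth_at_has_derivative[OF assms(1)] by simp
    have "(?\<gamma> has_derivative (\<lambda>t. frechet_derivative \<Phi> (at v) (t *\<^sub>R \<xi>))) (at 0)"
      by (rule has_derivative_compose[OF 1 2])
    then show ?thesis
      unfolding has_vector_derivative_def
      using linear_scale[OF linear_frechet[OF smooth_at_differentiable[OF assms(1)]]] by simp
  qed
  ultimately show ?thesis
    unfolding tangent_space_def using e(1) W(3) in_W by (auto intro!: exI[of _ e] exI[of _ ?\<gamma>])
qed

lemma tangent_spaceE:
  assumes "v \<in> tangent_space S p"
  obtains \<gamma> where "smooth_at 0 \<gamma>" "\<forall>\<^sub>F t in nhds 0. \<gamma> t \<in> S" "\<gamma> 0 = p" "(\<gamma> has_derivative (\<lambda>t. t *\<^sub>R v)) (at (0::real))"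
proof -
  obtain e \<gamma> where e: "e > 0" "smooth_on {-e<..<e} \<gamma>" "\<gamma> ` {-e<..<e} \<subseteq> S" "\<gamma> 0 = p" "(\<gamma> has_vector_derivative v) (at 0)"
    using assms unfolding tangent_space_def by blast
  have "smooth_at 0 \<gamma>" using e by (intro smooth_atI[of "{-e<..<e}"]) auto
  moreover have "\<forall>\<^sub>F t in nhds 0. \<gamma> t \<in> S"
    using eventually_in[of "{-e<..<e}" 0] e by (auto elim!: eventually_mono)
  ultimately show ?thesis using that e by (auto simp: has_vector_derivative_def)
qed

lemma re01_double_cnj:
  "re01 (\<chi> j. 2 * cnj (y $ j)) = y" "im01 (\<chi> j. 2 * cnj (y $ j)) = (\<chi> j. \<i> * y $ j)"
  by (simp_all add: re01_def im01_def vec_eq_iff)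

text \<open>That \<open>K\<close> kills the components of \<open>\<Phi>\<close> means that its image
  under the complexified differential is of type (0,1): the imaginary part is \<open>\<i>\<close>
  times the real part. The image is tangent to \<open>S\<close>, so \<open>h\<close> maps it to a
  (0,1) vector \<open>b\<close>, and the components of \<open>re01 b + \<i> * im01 b\<close>
  vanish.\<close>

lemma CR_map_pullback:
  fixes \<Phi> :: "real ^ 'd \<Rightarrow> complex ^ 'n"
  assumes h: "CR_map S S' h" and \<Phi>: "smooth_at v \<Phi>" "\<forall>\<^sub>F w in nhds v. \<Phi> w \<in> S"
    and K: "\<And>j. vf K (\<lambda>w. \<Phi> w $ j) v = 0"
  shows "vf K (\<lambda>w. h (\<Phi> w) $ j) v = 0"
proof -
  let ?D = "frechet_derivative \<Phi> (at v)" and ?\<xi> = "re_vec (K v)" and ?\<eta> = "im_vec (K v)"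
  \<comment> \<open>Twice the conjugate, since \<open>re01\<close> conjugates and halves; then
    \<open>re01 ?a\<close> and \<open>im01 ?a\<close> are the images of \<open>?\<xi>\<close> and
    \<open>?\<eta>\<close>.\<close>
  let ?a = "\<chi> j. 2 * cnj (?D ?\<xi> $ j)"
  let ?h = "frechet_derivative h (at (\<Phi> v) within S)"
  have v: "\<Phi> v \<in> S" using \<Phi>(2) eventually_nhds_x_imp_x by blast
  note dif = smooth_at_differentiable[OF \<Phi>(1)]
  have \<eta>: "?D ?\<eta> = (\<chi> j. \<i> * ?D ?\<xi> $ j)"
  proof (subst vec_eq_iff, rule allI)
    fix j
    have "?D ?\<xi> $ j + \<i> * ?D ?\<eta> $ j = 0" using K[of j] vf_complex[OF dif, of K j] by simp
    then have "\<i> * (?D ?\<xi> $ j + \<i> * ?D ?\<eta> $ j) = 0" by simp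
    then show "?D ?\<eta> $ j = (\<chi> j. \<i> * ?D ?\<xi> $ j) $ j" by (simp add: algebra_simps)
  qed
  have "?a \<in> CR_vectors S (\<Phi> v)"
    unfolding CR_vectors_def mem_Collect_eq re01_double_cnj \<eta>[symmetric]
    using tangent_curve[OF \<Phi>] by blast
  then obtain b where b: "?h (re01 ?a) = re01 b" "?h (im01 ?a) = im01 b"
    using h v unfolding CR_map_def by blast
  then have hb: "?h (?D ?\<xi>) = re01 b" "?h (?D ?\<eta>) = im01 b"
    unfolding re01_double_cnj \<eta>[symmetric] by auto
  obtain W where W: "open W" "v \<in> W" "\<And>w. w \<in> W \<Longrightarrow> \<Phi> w \<in> S" using \<Phi>(2) unfolding eventually_nhds by blast
  \<comment> \<open>Restricting the derivative within \<open>S\<close> to the image of an open set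
    \<open>W\<close> makes the chain rule applicable; on the source side, being within
    \<open>W\<close> is no restriction.\<close>
  have "(h has_derivative ?h) (at (\<Phi> v) within \<Phi> ` W)"
    by (rule has_derivative_subset[OF smooth_map_on_has_derivative]) (use h v W in \<open>auto simp: CR_map_def\<close>)
  moreover have "(\<Phi> has_derivative ?D) (at v within W)"
    by (rule has_derivative_at_withinI[OF smooth_at_has_derivative[OF \<Phi>(1)]])
  ultimately have "((\<lambda>w. h (\<Phi> w)) has_derivative (\<lambda>d. ?h (?D d))) (at v within W)"
    by (rule has_derivative_in_compose[rotated])
  then have D: "((\<lambda>w. h (\<Phi> w)) has_derivative (\<lambda>d. ?h (?D d))) (at v)"
    using at_within_open[OF W(2,1)] by simp
  have "vf K (\<lambda>w. h (\<Phi> w) $ j) v = ?h (?D ?\<xi>) $ j + \<i> * ?h (?D ?\<eta>) $ j"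
    by (subst vf_complex) (use D in \<open>auto simp: frechet_derivative_eqI[OF D] differentiable_def\<close>)
  then show ?thesis by (simp add: hb re01_def im01_def)
qed

lemma dzbar_of_real:
  assumes "smooth_at p \<rho>"
  shows "dzbar j (\<lambda>z. complex_of_real (\<rho> z)) p = cnj (dz j (\<lambda>z. complex_of_real (\<rho> z)) p)"
  unfolding dz_def dzbar_def frechet_derivative_bounded_linear[OF bounded_linear_of_real smooth_at_differentiable[OF assms]]
  by (simp add: complex_eq_iff)

lemma frechet_real_dz:
  assumes "smooth_at p \<rho>"
  shows "frechet_derivative \<rho> (at p) v = 2 * Re (\<Sum>j\<in>UNIV. dz j (\<lambda>z. complex_of_real (\<rho> z)) p * v $ j)"
proof -
  let ?r = "\<lambda>z. complex_of_real (\<rho> z)"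
  have d: "frechet_derivative ?r (at p) v = complex_of_real (frechet_derivative \<rho> (at p) v)" for v
    by (simp add: frechet_derivative_bounded_linear[OF bounded_linear_of_real smooth_at_differentiable[OF assms]])
  have "linear (frechet_derivative ?r (at p))"
    by (intro linear_frechet smooth_at_differentiable smooth_at_of_real assms)
  from wirtinger[OF this, of v]
  have "complex_of_real (frechet_derivative \<rho> (at p) v) = (\<Sum>j\<in>UNIV. dz j ?r p * v $ j) + (\<Sum>j\<in>UNIV. dzbar j ?r p * cnj (v $ j))"
    by (simp only: d[symmetric] dz_def dzbar_def)
  also have "(\<Sum>j\<in>UNIV. dzbar j ?r p * cnj (v $ j)) = cnj (\<Sum>j\<in>UNIV. dz j ?r p * v $ j)"
    by (simp add: dzbar_of_real[OF assms])
  finally have "Re (complex_of_real (frechet_derivative \<rho> (at p) v)) = Re ((\<Sum>j\<in>UNIV. dz j ?r p * v $ j) + cnj (\<Sum>j\<in>UNIV. dz j ?r p * v $ j))"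
    by simp
  then show ?thesis by simp
qed

lemma vf_defining:
  assumes F: "smooth_at v F" and \<rho>: "smooth_at (F v) \<rho>" and z: "\<forall>\<^sub>F w in nhds v. \<rho> (F w) = (0::real)"
  shows "(\<Sum>j\<in>UNIV. dz j (\<lambda>z. complex_of_real (\<rho> z)) (F v) * vf K (\<lambda>w. F w $ j) v) +
    (\<Sum>j\<in>UNIV. cnj (dz j (\<lambda>z. complex_of_real (\<rho> z)) (F v)) * vf K (\<lambda>w. cnj (F w $ j)) v) = 0"
proof -
  have "vf K (\<lambda>w. complex_of_real (\<rho> (F w))) v = vf K (\<lambda>w. 0) v"
    by (rule vf_cong_ev) (use z in \<open>auto elim: eventually_mono\<close>)
  then show ?thesis
    using vf_chain_amb[OF F smooth_at_of_real[OF \<rho>], of K] by (simp add: dzbar_of_real[OF \<rho>])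
qed

section \<open>Words of vector fields on sums and products\<close>

lemma foldr_vf_cong_ev: "\<forall>\<^sub>F v in nhds u. f v = g v \<Longrightarrow> \<forall>\<^sub>F v in nhds u. foldr vf Ks f v = foldr vf Ks g v"
  by (induction Ks) (auto intro: vf_cong_ev')

lemma foldr_vf_smooth: "\<forall>K\<in>set Ks. smooth_at u K \<Longrightarrow> smooth_at u g \<Longrightarrow> smooth_at u (foldr vf Ks g)"
  by (induction Ks) (auto intro: smooth_at_vf)

lemma foldr_vf_lincomb:
  assumes "finite I" "\<And>i. i \<in> I \<Longrightarrow> smooth_at u (g i)" "\<forall>K\<in>set Ks. smooth_at u K"
  shows "foldr vf Ks (\<lambda>v. \<Sum>i\<in>I. c i * g i v) u = (\<Sum>i\<in>I. c i * foldr vf Ks (g i) u)"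
  using assms(2,3)
proof (induction Ks arbitrary: u)
  case (Cons K Ks)
  have "\<forall>\<^sub>F v in nhds u. \<forall>i\<in>I. smooth_at v (g i)"
    using Cons.prems(1) by (subst eventually_ball_finite_distrib[OF assms(1)]) (auto intro: smooth_at_ev)
  moreover have "\<forall>\<^sub>F v in nhds u. \<forall>K\<in>set Ks. smooth_at v K"
    using Cons.prems(2) by (subst eventually_ball_finite_distrib[OF finite_set]) (auto intro: smooth_at_ev)
  ultimately have "\<forall>\<^sub>F v in nhds u. foldr vf Ks (\<lambda>v. \<Sum>i\<in>I. c i * g i v) v = (\<Sum>i\<in>I. c i * foldr vf Ks (g i) v)"
    by eventually_elim (auto intro: Cons.IH)
  from vf_cong_ev[OF this, of K]
  have "foldr vf (K # Ks) (\<lambda>v. \<Sum>i\<in>I. c i * g i v) u = vf K (\<lambda>v. \<Sum>i\<in>I. c i * foldr vf Ks (g i) v) u" by simp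
  also have "\<dots> = (\<Sum>i\<in>I. vf K (\<lambda>v. c i * foldr vf Ks (g i) v) u)"
    using Cons.prems by (intro vf_sum smooth_at_mult smooth_at_const foldr_vf_smooth) auto
  also have "\<dots> = (\<Sum>i\<in>I. c i * foldr vf (K # Ks) (g i) u)"
    using Cons.prems by (intro sum.cong refl) (simp add: vf_cmult foldr_vf_smooth)
  finally show ?case .
qed simp

text \<open>By Leibniz the smooth germs annihilated at \<open>u\<close> by all words of length at
  most \<open>n\<close> form an ideal; thus nondegeneracy survives multiplication by a nonvanishing
  factor.\<close>

lemma foldr_vf_ideal:
  assumes "\<And>K. K \<in> B \<Longrightarrow> smooth_at u K"
    and "smooth_at u a" "smooth_at u h" "\<And>Ks. set Ks \<subseteq> B \<Longrightarrow> length Ks \<le> n \<Longrightarrow> foldr vf Ks h u = 0"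
    and "set Ks \<subseteq> B" "length Ks \<le> n"
  shows "foldr vf Ks (\<lambda>v. a v * h v) u = 0"
  using assms(2-)
proof (induction n arbitrary: a h Ks)
  case 0 then show ?case using 0(3)[of "[]"] by simp
next
  case (Suc n)
  show ?case
  proof (cases Ks rule: rev_cases)
    case Nil then show ?thesis using Suc.prems(3)[of "[]"] by simp
  next
    case (snoc Ls K)
    have K: "K \<in> B" "set Ls \<subseteq> B" "length Ls \<le> n" using snoc Suc.prems by auto
    have sm: "smooth_at u (\<lambda>v. vf K a v * h v)" "smooth_at u (\<lambda>v. a v * vf K h v)"
      using Suc.prems assms(1)[OF K(1)] by (auto intro!: smooth_at_mult smooth_at_vf)
    have "\<forall>\<^sub>F v in nhds u. vf K (\<lambda>v. a v * h v) v = (\<Sum>i\<in>{True, False}. 1 * (if i then (\<lambda>v. vf K a v * h v) else (\<lambda>v. a v * vf K h v)) v)"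
      using smooth_at_ev[OF Suc.prems(1)] smooth_at_ev[OF Suc.prems(2)] by eventually_elim (simp add: vf_mult)
    from eventually_nhds_x_imp_x[OF foldr_vf_cong_ev[OF this, of Ls]]
    have "foldr vf Ks (\<lambda>v. a v * h v) u = foldr vf Ls (\<lambda>v. \<Sum>i\<in>{True, False}. 1 * (if i then (\<lambda>v. vf K a v * h v) else (\<lambda>v. a v * vf K h v)) v) u"
      by (simp add: snoc)
    also have "\<dots> = (\<Sum>i\<in>{True, False}. 1 * foldr vf Ls (if i then (\<lambda>v. vf K a v * h v) else (\<lambda>v. a v * vf K h v)) u)"
      by (rule foldr_vf_lincomb) (use sm K assms(1) in auto)
    also have "\<dots> = foldr vf Ls (\<lambda>v. vf K a v * h v) u + foldr vf Ls (\<lambda>v. a v * vf K h v) u" by simp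
    also have "foldr vf Ls (\<lambda>v. vf K a v * h v) u = 0"
      by (rule Suc.IH) (use Suc.prems K assms(1) in \<open>auto intro: smooth_at_vf\<close>)
    also have "foldr vf Ls (\<lambda>v. a v * vf K h v) u = 0"
    proof (rule Suc.IH[OF Suc.prems(1) _ _ K(2,3)])
      show "smooth_at u (vf K h)" using Suc.prems assms(1)[OF K(1)] by (intro smooth_at_vf)
      fix Ks' assume "set Ks' \<subseteq> B" "length Ks' \<le> n"
      then show "foldr vf Ks' (vf K h) u = 0" using Suc.prems(3)[of "Ks' @ [K]"] K by simp
    qed
    finally show ?thesis by simp
  qed
qed

lemma ops_word:
  "ops b is \<alpha> = foldr vf (concat (map (\<lambda>i. replicate (\<alpha> i) (b i)) is))"
proof
  fix g show "ops b is \<alpha> g = foldr vf (concat (map (\<lambda>i. replicate (\<alpha> i) (b i)) is)) g"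
    by (induction "is") (auto simp: ops_def)
qed

lemma word_upt:
  "set (concat (map (\<lambda>i. replicate (\<alpha> i) (b i)) [0..<m])) \<subseteq> b ` {..<m}"
  "length (concat (map (\<lambda>i. replicate (\<alpha> i) (b i)) [0..<m])) = (\<Sum>i<m. \<alpha> i)"
proof -
  show "set (concat (map (\<lambda>i. replicate (\<alpha> i) (b i)) [0..<m])) \<subseteq> b ` {..<m}" by auto
  show "length (concat (map (\<lambda>i. replicate (\<alpha> i) (b i)) [0..<m])) = (\<Sum>i<m. \<alpha> i)"
    by (simp add: length_concat o_def interv_sum_list_conv_sum_set_nat atLeast0LessThan)
qed

lemma smooth_at_deriv_along:
  fixes \<Phi> :: "'a::euclidean_space \<Rightarrow> 'b::euclidean_space" and X :: "'b \<Rightarrow> 'c::euclidean_space"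
  assumes "smooth_at u \<Phi>" "smooth_at (\<Phi> u) X" "smooth_at u y"
  shows "smooth_at u (\<lambda>u. frechet_derivative X (at (\<Phi> u)) (y u))"
proof -
  have "smooth_at u (\<lambda>u. \<Sum>c\<in>Basis. (y u \<bullet> c) *\<^sub>R frechet_derivative X (at (\<Phi> u)) c)"
  proof (rule smooth_at_sum)
    fix c :: 'b
    show "smooth_at u (\<lambda>u. (y u \<bullet> c) *\<^sub>R frechet_derivative X (at (\<Phi> u)) c)"
      by (rule smooth_at_bilinear[OF bounded_bilinear_scaleR smooth_at_linear[OF bounded_linear_inner_left assms(3)]
            smooth_at_compose[OF assms(1) smooth_at_deriv[OF assms(2)]]])
  qed
  moreover have "\<forall>\<^sub>F w in nhds u. smooth_at (\<Phi> w) X"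
    using filterlim_iff[THEN iffD1, OF smooth_at_tendsto[OF assms(1)]] smooth_at_ev[OF assms(2)] by blast
  then have "\<forall>\<^sub>F w in nhds u. (\<Sum>c\<in>Basis. (y w \<bullet> c) *\<^sub>R frechet_derivative X (at (\<Phi> w)) c) = frechet_derivative X (at (\<Phi> w)) (y w)"
    by eventually_elim (rule linear_expand_Basis[OF linear_frechet[OF smooth_at_differentiable], symmetric])
  ultimately show ?thesis by (rule smooth_at_cong_ev[THEN iffD1, rotated])
qed

lemma bounded_linear_re01: "bounded_linear (re01 :: complex ^ 'n::finite \<Rightarrow> complex ^ 'n)"
  and bounded_linear_im01: "bounded_linear (im01 :: complex ^ 'n::finite \<Rightarrow> complex ^ 'n)"
  unfolding linear_conv_bounded_linear[symmetric]
  by (auto intro!: linearI simp: re01_def im01_def vec_eq_iff complex_eq_iff add_divide_distrib distrib_left)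

section \<open>Frames on a nondegenerate hypersurface\<close>

text \<open>The chart \<open>x\<close> is only meaningful on \<open>A\<close>; \<open>X\<close>
  extends it smoothly to an ambient neighbourhood, so that it can be differentiated in ambient
  directions.\<close>

locale hypersurface_chart =
  fixes M :: "(complex ^ 'n::finite) set" and p0 :: "complex ^ 'n" and A :: "(complex ^ 'n) set"
    and x :: "complex ^ 'n \<Rightarrow> real ^ 'd::finite" and U :: "(complex ^ 'n) set" and \<rho> :: "complex ^ 'n \<Rightarrow> real"
    and L :: "nat \<Rightarrow> complex ^ 'n \<Rightarrow> complex ^ 'n" and W :: "(complex ^ 'n) set" and X :: "complex ^ 'n \<Rightarrow> real ^ 'd" and k0 m :: nat
  assumes m_eq: "m = CARD('n) - 1" and card_n: "CARD('n) \<ge> 2" and card_d: "CARD('d) = 2 * CARD('n) - 1"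
    and chart: "local_coords M p0 A x" and defining: "defining_function M p0 U \<rho>"
    and frame: "CR_frame M U m L"
    and span: "vec.span {(\<chi> j. CR_derivs m L \<alpha> (dz j (\<lambda>z. complex_of_real (\<rho> z))) p0) | \<alpha>.
                    (\<Sum>i<m. \<alpha> i) \<le> k0} = UNIV"
    and W: "open W" "p0 \<in> W" "smooth_on W X" "\<And>y. y \<in> A \<Longrightarrow> y \<in> W \<Longrightarrow> X y = x y"
begin

abbreviation "\<phi> \<equiv> inv_into A x"
abbreviation "u0 \<equiv> x p0"
abbreviation "z j \<equiv> (\<lambda>u. \<phi> u $ j)"
abbreviation "\<rho>c \<equiv> (\<lambda>z. complex_of_real (\<rho> z))"

definition "\<Omega>1 = {u \<in> x ` A. \<phi> u \<in> U \<inter> W}"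

lemma A_facts: "openin (top_of_set M) A" "p0 \<in> A" "inj_on x A" "open (x ` A)" "smooth_on (x ` A) \<phi>"
  using chart by (auto simp: local_coords_def)

lemma A_sub: "A \<subseteq> M" using A_facts(1) openin_imp_subset by blast

lemma U_facts: "open U" "p0 \<in> U" "smooth_on U \<rho>" "M \<inter> U = {z \<in> U. \<rho> z = 0}" "frechet_derivative \<rho> (at p0) \<noteq> (\<lambda>v. 0)"
  using defining by (auto simp: defining_function_def)

lemma \<phi>_x: "y \<in> A \<Longrightarrow> \<phi> (x y) = y" using A_facts(3) by simp

lemma x_\<phi>: "u \<in> x ` A \<Longrightarrow> x (\<phi> u) = u" "u \<in> x ` A \<Longrightarrow> \<phi> u \<in> A"
  by (auto simp: f_inv_into_f inv_into_into)

lemma smooth_\<phi>: "u \<in> x ` A \<Longrightarrow> smooth_at u \<phi>"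
  using A_facts by (blast intro: smooth_atI)

lemma open_\<Omega>1: "open \<Omega>1"
proof -
  have "open (x ` A \<inter> \<phi> -` (U \<inter> W))"
    by (intro continuous_open_preimage smooth_on_continuous A_facts open_Int U_facts W)
  then show ?thesis by (simp add: \<Omega>1_def vimage_def Int_def)
qed

lemma u0: "u0 \<in> \<Omega>1"
  using A_facts(2) U_facts(2) W(2) by (auto simp: \<Omega>1_def \<phi>_x)

lemma \<Omega>1D: "u \<in> \<Omega>1 \<Longrightarrow> u \<in> x ` A" "u \<in> \<Omega>1 \<Longrightarrow> \<phi> u \<in> U" "u \<in> \<Omega>1 \<Longrightarrow> \<phi> u \<in> W" "u \<in> \<Omega>1 \<Longrightarrow> \<phi> u \<in> M"
    "u \<in> \<Omega>1 \<Longrightarrow> smooth_at u \<phi>" "u \<in> \<Omega>1 \<Longrightarrow> smooth_at (\<phi> u) X" "u \<in> \<Omega>1 \<Longrightarrow> smooth_at (\<phi> u) \<rho>"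
    "u \<in> \<Omega>1 \<Longrightarrow> X (\<phi> u) = u" "u \<in> \<Omega>1 \<Longrightarrow> \<rho> (\<phi> u) = 0"
proof -
  assume u: "u \<in> \<Omega>1"
  then show 1: "u \<in> x ` A" "\<phi> u \<in> U" "\<phi> u \<in> W" by (auto simp: \<Omega>1_def)
  then show "\<phi> u \<in> M" "smooth_at u \<phi>" using A_sub x_\<phi> smooth_\<phi> by blast+
  show "smooth_at (\<phi> u) X" "smooth_at (\<phi> u) \<rho>" using 1 W U_facts by (blast intro: smooth_atI)+
  show "X (\<phi> u) = u" using W(4)[of "\<phi> u"] 1 x_\<phi> by simp
  have "\<phi> u \<in> M \<inter> U" using 1 \<open>\<phi> u \<in> M\<close> by simp
  then show "\<rho> (\<phi> u) = 0" unfolding U_facts(4) by simp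
qed

lemma ev_\<Omega>1: "u \<in> \<Omega>1 \<Longrightarrow> \<forall>\<^sub>F w in nhds u. w \<in> \<Omega>1"
  by (rule eventually_in[OF open_\<Omega>1])

lemma ev_M:
  assumes "u \<in> \<Omega>1" shows "\<forall>\<^sub>F w in nhds u. \<phi> w \<in> M"
  using ev_\<Omega>1[OF assms] by (rule eventually_mono) (rule \<Omega>1D)

text \<open>Along a curve in \<open>M\<close> through the point, \<open>\<phi> \<circ> X\<close> is
  the identity; this is differentiated at time 0.\<close>

lemma tangent_param:
  assumes u: "u \<in> \<Omega>1" and v: "v \<in> tangent_space M (\<phi> u)"
  shows "frechet_derivative \<phi> (at u) (frechet_derivative X (at (\<phi> u)) v) = v"
proof -
  obtain \<gamma> where g: "smooth_at 0 \<gamma>" "\<forall>\<^sub>F t in nhds 0. \<gamma> t \<in> M" "\<gamma> 0 = \<phi> u" "(\<gamma> has_derivative (\<lambda>t. t *\<^sub>R v)) (at (0::real))"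
    using tangent_spaceE[OF v] by blast
  obtain OA where OA: "open OA" "A = M \<inter> OA" using A_facts(1) openin_open by blast
  have "\<phi> u \<in> OA \<inter> W" using OA x_\<phi>(2)[OF \<Omega>1D(1)[OF u]] \<Omega>1D(3)[OF u] by blast
  then have "\<forall>\<^sub>F t in nhds 0. \<gamma> t \<in> OA \<inter> W"
    using topological_tendstoD[OF smooth_at_tendsto[OF g(1)], of "OA \<inter> W"] OA(1) W(1) g(3) by auto
  with g(2) have ev: "\<forall>\<^sub>F t in nhds 0. \<phi> (X (\<gamma> t)) = \<gamma> t"
    by eventually_elim (use OA(2) W(4) \<phi>_x in auto)
  have "((\<lambda>t. X (\<gamma> t)) has_derivative (\<lambda>t. frechet_derivative X (at (\<phi> u)) (t *\<^sub>R v))) (at 0)"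
    using has_derivative_compose[OF g(4), of X] smooth_at_has_derivative[OF \<Omega>1D(6)[OF u]] by (simp add: g(3))
  from has_derivative_compose[OF this, of \<phi>] smooth_at_has_derivative[OF \<Omega>1D(5)[OF u]]
  have "((\<lambda>t. \<phi> (X (\<gamma> t))) has_derivative (\<lambda>t. frechet_derivative \<phi> (at u) (frechet_derivative X (at (\<phi> u)) (t *\<^sub>R v)))) (at 0)"
    by (simp add: g(3) \<Omega>1D(8)[OF u])
  then have "(\<gamma> has_derivative (\<lambda>t. frechet_derivative \<phi> (at u) (frechet_derivative X (at (\<phi> u)) (t *\<^sub>R v)))) (at 0)"
    using has_derivative_cong_nhds[OF ev] by blast
  from fun_cong[OF has_derivative_unique[OF this g(4)], of 1] show ?thesis by simp
qed

lemma d\<rho>_tangent: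
  assumes u: "u \<in> \<Omega>1" and v: "v \<in> tangent_space M (\<phi> u)"
  shows "frechet_derivative \<rho> (at (\<phi> u)) v = 0"
proof -
  have "((\<lambda>w. \<rho> (\<phi> w)) has_derivative (\<lambda>d. frechet_derivative \<rho> (at (\<phi> u)) (frechet_derivative \<phi> (at u) d))) (at u)"
    by (rule has_derivative_compose[OF smooth_at_has_derivative[OF \<Omega>1D(5)[OF u]] smooth_at_has_derivative[OF \<Omega>1D(7)[OF u]]])
  moreover have "\<forall>\<^sub>F w in nhds u. \<rho> (\<phi> w) = 0" using ev_\<Omega>1[OF u] by (rule eventually_mono) (rule \<Omega>1D)
  then have "((\<lambda>w. \<rho> (\<phi> w)) has_derivative (\<lambda>d. 0)) (at u)"
    using has_derivative_cong_nhds[of "\<lambda>w. \<rho> (\<phi> w)" "\<lambda>w. 0" u] by simp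
  ultimately have "(\<lambda>d. frechet_derivative \<rho> (at (\<phi> u)) (frechet_derivative \<phi> (at u) d)) = (\<lambda>d. 0)"
    by (rule has_derivative_unique)
  from fun_cong[OF this, of "frechet_derivative X (at (\<phi> u)) v"] show ?thesis
    by (simp add: tangent_param[OF u v])
qed

lemma \<phi>_u0: "\<phi> u0 = p0" using A_facts(2) by (rule \<phi>_x)

text \<open>A dimension count: the differential of the parametrization is injective, so its image
  has dimension \<open>CARD('d) = 2 * CARD('n) - 1\<close>; it lies in the kernel of a nonzero real
  functional and must fill it.\<close>

lemma ker_tangent:
  assumes "frechet_derivative \<rho> (at p0) v = 0"
  shows "v \<in> tangent_space M p0" "\<exists>\<xi>. v = frechet_derivative \<phi> (at u0) \<xi>"
proof -
  let ?D = "frechet_derivative \<phi> (at u0)" and ?R = "frechet_derivative \<rho> (at p0)"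
  have linD: "linear ?D" by (rule linear_frechet[OF smooth_at_differentiable[OF \<Omega>1D(5)[OF u0]]])
  have linR: "linear ?R"
    using linear_frechet[OF smooth_at_differentiable[OF \<Omega>1D(7)[OF u0]]] by (simp add: \<phi>_u0)
  have "((\<lambda>w. X (\<phi> w)) has_derivative (\<lambda>d. frechet_derivative X (at (\<phi> u0)) (?D d))) (at u0)"
    by (rule has_derivative_compose[OF smooth_at_has_derivative[OF \<Omega>1D(5)[OF u0]] smooth_at_has_derivative[OF \<Omega>1D(6)[OF u0]]])
  moreover have "\<forall>\<^sub>F w in nhds u0. X (\<phi> w) = w" using ev_\<Omega>1[OF u0] by (rule eventually_mono) (rule \<Omega>1D)
  then have "((\<lambda>w. X (\<phi> w)) has_derivative (\<lambda>d. d)) (at u0)"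
    using has_derivative_cong_nhds[of "\<lambda>w. X (\<phi> w)" "\<lambda>w. w" u0] by simp
  ultimately have "(\<lambda>d. frechet_derivative X (at (\<phi> u0)) (?D d)) = (\<lambda>d. d)"
    by (rule has_derivative_unique)
  then have inj: "inj ?D" by (metis injI)
  let ?T = "range ?D" and ?K = "{v. ?R v = 0}"
  have sT: "subspace ?T" using linear_subspace_image[OF linD subspace_UNIV] .
  have sK: "subspace ?K" using linear_subspace_kernel[OF linR] .
  have T_tan: "?T \<subseteq> tangent_space M p0"
    using tangent_curve[OF \<Omega>1D(5)[OF u0] ev_M[OF u0]] by (auto simp: \<phi>_u0)
  have T_K: "?T \<subseteq> ?K"
    using T_tan d\<rho>_tangent[OF u0] by (auto simp: \<phi>_u0)
  have "dim ?T = CARD('d)"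
    using dim_image_eq[OF linD, of UNIV] inj by simp
  moreover have "dim ?K < DIM(complex ^ 'n)"
  proof -
    have "?K \<noteq> UNIV" using U_facts(5) by (auto simp: fun_eq_iff)
    then have "span ?K \<noteq> UNIV" by (subst span_eq_iff[THEN iffD2, OF sK])
    then have "dim ?K \<noteq> DIM(complex ^ 'n)" using dim_eq_full by blast
    then show ?thesis using dim_subset_UNIV[of ?K] by simp
  qed
  ultimately have "dim ?K \<le> dim ?T" using card_d card_n by simp
  then have "?T = ?K" using subspace_dim_equal[OF sT sK T_K] by simp
  then show "v \<in> tangent_space M p0" "\<exists>\<xi>. v = ?D \<xi>" using assms T_tan by blast+
qed

definition w :: "'n \<Rightarrow> real ^ 'd \<Rightarrow> complex" where "w j u = dz j \<rho>c (\<phi> u)"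

definition a :: "nat \<Rightarrow> real ^ 'd \<Rightarrow> complex ^ 'n" where "a l u = L l (\<phi> u)"

text \<open>The CR field \<open>L l\<close> read in the chart: its real and imaginary parts are
  pushed forward by the differential of \<open>X\<close>.\<close>

definition b :: "nat \<Rightarrow> 'd field" where
  "b l u = (\<chi> i. Complex (frechet_derivative X (at (\<phi> u)) (re01 (a l u)) $ i) (frechet_derivative X (at (\<phi> u)) (im01 (a l u)) $ i))"

lemma smooth_w: "u \<in> \<Omega>1 \<Longrightarrow> smooth_at u (w j)"
  unfolding w_def[abs_def]
  by (rule smooth_at_compose[OF \<Omega>1D(5) smooth_dz(1)[OF smooth_at_of_real[OF \<Omega>1D(7)]]])

lemma smooth_L: "l < m \<Longrightarrow> y \<in> U \<Longrightarrow> smooth_at y (L l)"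
  using frame U_facts(1) unfolding CR_frame_def by (blast intro: smooth_atI)

lemma smooth_a: "l < m \<Longrightarrow> u \<in> \<Omega>1 \<Longrightarrow> smooth_at u (a l)"
  unfolding a_def[abs_def] by (rule smooth_at_compose[OF \<Omega>1D(5) smooth_L[OF _ \<Omega>1D(2)]])

lemma smooth_b:
  assumes "l < m" "u \<in> \<Omega>1" shows "smooth_at u (b l)"
proof -
  have re: "smooth_at u (\<lambda>u. frechet_derivative X (at (\<phi> u)) (re01 (a l u)))"
    and im: "smooth_at u (\<lambda>u. frechet_derivative X (at (\<phi> u)) (im01 (a l u)))"
    by (rule smooth_at_deriv_along[OF \<Omega>1D(5)[OF assms(2)] \<Omega>1D(6)[OF assms(2)]
         smooth_at_linear[OF bounded_linear_re01 smooth_a[OF assms]]],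
       rule smooth_at_deriv_along[OF \<Omega>1D(5)[OF assms(2)] \<Omega>1D(6)[OF assms(2)]
         smooth_at_linear[OF bounded_linear_im01 smooth_a[OF assms]]])
  have "smooth_at u (\<lambda>u. complex_of_real (frechet_derivative X (at (\<phi> u)) (re01 (a l u)) $ i) +
      \<i> * complex_of_real (frechet_derivative X (at (\<phi> u)) (im01 (a l u)) $ i))" for i
    by (intro smooth_at_add smooth_at_mult smooth_at_const smooth_at_of_real smooth_at_vec_nth[OF re] smooth_at_vec_nth[OF im])
  then show ?thesis
    by (subst smooth_at_vec_iff) (simp add: b_def Complex_eq)
qed

lemma a_CR: "l < m \<Longrightarrow> u \<in> \<Omega>1 \<Longrightarrow> a l u \<in> CR_vectors M (\<phi> u)"
proof -
  assume l: "l < m" and u: "u \<in> \<Omega>1"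
  have "vec.span ((\<lambda>i. L i (\<phi> u)) ` {..<m}) = CR_vectors M (\<phi> u)"
    using frame \<Omega>1D[OF u] unfolding CR_frame_def by blast
  moreover have "a l u \<in> vec.span ((\<lambda>i. L i (\<phi> u)) ` {..<m})"
    using l by (intro vec.span_base) (auto simp: a_def)
  ultimately show ?thesis by simp
qed

lemma b_z:
  assumes "l < m" "u \<in> \<Omega>1"
  shows "vf (b l) (z j) u = 0" "vf (b l) (\<lambda>u. cnj (z j u)) u = a l u $ j"
proof -
  let ?D = "frechet_derivative \<phi> (at u)"
  note dif = smooth_at_differentiable[OF \<Omega>1D(5)[OF assms(2)]]
  have tan: "re01 (a l u) \<in> tangent_space M (\<phi> u)" "im01 (a l u) \<in> tangent_space M (\<phi> u)"
    using a_CR[OF assms] by (auto simp: CR_vectors_def)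
  have re: "re_vec (b l u) = frechet_derivative X (at (\<phi> u)) (re01 (a l u))"
    and im: "im_vec (b l u) = frechet_derivative X (at (\<phi> u)) (im01 (a l u))"
    by (simp_all add: re_vec_def im_vec_def b_def vec_eq_iff)
  have re': "re_vec (cnjf (b l) u) = frechet_derivative X (at (\<phi> u)) (re01 (a l u))"
    and im': "im_vec (cnjf (b l) u) = - frechet_derivative X (at (\<phi> u)) (im01 (a l u))"
    by (simp_all add: re_vec_def im_vec_def b_def cnjf_def vec_eq_iff)
  show "vf (b l) (z j) u = 0"
    unfolding vf_complex[OF dif] re im tangent_param[OF assms(2) tan(1)] tangent_param[OF assms(2) tan(2)]
    by (simp add: re01_def im01_def)
  have "vf (cnjf (b l)) (z j) u = cnj (a l u $ j)"
    unfolding vf_complex[OF dif] re' im' linear_neg[OF linear_frechet[OF dif]] tangent_param[OF assms(2) tan(1)] tangent_param[OF assms(2) tan(2)]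
    by (simp add: re01_def im01_def)
  then show "vf (b l) (\<lambda>u. cnj (z j u)) u = a l u $ j"
    by (simp add: vf_cnj smooth_at_vec_nth \<Omega>1D[OF assms(2)])
qed

lemma w_relation:
  assumes "u \<in> \<Omega>1"
  shows "(\<Sum>j\<in>UNIV. w j u * vf K (z j) u) + (\<Sum>j\<in>UNIV. cnj (w j u) * vf K (\<lambda>u. cnj (z j u)) u) = 0"
  unfolding w_def
proof (rule vf_defining[OF \<Omega>1D(5)[OF assms] \<Omega>1D(7)[OF assms]])
  show "\<forall>\<^sub>F w in nhds u. \<rho> (\<phi> w) = 0" using ev_\<Omega>1[OF assms] by (rule eventually_mono) (rule \<Omega>1D)
qed

text \<open>When \<open>\<rho> \<circ> \<phi> = 0\<close> is differentiated along a (1,0) field, the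
  conjugate terms drop out.\<close>

lemma w_zero_one:
  assumes "u \<in> \<Omega>1" "\<And>j. vf K (z j) u = 0"
  shows "(\<Sum>j\<in>UNIV. w j u * vf (cnjf K) (z j) u) = 0"
proof -
  have "vf (cnjf K) (\<lambda>u. cnj (z j u)) u = 0" for j
    using assms by (simp add: vf_cnj smooth_at_vec_nth \<Omega>1D)
  then show ?thesis using w_relation[OF assms(1), of "cnjf K"] by simp
qed

lemma vf_b_comp:
  assumes "l < m" "u \<in> \<Omega>1" "smooth_at (\<phi> u) g"
  shows "vf (b l) (\<lambda>u. g (\<phi> u)) u = CR_deriv (L l) g (\<phi> u)"
  using vf_chain_amb[OF \<Omega>1D(5)[OF assms(2)] assms(3), of "b l"] b_z[OF assms(1,2)]
  by (simp add: CR_deriv_def a_def mult.commute)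

text \<open>Smoothness on all of \<open>U\<close> is carried along, since each induction step
  differentiates the previous function in the ambient space.\<close>

lemma ops_CR_derivs:
  assumes "\<forall>i\<in>set is. i < m" "\<And>y. y \<in> U \<Longrightarrow> smooth_at y g"
  shows "(\<forall>y\<in>U. smooth_at y (foldr (\<lambda>i. CR_deriv (L i) ^^ \<alpha> i) is g)) \<and>
    (\<forall>u\<in>\<Omega>1. ops b is \<alpha> (\<lambda>u. g (\<phi> u)) u = foldr (\<lambda>i. CR_deriv (L i) ^^ \<alpha> i) is g (\<phi> u))"
  using assms(1)
proof (induction "is")
  case Nil then show ?case using assms(2) by (simp add: ops_def)
next
  case (Cons i xs)
  let ?h = "foldr (\<lambda>i. CR_deriv (L i) ^^ \<alpha> i) xs g"
  have i: "i < m" using Cons.prems by simp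
  have "(\<forall>y\<in>U. smooth_at y ((CR_deriv (L i) ^^ r) ?h)) \<and>
     (\<forall>u\<in>\<Omega>1. (vf (b i) ^^ r) (ops b xs \<alpha> (\<lambda>u. g (\<phi> u))) u = (CR_deriv (L i) ^^ r) ?h (\<phi> u))" for r
  proof (induction r)
    case 0 then show ?case using Cons by simp
  next
    case (Suc r)
    let ?h' = "(CR_deriv (L i) ^^ r) ?h"
    have "smooth_at y (CR_deriv (L i) ?h')" if "y \<in> U" for y
      unfolding CR_deriv_def[of "L i" ?h'] using that Suc smooth_L[OF i that]
      by (intro smooth_at_sum smooth_at_mult smooth_at_vec_nth smooth_dz) auto
    moreover have "vf (b i) ((vf (b i) ^^ r) (ops b xs \<alpha> (\<lambda>u. g (\<phi> u)))) u = CR_deriv (L i) ?h' (\<phi> u)" if u: "u \<in> \<Omega>1" for u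
    proof -
      have "vf (b i) ((vf (b i) ^^ r) (ops b xs \<alpha> (\<lambda>u. g (\<phi> u)))) u = vf (b i) (\<lambda>u. ?h' (\<phi> u)) u"
        by (rule vf_cong_on[OF open_\<Omega>1 _ u]) (use Suc in blast)
      also have "\<dots> = CR_deriv (L i) ?h' (\<phi> u)"
        by (rule vf_b_comp[OF i u]) (use Suc \<Omega>1D(2)[OF u] in blast)
      finally show ?thesis .
    qed
    ultimately show ?case by simp
  qed
  from this[of "\<alpha> i"] show ?case by (simp add: ops_def)
qed

text \<open>The dual form of the spanning condition: the vectors annihilated by the functional
  \<open>c\<close> form a complex subspace containing a spanning set.\<close>

lemma w_independent:
  assumes "\<And>\<alpha>. (\<Sum>i<m. \<alpha> i) \<le> k0 \<Longrightarrow> (\<Sum>j\<in>UNIV. c j * ops b [0..<m] \<alpha> (w j) u0) = 0"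
  shows "c j = 0"
proof -
  let ?S = "{y :: complex ^ 'n. (\<Sum>j\<in>UNIV. c j * y $ j) = 0}"
  have S: "vec.subspace ?S"
    by (auto simp: vec.subspace_def distrib_left sum.distrib mult.left_commute[of _ "_ :: complex"] simp flip: sum_distrib_left)
  have "{(\<chi> j. CR_derivs m L \<alpha> (dz j \<rho>c) p0) | \<alpha>. (\<Sum>i<m. \<alpha> i) \<le> k0} \<subseteq> ?S"
  proof clarify
    fix \<alpha> :: "nat \<Rightarrow> nat" assume \<alpha>: "(\<Sum>i<m. \<alpha> i) \<le> k0"
    have "ops b [0..<m] \<alpha> (w j) u0 = CR_derivs m L \<alpha> (dz j \<rho>c) p0" for j
    proof -
      have "ops b [0..<m] \<alpha> (\<lambda>u. dz j \<rho>c (\<phi> u)) u0 = foldr (\<lambda>i. CR_deriv (L i) ^^ \<alpha> i) [0..<m] (dz j \<rho>c) (\<phi> u0)"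
        using ops_CR_derivs[of "[0..<m]" "dz j \<rho>c" \<alpha>] u0 U_facts(1,3)
        by (auto intro!: smooth_dz smooth_at_of_real intro: smooth_atI)
      then show ?thesis by (simp add: CR_derivs_def \<phi>_u0 w_def[abs_def])
    qed
    then show "(\<Sum>j\<in>UNIV. c j * (\<chi> j. CR_derivs m L \<alpha> (dz j \<rho>c) p0) $ j) = 0" using assms[OF \<alpha>] by simp
  qed
  from vec.span_minimal[OF this S] have "axis j 1 \<in> ?S" unfolding span by auto
  then show ?thesis by (simp add: axis_def if_distrib[of "\<lambda>y. _ * y"] cong: if_cong)
qed

lemma w_nonzero: "\<exists>\<nu>. w \<nu> u0 \<noteq> 0"
proof (rule ccontr)
  assume "\<not> ?thesis"
  then have "dz j \<rho>c p0 = 0" for j by (simp add: w_def \<phi>_u0)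
  then have "frechet_derivative \<rho> (at p0) v = 0" for v
    using frechet_real_dz[of p0 \<rho> v] \<Omega>1D(7)[OF u0] by (simp add: \<phi>_u0)
  then show False using U_facts(5) by auto
qed

lemma d\<rho>_w: "frechet_derivative \<rho> (at p0) v = 2 * Re (\<Sum>j\<in>UNIV. w j u0 * v $ j)"
  using frechet_real_dz[of p0 \<rho> v] \<Omega>1D(7)[OF u0] by (simp add: \<phi>_u0 w_def)

text \<open>Containment of kernels forces proportionality; the test vector is
  \<open>w \<nu> u0 *s axis i 1 - w i u0 *s axis \<nu> 1\<close>.\<close>

lemma proportional_to_w:
  assumes "\<And>v. (\<Sum>j\<in>UNIV. w j u0 * v $ j) = 0 \<Longrightarrow> (\<Sum>j\<in>UNIV. c j * v $ j) = 0"
  shows "c i * w \<nu> u0 = w i u0 * c \<nu>"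
proof -
  have s: "(\<Sum>j\<in>UNIV. f j * (w \<nu> u0 *s axis i 1 - w i u0 *s axis \<nu> 1 :: complex ^ 'n) $ j) = f i * w \<nu> u0 - f \<nu> * w i u0"
    for f :: "'n \<Rightarrow> complex"
  proof -
    have "(\<Sum>j\<in>UNIV. f j * (w \<nu> u0 *s axis i 1 - w i u0 *s axis \<nu> 1 :: complex ^ 'n) $ j)
      = (\<Sum>j\<in>UNIV. if j = i then f i * w \<nu> u0 else 0) - (\<Sum>j\<in>UNIV. if j = \<nu> then f \<nu> * w i u0 else 0)"
      unfolding sum_subtractf[symmetric] by (intro sum.cong) (auto simp: axis_def algebra_simps)
    then show ?thesis by simp
  qed
  from assms[of "w \<nu> u0 *s axis i 1 - w i u0 *s axis \<nu> 1"] show ?thesis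
    unfolding s by (simp add: mult.commute)
qed

text \<open>A vector in the kernel of \<open>w\<close> lies, with all its complex multiples, in the
  kernel of the differential of \<open>\<rho>\<close>, hence is tangent; so it is the conjugate of a
  CR vector. The conjugated frame therefore spans the kernel of \<open>w\<close>.\<close>

lemma frame_spans:
  assumes "\<And>l. l < m \<Longrightarrow> (\<Sum>j\<in>UNIV. c j * cnj (a l u0 $ j)) = 0" and v: "(\<Sum>j\<in>UNIV. w j u0 * v $ j) = 0"
  shows "(\<Sum>j\<in>UNIV. c j * v $ j) = 0"
proof -
  let ?S = "{y :: complex ^ 'n. (\<Sum>j\<in>UNIV. c j * cnj (y $ j)) = 0}"
  have S: "vec.subspace ?S"
    by (auto simp: vec.subspace_def distrib_left sum.distrib mult.left_commute[of _ "_ :: complex"] simp flip: sum_distrib_left)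
  have "(\<lambda>i. L i p0) ` {..<m} \<subseteq> ?S" using assms(1) by (auto simp: a_def \<phi>_u0)
  then have sub: "vec.span ((\<lambda>i. L i p0) ` {..<m}) \<subseteq> ?S" by (rule vec.span_minimal[OF _ S])
  have "p0 \<in> M \<inter> U" using A_sub A_facts(2) U_facts(2) by auto
  then have sp: "vec.span ((\<lambda>i. L i p0) ` {..<m}) = CR_vectors M p0" using frame unfolding CR_frame_def by blast
  let ?y = "\<chi> j. cnj (v $ j)"
  have k: "frechet_derivative \<rho> (at p0) (\<chi> j. t * v $ j) = 0" for t
  proof -
    have "(\<Sum>j\<in>UNIV. w j u0 * (t * v $ j)) = t * (\<Sum>j\<in>UNIV. w j u0 * v $ j)"
      by (simp add: sum_distrib_left mult.left_commute)
    then show ?thesis using v by (simp add: d\<rho>_w)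
  qed
  have "re01 ?y = (\<chi> j. (1 / 2) * v $ j)" "im01 ?y = (\<chi> j. (\<i> / 2) * v $ j)"
    by (simp_all add: re01_def im01_def vec_eq_iff)
  then have "?y \<in> CR_vectors M p0"
    using ker_tangent(1)[OF k, of "1 / 2"] ker_tangent(1)[OF k, of "\<i> / 2"] by (simp add: CR_vectors_def)
  then show ?thesis using sub sp by auto
qed

end

section \<open>Fields adapted to the coordinates \<open>z j\<close>\<close>

lemma smooth_at_field_scale: "smooth_at u c \<Longrightarrow> smooth_at u K \<Longrightarrow> smooth_at u (\<lambda>u. (c u :: complex) *s (K u :: complex ^ 'd))"
  by (subst smooth_at_vec_iff) (auto intro: smooth_at_mult smooth_at_vec_nth)

context hypersurface_chart
begin

text \<open>The conjugated frame coefficients and the unit row at \<open>\<nu>\<close> have full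
  rank, since the frame spans the kernel of \<open>w\<close> and \<open>w \<nu>\<close> is nonzero.
  Solving for the unit row at \<open>i\<close> yields a (1,0) field up to a multiple of the row at
  \<open>\<nu>\<close>.\<close>

lemma normalized_10_field:
  assumes \<nu>: "w \<nu> u0 \<noteq> 0"
  shows "\<exists>K. smooth_at u0 K \<and> (\<forall>\<^sub>F u in nhds u0. (\<forall>j. vf K (z j) u = 0) \<and>
    (\<forall>j. vf (cnjf K) (z j) u = (if j = i then 1 else 0) - w i u / w \<nu> u * (if j = \<nu> then 1 else 0)))"
proof -
  \<comment> \<open>Indices below \<open>m\<close> are the frame; every other index stands for the
    extra unit row at \<open>\<nu>\<close>.\<close>
  define V where "V l j u = (if l < m then cnj (a l u $ j) else if j = \<nu> then 1 else 0)" for l :: nat and j u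
  let ?R = "{c. smooth_at u0 c}"
  have VR: "V l j \<in> ?R" for l j
    using smooth_at_cnj[OF smooth_at_vec_nth[OF smooth_a[OF _ u0]], of l j] by (cases "l < m") (auto simp: V_def[abs_def])
  have "\<exists>g\<in>rcomb ?R UNIV V. \<forall>\<^sub>F u in nhds u0. \<forall>j\<in>UNIV. g j u = (if j = i then 1 else 0)"
  proof (rule local_ring.left_inverse[OF local_ring_germs])
    fix c assume c: "\<And>l. l \<in> UNIV \<Longrightarrow> (\<Sum>j\<in>UNIV. c j * V l j u0) = 0"
    have c1: "(\<Sum>j\<in>UNIV. c j * cnj (a l u0 $ j)) = 0" if "l < m" for l using c[of l] that by (simp add: V_def)
    have "(\<Sum>j\<in>UNIV. c j * V m j u0) = c \<nu>" by (simp add: V_def if_distrib[of "\<lambda>y. _ * y"] cong: if_cong)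
    then have c2: "c \<nu> = 0" using c[of m] by simp
    show "\<forall>i\<in>UNIV. c i = 0"
      using proportional_to_w[of c _ \<nu>, OF frame_spans[OF c1]] c2 \<nu> by simp
  qed (use VR in auto)
  then obtain g where g: "g \<in> rcomb ?R UNIV V" "\<forall>\<^sub>F u in nhds u0. \<forall>j. g j u = (if j = i then 1 else 0)" by auto
  \<comment> \<open>Combinations of rows are traced back to combinations of fields; \<open>t\<close>
    collects the multiples of the extra row.\<close>
  from g(1) have "\<exists>K t. smooth_at u0 K \<and> smooth_at u0 t \<and> (\<forall>\<^sub>F u in nhds u0. (\<forall>j. vf K (z j) u = 0) \<and>
     (\<forall>j. g j u = vf (cnjf K) (z j) u + t u * (if j = \<nu> then 1 else 0)))"
  proof induction
    case (row l)
    show ?case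
    proof (cases "l < m")
      case True
      have "\<forall>\<^sub>F u in nhds u0. (\<forall>j. vf (b l) (z j) u = 0) \<and> (\<forall>j. V l j u = vf (cnjf (b l)) (z j) u + 0 * (if j = \<nu> then 1 else 0))"
        using ev_\<Omega>1[OF u0]
      proof eventually_elim
        case (elim u)
        have "vf (cnjf (b l)) (z j) u = cnj (vf (b l) (\<lambda>u. cnj (z j u)) u)" for j
          using vf_cnj[of u "z j" "b l"] \<Omega>1D(5)[OF elim] by (simp add: smooth_at_vec_nth)
        then show ?case using b_z[OF True elim] True by (simp add: V_def)
      qed
      then show ?thesis using smooth_b[OF True u0] by (intro exI[of _ "b l"] exI[of _ "\<lambda>_. 0"]) auto
    next
      case False
      then show ?thesis
        by (intro exI[of _ "\<lambda>_. 0"] exI[of _ "\<lambda>_. 1"]) (auto simp: V_def vf_def cnjf_def)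
    qed
  next
    case (add g h)
    then obtain K t K' t' where *: "smooth_at u0 K" "smooth_at u0 t" "smooth_at u0 K'" "smooth_at u0 t'"
      "\<forall>\<^sub>F u in nhds u0. (\<forall>j. vf K (z j) u = 0) \<and> (\<forall>j. g j u = vf (cnjf K) (z j) u + t u * (if j = \<nu> then 1 else 0))"
      "\<forall>\<^sub>F u in nhds u0. (\<forall>j. vf K' (z j) u = 0) \<and> (\<forall>j. h j u = vf (cnjf K') (z j) u + t' u * (if j = \<nu> then 1 else 0))"
      by blast
    let ?K = "\<lambda>u. K u + K' u"
    have c: "cnjf ?K = (\<lambda>u. cnjf K u + cnjf K' u)" by (simp add: cnjf_def fun_eq_iff vec_eq_iff)
    have "\<forall>\<^sub>F u in nhds u0. (\<forall>j. vf ?K (z j) u = 0) \<and> (\<forall>j. g j u + h j u = vf (cnjf ?K) (z j) u + (t u + t' u) * (if j = \<nu> then 1 else 0))"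
      using *(5,6) by eventually_elim (auto simp: c vf_field_add)
    then show ?case using *(1-4) by (intro exI[of _ ?K] exI[of _ "\<lambda>u. t u + t' u"]) (auto intro: smooth_at_add)
  next
    case (scale r g)
    then obtain K t where *: "smooth_at u0 K" "smooth_at u0 t" "smooth_at u0 r"
      "\<forall>\<^sub>F u in nhds u0. (\<forall>j. vf K (z j) u = 0) \<and> (\<forall>j. g j u = vf (cnjf K) (z j) u + t u * (if j = \<nu> then 1 else 0))"
      by auto
    let ?K = "\<lambda>u. cnj (r u) *s K u"
    have c: "cnjf ?K = (\<lambda>u. r u *s cnjf K u)" by (simp add: cnjf_def fun_eq_iff vec_eq_iff)
    have "\<forall>\<^sub>F u in nhds u0. (\<forall>j. vf ?K (z j) u = 0) \<and> (\<forall>j. r u * g j u = vf (cnjf ?K) (z j) u + (r u * t u) * (if j = \<nu> then 1 else 0))"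
      using *(4) by eventually_elim (auto simp: c vf_field_scale algebra_simps)
    then show ?case using *(1-3)
      by (intro exI[of _ ?K] exI[of _ "\<lambda>u. r u * t u"]) (auto intro: smooth_at_mult smooth_at_field_scale smooth_at_cnj)
  qed
  then obtain K t where K: "smooth_at u0 K" "\<forall>\<^sub>F u in nhds u0. (\<forall>j. vf K (z j) u = 0) \<and>
     (\<forall>j. g j u = vf (cnjf K) (z j) u + t u * (if j = \<nu> then 1 else 0))" by blast
  have w0: "\<forall>\<^sub>F u in nhds u0. w \<nu> u \<noteq> 0"
    by (rule tendsto_imp_eventually_ne[OF smooth_at_tendsto[OF smooth_w[OF u0]] \<nu>])
  have "\<forall>\<^sub>F u in nhds u0. (\<forall>j. vf K (z j) u = 0) \<and>
    (\<forall>j. vf (cnjf K) (z j) u = (if j = i then 1 else 0) - w i u / w \<nu> u * (if j = \<nu> then 1 else 0))"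
    using K(2) g(2) w0 ev_\<Omega>1[OF u0]
  proof eventually_elim
    case (elim u)
    have e: "vf (cnjf K) (z j) u = (if j = i then 1 else 0) - t u * (if j = \<nu> then 1 else 0)" for j
    proof -
      have "g j u = vf (cnjf K) (z j) u + t u * (if j = \<nu> then 1 else 0)" using elim(1) by blast
      moreover have "g j u = (if j = i then 1 else 0)" using elim(2) by blast
      ultimately show ?thesis by (simp only: add_diff_cancel eq_diff_eq)
    qed
    \<comment> \<open>The field is of type (1,0), so the complex gradient annihilates it; this
      determines \<open>t\<close>.\<close>
    have "(\<Sum>j\<in>UNIV. w j u * vf (cnjf K) (z j) u) = (\<Sum>j\<in>UNIV. (if j = i then w i u else 0) - (if j = \<nu> then w \<nu> u * t u else 0))"
      unfolding e by (intro sum.cong) (auto simp: algebra_simps)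
    then have "(\<Sum>j\<in>UNIV. w j u * vf (cnjf K) (z j) u) = w i u - w \<nu> u * t u"
      by (simp add: sum_subtractf)
    then have "t u = w i u / w \<nu> u"
      using w_zero_one[OF elim(4), of K] elim(1,3) by (simp add: field_simps)
    then show ?case using elim(1) e by simp
  qed
  then show ?thesis using K(1) by blast
qed

text \<open>No nonzero complex linear functional vanishes on the whole tangent space of a real
  hypersurface, so the derivatives of the coordinates have full rank and the unit row at
  \<open>\<nu>\<close> can be solved for.\<close>

lemma transversal_field:
  assumes \<nu>: "w \<nu> u0 \<noteq> 0"
  shows "\<exists>K. smooth_at u0 K \<and> (\<forall>\<^sub>F u in nhds u0. \<forall>j. vf K (z j) u = (if j = \<nu> then 1 else 0))"
proof -
  let ?R = "{c. smooth_at u0 c}" and ?V = "\<lambda>i j. pd i (z j)"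
  have "\<exists>g\<in>rcomb ?R UNIV ?V. \<forall>\<^sub>F u in nhds u0. \<forall>j\<in>UNIV. g j u = (if j = \<nu> then 1 else 0)"
  proof (rule local_ring.left_inverse[OF local_ring_germs])
    fix c assume c: "\<And>i. i \<in> UNIV \<Longrightarrow> (\<Sum>j\<in>UNIV. c j * pd i (z j) u0) = 0"
    note dif = smooth_at_differentiable[OF \<Omega>1D(5)[OF u0]]
    let ?D = "frechet_derivative \<phi> (at u0)"
    have D: "(\<Sum>j\<in>UNIV. c j * ?D \<xi> $ j) = 0" for \<xi>
    proof -
      have p: "pd i (z j) u0 = ?D (axis i 1) $ j" for i j
        unfolding pd_def frechet_derivative_bounded_linear[OF bounded_linear_vec_nth dif] ..
      have "?D \<xi> = (\<Sum>i\<in>UNIV. \<xi> $ i *\<^sub>R ?D (axis i 1))" by (rule real_vec_expand[OF linear_frechet[OF dif]])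
      then have "?D \<xi> $ j = (\<Sum>i\<in>UNIV. \<xi> $ i *\<^sub>R pd i (z j) u0)" for j
        by (simp only: sum_component vector_scaleR_component p)
      then have "(\<Sum>j\<in>UNIV. c j * ?D \<xi> $ j) = (\<Sum>j\<in>UNIV. \<Sum>i\<in>UNIV. complex_of_real (\<xi> $ i) * (c j * pd i (z j) u0))"
        by (simp add: scaleR_conv_of_real sum_distrib_left mult.left_commute)
      also have "\<dots> = 0"
        by (subst sum.swap) (simp add: c flip: sum_distrib_left)
      finally show ?thesis .
    qed
    have k: "(\<Sum>j\<in>UNIV. c j * v $ j) = 0" if "Re (\<Sum>j\<in>UNIV. w j u0 * v $ j) = 0" for v
      using ker_tangent(2)[of v] that D by (auto simp: d\<rho>_w)
    have pr: "c i * w \<nu> u0 = w i u0 * c \<nu>" for i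
      by (rule proportional_to_w) (simp add: k)
    \<comment> \<open>A functional vanishing on the tangent space is a multiple of \<open>w\<close>.
      This vector is tangent because its pairing with \<open>w\<close> is \<open>\<i>\<close> times
      the squared norm of \<open>w\<close>; the pairing is nonzero, so the multiple is zero.\<close>
    let ?v = "\<chi> j. \<i> * cnj (w j u0)"
    define S where "S = (\<Sum>j\<in>UNIV. w j u0 * cnj (w j u0))"
    have S: "S = complex_of_real (\<Sum>j\<in>UNIV. (cmod (w j u0))\<^sup>2)"
      unfolding S_def by (simp only: of_real_sum complex_norm_square)
    have "(\<Sum>j\<in>UNIV. w j u0 * ?v $ j) = \<i> * S"
      by (simp add: S_def sum_distrib_left mult.left_commute)
    then have "(\<Sum>j\<in>UNIV. c j * ?v $ j) = 0" by (intro k) (simp add: S del: of_real_sum of_real_power)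
    then have "0 = w \<nu> u0 * (\<Sum>j\<in>UNIV. c j * (\<i> * cnj (w j u0)))" by simp
    also have "\<dots> = (\<Sum>j\<in>UNIV. (c j * w \<nu> u0) * (\<i> * cnj (w j u0)))"
      unfolding sum_distrib_left by (intro sum.cong refl) (simp add: mult_ac)
    also have "\<dots> = \<i> * c \<nu> * S"
      unfolding pr S_def sum_distrib_left by (intro sum.cong refl) (simp add: mult_ac)
    finally have "c \<nu> * S = 0" by simp
    moreover have "(\<Sum>j\<in>UNIV. (cmod (w j u0))\<^sup>2) \<noteq> 0"
      using \<nu> by (subst sum_nonneg_eq_0_iff) auto
    then have "S \<noteq> 0" unfolding S of_real_eq_0_iff .
    ultimately have "c \<nu> = 0" by simp
    then show "\<forall>i\<in>UNIV. c i = 0" using pr \<nu> by simp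
  qed (use \<Omega>1D(5)[OF u0] in \<open>auto intro: smooth_at_pd smooth_at_vec_nth\<close>)
  then obtain g where g: "g \<in> rcomb ?R UNIV ?V" "\<forall>\<^sub>F u in nhds u0. \<forall>j. g j u = (if j = \<nu> then 1 else 0)" by auto
  from g(1) have "\<exists>K. smooth_at u0 K \<and> (\<forall>\<^sub>F u in nhds u0. \<forall>j. g j u = vf K (z j) u)"
  proof induction
    case (row i) show ?case by (intro exI[of _ "cf i"]) simp
  next
    case (add g h)
    then obtain K K' where *: "smooth_at u0 K" "smooth_at u0 K'"
      "\<forall>\<^sub>F u in nhds u0. \<forall>j. g j u = vf K (z j) u" "\<forall>\<^sub>F u in nhds u0. \<forall>j. h j u = vf K' (z j) u" by blast
    have "\<forall>\<^sub>F u in nhds u0. \<forall>j. g j u + h j u = vf (\<lambda>u. K u + K' u) (z j) u"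
      using *(3,4) by eventually_elim (simp add: vf_field_add)
    then show ?case using * by (intro exI[of _ "\<lambda>u. K u + K' u"]) (auto intro: smooth_at_add)
  next
    case (scale r g)
    then obtain K where *: "smooth_at u0 K" "smooth_at u0 r" "\<forall>\<^sub>F u in nhds u0. \<forall>j. g j u = vf K (z j) u" by blast
    have "\<forall>\<^sub>F u in nhds u0. \<forall>j. r u * g j u = vf (\<lambda>u. r u *s K u) (z j) u"
      using *(3) by eventually_elim (simp add: vf_field_scale)
    then show ?case using * by (intro exI[of _ "\<lambda>u. r u *s K u"]) (auto intro: smooth_at_field_scale)
  qed
  then obtain K where K: "smooth_at u0 K" "\<forall>\<^sub>F u in nhds u0. \<forall>j. g j u = vf K (z j) u" by blast
  have "\<forall>\<^sub>F u in nhds u0. \<forall>j. vf K (z j) u = (if j = \<nu> then 1 else 0)"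
    using K(2) g(2) by eventually_elim simp
  then show ?thesis using K(1) by blast
qed

text \<open>The \<open>q j\<close> are ratios of components of the complex gradient, with
  denominator index \<open>\<nu>\<close> chosen so that it does not vanish at the base point. The
  last two clauses are the two forms in which nondegeneracy of \<open>M\<close> is used:
  \<open>q i\<close> is not constant to infinite order, and the \<open>q j\<close> are independent
  under words of length at most \<open>k0\<close>.\<close>

lemma source_frame:
  "\<exists>\<Omega> Z Kf q \<nu>. cr_structure \<Omega> z Z \<and> u0 \<in> \<Omega> \<and> \<Omega> \<subseteq> \<Omega>1 \<and>
    (\<forall>i. Sm \<Omega> (Kf i)) \<and> (\<forall>i j. \<forall>u\<in>\<Omega>. vf (Kf i) (z j) u = 0) \<and>
    (\<forall>i. Sm \<Omega> (q i)) \<and> (\<forall>i. \<forall>u\<in>\<Omega>. cnjf (Kf i) u = Z i u - q i u *s Z \<nu> u) \<and>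
    (\<forall>i. i \<noteq> \<nu> \<longrightarrow> (\<forall>r. \<exists>\<alpha>. ops b [0..<m] \<alpha> (\<lambda>u. q i u - r) u0 \<noteq> 0)) \<and>
    (\<forall>c. (\<forall>Ks. set Ks \<subseteq> b ` {..<m} \<longrightarrow> length Ks \<le> k0 \<longrightarrow> foldr vf Ks (\<lambda>u. \<Sum>j\<in>UNIV. c j * q j u) u0 = 0) \<longrightarrow> (\<forall>j. c j = 0))"
proof -
  obtain \<nu> where \<nu>: "w \<nu> u0 \<noteq> 0" using w_nonzero by blast
  define q where "q j u = w j u / w \<nu> u" for j u
  have "\<forall>i. \<exists>K. smooth_at u0 K \<and> (\<forall>\<^sub>F u in nhds u0. (\<forall>j. vf K (z j) u = 0) \<and>
    (\<forall>j. vf (cnjf K) (z j) u = (if j = i then 1 else 0) - q i u * (if j = \<nu> then 1 else 0)))"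
    unfolding q_def using normalized_10_field[OF \<nu>] by blast
  from choice[OF this] obtain Kf where Kf: "\<forall>i. smooth_at u0 (Kf i) \<and> (\<forall>\<^sub>F u in nhds u0. (\<forall>j. vf (Kf i) (z j) u = 0) \<and>
    (\<forall>j. vf (cnjf (Kf i)) (z j) u = (if j = i then 1 else 0) - q i u * (if j = \<nu> then 1 else 0)))" by blast
  obtain N where N: "smooth_at u0 N" "\<forall>\<^sub>F u in nhds u0. \<forall>j. vf N (z j) u = (if j = \<nu> then 1 else 0)"
    using transversal_field[OF \<nu>] by blast
  have w0: "\<forall>\<^sub>F u in nhds u0. w \<nu> u \<noteq> 0"
    by (rule tendsto_imp_eventually_ne[OF smooth_at_tendsto[OF smooth_w[OF u0]] \<nu>])
  have "\<forall>\<^sub>F u in nhds u0. \<forall>i. smooth_at u (Kf i) \<and> (\<forall>j. vf (Kf i) (z j) u = 0) \<and>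
    (\<forall>j. vf (cnjf (Kf i)) (z j) u = (if j = i then 1 else 0) - q i u * (if j = \<nu> then 1 else 0))"
  proof (rule eventually_all_finite)
    fix i
    have "\<forall>\<^sub>F u in nhds u0. smooth_at u (Kf i)" using Kf smooth_at_ev by blast
    then show "\<forall>\<^sub>F u in nhds u0. smooth_at u (Kf i) \<and> (\<forall>j. vf (Kf i) (z j) u = 0) \<and>
      (\<forall>j. vf (cnjf (Kf i)) (z j) u = (if j = i then 1 else 0) - q i u * (if j = \<nu> then 1 else 0))"
      using Kf[rule_format, of i, THEN conjunct2] by eventually_elim blast
  qed
  note ev_Kf = this
  define good where "good u \<longleftrightarrow> u \<in> \<Omega>1 \<and> w \<nu> u \<noteq> 0 \<and> smooth_at u N \<and> (\<forall>j. vf N (z j) u = (if j = \<nu> then 1 else 0)) \<and>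
    (\<forall>i. smooth_at u (Kf i) \<and> (\<forall>j. vf (Kf i) (z j) u = 0) \<and>
    (\<forall>j. vf (cnjf (Kf i)) (z j) u = (if j = i then 1 else 0) - q i u * (if j = \<nu> then 1 else 0)))" for u
  have "\<forall>\<^sub>F u in nhds u0. good u"
    unfolding good_def by (intro eventually_conj ev_\<Omega>1[OF u0] w0 N(2) smooth_at_ev[OF N(1)] ev_Kf)
  then obtain \<Omega> where \<Omega>0: "open \<Omega>" "u0 \<in> \<Omega>" "\<forall>u\<in>\<Omega>. good u"
    unfolding eventually_nhds by blast
  note \<Omega> = \<Omega>0(1,2) bspec[OF \<Omega>0(3), unfolded good_def]
  \<comment> \<open>Adding a multiple of the transversal field removes the unwanted component at
    \<open>\<nu>\<close>, so the \<open>Z i\<close> are dual to the coordinates.\<close>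
  define Z where "Z i u = cnjf (Kf i) u + q i u *s N u" for i u
  have q\<nu>: "q \<nu> u = 1" if "u \<in> \<Omega>" for u using \<Omega>(3)[OF that] by (simp add: q_def)
  have smq: "Sm \<Omega> (q i)" for i
    unfolding Sm_def q_def[abs_def] using \<Omega>(3) by (auto intro!: smooth_at_divide smooth_w)
  have smz: "Sm \<Omega> (z j)" for j
    using \<Omega>(3) \<Omega>1D(5) by (auto simp: Sm_def intro: smooth_at_vec_nth)
  have Zz: "vf (Z i) (z j) u = (if i = j then 1 else 0)" if "u \<in> \<Omega>" for i j u
    using \<Omega>(3)[OF that] unfolding Z_def[abs_def] vf_field_add vf_field_scale by simp
  have smZ: "Sm \<Omega> (Z i)" for i
    unfolding Sm_def Z_def[abs_def] using \<Omega>(3) smq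
    by (auto intro!: smooth_at_add smooth_at_cnjf smooth_at_field_scale simp: Sm_def)
  interpret cr_structure \<Omega> z Z
    by unfold_locales (use \<Omega> smz smZ Zz in auto)
  have smb: "Sm \<Omega> (b l)" if "l < m" for l using smooth_b[OF that] \<Omega>(3) by (auto simp: Sm_def)
  have smw: "Sm \<Omega> (w j)" for j using smooth_w \<Omega>(3) by (auto simp: Sm_def)
  \<comment> \<open>As \<open>q \<nu> = 1\<close>, this field kills the \<open>z j\<close> and their
    conjugates and hence vanishes; therefore \<open>Z \<nu>\<close> is the transversal field
    \<open>N\<close>.\<close>
  have cnj\<nu>: "cnjf (Kf \<nu>) u = 0" if u: "u \<in> \<Omega>" for u
  proof -
    let ?D = "frechet_derivative \<phi> (at u)"
    have u1: "u \<in> \<Omega>1" using \<Omega>(3)[OF u] by blast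
    note dif = smooth_at_differentiable[OF \<Omega>1D(5)[OF u1]]
    have 1: "vf (Kf \<nu>) (z j) u = 0" "vf (cnjf (Kf \<nu>)) (z j) u = 0" for j
      using \<Omega>(3)[OF u] q\<nu>[OF u] by auto
    have re: "re_vec (cnjf (Kf \<nu>) u) = re_vec (Kf \<nu> u)" and im: "im_vec (cnjf (Kf \<nu>) u) = - im_vec (Kf \<nu> u)"
      by (simp_all add: re_vec_def im_vec_def cnjf_def vec_eq_iff)
    have "?D (re_vec (Kf \<nu> u)) $ j = 0 \<and> ?D (im_vec (Kf \<nu> u)) $ j = 0" for j
      using 1[of j] unfolding vf_complex[OF dif] re im linear_neg[OF linear_frechet[OF dif]] by simp
    then have D0: "?D (re_vec (Kf \<nu> u)) = 0" "?D (im_vec (Kf \<nu> u)) = 0" by (simp_all add: vec_eq_iff)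
    have "((\<lambda>w. X (\<phi> w)) has_derivative (\<lambda>d. frechet_derivative X (at (\<phi> u)) (?D d))) (at u)"
      by (rule has_derivative_compose[OF smooth_at_has_derivative[OF \<Omega>1D(5)[OF u1]] smooth_at_has_derivative[OF \<Omega>1D(6)[OF u1]]])
    moreover have "\<forall>\<^sub>F w in nhds u. X (\<phi> w) = w" using ev_\<Omega>1[OF u1] by (rule eventually_mono) (rule \<Omega>1D)
    then have "((\<lambda>w. X (\<phi> w)) has_derivative (\<lambda>d. d)) (at u)"
      using has_derivative_cong_nhds[of "\<lambda>w. X (\<phi> w)" "\<lambda>w. w" u] by simp
    ultimately have XD: "(\<lambda>d. frechet_derivative X (at (\<phi> u)) (?D d)) = (\<lambda>d. d)"
      by (rule has_derivative_unique)
    have "frechet_derivative X (at (\<phi> u)) 0 = 0"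
      by (rule linear_0[OF linear_frechet[OF smooth_at_differentiable[OF \<Omega>1D(6)[OF u1]]]])
    then have "re_vec (Kf \<nu> u) = 0" "im_vec (Kf \<nu> u) = 0"
      using fun_cong[OF XD, of "re_vec (Kf \<nu> u)"] fun_cong[OF XD, of "im_vec (Kf \<nu> u)"] by (simp_all add: D0)
    then show ?thesis by (simp add: re_vec_def im_vec_def cnjf_def vec_eq_iff complex_eq_iff)
  qed
  have Keq: "cnjf (Kf i) u = Z i u - q i u *s Z \<nu> u" if "u \<in> \<Omega>" for i u
    using cnj\<nu>[OF that] q\<nu>[OF that] by (simp add: Z_def)
  have w_q: "w j u = w \<nu> u * q j u" if "u \<in> \<Omega>" for j u using \<Omega>(3)[OF that] by (simp add: q_def)
  \<comment> \<open>If \<open>q i - r\<close> were flat, so would be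
    \<open>w i - r * w \<nu>\<close>, a nontrivial relation excluded by
    \<open>w_independent\<close>.\<close>
  have nf: "\<exists>\<alpha>. ops b [0..<m] \<alpha> (\<lambda>u. q i u - r) u0 \<noteq> 0" if i: "i \<noteq> \<nu>" for i r
  proof (rule ccontr)
    assume "\<not> ?thesis"
    then have z: "ops b [0..<m] \<alpha> (\<lambda>u. q i u - r) u0 = 0" for \<alpha> by blast
    let ?P = "flats \<Omega> u0 b (rev [0..<m])"
    have P: "g \<in> ?P \<longleftrightarrow> Sm \<Omega> g \<and> (\<forall>\<alpha>. ops b [0..<m] \<alpha> g u0 = 0)" for g
      using flats_iff[of "rev [0..<m]" \<Omega> b g u0] smb by simp
    have pr: "prime_in \<Omega> ?P" by (rule prime_in_flats) (use \<Omega> smb in auto)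
    have "(\<lambda>u. q i u - r) \<in> ?P" using z smq by (auto simp: P Sm_def intro: smooth_at_diff)
    from prime_in_mult[OF pr smw[of \<nu>] this] have "(\<lambda>u. w \<nu> u * (q i u - r)) \<in> ?P" .
    then have "(\<lambda>u. \<Sum>j\<in>UNIV. ((if j = i then 1 else 0) - (if j = \<nu> then r else 0)) * w j u) \<in> ?P"
    proof (rule prime_in_cong[OF pr])
      show "Sm \<Omega> (\<lambda>u. \<Sum>j\<in>UNIV. ((if j = i then 1 else 0) - (if j = \<nu> then r else 0)) * w j u)"
        using smw by (auto simp: Sm_def intro!: smooth_at_sum smooth_at_mult)
      have S: "(\<Sum>j\<in>UNIV. ((if j = i then 1 else 0) - (if j = \<nu> then r else 0)) * w j u) = w i u - r * w \<nu> u" for u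
      proof -
        have "(\<Sum>j\<in>UNIV. ((if j = i then 1 else 0) - (if j = \<nu> then r else 0)) * w j u) =
          (\<Sum>j\<in>UNIV. (if j = i then w i u else 0) - (if j = \<nu> then r * w \<nu> u else 0))"
          by (intro sum.cong) (auto simp: algebra_simps)
        then show ?thesis by (simp add: sum_subtractf)
      qed
      show "\<forall>u\<in>\<Omega>. w \<nu> u * (q i u - r) = (\<Sum>j\<in>UNIV. ((if j = i then 1 else 0) - (if j = \<nu> then r else 0)) * w j u)"
      proof
        fix u assume "u \<in> \<Omega>"
        from w_q[OF this, of i] show "w \<nu> u * (q i u - r) = (\<Sum>j\<in>UNIV. ((if j = i then 1 else 0) - (if j = \<nu> then r else 0)) * w j u)"
          unfolding S by (simp add: algebra_simps)
      qed
    qed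
    then have "ops b [0..<m] \<alpha> (\<lambda>u. \<Sum>j\<in>UNIV. ((if j = i then 1 else 0) - (if j = \<nu> then r else 0)) * w j u) u0 = 0" for \<alpha>
      by (simp add: P)
    moreover have "ops b [0..<m] \<alpha> (\<lambda>u. \<Sum>j\<in>UNIV. c j * w j u) u0 = (\<Sum>j\<in>UNIV. c j * ops b [0..<m] \<alpha> (w j) u0)" for \<alpha> c
      unfolding ops_word by (rule foldr_vf_lincomb) (use smw smb \<Omega>(2) in \<open>auto simp: Sm_def\<close>)
    ultimately show False
      using w_independent[of "\<lambda>j. (if j = i then 1 else 0) - (if j = \<nu> then r else 0)" i] i by simp
  qed
  \<comment> \<open>Multiplication by \<open>w \<nu>\<close> passes from the \<open>q j\<close> to
    the \<open>w j\<close> by the ideal property.\<close>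
  have Q: "\<And>j. c j = 0" if c: "\<And>Ks. set Ks \<subseteq> b ` {..<m} \<Longrightarrow> length Ks \<le> k0 \<Longrightarrow> foldr vf Ks (\<lambda>u. \<Sum>j\<in>UNIV. c j * q j u) u0 = 0" for c
  proof (rule w_independent[of c])
    fix \<alpha> :: "nat \<Rightarrow> nat" assume \<alpha>: "(\<Sum>i<m. \<alpha> i) \<le> k0"
    let ?Ks = "concat (map (\<lambda>i. replicate (\<alpha> i) (b i)) [0..<m])"
    have smB: "smooth_at u0 K" if "K \<in> b ` {..<m}" for K using that smb \<Omega>(2) by (auto simp: Sm_def)
    have "foldr vf ?Ks (\<lambda>v. w \<nu> v * (\<Sum>j\<in>UNIV. c j * q j v)) u0 = 0"
    proof (rule foldr_vf_ideal[OF smB])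
      show "smooth_at u0 (\<lambda>v. \<Sum>j\<in>UNIV. c j * q j v)"
        using smq \<Omega>(2) by (intro smooth_at_sum smooth_at_mult) (auto simp: Sm_def)
    qed (use c word_upt[of \<alpha> b m] \<alpha> smw \<Omega>(2) in \<open>auto simp: Sm_def\<close>)
    moreover have "\<forall>\<^sub>F v in nhds u0. w \<nu> v * (\<Sum>j\<in>UNIV. c j * q j v) = (\<Sum>j\<in>UNIV. c j * w j v)"
      using eventually_in[OF \<Omega>(1,2)] by eventually_elim (auto simp: w_q[symmetric] sum_distrib_left mult.left_commute intro!: sum.cong)
    from eventually_nhds_x_imp_x[OF foldr_vf_cong_ev[OF this, of ?Ks]]
    have "foldr vf ?Ks (\<lambda>v. w \<nu> v * (\<Sum>j\<in>UNIV. c j * q j v)) u0 = foldr vf ?Ks (\<lambda>v. \<Sum>j\<in>UNIV. c j * w j v) u0" .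
    moreover have "\<dots> = (\<Sum>j\<in>UNIV. c j * foldr vf ?Ks (w j) u0)"
      by (rule foldr_vf_lincomb) (use smw smb \<Omega>(2) in \<open>auto simp: Sm_def\<close>)
    ultimately show "(\<Sum>j\<in>UNIV. c j * ops b [0..<m] \<alpha> (w j) u0) = 0" by (simp add: ops_word)
  qed
  show ?thesis
  proof (intro exI conjI)
    show "cr_structure \<Omega> z Z" by unfold_locales
    show "\<Omega> \<subseteq> \<Omega>1" using \<Omega>(3) by blast
    show "\<forall>i. Sm \<Omega> (Kf i)" using \<Omega>(3) by (simp add: Sm_def)
    show "\<forall>i j. \<forall>u\<in>\<Omega>. vf (Kf i) (z j) u = 0" using \<Omega>(3) by simp
    show "\<forall>i. \<forall>u\<in>\<Omega>. cnjf (Kf i) u = Z i u - q i u *s Z \<nu> u" using Keq by simp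
    show "\<forall>i. i \<noteq> \<nu> \<longrightarrow> (\<forall>r. \<exists>\<alpha>. ops b [0..<m] \<alpha> (\<lambda>u. q i u - r) u0 \<noteq> 0)" using nf by simp
    show "\<forall>c. (\<forall>Ks. set Ks \<subseteq> b ` {..<m} \<longrightarrow> length Ks \<le> k0 \<longrightarrow> foldr vf Ks (\<lambda>u. \<Sum>j\<in>UNIV. c j * q j u) u0 = 0) \<longrightarrow> (\<forall>j. c j = 0)"
      using Q by blast
  qed (use \<Omega>(2) smq in auto)
qed

end

context cr_structure
begin

lemma crf_lincomb:
  assumes "finite I" "\<And>i. i \<in> I \<Longrightarrow> crf (g i) u"
  shows "crf (\<lambda>v. \<Sum>i\<in>I. c i * g i v) u"
proof -
  have "\<forall>\<^sub>F v in nhds u. \<forall>i\<in>I. smooth_at v (g i) \<and> cr_at (g i) v"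
    using assms by (simp add: eventually_ball_finite_distrib crf_def)
  then show ?thesis unfolding crf_def
  proof eventually_elim
    case (elim v)
    have "vf K (\<lambda>v. \<Sum>i\<in>I. c i * g i v) v = (\<Sum>i\<in>I. c i * vf K (g i) v)" for K
      using elim by (subst vf_sum) (auto intro!: smooth_at_mult sum.cong simp: vf_cmult)
    then show ?case using elim by (auto simp: cr_at_def intro!: smooth_at_sum smooth_at_mult)
  qed
qed

text \<open>The analogue of \<open>ops_linear\<close> for arbitrary words, with coefficients smooth
  only near \<open>u\<close>.\<close>

lemma foldr_vf_crf:
  assumes "finite I" "\<forall>K\<in>set Ks. Sm \<Omega> K \<and> (\<forall>u\<in>\<Omega>. \<forall>j. vf K (z j) u = 0)"
    and "u \<in> \<Omega>" "\<And>l. l \<in> I \<Longrightarrow> smooth_at u (c l)" "\<And>l. l \<in> I \<Longrightarrow> crf (h l) u"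
  shows "foldr vf Ks (\<lambda>v. \<Sum>l\<in>I. c l v * h l v) u = (\<Sum>l\<in>I. foldr vf Ks (c l) u * h l u)"
  using assms(2-)
proof (induction Ks arbitrary: u)
  case (Cons K Ks)
  have "\<forall>\<^sub>F v in nhds u. \<forall>l\<in>I. smooth_at v (c l)"
    using Cons.prems(3) by (subst eventually_ball_finite_distrib[OF assms(1)]) (auto intro: smooth_at_ev)
  moreover have "\<forall>\<^sub>F v in nhds u. \<forall>l\<in>I. crf (h l) v"
    using Cons.prems(4) by (subst eventually_ball_finite_distrib[OF assms(1)]) (auto intro: crf_ev)
  ultimately have "\<forall>\<^sub>F v in nhds u. foldr vf Ks (\<lambda>v. \<Sum>l\<in>I. c l v * h l v) v = (\<Sum>l\<in>I. foldr vf Ks (c l) v * h l v)"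
    using eventually_in[OF open_\<Omega> Cons.prems(2)]
    by eventually_elim (use Cons.prems(1) in \<open>auto intro!: Cons.IH\<close>)
  from vf_cong_ev[OF this, of K]
  have "foldr vf (K # Ks) (\<lambda>v. \<Sum>l\<in>I. c l v * h l v) u = vf K (\<lambda>v. \<Sum>l\<in>I. foldr vf Ks (c l) v * h l v) u" by simp
  also have "\<dots> = (\<Sum>l\<in>I. foldr vf (K # Ks) (c l) u * h l u)"
  proof (subst vf_sum)
    have sm: "smooth_at u (foldr vf Ks (c l))" if "l \<in> I" for l
      using Cons.prems(1-3) that by (intro foldr_vf_smooth) (auto simp: Sm_def)
    show "smooth_at u (\<lambda>v. foldr vf Ks (c l) v * h l v)" if "l \<in> I" for l
      using sm[OF that] crf_D(1)[OF Cons.prems(4)[OF that]] by (rule smooth_at_mult)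
    have "vf K (\<lambda>v. foldr vf Ks (c l) v * h l v) u = vf K (foldr vf Ks (c l)) u * h l u" if "l \<in> I" for l
      using sm[OF that] crf_D[OF Cons.prems(4)[OF that]] Cons.prems(1,2)
      by (intro crf_mult_zero_one) (auto simp: cr_at_def)
    then show "(\<Sum>l\<in>I. vf K (\<lambda>v. foldr vf Ks (c l) v * h l v) u) = (\<Sum>l\<in>I. foldr vf (K # Ks) (c l) u * h l u)" by simp
  qed
  finally show ?case .
qed simp

end

section \<open>The complete system\<close>

lemma mpartial_cong_ev:
  assumes "\<forall>\<^sub>F v in nhds u. f v = g v" shows "mpartial \<beta> f u = mpartial \<beta> g u"
proof -
  have "\<forall>\<^sub>F v in nhds u. partials is f v = partials is g v" for "is"
  proof (induction "is")
    case (Cons i xs)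
    from nhds_ev_ev[OF Cons.IH] show ?case
      by eventually_elim (simp add: frechet_derivative_cong_ev)
  qed (use assms in simp)
  then show ?thesis unfolding mpartial_def by (rule eventually_nhds_x_imp_x)
qed

lemma smooth_map_on_continuous_on:
  assumes "smooth_map_on S f" shows "continuous_on S f"
  unfolding continuous_on_eq_continuous_within
proof
  fix p assume "p \<in> S"
  from smooth_map_on_has_derivative[OF assms this] show "continuous (at p within S) f"
    by (rule has_derivative_continuous)
qed

text \<open>Makes a CR map on a neighbourhood of \<open>p0\<close> admissible in the chart; it
  serves both the given map and the unknown ones.\<close>

lemma (in hypersurface_chart) adm_CR_map:
  assumes cr: "cr_structure \<Omega> z Z" and \<Omega>: "u0 \<in> \<Omega>" "\<Omega> \<subseteq> \<Omega>1"
    and V: "openin (top_of_set M) V" "p0 \<in> V" and f: "CR_map V S' f" "S' \<subseteq> M'"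
    and T: "open B" "f p0 \<in> B"
  shows "\<forall>\<^sub>F v in nhds u0. v \<in> \<Omega> \<and> \<phi> v \<in> V \<and> smooth_at v (\<lambda>w. f (\<phi> w)) \<and> f (\<phi> v) \<in> M' \<inter> B \<and>
    (\<forall>j. cr_structure.cr_at z (\<lambda>w. f (\<phi> w) $ j) v)"
proof -
  interpret cr_structure \<Omega> z Z by fact
  obtain OV where OV: "open OV" "V = M \<inter> OV" using V(1) openin_open by blast
  have "\<forall>\<^sub>F v in nhds u0. \<phi> v \<in> OV"
    by (rule topological_tendstoD[OF smooth_at_tendsto[OF \<Omega>1D(5)[OF u0]] OV(1)]) (use V(2) OV in \<open>simp add: \<phi>_u0\<close>)
  with ev_M[OF u0] have evV: "\<forall>\<^sub>F v in nhds u0. \<phi> v \<in> V" by eventually_elim (use OV in auto)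
  have sm: "smooth_map_on V f" and fV: "f ` V \<subseteq> S'" using f by (auto simp: CR_map_def)
  have "smooth_at u0 (\<lambda>w. f (\<phi> w))" by (rule smooth_map_on_compose[OF sm \<Omega>1D(5)[OF u0] evV])
  then have "\<forall>\<^sub>F v in nhds u0. f (\<phi> v) \<in> B"
    by (intro topological_tendstoD[OF smooth_at_tendsto T(1)]) (use T(2) in \<open>simp_all add: \<phi>_u0\<close>)
  then show ?thesis
    using evV nhds_ev_ev[OF evV] eventually_in[OF open_\<Omega> \<Omega>(1)]
  proof eventually_elim
    case (elim v)
    have v1: "v \<in> \<Omega>1" using elim \<Omega> by auto
    have "smooth_at v (\<lambda>w. f (\<phi> w))" by (rule smooth_map_on_compose[OF sm \<Omega>1D(5)[OF v1] elim(3)])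
    moreover have "cr_at (\<lambda>w. f (\<phi> w) $ j) v" for j
      unfolding cr_at_def
      using CR_map_pullback[OF f(1) \<Omega>1D(5)[OF v1] elim(3)] by blast
    ultimately show ?case using elim f(2) fV by auto
  qed
qed

text \<open>The form in which the prescribed jet order enters; it rests on
  \<open>k0 \<le> k0 ^ 2\<close> and \<open>k0 \<le> k0 ^ 3\<close>.\<close>

lemma three_mul_le: "3 * k0 \<le> k0 ^ 3 + k0 ^ 2 + k0 + (1 :: nat)"
proof -
  have "k0 \<le> k0 ^ 2" "k0 \<le> k0 ^ 3" by (cases "k0 = 0"; simp add: self_le_power)+
  then show ?thesis by simp
qed

text \<open>With \<open>J\<^sub>i\<^sub>j = Z\<^sub>i F0\<^sub>j\<close>, which are CR functions, and \<open>w'\<^sub>j = \<partial>\<rho>'/\<partial>z\<^sub>j \<circ> F0\<close>, differentiating \<open>\<rho>' \<circ> F0 = 0\<close> gives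
  \<open>\<Sum>\<^sub>j J\<^sub>i\<^sub>j w'\<^sub>j = - q\<^sub>i \<mu>\<close>; since CR fields annihilate \<open>J\<close>, nondegeneracy passes from \<open>q\<close> to \<open>w'\<close>.\<close>

lemma (in jet_setting) nondegenerate_target:
  fixes \<rho>' :: "complex ^ 'n \<Rightarrow> real"
  assumes \<rho>': "\<And>\<zeta>. \<zeta> \<in> T \<Longrightarrow> smooth_at \<zeta> \<rho>'" "\<And>\<zeta>. \<zeta> \<in> T \<Longrightarrow> \<rho>' \<zeta> = 0" "frechet_derivative \<rho>' (at (F0 u0)) \<noteq> (\<lambda>v. 0)"
    and Kf: "\<And>i. type01 (Kf i)" "\<And>i u. u \<in> \<Omega> \<Longrightarrow> cnjf (Kf i) u = Z i u - q i u *s Z \<nu> u"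
    and q: "\<And>i. Sm \<Omega> (q i)" and B: "\<And>K. K \<in> B \<Longrightarrow> type01 K"
    and Q: "\<And>c. (\<And>Ks. set Ks \<subseteq> B \<Longrightarrow> length Ks \<le> k0 \<Longrightarrow> foldr vf Ks (\<lambda>u. \<Sum>j\<in>UNIV. c j * q j u) u0 = 0) \<Longrightarrow> \<forall>j. c j = 0"
    and inj: "\<And>K. (\<And>j. vf K (\<lambda>w. F0 w $ j) u0 = 0) \<Longrightarrow> \<forall>j. vf K (z j) u0 = 0"
    and c: "\<And>Ks. (\<forall>K\<in>set Ks. type01 K) \<Longrightarrow> length Ks \<le> k0 \<Longrightarrow>
       (\<Sum>j\<in>UNIV. c j * foldr vf Ks (\<lambda>v. dz j (\<lambda>z. complex_of_real (\<rho>' z)) (F0 v)) u0) = 0"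
  shows "c j = 0"
proof -
  let ?\<rho> = "\<lambda>z. complex_of_real (\<rho>' z)"
  define w' where "w' j u = dz j ?\<rho> (F0 u)" for j u
  define Jm where "Jm i j = vf (Z i) (\<lambda>w. F0 w $ j)" for i j
  define \<mu> where "\<mu> u = (\<Sum>j\<in>UNIV. cnj (w' j u) * vf (Z \<nu>) (\<lambda>w. cnj (F0 w $ j)) u)" for u
  have smw: "smooth_at u (w' j)" if "adm F0 u" for u j
    unfolding w'_def[abs_def]
    by (rule smooth_at_compose[OF admD(2)[OF that] smooth_dz(1)[OF smooth_at_of_real[OF \<rho>'(1)[OF admD(3)[OF that]]]]])
  have smz: "smooth_at u (vf (Z \<nu>) (\<lambda>w. cnj (F0 w $ j)))" if "adm F0 u" for u j
    using that SmD[OF Sm_Z] by (intro smooth_at_vf) (auto intro: admD)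
  have sm\<mu>: "smooth_at u \<mu>" if "adm F0 u" for u
    unfolding \<mu>_def[abs_def] by (intro smooth_at_sum smooth_at_mult smooth_at_cnj smw smz that)
  have E: "(\<Sum>j\<in>UNIV. w' j u * Jm i j u) = - (\<mu> u * q i u)" if a: "adm F0 u" for i u
  proof -
    have "vf (Z i) (\<lambda>w. cnj (F0 w $ j)) u = q i u * vf (Z \<nu>) (\<lambda>w. cnj (F0 w $ j)) u" for j
    proof -
      have "Z i u = cnjf (Kf i) u + q i u *s Z \<nu> u" using Kf(2)[OF admD(1)[OF a], of i] by simp
      then have "vf (Z i) (\<lambda>w. cnj (F0 w $ j)) u = vf (\<lambda>u. cnjf (Kf i) u + q i u *s Z \<nu> u) (\<lambda>w. cnj (F0 w $ j)) u"
        by (rule vf_point)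
      also have "\<dots> = vf (cnjf (Kf i)) (\<lambda>w. cnj (F0 w $ j)) u + q i u * vf (Z \<nu>) (\<lambda>w. cnj (F0 w $ j)) u"
        by (simp only: vf_field_add vf_field_scale)
      finally show ?thesis using type01_B[OF Kf(1) a] by simp
    qed
    then have "(\<Sum>j\<in>UNIV. cnj (w' j u) * vf (Z i) (\<lambda>w. cnj (F0 w $ j)) u) = \<mu> u * q i u"
      unfolding \<mu>_def sum_distrib_right by (intro sum.cong refl) (simp add: mult_ac)
    moreover have "\<forall>\<^sub>F w in nhds u. \<rho>' (F0 w) = 0"
      using adm_ev[OF a] by eventually_elim (rule \<rho>'(2)[OF admD(3)])
    from vf_defining[OF admD(2)[OF a] \<rho>'(1)[OF admD(3)[OF a]] this, of "Z i"]
    have "(\<Sum>j\<in>UNIV. w' j u * Jm i j u) + (\<Sum>j\<in>UNIV. cnj (w' j u) * vf (Z i) (\<lambda>w. cnj (F0 w $ j)) u) = 0"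
      by (simp add: w'_def Jm_def)
    ultimately show ?thesis by (simp add: eq_neg_iff_add_eq_0)
  qed
  have crJ: "crf (Jm i j) u0" for i j
    unfolding Jm_def by (rule crf_Z[OF u0 adm_crf[OF adm_F0]])
  \<comment> \<open>The derivatives of \<open>F0\<close> along the \<open>Z i\<close>. A kernel
    vector gives a combination of the \<open>Z i\<close> that kills all components of
    \<open>F0\<close>, hence all \<open>z j\<close> by \<open>inj\<close>, so it is zero by
    duality.\<close>
  define Am :: "complex ^ 'n ^ 'n" where "Am = (\<chi> j i. Jm i j u0)"
  have Am: "(Am *v d) $ j = (\<Sum>i\<in>UNIV. Jm i j u0 * d $ i)" for d j
    by (simp add: matrix_vector_mult_def Am_def)
  have "inj ((*v) Am)"
  proof (rule injI)
    fix d d' assume "Am *v d = Am *v d'"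
    then have "Am *v (d - d') = 0" by (simp add: matrix_vector_mult_diff_distrib)
    then have 0: "(\<Sum>i\<in>UNIV. Jm i j u0 * (d - d') $ i) = 0" for j using Am[of "d - d'" j] by simp
    let ?K = "\<lambda>u. \<Sum>i\<in>UNIV. (d - d') $ i *s Z i u"
    have K: "vf ?K g u = (\<Sum>i\<in>UNIV. (d - d') $ i * vf (Z i) g u)" for g u
      by (rule vf_lincomb[where c="\<lambda>i u. (d - d') $ i"])
    have "vf ?K (\<lambda>w. F0 w $ j) u0 = 0" for j
      unfolding K using 0[of j] by (simp add: Jm_def mult.commute)
    then have "\<forall>j. vf ?K (z j) u0 = 0" by (rule inj)
    then have "(\<Sum>i\<in>UNIV. (d - d') $ i * (if i = j then 1 else 0)) = 0" for j
      unfolding K using Z_z[OF u0] by simp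
    then have "(d - d') $ j = 0" for j by (simp add: if_distrib[of "\<lambda>y. _ * y"] cong: if_cong)
    then show "d = d'" by (simp add: vec_eq_iff)
  qed
  then obtain Bm where "Bm ** Am = mat 1" using matrix_left_invertible_injective by blast
  then have AB: "Am ** Bm = mat 1" by (simp add: matrix_left_right_inverse)
  have surj: "\<exists>d. \<forall>j. y j = (\<Sum>i\<in>UNIV. d i * Jm i j u0)" for y :: "'n \<Rightarrow> complex"
  proof -
    let ?d = "Bm *v (\<chi> j. y j)"
    have "Am *v ?d = (\<chi> j. y j)" by (simp add: matrix_vector_mul_assoc AB)
    then have "y j = (\<Sum>i\<in>UNIV. ?d $ i * Jm i j u0)" for j
      using Am[of ?d j] by (simp add: mult.commute)
    then show ?thesis by blast
  qed
  \<comment> \<open>Otherwise an invertible matrix would annihilate the complex gradient of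
    \<open>\<rho>'\<close>, against the nonvanishing of its differential.\<close>
  have \<mu>0: "\<mu> u0 \<noteq> 0"
  proof
    assume "\<mu> u0 = 0"
    then have 0: "(\<Sum>j\<in>UNIV. w' j u0 * Jm i j u0) = 0" for i using E[OF adm_F0, of i] by simp
    have "w' l u0 = 0" for l
    proof -
      obtain d where d: "\<And>j. (if j = l then 1 else 0) = (\<Sum>i\<in>UNIV. d i * Jm i j u0)"
        using surj[of "\<lambda>j. if j = l then 1 else 0"] by blast
      have "w' l u0 = (\<Sum>j\<in>UNIV. w' j u0 * (if j = l then 1 else 0))"
        by (simp add: if_distrib[of "\<lambda>y. _ * y"] cong: if_cong)
      also have "\<dots> = (\<Sum>i\<in>UNIV. d i * (\<Sum>j\<in>UNIV. w' j u0 * Jm i j u0))"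
        unfolding d sum_distrib_left by (subst sum.swap) (simp add: mult_ac)
      finally show ?thesis by (simp add: 0)
    qed
    then have "frechet_derivative \<rho>' (at (F0 u0)) v = 0" for v
      using frechet_real_dz[OF \<rho>'(1)[OF admD(3)[OF adm_F0]], of v] by (simp add: w'_def)
    then show False using \<rho>'(3) by auto
  qed
  \<comment> \<open>Writing \<open>c\<close> through the matrix turns the relation for
    \<open>w'\<close> into one for \<open>\<mu>\<close> times the combination of the
    \<open>q i\<close> with coefficients \<open>d\<close>.\<close>
  obtain d where d: "\<And>j. c j = (\<Sum>i\<in>UNIV. d i * Jm i j u0)" using surj[of c] by blast
  let ?g = "\<lambda>u. \<Sum>i\<in>UNIV. d i * q i u"
  have smg: "smooth_at u0 ?g" using q u0 by (auto simp: Sm_def intro!: smooth_at_sum smooth_at_mult)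
  have smB: "smooth_at u0 K" if "K \<in> B" for K using B[OF that] u0 by (auto simp: type01_def Sm_def)
  have zero: "foldr vf Ks (\<lambda>v. - \<mu> v * ?g v) u0 = 0" if Ks: "set Ks \<subseteq> B" "length Ks \<le> k0" for Ks
  proof -
    have t: "\<forall>K\<in>set Ks. type01 K" using Ks B by blast
    have "\<forall>\<^sub>F v in nhds u0. - \<mu> v * ?g v = (\<Sum>j\<in>UNIV. w' j v * (\<Sum>i\<in>UNIV. d i * Jm i j v))"
      using adm_ev[OF adm_F0]
    proof eventually_elim
      case (elim v)
      have "- \<mu> v * ?g v = (\<Sum>i\<in>UNIV. d i * (\<Sum>j\<in>UNIV. w' j v * Jm i j v))"
        unfolding E[OF elim] sum_distrib_left by (intro sum.cong refl) (simp add: mult_ac)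
      also have "\<dots> = (\<Sum>j\<in>UNIV. w' j v * (\<Sum>i\<in>UNIV. d i * Jm i j v))"
        unfolding sum_distrib_left by (subst sum.swap) (simp add: mult_ac)
      finally show ?case .
    qed
    from eventually_nhds_x_imp_x[OF foldr_vf_cong_ev[OF this, of Ks]]
    have "foldr vf Ks (\<lambda>v. - \<mu> v * ?g v) u0 = foldr vf Ks (\<lambda>v. \<Sum>j\<in>UNIV. w' j v * (\<Sum>i\<in>UNIV. d i * Jm i j v)) u0" .
    also have "\<dots> = (\<Sum>j\<in>UNIV. foldr vf Ks (w' j) u0 * (\<Sum>i\<in>UNIV. d i * Jm i j u0))"
      by (rule foldr_vf_crf[OF finite _ u0 smw[OF adm_F0] crf_lincomb[OF finite crJ]])
        (use t in \<open>auto simp: type01_def\<close>)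
    also have "\<dots> = 0"
      using c[OF t Ks(2)] by (simp add: d[symmetric] w'_def[abs_def] mult.commute)
    finally show ?thesis .
  qed
  \<comment> \<open>As \<open>\<mu>\<close> is nonzero at the base point, it is divided out by the
    ideal property.\<close>
  have "\<forall>i. d i = 0"
  proof (rule Q)
    fix Ks assume Ks: "set Ks \<subseteq> B" "length Ks \<le> k0"
    have inv: "smooth_at u0 (\<lambda>v. inverse (- \<mu> v))"
      using sm\<mu>[OF adm_F0] \<mu>0 by (intro smooth_at_inverse smooth_at_uminus) auto
    have prod: "smooth_at u0 (\<lambda>v. - \<mu> v * ?g v)"
      by (intro smooth_at_mult smooth_at_uminus sm\<mu>[OF adm_F0] smg)
    have "foldr vf Ks (\<lambda>v. inverse (- \<mu> v) * (- \<mu> v * ?g v)) u0 = 0"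
      by (rule foldr_vf_ideal[OF smB inv prod zero Ks])
    moreover have "\<forall>\<^sub>F v in nhds u0. \<mu> v \<noteq> 0"
      by (rule tendsto_imp_eventually_ne[OF smooth_at_tendsto[OF sm\<mu>[OF adm_F0]] \<mu>0])
    then have "\<forall>\<^sub>F v in nhds u0. inverse (- \<mu> v) * (- \<mu> v * ?g v) = ?g v"
      by eventually_elim (simp flip: mult.assoc)
    from eventually_nhds_x_imp_x[OF foldr_vf_cong_ev[OF this, of Ks]]
    have "foldr vf Ks (\<lambda>v. inverse (- \<mu> v) * (- \<mu> v * ?g v)) u0 = foldr vf Ks ?g u0" .
    ultimately show "foldr vf Ks ?g u0 = 0" by simp
  qed
  then show ?thesis by (simp add: d)
qed

theorem theorem2:
  fixes M M' :: "(complex ^ 'n) set"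
    and A A' :: "(complex ^ 'n) set"
    and x x' :: "complex ^ 'n \<Rightarrow> real ^ 'd"
    and f0 :: "complex ^ 'n \<Rightarrow> complex ^ 'n"
    and p0 :: "complex ^ 'n"
    and k0 k :: nat
    and e :: "'j::finite \<Rightarrow> 'd \<times> ('d \<Rightarrow> nat)"
  assumes "CARD('n) \<ge> 2"
    and "CARD('d) = 2 * CARD('n) - 1"
    and "real_hypersurface M" and "real_hypersurface M'"
    and "p0 \<in> M" and "nondegenerate_at k0 M p0"
    and "CR_diffeo M M' f0"
    and "local_coords M p0 A x" and "local_coords M' (f0 p0) A' x'"
    and "k = k0 ^ 3 + k0 ^ 2 + k0 + 1"
    and "bij_betw e UNIV (jet_indices k)"
  shows "\<exists>(U :: ((real ^ 'j) \<times> (complex ^ 'n) \<times> (complex ^ 'n)) set) r.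
    openin (top_of_set (UNIV \<times> A' \<times> A)) U \<and>
    (jet e A x x' f0 p0, f0 p0, p0) \<in> U \<and>
    (\<forall>\<alpha> j. msize \<alpha> = k + 1 \<longrightarrow>
       smooth_map_on U (r \<alpha> j) \<and> rational_in_fst_on U (r \<alpha> j)) \<and>
    (\<forall>V f. openin (top_of_set M) V \<and> p0 \<in> V \<and> f ` V \<subseteq> M' \<and> CR_diffeo V (f ` V) f \<and>
       (jet e A x x' f p0, f p0, p0) \<in> U \<longrightarrow>
       (\<exists>W. openin (top_of_set M) W \<and> p0 \<in> W \<and> W \<subseteq> V \<and>
          (\<forall>y\<in>W. (jet e A x x' f y, f y, y) \<in> U \<and>
             (\<forall>\<alpha> j. msize \<alpha> = k + 1 \<longrightarrow>
                coord_deriv A x x' \<alpha> f j y = r \<alpha> j (jet e A x x' f y, f y, y)))))"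
proof -
  have c2: "CARD('n) \<ge> 2" and cd: "CARD('d) = 2 * CARD('n) - 1" and M': "real_hypersurface M'" and p0: "p0 \<in> M"
    and nd: "nondegenerate_at k0 M p0" and f0: "CR_diffeo M M' f0" and x: "local_coords M p0 A x"
    and x': "local_coords M' (f0 p0) A' x'" and k: "k = k0 ^ 3 + k0 ^ 2 + k0 + 1" and e: "bij_betw e UNIV (jet_indices k)"
    by (fact assms)+
  define m where "m = CARD('n) - 1"
  obtain U \<rho> L where source: "defining_function M p0 U \<rho>" "CR_frame M U m L"
    "vec.span {(\<chi> j. CR_derivs m L \<alpha> (dz j (\<lambda>z. complex_of_real (\<rho> z))) p0) | \<alpha>. (\<Sum>i<m. \<alpha> i) \<le> k0} = UNIV"
    using nd unfolding nondegenerate_at_def m_def by blast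
  have xA: "openin (top_of_set M) A" "p0 \<in> A" "inj_on x A" "smooth_map_on A x"
    using x by (auto simp: local_coords_def)
  have xA': "openin (top_of_set M') A'" "f0 p0 \<in> A'" "inj_on x' A'" "smooth_map_on A' x'" "open (x' ` A')" "smooth_on (x' ` A') (inv_into A' x')"
    using x' by (auto simp: local_coords_def)
  obtain W X where W: "open W" "p0 \<in> W" "smooth_on W X" "\<forall>y\<in>A \<inter> W. X y = x y"
    using xA(2,4) unfolding smooth_map_on_def by blast
  obtain W' X' where W': "open W'" "f0 p0 \<in> W'" "smooth_on W' X'" "\<forall>y\<in>A' \<inter> W'. X' y = x' y"
    using xA'(2,4) unfolding smooth_map_on_def by blast
  have "f0 p0 \<in> M'" using f0 p0 by (auto simp: CR_diffeo_def bij_betw_def)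
  then obtain U' \<rho>' where target: "defining_function M' (f0 p0) U' \<rho>'"
    using M' unfolding real_hypersurface_def by blast
  then have U': "open U'" "f0 p0 \<in> U'" "smooth_on U' \<rho>'" "M' \<inter> U' = {z \<in> U'. \<rho>' z = 0}"
    "frechet_derivative \<rho>' (at (f0 p0)) \<noteq> (\<lambda>v. 0)" by (auto simp: defining_function_def)
  obtain OA' where OA': "open OA'" "A' = M' \<inter> OA'" using xA'(1) openin_open by blast
  interpret H: hypersurface_chart M p0 A x U \<rho> L W X k0 m
    by unfold_locales (use c2 cd x source W m_def in auto)
  obtain \<Omega> Z Kf q \<nu> where cr: "cr_structure \<Omega> H.z Z" and \<Omega>: "x p0 \<in> \<Omega>" "\<Omega> \<subseteq> H.\<Omega>1"
    and smKf: "\<forall>i. Sm \<Omega> (Kf i)" and Kfz: "\<forall>i j. \<forall>u\<in>\<Omega>. vf (Kf i) (H.z j) u = 0"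
    and smq: "\<forall>i. Sm \<Omega> (q i)" and Kfeq: "\<forall>i. \<forall>u\<in>\<Omega>. cnjf (Kf i) u = Z i u - q i u *s Z \<nu> u"
    and nf: "\<forall>i. i \<noteq> \<nu> \<longrightarrow> (\<forall>r. \<exists>\<alpha>. ops H.b [0..<m] \<alpha> (\<lambda>u. q i u - r) (x p0) \<noteq> 0)"
    and Q: "\<forall>c. (\<forall>Ks. set Ks \<subseteq> H.b ` {..<m} \<longrightarrow> length Ks \<le> k0 \<longrightarrow> foldr vf Ks (\<lambda>u. \<Sum>j\<in>UNIV. c j * q j u) (x p0) = 0) \<longrightarrow> (\<forall>j. c j = 0)"
    using H.source_frame by (elim exE conjE)
  interpret cr_structure \<Omega> H.z Z by (fact cr)
  have "\<exists>i. i \<noteq> \<nu>"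
  proof (rule ccontr)
    assume "\<not> ?thesis"
    then have "(UNIV :: 'n set) = {\<nu>}" by auto
    then have "CARD('n) = 1" by (metis card.empty card.insert empty_iff finite.emptyI One_nat_def)
    then show False using c2 by simp
  qed
  then obtain i1 where i1: "i1 \<noteq> \<nu>" by blast
  \<comment> \<open>Inside this ambient open set \<open>M'\<close> lies in \<open>A'\<close>, and
    both the extended target chart and the defining function of \<open>M'\<close> are
    available.\<close>
  define B where "B = OA' \<inter> W' \<inter> U'"
  define T where "T = M' \<inter> B"
  have B: "open B" "f0 p0 \<in> B" using OA' W' U' xA'(2) by (auto simp: B_def)
  have T: "T \<subseteq> A'" "T \<subseteq> W'" "T \<subseteq> U'" using OA' by (auto simp: T_def B_def)
  have A'B: "\<zeta> \<in> T" if "\<zeta> \<in> A'" "\<zeta> \<in> W' \<inter> U'" for \<zeta> using that OA' by (auto simp: T_def B_def)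
  define F0 where "F0 = (\<lambda>u. f0 (H.\<phi> u))"
  let ?\<psi> = "inv_into A' x'"
  have X'_T: "X' \<zeta> = x' \<zeta>" if "\<zeta> \<in> T" for \<zeta> using that T W'(4) by auto
  have crf0: "CR_map M M' f0" "CR_map M' M (inv_into M f0)" "inj_on f0 M"
    using f0 by (auto simp: CR_diffeo_def bij_betw_def)
  have M_open: "openin (top_of_set M) M" by simp
  note adm_map = H.adm_CR_map[OF cr \<Omega>]
  have F0_ev: "\<forall>\<^sub>F v in nhds (x p0). v \<in> \<Omega> \<and> H.\<phi> v \<in> M \<and> smooth_at v F0 \<and> F0 v \<in> T \<and> (\<forall>j. cr_at (\<lambda>w. F0 w $ j) v)"
    unfolding F0_def T_def by (rule adm_map[OF M_open p0 crf0(1) subset_refl B])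
  interpret J: jet_setting \<Omega> H.z Z "x p0" T X' ?\<psi> F0 k e
  proof
    show "x p0 \<in> \<Omega>" by (rule \<Omega>(1))
    show "bij_betw e UNIV (jet_indices k)" by (rule e)
    show "smooth_at \<zeta> X'" if "\<zeta> \<in> T" for \<zeta> using that T W' by (blast intro: smooth_atI)
    show "smooth_at (X' \<zeta>) ?\<psi>" if "\<zeta> \<in> T" for \<zeta>
      using that T X'_T[OF that] xA'(5,6) by (intro smooth_atI[of "x' ` A'"]) auto
    show "?\<psi> (X' \<zeta>) = \<zeta>" if "\<zeta> \<in> T" for \<zeta> using that T X'_T[OF that] xA'(3) by auto
    show "\<forall>\<^sub>F v in nhds (x p0). v \<in> \<Omega> \<and> smooth_at v F0 \<and> F0 v \<in> T \<and> (\<forall>j. cr_at (\<lambda>w. F0 w $ j) v)"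
      using F0_ev by eventually_elim blast
  qed
  have F0_0: "F0 (x p0) = f0 p0" by (simp add: F0_def H.\<phi>_u0)
  have b01: "J.type01 (H.b l)" if "l < m" for l
    using H.smooth_b[OF that] H.b_z(1)[OF that] \<Omega>(2) by (auto simp: J.type01_def Sm_def)
  have Kf01: "J.type01 (Kf i)" for i using smKf Kfz by (simp add: J.type01_def)
  have sm\<rho>: "smooth_at \<zeta> \<rho>'" "\<rho>' \<zeta> = 0" if "\<zeta> \<in> T" for \<zeta>
  proof -
    show "smooth_at \<zeta> \<rho>'" using that T U' by (blast intro: smooth_atI)
    have "\<zeta> \<in> M' \<inter> U'" using that T by (auto simp: T_def)
    then show "\<rho>' \<zeta> = 0" unfolding U'(4) by simp
  qed
  \<comment> \<open>The inverse of \<open>f0\<close> is CR, so a vector that kills the components of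
    \<open>F0\<close> also kills those of the inverse applied to \<open>F0\<close>, which are the
    coordinates \<open>H.z j\<close>.\<close>
  have inj: "\<forall>j. vf K (H.z j) (x p0) = 0" if K: "\<And>j. vf K (\<lambda>w. F0 w $ j) (x p0) = 0" for K
  proof
    fix j
    have ev: "\<forall>\<^sub>F v in nhds (x p0). F0 v \<in> M'" using F0_ev by eventually_elim (simp add: T_def)
    have "vf K (\<lambda>w. inv_into M f0 (F0 w) $ j) (x p0) = 0"
      by (rule CR_map_pullback[OF crf0(2) J.admD(2)[OF J.adm_F0] ev K])
    moreover have "\<forall>\<^sub>F v in nhds (x p0). inv_into M f0 (F0 v) $ j = H.\<phi> v $ j"
      using F0_ev by eventually_elim (simp add: F0_def crf0(3))
    ultimately show "vf K (H.z j) (x p0) = 0" by (simp add: vf_cong_ev)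
  qed
  interpret cr_jets \<Omega> H.z Z "x p0" T X' ?\<psi> F0 k e k0 "\<lambda>z. complex_of_real (\<rho>' z)" Kf q \<nu> i1 H.b m
  proof
    show "3 * k0 \<le> k" unfolding k by (rule three_mul_le)
    have F0T: "F0 (x p0) \<in> T" by (rule J.admD(3)[OF J.adm_F0])
    show "smooth_at (F0 (x p0)) (\<lambda>z. complex_of_real (\<rho>' z))" by (rule smooth_at_of_real[OF sm\<rho>(1)[OF F0T]])
    show "complex_of_real (\<rho>' \<zeta>) = 0" if "\<zeta> \<in> T" for \<zeta> using sm\<rho>(2)[OF that] by simp
    show "J.type01 (Kf i)" for i by (rule Kf01)
    show "Sm \<Omega> (q i)" for i using smq by blast
    show "cnjf (Kf i) u = Z i u - q i u *s Z \<nu> u" if "u \<in> \<Omega>" for i u using Kfeq that by blast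
    show "J.type01 (H.b l)" if "l < m" for l by (rule b01[OF that])
    show "\<exists>\<alpha>. ops H.b [0..<m] \<alpha> (\<lambda>u. q i1 u - r) (x p0) \<noteq> 0" for r using nf i1 by blast
    fix c j
    assume c: "\<And>Ks. (\<forall>K\<in>set Ks. J.type01 K) \<Longrightarrow> length Ks \<le> k0 \<Longrightarrow>
       (\<Sum>j\<in>UNIV. c j * foldr vf Ks (\<lambda>v. dz j (\<lambda>z. complex_of_real (\<rho>' z)) (F0 v)) (x p0)) = 0"
    show "c j = 0"
    proof (rule J.nondegenerate_target[where \<rho>'=\<rho>' and Kf=Kf and q=q and \<nu>=\<nu> and B="H.b ` {..<m}" and ?k0.0=k0 and c=c])
      show "frechet_derivative \<rho>' (at (F0 (x p0))) \<noteq> (\<lambda>v. 0)" using U'(5) by (simp add: F0_0)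
      show "J.type01 K" if "K \<in> H.b ` {..<m}" for K using that b01 by auto
      show "\<forall>j. c j = 0" if "\<And>Ks. set Ks \<subseteq> H.b ` {..<m} \<Longrightarrow> length Ks \<le> k0 \<Longrightarrow> foldr vf Ks (\<lambda>u. \<Sum>j\<in>UNIV. c j * q j u) (x p0) = 0" for c
        using Q that by blast
    qed (use sm\<rho> Kf01 smq Kfeq inj c in auto)
  qed
  obtain S R where S: "open S" "J.J (F0, x p0) \<in> S"
    and R: "\<And>\<alpha> j. msize \<alpha> = Suc k \<Longrightarrow> (\<forall>p\<in>S. smooth_at p (R \<alpha> j)) \<and> rational_in_fst_on S (R \<alpha> j) \<and>
     (\<forall>F u. J.adm F u \<longrightarrow> J.J (F, u) \<in> S \<longrightarrow> mpartial \<alpha> (\<lambda>w. X' (F w) $ j) u = R \<alpha> j (J.J (F, u)))"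
    using complete_system by blast
  \<comment> \<open>\<open>R\<close> expects the chart coordinates of the source point, the
    statement the point itself.\<close>
  define c where "c = (\<lambda>(t :: real ^ 'j, \<zeta> :: complex ^ 'n, y). (t, \<zeta>, x y))"
  \<comment> \<open>With \<open>W'\<close> and \<open>U'\<close> built into the domain, membership
    of the jet of an unknown map in \<open>UU\<close> places its value in \<open>T\<close>.\<close>
  define N where "N = S \<inter> (UNIV \<times> (W' \<inter> U') \<times> UNIV)"
  define D where "D = ((UNIV :: (real ^ 'j) set) \<times> A' \<times> A)"
  define UU where "UU = D \<inter> c -` N"
  define r where "r \<alpha> j p = R \<alpha> j (c p)" for \<alpha> j p
  have "continuous_on D c"
    unfolding c_def case_prod_unfold
    by (intro continuous_intros continuous_on_compose2[OF smooth_map_on_continuous_on[OF xA(4)]]) (auto simp: D_def)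
  moreover have "open N" unfolding N_def using S(1) W'(1) U'(1) by (intro open_Int open_Times) auto
  ultimately have UU_open: "openin (top_of_set D) UU"
    unfolding UU_def by (rule continuous_openin_preimage_gen)
  have UU_iff: "(t, \<zeta>, y) \<in> UU \<longleftrightarrow> \<zeta> \<in> A' \<and> y \<in> A \<and> (t, \<zeta>, x y) \<in> S \<and> \<zeta> \<in> W' \<inter> U'" for t \<zeta> y
    by (auto simp: UU_def D_def c_def N_def)
  \<comment> \<open>The jets of the statement use \<open>x'\<close>, the functionals its extension
    \<open>X'\<close>; both agree here because admissible maps take values in
    \<open>T\<close>.\<close>
  have X'_ev: "\<forall>\<^sub>F w in nhds u. X' (f (H.\<phi> w)) $ i = x' (f (H.\<phi> w)) $ i" if "J.adm (\<lambda>u. f (H.\<phi> u)) u" for f u i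
    using J.adm_ev[OF that]
  proof eventually_elim
    case (elim w)
    from X'_T[OF J.admD(3)[OF elim]] show ?case by simp
  qed
  have jet_J: "J.J (\<lambda>u. f (H.\<phi> u), x y) = (jet e A x x' f y, f y, x y)" if "J.adm (\<lambda>u. f (H.\<phi> u)) (x y)" "y \<in> A" for f y
  proof -
    from mpartial_cong_ev[OF X'_ev[OF that(1)]] show ?thesis
      using H.\<phi>_x[OF that(2)] by (simp add: J.J_def jet_def coord_deriv_def)
  qed
  have coord: "coord_deriv A x x' \<alpha> f j y = mpartial \<alpha> (\<lambda>w. X' (f (H.\<phi> w)) $ j) (x y)" if "J.adm (\<lambda>u. f (H.\<phi> u)) (x y)" for f y \<alpha> j
    unfolding coord_deriv_def
    by (rule mpartial_cong_ev[OF X'_ev[OF that], symmetric])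
  have base: "(jet e A x x' f0 p0, f0 p0, p0) \<in> UU"
    using S(2) jet_J[of f0 p0] J.adm_F0 xA(2) xA'(2) W'(2) U'(2) by (simp add: UU_iff F0_def)
  have smooth_r: "smooth_map_on UU (r \<alpha> j)" if \<alpha>: "msize \<alpha> = k + 1" for \<alpha> j
    unfolding smooth_map_on_def
  proof
    fix p assume p: "p \<in> UU"
    obtain t \<zeta> y where p_eq: "p = (t, \<zeta>, y)" by (cases p)
    have y: "y \<in> A" "(t, \<zeta>, x y) \<in> S" using p by (auto simp: p_eq UU_iff)
    \<comment> \<open>Smoothness on \<open>UU\<close> asks for ambient extensions, so the source
      chart is extended around \<open>y\<close>.\<close>
    obtain Wy Xy where Wy: "open Wy" "y \<in> Wy" "smooth_on Wy Xy" "\<forall>v\<in>A \<inter> Wy. Xy v = x v"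
      using xA(4) y(1) unfolding smooth_map_on_def by blast
    let ?G = "\<lambda>p. (fst p, fst (snd p), Xy (snd (snd p)))"
    have l1: "smooth_at p (\<lambda>p :: (real ^ 'j) \<times> (complex ^ 'n) \<times> (complex ^ 'n). fst p)"
      and l2: "smooth_at p (\<lambda>p :: (real ^ 'j) \<times> (complex ^ 'n) \<times> (complex ^ 'n). fst (snd p))"
      and l3: "smooth_at p (\<lambda>p :: (real ^ 'j) \<times> (complex ^ 'n) \<times> (complex ^ 'n). snd (snd p))"
      by (rule smooth_at_linear_self, intro bounded_linear_fst bounded_linear_fst_comp bounded_linear_snd_comp bounded_linear_snd)+
    have "smooth_at p (\<lambda>p. Xy (snd (snd p)))"
      by (rule smooth_at_compose[OF l3]) (use Wy in \<open>auto simp: p_eq intro: smooth_atI\<close>)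
    then have "smooth_at p ?G" by (intro smooth_at_Pair l1 l2)
    moreover have "?G p = (t, \<zeta>, x y)" using Wy(2,4) y(1) by (simp add: p_eq)
    moreover have "smooth_at (t, \<zeta>, x y) (R \<alpha> j)" using R[of \<alpha> j] \<alpha> y(2) by simp
    ultimately have "smooth_at p (\<lambda>p. R \<alpha> j (?G p))"
      using smooth_at_compose[of p ?G "R \<alpha> j"] by (simp only:)
    then obtain V where V: "open V" "p \<in> V" "smooth_on V (\<lambda>p. R \<alpha> j (?G p))" unfolding smooth_at_def by blast
    let ?V = "V \<inter> (UNIV \<times> UNIV \<times> Wy)"
    have "open ?V" using V(1) Wy(1) by (intro open_Int open_Times) auto
    moreover have "p \<in> ?V" using V(2) Wy(2) by (simp add: p_eq)
    moreover have "smooth_on ?V (\<lambda>p. R \<alpha> j (?G p))" by (rule smooth_on_subset[OF V(3)]) simp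
    moreover have "\<forall>v\<in>UU \<inter> ?V. R \<alpha> j (?G v) = r \<alpha> j v"
      using Wy(4) by (auto simp: r_def c_def UU_iff)
    ultimately show "\<exists>W F. open W \<and> p \<in> W \<and> smooth_on W F \<and> (\<forall>x\<in>UU \<inter> W. F x = r \<alpha> j x)" by blast
  qed
  have rational_r: "rational_in_fst_on UU (r \<alpha> j)" if \<alpha>: "msize \<alpha> = k + 1" for \<alpha> j
  proof -
    have "rational_in_fst_on S (R \<alpha> j)" using R[of \<alpha> j] \<alpha> by simp
    then obtain E P Q where E: "finite E" and ev: "\<forall>(t, y)\<in>S. (\<Sum>m\<in>E. Q m y * (\<Prod>l\<in>UNIV. (t $ l) ^ m l)) \<noteq> 0 \<and>
           R \<alpha> j (t, y) = (\<Sum>m\<in>E. P m y * (\<Prod>l\<in>UNIV. (t $ l) ^ m l)) / (\<Sum>m\<in>E. Q m y * (\<Prod>l\<in>UNIV. (t $ l) ^ m l))"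
      unfolding rational_in_fst_on_def by (elim exE conjE)
    have EPQ: "(\<Sum>m\<in>E. Q m y * (\<Prod>l\<in>UNIV. (t $ l) ^ m l)) \<noteq> 0 \<and>
           R \<alpha> j (t, y) = (\<Sum>m\<in>E. P m y * (\<Prod>l\<in>UNIV. (t $ l) ^ m l)) / (\<Sum>m\<in>E. Q m y * (\<Prod>l\<in>UNIV. (t $ l) ^ m l))"
      if "(t, y) \<in> S" for t y
      using ev that by blast
    show ?thesis unfolding rational_in_fst_on_def
    proof (rule exI[of _ E], rule exI[of _ "\<lambda>m y. P m (fst y, x (snd y))"], rule exI[of _ "\<lambda>m y. Q m (fst y, x (snd y))"], intro conjI ballI)
      fix p assume "p \<in> UU"
      then show "case p of (t, y) \<Rightarrow> (\<Sum>m\<in>E. Q m (fst y, x (snd y)) * (\<Prod>l\<in>UNIV. (t $ l) ^ m l)) \<noteq> 0 \<and>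
           r \<alpha> j (t, y) = (\<Sum>m\<in>E. P m (fst y, x (snd y)) * (\<Prod>l\<in>UNIV. (t $ l) ^ m l)) / (\<Sum>m\<in>E. Q m (fst y, x (snd y)) * (\<Prod>l\<in>UNIV. (t $ l) ^ m l))"
        using EPQ by (cases p) (auto simp: UU_iff r_def c_def)
    qed (rule E)
  qed
  have main: "\<exists>W. openin (top_of_set M) W \<and> p0 \<in> W \<and> W \<subseteq> V \<and>
          (\<forall>y\<in>W. (jet e A x x' f y, f y, y) \<in> UU \<and>
             (\<forall>\<alpha> j. msize \<alpha> = k + 1 \<longrightarrow> coord_deriv A x x' \<alpha> f j y = r \<alpha> j (jet e A x x' f y, f y, y)))"
    if V: "openin (top_of_set M) V" "p0 \<in> V" "f ` V \<subseteq> M'" "CR_diffeo V (f ` V) f" "(jet e A x x' f p0, f p0, p0) \<in> UU" for V f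
  proof -
    let ?F = "\<lambda>u. f (H.\<phi> u)"
    have crf: "CR_map V (f ` V) f" using V(4) by (simp add: CR_diffeo_def)
    have fp: "f p0 \<in> T" using V(5) A'B by (auto simp: UU_iff)
    then have fB: "f p0 \<in> B" by (simp add: T_def)
    have ev: "\<forall>\<^sub>F v in nhds (x p0). v \<in> \<Omega> \<and> H.\<phi> v \<in> V \<and> smooth_at v ?F \<and> ?F v \<in> T \<and> (\<forall>j. cr_at (\<lambda>w. ?F w $ j) v)"
      unfolding T_def by (rule adm_map[OF V(1,2) crf V(3) B(1) fB])
    have adm: "J.adm ?F (x p0)"
      unfolding J.adm_def using ev by eventually_elim blast
    have "J.J (?F, x p0) \<in> S" using V(5) jet_J[OF adm xA(2)] by (simp add: UU_iff)
    then have "\<forall>\<^sub>F v in nhds (x p0). J.J (?F, v) \<in> S"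
      by (rule topological_tendstoD[OF J.isCont_J[OF adm] S(1)])
    \<comment> \<open>Closeness of the jet, admissibility and membership in \<open>V\<close> all
      persist near the base point; this provides the neighbourhood on which the system
      holds.\<close>
    then have "\<forall>\<^sub>F v in nhds (x p0). J.J (?F, v) \<in> S \<and> J.adm ?F v \<and> H.\<phi> v \<in> V"
      using J.adm_ev[OF adm] ev by eventually_elim blast
    then obtain O' where O': "open O'" "x p0 \<in> O'" "\<forall>v\<in>O'. J.J (?F, v) \<in> S \<and> J.adm ?F v \<and> H.\<phi> v \<in> V"
      unfolding eventually_nhds by blast
    let ?W = "A \<inter> x -` O'"
    have "openin (top_of_set A) ?W"
      by (rule continuous_openin_preimage_gen[OF smooth_map_on_continuous_on[OF xA(4)] O'(1)])
    then have 1: "openin (top_of_set M) ?W" using openin_trans xA(1) by blast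
    have y: "y \<in> V" "(jet e A x x' f y, f y, y) \<in> UU"
      "\<And>\<alpha> j. msize \<alpha> = k + 1 \<Longrightarrow> coord_deriv A x x' \<alpha> f j y = r \<alpha> j (jet e A x x' f y, f y, y)" if y: "y \<in> ?W" for y
    proof -
      have yA: "y \<in> A" and o: "J.J (?F, x y) \<in> S" "J.adm ?F (x y)" "H.\<phi> (x y) \<in> V" using y O'(3) by auto
      have \<phi>: "H.\<phi> (x y) = y" by (rule H.\<phi>_x[OF yA])
      show "y \<in> V" using o(3) \<phi> by simp
      have "f y \<in> T" using J.admD(3)[OF o(2)] \<phi> by simp
      then show "(jet e A x x' f y, f y, y) \<in> UU"
        using o(1) jet_J[OF o(2) yA] yA T by (auto simp: UU_iff)
      show "coord_deriv A x x' \<alpha> f j y = r \<alpha> j (jet e A x x' f y, f y, y)" if "msize \<alpha> = k + 1" for \<alpha> j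
        using R[of \<alpha> j] that o coord[OF o(2)] jet_J[OF o(2) yA] by (simp add: r_def c_def)
    qed
    show ?thesis
      by (rule exI[of _ ?W]) (use 1 xA(2) O'(2) y in auto)
  qed
  show ?thesis
  proof (rule exI[of _ UU], rule exI[of _ r], intro conjI)
    show "openin (top_of_set (UNIV \<times> A' \<times> A)) UU" using UU_open by (simp only: D_def)
    show "(jet e A x x' f0 p0, f0 p0, p0) \<in> UU" by (rule base)
  qed (use smooth_r rational_r in simp, use main in simp)
qed

end
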